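(* Let $W$ be a $d$-dimensional standard Brownian motion on $[0,T]$. (a) Let $(\widehat W^N)_{N\ge1}$ be a sequence of stationary quadratic functional quantizers of $W$ ($\widehat W^N$ of level $N$), each of them a Karhunen–Loève product quantization or an optimal quadratic quantization of $W$ (componentwise), converging to $W$ in the purely quadratic sense, i.e. $\mathbb{E}\int_0^T|W_t-\widehat W^N_t|^2dt\to0$ as $N\to\infty$. Then, for every $q>2$ and every $p\in(0,\infty)$, $$\|W-\widehat W^N\|_{q,Hol}\longrightarrow0\quad\text{in }L^p(\mathbb{P})\text{ as }N\to\infty.$$ (b) Let $q>2$ and assume that, for every $N\ge1$, $\widehat W^N$ is an optimal product quantization of $W$ at level $N$. Then, for every $p\in(0,\infty)$ and every $\alpha>0$, $$\Big\|\,\|W-\widehat W^N\|_{q,Hol}\Big\|_{L^p(\mathbb{P})}=o\Big((\log N)^{-\frac32\min\left(\frac15(1-\frac2q),\frac1p\right)+\alpha}\Big)\quad\text{as }N\to\infty.$$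
   Context: Karhunen–Loève system of scalar Brownian motion on $[0,T]$: for $k\ge1$, $\lambda_k=\big(\frac{T}{\pi(k-1/2)}\big)^2$, $e^W_k(t)=\sqrt{2/T}\,\sin(t/\sqrt{\lambda_k})$, and $\xi_k=\frac{1}{\sqrt{\lambda_k}}\int_0^TW_te^W_k(t)dt$, so the $\xi_k$ are i.i.d. $\mathcal{N}(0;1)$ and $W_t=\sum_k\sqrt{\lambda_k}\,\xi_k e^W_k(t)$. Quantization: for a random vector $Z$ in a separable Hilbert space $H$ with $\mathbb{E}|Z|^2<\infty$, an optimal quadratic quantization of $Z$ at level $M$ is a nearest-neighbour (Voronoi) projection $\widehat Z$ of $Z$ on a set $\alpha\subset H$ of at most $M$ points minimizing $\mathbb{E}\min_{a\in\alpha}|Z-a|^2$. A quantization $\widehat W$ of $W$ is stationary if $\widehat W=\mathbb{E}(W|\sigma(\widehat W))$ a.s. Scalar case. A product quantization of $W$ at level $M$ is $\widehat W_t=\sum_{k=1}^{L}\sqrt{\lambda_k}\,\widehat\xi_k^{N_k}e^W_k(t)$, where $L\ge1$, $N_1,\ldots,N_L\ge1$, $N_1\cdots N_L\le M$ and $\widehat\xi_k^{N_k}$ is the optimal quadratic quantization of $\xi_k$ at level $N_k$. It is an optimal product quantization at level $M$ if $L,N_1,\ldots,N_L$ minimize $\mathbb{E}\int_0^T|W_t-\widehat W_t|^2dt$ under these constraints. An optimal quadratic quantization of $W$ at level $M$ is one for $H=L^2([0,T],dt)$; it reads $\widehat W_t=\sum_{k=1}^{m}\widehat\zeta^{\,k}e^W_k(t)$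 for some $m=m(M)$, where $\widehat\zeta=(\widehat\zeta^{\,1},\ldots,\widehat\zeta^{\,m})$ is an optimal quadratic quantization at level $M$ of $(\sqrt{\lambda_k}\,\xi_k)_{1\le k\le m}$. Dimension $d$: $\widehat W^N=(\widehat W^{1,N},\ldots,\widehat W^{d,N})$, where $\widehat W^{i,N}$ is a quantization of the corresponding type of $W^i$ at level $\lfloor N^{1/d}\rfloor$ (for optimal product quantization: the optimal product quantization at level $\lfloor N^{1/d}\rfloor$). Hölder semi-norm: $\|x\|_{q,Hol}=T^{1/q}\sup_{0\le s<t\le T}\frac{|x(t)-x(s)|}{|t-s|^{1/q}}$. $\|\cdot\|_{L^p(\mathbb{P})}=(\mathbb{E}|\cdot|^p)^{1/p}$ for every $p>0$. *)

theory Defs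
  imports "HOL-Probability.Probability" "HOL-Library.Landau_Symbols"
begin

section \<open>Brownian motion\<close>

definition scalar_brownian_motion :: "'a measure \<Rightarrow> real \<Rightarrow> (real \<Rightarrow> 'a \<Rightarrow> real) \<Rightarrow> bool" where
  "scalar_brownian_motion M T X \<longleftrightarrow>
     (\<forall>t\<in>{0..T}. X t \<in> borel_measurable M) \<and>
     (AE \<omega> in M. X 0 \<omega> = 0) \<and>
     (\<forall>\<omega>\<in>space M. continuous_on {0..T} (\<lambda>t. X t \<omega>)) \<and>
     (\<forall>s t. 0 \<le> s \<and> s < t \<and> t \<le> T \<longrightarrow>
        distributed M lborel (\<lambda>\<omega>. X t \<omega> - X s \<omega>) (normal_density 0 (sqrt (t - s)))) \<and>
     (\<forall>(n::nat) \<tau>. strict_mono_on {..n} \<tau> \<and> \<tau> ` {..n} \<subseteq> {0..T} \<longrightarrow>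
        prob_space.indep_vars M (\<lambda>_. borel) (\<lambda>j \<omega>. X (\<tau> (Suc j)) \<omega> - X (\<tau> j) \<omega>) {..<n})"

definition coordinate :: "(real \<Rightarrow> 'a \<Rightarrow> real ^ 'd) \<Rightarrow> 'd \<Rightarrow> real \<Rightarrow> 'a \<Rightarrow> real" where
  "coordinate W i = (\<lambda>t \<omega>. W t \<omega> $ i)"

text \<open>The path of \<open>X\<close> on \<open>[0,T]\<close>, as an extensional function.\<close>

definition path_on :: "real \<Rightarrow> (real \<Rightarrow> 'a \<Rightarrow> 'b) \<Rightarrow> 'a \<Rightarrow> real \<Rightarrow> 'b" where
  "path_on T X \<omega> = (\<lambda>t\<in>{0..T}. X t \<omega>)"

definition brownian_motion ::
  "'a measure \<Rightarrow> real \<Rightarrow> (real \<Rightarrow> 'a \<Rightarrow> real ^ 'd::finite) \<Rightarrow> bool" where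
  "brownian_motion M T W \<longleftrightarrow>
     (\<forall>i. scalar_brownian_motion M T (coordinate W i)) \<and>
     prob_space.indep_vars M (\<lambda>_. PiM {0..T} (\<lambda>_. borel)) (\<lambda>i. path_on T (coordinate W i)) UNIV"


section \<open>The Karhunen-Loeve system\<close>

definition kl_lambda :: "real \<Rightarrow> nat \<Rightarrow> real" where
  "kl_lambda T k = (T / (pi * (real k - 1 / 2)))\<^sup>2"

definition kl_e :: "real \<Rightarrow> nat \<Rightarrow> real \<Rightarrow> real" where
  "kl_e T k t = sqrt (2 / T) * sin (t / sqrt (kl_lambda T k))"

definition kl_xi :: "real \<Rightarrow> (real \<Rightarrow> 'a \<Rightarrow> real) \<Rightarrow> nat \<Rightarrow> 'a \<Rightarrow> real" where
  "kl_xi T X k \<omega> = 1 / sqrt (kl_lambda T k) * (LINT t:{0..T}|lborel. X t \<omega> * kl_e T k t)"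


section \<open>Optimal quadratic quantization\<close>

text \<open>
  The Hilbert space is given by a carrier \<open>H\<close> and the distance \<open>\<delta>\<close> of its norm, so that
  the same notion applies to the real line, to Euclidean spaces of varying dimension and to
  \<open>L\<^sup>2([0,T],dt)\<close>, none of which needs to be a type of its own. It is meant for random
  vectors \<open>Z\<close> with a finite second moment.
\<close>

definition distortion :: "'a measure \<Rightarrow> ('h \<Rightarrow> 'h \<Rightarrow> real) \<Rightarrow> ('a \<Rightarrow> 'h) \<Rightarrow> 'h set \<Rightarrow> ennreal" where
  "distortion M \<delta> Z \<alpha> = (\<integral>\<^sup>+\<omega>. ennreal (MIN a\<in>\<alpha>. (\<delta> (Z \<omega>) a)\<^sup>2) \<partial>M)"

definition codebooks :: "'h set \<Rightarrow> nat \<Rightarrow> 'h set set" where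
  "codebooks H m = {\<alpha>. \<alpha> \<subseteq> H \<and> finite \<alpha> \<and> \<alpha> \<noteq> {} \<and> card \<alpha> \<le> m}"

definition nearest_neighbour_projection ::
  "'h set \<Rightarrow> ('h \<Rightarrow> 'h \<Rightarrow> real) \<Rightarrow> 'h set \<Rightarrow> ('h \<Rightarrow> 'h) \<Rightarrow> bool" where
  "nearest_neighbour_projection H \<delta> \<alpha> \<pi> \<longleftrightarrow>
     (\<forall>z\<in>H. \<pi> z \<in> \<alpha> \<and> (\<forall>a\<in>\<alpha>. \<delta> z (\<pi> z) \<le> \<delta> z a))"

definition optimal_quantization ::
  "'a measure \<Rightarrow> 'h set \<Rightarrow> ('h \<Rightarrow> 'h \<Rightarrow> real) \<Rightarrow> ('a \<Rightarrow> 'h) \<Rightarrow> nat \<Rightarrow> ('a \<Rightarrow> 'h) \<Rightarrow> bool" where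
  "optimal_quantization M H \<delta> Z m Zh \<longleftrightarrow>
     (\<exists>\<alpha>\<in>codebooks H m.
        (\<forall>\<beta>\<in>codebooks H m. distortion M \<delta> Z \<alpha> \<le> distortion M \<delta> Z \<beta>) \<and>
        (\<exists>\<pi>. nearest_neighbour_projection H \<delta> \<alpha> \<pi> \<and> (\<forall>\<omega>\<in>space M. Zh \<omega> = \<pi> (Z \<omega>))) \<and>
        (\<forall>a\<in>\<alpha>. {\<omega>\<in>space M. Zh \<omega> = a} \<in> sets M))"

definition euclidean_carrier :: "nat \<Rightarrow> (nat \<Rightarrow> real) set" where
  "euclidean_carrier m = extensional {1..m}"

definition euclidean_distance :: "nat \<Rightarrow> (nat \<Rightarrow> real) \<Rightarrow> (nat \<Rightarrow> real) \<Rightarrow> real" where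
  "euclidean_distance m x y = L2_set (\<lambda>k. x k - y k) {1..m}"

text \<open>
  Square integrable functions on \<open>[0,T]\<close> with the \<open>L\<^sup>2\<close> pseudo-distance. Passing to classes
  modulo null sets would change neither the distortions nor their infimum at a given level.
\<close>

definition L2_carrier :: "real \<Rightarrow> (real \<Rightarrow> real) set" where
  "L2_carrier T = {f \<in> extensional {0..T}.
     set_borel_measurable lborel {0..T} f \<and> set_integrable lborel {0..T} (\<lambda>t. (f t)\<^sup>2)}"

definition L2_distance :: "real \<Rightarrow> (real \<Rightarrow> real) \<Rightarrow> (real \<Rightarrow> real) \<Rightarrow> real" where
  "L2_distance T f g = sqrt (LINT t:{0..T}|lborel. (f t - g t)\<^sup>2)"


section \<open>Quantizations of Brownian motion\<close>

definition quadratic_error ::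
  "'a measure \<Rightarrow> real \<Rightarrow> (real \<Rightarrow> 'a \<Rightarrow> 'b::real_normed_vector) \<Rightarrow> (real \<Rightarrow> 'a \<Rightarrow> 'b) \<Rightarrow> ennreal" where
  "quadratic_error M T X Xh =
     (\<integral>\<^sup>+\<omega>. (\<integral>\<^sup>+t\<in>{0..T}. ennreal ((norm (X t \<omega> - Xh t \<omega>))\<^sup>2) \<partial>lborel) \<partial>M)"

definition product_quantization ::
  "'a measure \<Rightarrow> real \<Rightarrow> (real \<Rightarrow> 'a \<Rightarrow> real) \<Rightarrow> nat \<Rightarrow> (real \<Rightarrow> 'a \<Rightarrow> real) \<Rightarrow> bool" where
  "product_quantization M T X m Xh \<longleftrightarrow>
     (\<exists>(L::nat) (n :: nat \<Rightarrow> nat) \<xi>h.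
        1 \<le> L \<and> (\<forall>k\<in>{1..L}. 1 \<le> n k) \<and> (\<Prod>k=1..L. n k) \<le> m \<and>
        (\<forall>k\<in>{1..L}. optimal_quantization M UNIV dist (kl_xi T X k) (n k) (\<xi>h k)) \<and>
        (\<forall>\<omega>\<in>space M. \<forall>t\<in>{0..T}.
           Xh t \<omega> = (\<Sum>k=1..L. sqrt (kl_lambda T k) * \<xi>h k \<omega> * kl_e T k t)))"

text \<open>
  The error of a product quantization depends only on \<open>L, N\<^sub>1, \<dots>, N\<^sub>L\<close>, so minimizing over
  these parameters is minimizing over all product quantizations of the given level.
\<close>

definition optimal_product_quantization ::
  "'a measure \<Rightarrow> real \<Rightarrow> (real \<Rightarrow> 'a \<Rightarrow> real) \<Rightarrow> nat \<Rightarrow> (real \<Rightarrow> 'a \<Rightarrow> real) \<Rightarrow> bool" where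
  "optimal_product_quantization M T X m Xh \<longleftrightarrow>
     product_quantization M T X m Xh \<and>
     (\<forall>Y. product_quantization M T X m Y \<longrightarrow> quadratic_error M T X Xh \<le> quadratic_error M T X Y)"

text \<open>
  Optimality in \<open>L\<^sup>2([0,T],dt)\<close> determines the codebook only up to null sets of \<open>t\<close>. The second
  conjunct selects the version that is a finite Karhunen-Loeve expansion; the Hoelder
  semi-norm below depends on this choice.
\<close>

definition optimal_functional_quantization ::
  "'a measure \<Rightarrow> real \<Rightarrow> (real \<Rightarrow> 'a \<Rightarrow> real) \<Rightarrow> nat \<Rightarrow> (real \<Rightarrow> 'a \<Rightarrow> real) \<Rightarrow> bool" where
  "optimal_functional_quantization M T X m Xh \<longleftrightarrow>
     optimal_quantization M (L2_carrier T) (L2_distance T) (path_on T X) m (path_on T Xh) \<and>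
     (\<exists>(l::nat) \<zeta>h.
        optimal_quantization M (euclidean_carrier l) (euclidean_distance l)
          (\<lambda>\<omega>. \<lambda>k\<in>{1..l}. sqrt (kl_lambda T k) * kl_xi T X k \<omega>) m \<zeta>h \<and>
        (\<forall>\<omega>\<in>space M. \<forall>t\<in>{0..T}. Xh t \<omega> = (\<Sum>k=1..l. \<zeta>h \<omega> k * kl_e T k t)))"

text \<open>A quantization of a given scalar type in dimension \<open>d\<close>, at level \<open>N\<close>.\<close>

definition componentwise ::
  "((real \<Rightarrow> 'a \<Rightarrow> real) \<Rightarrow> nat \<Rightarrow> (real \<Rightarrow> 'a \<Rightarrow> real) \<Rightarrow> bool) \<Rightarrow>
   (real \<Rightarrow> 'a \<Rightarrow> real ^ 'd::finite) \<Rightarrow> nat \<Rightarrow> (real \<Rightarrow> 'a \<Rightarrow> real ^ 'd) \<Rightarrow> bool" where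
  "componentwise Q W N Wh \<longleftrightarrow>
     (\<forall>i. Q (coordinate W i) (nat \<lfloor>root CARD('d) (real N)\<rfloor>) (coordinate Wh i))"

definition generated_algebra ::
  "'a measure \<Rightarrow> real \<Rightarrow> (real \<Rightarrow> 'a \<Rightarrow> real ^ 'd::finite) \<Rightarrow> 'a measure" where
  "generated_algebra M T Y = vimage_algebra (space M) (path_on T Y) (PiM {0..T} (\<lambda>_. borel))"

definition stationary ::
  "'a measure \<Rightarrow> real \<Rightarrow> (real \<Rightarrow> 'a \<Rightarrow> real ^ 'd::finite) \<Rightarrow> (real \<Rightarrow> 'a \<Rightarrow> real ^ 'd) \<Rightarrow> bool" where
  "stationary M T W Wh \<longleftrightarrow>
     (\<forall>t\<in>{0..T}. \<forall>i. AE \<omega> in M.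
        Wh t \<omega> $ i = real_cond_exp M (generated_algebra M T Wh) (\<lambda>\<omega>. W t \<omega> $ i) \<omega>)"


section \<open>Hoelder semi-norm and \<open>L\<^sup>p\<close> norm\<close>

text \<open>Both take values in \<open>[0,\<infinity>]\<close>, so that no finiteness has to be presupposed.\<close>

definition holder_seminorm :: "real \<Rightarrow> real \<Rightarrow> (real \<Rightarrow> 'b::real_normed_vector) \<Rightarrow> ennreal" where
  "holder_seminorm T q x = ennreal (T powr (1 / q)) *
     (\<Squnion>(s, t)\<in>{(s, t). 0 \<le> s \<and> s < t \<and> t \<le> T}.
        ennreal (norm (x t - x s) / \<bar>t - s\<bar> powr (1 / q)))"

text \<open>Powers with positive real exponents on \<open>[0,\<infinity>]\<close>.\<close>

definition ennreal_powr :: "ennreal \<Rightarrow> real \<Rightarrow> ennreal" where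
  "ennreal_powr x a = (if x = \<infinity> then \<infinity> else ennreal (enn2real x powr a))"

definition Lp_norm :: "'a measure \<Rightarrow> real \<Rightarrow> ('a \<Rightarrow> ennreal) \<Rightarrow> ennreal" where
  "Lp_norm M p f = ennreal_powr (\<integral>\<^sup>+\<omega>. ennreal_powr (f \<omega>) p \<partial>M) (1 / p)"

definition holder_error ::
  "'a measure \<Rightarrow> real \<Rightarrow> real \<Rightarrow> real \<Rightarrow>
   (real \<Rightarrow> 'a \<Rightarrow> 'b::real_normed_vector) \<Rightarrow> (real \<Rightarrow> 'a \<Rightarrow> 'b) \<Rightarrow> ennreal" where
  "holder_error M T q p W Wh = Lp_norm M p (\<lambda>\<omega>. holder_seminorm T q (\<lambda>t. W t \<omega> - Wh t \<omega>))"

end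

theory Submission
  imports Defs "HOL-Real_Asymp.Real_Asymp"
begin

text \<open>
  The errors \<open>D = W - Wh\<close> are estimated coordinate by coordinate. By Kolmogorov's criterion it is
  enough to bound \<open>E (D\<^sub>t - D\<^sub>s)\<^sup>2\<^sup>l\<close> by a small multiple of a power of \<open>t - s\<close> larger than
  \<open>1 + 2 l / q\<close>, for an integer \<open>l\<close> with \<open>p \<le> 2 l\<close>.

  In (a), stationarity and Jensen's inequality give \<open>E (D\<^sub>t - D\<^sub>s)\<^sup>2\<^sup>l \<le> C (t - s)\<^sup>l\<close>. Together with the
  convergence of the quadratic error this forces \<open>E D\<^sub>t\<^sup>2 \<rightarrow> 0\<close> uniformly in \<open>t\<close>, and interpolating between
  the second and a higher moment yields a small multiple of \<open>(t - s)\<^sup>l\<^sup>-\<^sup>1\<close>.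

  In (b), \<open>D\<close> is a sum of independent centered terms. An exchange argument shows that the optimal
  sizes satisfy \<open>E (\<xi>\<^sub>k - \<xi>h\<^sub>k)\<^sup>2 = O(k\<^sup>2 (ln N)\<^sup>-\<^sup>2\<^sup>+\<^sup>\<epsilon>)\<close>. Since \<open>\<xi>\<^sub>k - \<xi>h\<^sub>k\<close> has at most linear growth in \<open>\<xi>\<^sub>k\<close>, its
  moment of order \<open>2 j\<close> is at most the power \<open>u j\<close> of this bound whenever \<open>u j < 1\<close>, and a moment inequality for
  independent sums transfers this to \<open>D\<^sub>t - D\<^sub>s\<close>. The minimum in the exponent comes from the constraints
  \<open>u l < 1\<close> and \<open>1/q + 1/(2 l) + u < 1/2\<close>.
\<close>

subsection \<open>Kolmogorov's criterion\<close>

text \<open>Constants must be uniform over all quantizers of all levels, so the analytic lemmas fix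
  their constants before quantifying over processes. Distributional facts about Brownian motion go
  through characteristic functions: one Gaussian formula for linear combinations of
  \<open>X t\<close> and the Karhunen-Loeve coefficients gives the laws of these coefficients, their
  independence and the law of the remainder. Convergence of the expansion enters only as convergence
  of variances. The slack \<alpha> in the rate pays for crude estimates: the scalar quantization
  error is used with exponent \<open>- 2 + \<epsilon>\<close>, which a uniform grid and a moment
  bound achieve, in place of the sharp -2. The factor 1/5 arises as follows. Let 1/r be the minimum
  in the exponent. The target is u close to 3/(2r). Choosing r <= 2l < 4r/3 gives both u l < 1 and
  1/(2l) <= 1/r, so 1/q + 1/(2l) + u stays below 1/q + 5/(2r), and this is at most 1/2 precisely
  when 1/r <= (1 - 2/q)/5.\<close>

lemma dyadic_chaining:
  fixes y :: "real \<Rightarrow> real"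
  assumes cont: "continuous_on {0..1} y" and r: "0 < r" "r < 1" and G: "0 \<le> G"
    and inc: "\<And>n i. i < 2 ^ n \<Longrightarrow> \<bar>y (real (Suc i) / 2 ^ n) - y (real i / 2 ^ n)\<bar> \<le> G * r ^ n"
    and u: "0 \<le> u" "u \<le> 1"
  shows "\<bar>y u - y (real (nat \<lfloor>2 ^ n * u\<rfloor>) / 2 ^ n)\<bar> \<le> G * (r ^ n / (1 - r))"
proof -
  \<comment> \<open>\<open>v n\<close> is the dyadic point of level n just below u. Two consecutive
    ones agree or are the end points of one cell of level n + 1, so going from \<open>v n\<close>
    towards u costs a geometric series, and continuity closes the gap to u itself.\<close>
  define k where "k n = nat \<lfloor>2 ^ n * u\<rfloor>" for n
  define v where "v n = real (k n) / 2 ^ n" for n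
  have k_le: "real (k n) \<le> 2 ^ n * u" and k_gt: "2 ^ n * u < real (k n) + 1" for n
    using u unfolding k_def by (auto simp: of_nat_nat)
  have step: "\<bar>y (v (Suc n)) - y (v n)\<bar> \<le> G * r ^ n" for n
  proof -
    have "2 * real (k n) < real (k (Suc n)) + 1" "real (k (Suc n)) < 2 * real (k n) + 2"
      using k_le[of n] k_gt[of n] k_le[of "Suc n"] k_gt[of "Suc n"] by auto
    then consider "k (Suc n) = 2 * k n" | "k (Suc n) = 2 * k n + 1" by linarith
    then show ?thesis
    proof cases
      case 1
      then have "v (Suc n) = v n" by (simp add: v_def)
      then show ?thesis using G r by simp
    next
      case 2
      have "2 ^ Suc n * u \<le> 2 ^ Suc n * 1" using u by (intro mult_left_mono) auto
      with k_le[of "Suc n"] have "real (k (Suc n)) \<le> 2 ^ Suc n" by linarith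
      then have "k (Suc n) \<le> 2 ^ Suc n" by (metis of_nat_le_iff of_nat_numeral of_nat_power)
      then have "2 * k n < 2 ^ Suc n" using 2 by linarith
      from inc[OF this] have "\<bar>y (real (k (Suc n)) / 2 ^ Suc n) - y (real (2 * k n) / 2 ^ Suc n)\<bar> \<le> G * r ^ Suc n"
        using 2 by simp
      also have "real (2 * k n) / 2 ^ Suc n = v n" by (simp add: v_def)
      also have "G * r ^ Suc n \<le> G * r ^ n" using G r by (intro mult_left_mono) (auto intro: mult_left_le_one_le)
      finally show ?thesis by (simp add: v_def)
    qed
  qed
  have part: "\<bar>y (v (n + j)) - y (v n)\<bar> \<le> G * (r ^ n / (1 - r))" for j
  proof -
    have "\<bar>y (v (n + j)) - y (v n)\<bar> \<le> (\<Sum>i<j. G * r ^ (n + i))"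
    proof (induction j)
      case (Suc j)
      then show ?case using step[of "n + j"] by (simp add: abs_diff_triangle_ineq)
    qed simp
    also have "\<dots> = G * r ^ n * (\<Sum>i<j. r ^ i)" by (simp add: sum_distrib_left power_add mult.assoc)
    also have "(\<Sum>i<j. r ^ i) = (1 - r ^ j) / (1 - r)" using r by (simp add: sum_gp_strict)
    also have "\<dots> \<le> 1 / (1 - r)" using r by (intro divide_right_mono) auto
    finally show ?thesis using G r by (simp add: mult_left_mono)
  qed
  have "(\<lambda>n. (1 / 2 :: real) ^ n) \<longlonglongrightarrow> 0" by (rule LIMSEQ_power_zero) simp
  have "(\<lambda>n. v n - u) \<longlonglongrightarrow> 0"
  proof (rule Lim_null_comparison)
    show "\<forall>\<^sub>F n in sequentially. norm (v n - u) \<le> (1/2) ^ n"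
    proof (intro always_eventually allI)
      fix n
      have "v n \<le> u" using k_le[of n] by (simp add: v_def field_simps)
      moreover have "u \<le> v n + (1/2)^n" using k_gt[of n] by (simp add: v_def field_simps power_one_over)
      ultimately show "norm (v n - u) \<le> (1/2) ^ n" by simp
    qed
  qed fact
  then have "v \<longlonglongrightarrow> u" by (simp add: LIM_zero_iff)
  then have lim: "(\<lambda>j. v (n + j)) \<longlonglongrightarrow> u" using LIMSEQ_ignore_initial_segment[of v u n] by (simp add: add.commute)
  have v01: "v j \<in> {0..1}" for j
  proof -
    have "v j \<le> u" using k_le[of j] by (simp add: v_def field_simps)
    moreover have "0 \<le> v j" by (simp add: v_def)
    ultimately show ?thesis using u by auto
  qed
  have "(\<lambda>j. y (v (n + j))) \<longlonglongrightarrow> y u"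
    by (rule continuous_on_tendsto_compose[OF cont lim]) (use u v01 in auto)
  then have "(\<lambda>j. \<bar>y (v (n + j)) - y (v n)\<bar>) \<longlonglongrightarrow> \<bar>y u - y (v n)\<bar>" by (intro tendsto_intros)
  then have "\<bar>y u - y (v n)\<bar> \<le> G * (r ^ n / (1 - r))"
    by (rule tendsto_upperbound) (use part in auto)
  then show ?thesis by (simp add: v_def k_def)
qed

text \<open>At the scale n with 2^-(n+1) < w - u <= 2^-n, the dyadic points below u and w coincide
  or are neighbours, so \<open>dyadic_chaining\<close> at both ends and one increment in between
  suffice. The lower bound on w - u turns r^n into a power of w - u at the price of a factor
  2^a.\<close>

lemma dyadic_modulus:
  fixes y :: "real \<Rightarrow> real"
  assumes cont: "continuous_on {0..1} y" and a: "0 < a" and G: "0 \<le> G"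
    and inc: "\<And>n i. i < 2 ^ n \<Longrightarrow> \<bar>y (real (Suc i) / 2 ^ n) - y (real i / 2 ^ n)\<bar> \<le> G * (2 powr (- a)) ^ n"
    and u: "0 \<le> u" "u < w" "w \<le> 1"
  shows "\<bar>y w - y u\<bar> \<le> 2 powr a * (1 + 2 / (1 - 2 powr (- a))) * G * (w - u) powr a"
proof -
  define r where "r = 2 powr (- a)"
  have r: "0 < r" "r < 1" unfolding r_def using a powr_less_mono[of "- a" 0 2] by auto
  define n where "n = (LEAST n. (1/2::real) ^ Suc n < w - u)"
  have ex: "\<exists>n. (1/2::real) ^ Suc n < w - u"
  proof -
    obtain n where "(1/2::real) ^ n < w - u" using u real_arch_pow_inv[of "w - u" "1/2"] by auto
    moreover have "(1/2::real) ^ Suc n \<le> (1/2)^n" by simp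
    ultimately show ?thesis by (intro exI[of _ n]) linarith
  qed
  have n1: "(1/2::real) ^ Suc n < w - u" unfolding n_def by (rule LeastI_ex[OF ex])
  have n2: "w - u \<le> (1/2) ^ n"
  proof (cases n)
    case 0 then show ?thesis using u by simp
  next
    case (Suc k)
    then have "k < n" by simp
    then have "\<not> (1/2::real) ^ Suc k < w - u" unfolding n_def by (rule not_less_Least)
    then show ?thesis using Suc by simp
  qed
  define i where "i = nat \<lfloor>2 ^ n * u\<rfloor>"
  define j where "j = nat \<lfloor>2 ^ n * w\<rfloor>"
  have i: "real i \<le> 2 ^ n * u" "2 ^ n * u < real i + 1" unfolding i_def using u by (auto simp: of_nat_nat)
  have j: "real j \<le> 2 ^ n * w" "2 ^ n * w < real j + 1" unfolding j_def using u by (auto simp: of_nat_nat)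
  have "2 ^ n * w - 2 ^ n * u \<le> 1" using n2 by (simp add: field_simps power_one_over)
  moreover have "2 ^ n * u < 2 ^ n * w" using u by simp
  ultimately have "real j < real i + 2" "real i < real j + 1" using i j by linarith+
  then consider "j = i" | "j = Suc i" by linarith
  then have mid: "\<bar>y (real j / 2 ^ n) - y (real i / 2 ^ n)\<bar> \<le> G * r ^ n"
  proof cases
    case 1 then show ?thesis using G r by simp
  next
    case 2
    have "2 ^ n * w \<le> 2 ^ n * 1" using u by (intro mult_left_mono) auto
    then have "real j \<le> 2 ^ n" using j by linarith
    then have "j \<le> 2 ^ n" by (metis of_nat_le_iff of_nat_numeral of_nat_power)
    then have "i < 2 ^ n" using 2 by linarith
    from inc[OF this] show ?thesis using 2 by (simp add: r_def)
  qed
  have cu: "\<bar>y u - y (real i / 2 ^ n)\<bar> \<le> G * (r ^ n / (1 - r))" unfolding i_def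
    by (rule dyadic_chaining[OF cont r G]) (use inc u in \<open>auto simp: r_def\<close>)
  have cw: "\<bar>y w - y (real j / 2 ^ n)\<bar> \<le> G * (r ^ n / (1 - r))" unfolding j_def
    by (rule dyadic_chaining[OF cont r G]) (use inc u in \<open>auto simp: r_def\<close>)
  have "r ^ n = (2 powr (- real n)) powr a"
    by (simp add: r_def powr_powr powr_realpow[symmetric] mult.commute)
  also have "2 powr (- real n) = 2 * (1/2) ^ Suc n" by (simp add: powr_minus powr_realpow field_simps power_one_over)
  also have "(2 * (1/2) ^ Suc n) powr a \<le> (2 * (w - u)) powr a" using n1 a by (intro powr_mono2) auto
  also have "(2 * (w - u)) powr a = 2 powr a * (w - u) powr a" by (rule powr_mult)
  finally have rn: "r ^ n \<le> 2 powr a * (w - u) powr a" .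
  have "\<bar>y w - y u\<bar> \<le> (1 + 2 / (1 - r)) * G * r ^ n"
  proof -
    have "\<bar>y w - y u\<bar> \<le> G * r ^ n + 2 * (G * (r ^ n / (1 - r)))" using mid cu cw by linarith
    then show ?thesis by (simp add: algebra_simps)
  qed
  also have "\<dots> \<le> (1 + 2 / (1 - r)) * G * (2 powr a * (w - u) powr a)"
    using rn r G by (intro mult_left_mono mult_nonneg_nonneg) auto
  finally show ?thesis unfolding r_def by (simp add: mult_ac)
qed

text \<open>Up to a factor, the random constant \<open>S\<close> is a weighted sum of the 2l-th
  powers of all dyadic increments of all levels; its 2l-th root dominates each single weighted
  increment, which is the hypothesis of \<open>dyadic_modulus\<close>. Level n contributes 2^n
  increments with moments at most K (T / 2^n)^b and weights 2^(2lan), so the expectations are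
  dominated by a geometric series of ratio \<open>\<rho>\<close>. \<open>S\<close> may be infinite
  at some \<omega>; the bound is trivial there because t - s > 0.\<close>

lemma (in prob_space) kolmogorov_modulus:
  fixes T a b :: real and l :: nat
  assumes T: "0 < T" and a: "0 < a" and l: "1 \<le> l" and b: "1 + 2 * real l * a < b"
  shows "\<exists>C>0. \<forall>(X :: real \<Rightarrow> 'a \<Rightarrow> real) K. 0 \<le> K \<longrightarrow> (\<forall>t\<in>{0..T}. X t \<in> borel_measurable M) \<longrightarrow>
     (\<forall>\<omega>\<in>space M. continuous_on {0..T} (\<lambda>t. X t \<omega>)) \<longrightarrow>
     (\<forall>s t. 0 \<le> s \<longrightarrow> s < t \<longrightarrow> t \<le> T \<longrightarrow>
        (\<integral>\<^sup>+\<omega>. ennreal ((X t \<omega> - X s \<omega>) ^ (2 * l)) \<partial>M) \<le> ennreal (K * (t - s) powr b)) \<longrightarrow>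
     (\<exists>S\<in>borel_measurable M. (\<integral>\<^sup>+\<omega>. S \<omega> \<partial>M) \<le> ennreal (C * K) \<and>
        (\<forall>\<omega>\<in>space M. \<forall>s t. 0 \<le> s \<longrightarrow> s < t \<longrightarrow> t \<le> T \<longrightarrow>
           ennreal ((X t \<omega> - X s \<omega>) ^ (2 * l)) \<le> S \<omega> * ennreal ((t - s) powr (2 * real l * a))))"
proof -
  define c where "c = 2 powr a * (1 + 2 / (1 - 2 powr (- a))) * (1 / T) powr a"
  define \<rho> where "\<rho> = 2 powr (1 + 2 * real l * a - b)"
  have "2 powr (- a) < 1" using a powr_less_mono[of "- a" 0 2] by auto
  then have c: "0 < c" unfolding c_def using T by (intro mult_pos_pos) (auto intro!: add_pos_pos divide_pos_pos)
  have \<rho>: "0 < \<rho>" "\<rho> < 1" using b powr_less_mono[of "1 + 2 * real l * a - b" 0 2] unfolding \<rho>_def by auto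
  define C where "C = c ^ (2 * l) * (T powr b * (1 / (1 - \<rho>)))"
  have C: "0 < C" unfolding C_def using c T \<rho> by (intro mult_pos_pos) auto
  show ?thesis
  proof (intro exI[of _ C] conjI allI impI C)
    fix X :: "real \<Rightarrow> 'a \<Rightarrow> real" and K :: real
    assume K: "0 \<le> K" and meas: "\<forall>t\<in>{0..T}. X t \<in> borel_measurable M"
      and cont: "\<forall>\<omega>\<in>space M. continuous_on {0..T} (\<lambda>t. X t \<omega>)"
      and mom: "\<forall>s t. 0 \<le> s \<longrightarrow> s < t \<longrightarrow> t \<le> T \<longrightarrow>
        (\<integral>\<^sup>+\<omega>. ennreal ((X t \<omega> - X s \<omega>) ^ (2 * l)) \<partial>M) \<le> ennreal (K * (t - s) powr b)"
    define g where "g n i = T * (real i / 2 ^ n)" for n i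
    have g_in: "i \<le> 2 ^ n \<Longrightarrow> g n i \<in> {0..T}" for n i
    proof -
      assume "i \<le> 2 ^ n"
      then have "real i \<le> real (2 ^ n)" by (rule of_nat_mono)
      then have "real i / 2 ^ n \<le> 1" by simp
      then have "T * (real i / 2 ^ n) \<le> T * 1" using T by (intro mult_left_mono) auto
      then show ?thesis using T by (simp add: g_def)
    qed
    define R where "R = (2 powr a) ^ (2 * l)"
    have R: "0 < R" by (simp add: R_def)
    define S0 where "S0 \<omega> = (\<Sum>n. \<Sum>i<2^n. ennreal (R ^ n * (X (g n (Suc i)) \<omega> - X (g n i) \<omega>) ^ (2 * l)))" for \<omega>
    have [measurable]: "i \<le> 2 ^ n \<Longrightarrow> X (g n i) \<in> borel_measurable M" for n i
      using meas g_in by blast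
    have S0m: "S0 \<in> borel_measurable M" unfolding S0_def by measurable
    have "(\<integral>\<^sup>+\<omega>. S0 \<omega> \<partial>M) = (\<Sum>n. \<Sum>i<2^n. \<integral>\<^sup>+\<omega>. ennreal (R ^ n * (X (g n (Suc i)) \<omega> - X (g n i) \<omega>) ^ (2 * l)) \<partial>M)"
      unfolding S0_def by (subst nn_integral_suminf) (auto intro!: suminf_cong nn_integral_sum)
    also have "\<dots> \<le> (\<Sum>n. ennreal (K * T powr b * \<rho> ^ n))"
    proof (intro suminf_le summableI)
      fix n
      have "(\<Sum>i<2^n. \<integral>\<^sup>+\<omega>. ennreal (R ^ n * (X (g n (Suc i)) \<omega> - X (g n i) \<omega>) ^ (2 * l)) \<partial>M)
         \<le> (\<Sum>i<(2::nat)^n. ennreal (R ^ n * (K * (T / 2 ^ n) powr b)))"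
      proof (intro sum_mono)
        fix i assume "i \<in> {..<(2::nat)^n}"
        then have i: "i < 2 ^ n" by simp
        have d: "g n (Suc i) - g n i = T / 2 ^ n" by (simp add: g_def field_simps)
        then have lt: "g n i < g n (Suc i)" using T by (smt (verit) divide_pos_pos zero_less_power)
        have "(\<integral>\<^sup>+\<omega>. ennreal (R ^ n * (X (g n (Suc i)) \<omega> - X (g n i) \<omega>) ^ (2 * l)) \<partial>M)
            = ennreal (R ^ n) * (\<integral>\<^sup>+\<omega>. ennreal ((X (g n (Suc i)) \<omega> - X (g n i) \<omega>) ^ (2 * l)) \<partial>M)"
          using R i by (subst nn_integral_cmult[symmetric]) (auto simp: ennreal_mult)
        also have "\<dots> \<le> ennreal (R ^ n) * ennreal (K * (T / 2 ^ n) powr b)"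
          using mom[rule_format, of "g n i" "g n (Suc i)"] lt g_in[of i n] g_in[of "Suc i" n] i d
          by (intro mult_left_mono) auto
        also have "\<dots> = ennreal (R ^ n * (K * (T / 2 ^ n) powr b))"
          using R K by (simp add: ennreal_mult)
        finally show "(\<integral>\<^sup>+\<omega>. ennreal (R ^ n * (X (g n (Suc i)) \<omega> - X (g n i) \<omega>) ^ (2 * l)) \<partial>M)
          \<le> ennreal (R ^ n * (K * (T / 2 ^ n) powr b))" .
      qed
      also have "\<dots> = ennreal (2 ^ n * (R ^ n * (K * (T / 2 ^ n) powr b)))"
        using R K by (simp add: ennreal_mult ennreal_power[symmetric] del: ennreal_power)
      also have "2 ^ n * (R ^ n * (K * (T / 2 ^ n) powr b)) = K * T powr b * \<rho> ^ n"
      proof -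
        have "(2::real) ^ n = 2 powr (real n)" by (simp add: powr_realpow)
        moreover have "R ^ n = 2 powr (2 * real l * a * real n)"
          by (simp add: R_def powr_realpow[symmetric] powr_powr power_mult[symmetric] mult_ac)
        moreover have "\<rho> ^ n = 2 powr ((1 + 2 * real l * a - b) * real n)"
          unfolding \<rho>_def by (simp add: powr_realpow[symmetric] powr_powr)
        moreover have "(T / 2 ^ n) powr b = T powr b * 2 powr (- b * real n)"
          using T by (simp add: powr_divide powr_realpow[symmetric] powr_powr powr_minus mult.commute)
            (simp add: divide_inverse)
        moreover have "2 powr (real n) * (2 powr (2 * real l * a * real n) * 2 powr (- b * real n))
            = (2::real) powr ((1 + 2 * real l * a - b) * real n)"
          by (simp add: powr_add[symmetric] algebra_simps)
        ultimately show ?thesis by (simp add: mult_ac)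
      qed
      finally show "(\<Sum>i<2^n. \<integral>\<^sup>+\<omega>. ennreal (R ^ n * (X (g n (Suc i)) \<omega> - X (g n i) \<omega>) ^ (2 * l)) \<partial>M)
         \<le> ennreal (K * T powr b * \<rho> ^ n)" .
    qed
    also have "\<dots> = ennreal (K * T powr b * (1 / (1 - \<rho>)))"
      using K \<rho> T by (subst suminf_ennreal2) (auto simp: suminf_mult suminf_geometric summable_geometric)
    finally have S0i: "(\<integral>\<^sup>+\<omega>. S0 \<omega> \<partial>M) \<le> ennreal (K * T powr b * (1 / (1 - \<rho>)))" .
    define S where "S \<omega> = ennreal (c ^ (2 * l)) * S0 \<omega>" for \<omega>
    have Sm: "S \<in> borel_measurable M" unfolding S_def using S0m by measurable
    show "\<exists>S\<in>borel_measurable M. (\<integral>\<^sup>+\<omega>. S \<omega> \<partial>M) \<le> ennreal (C * K) \<and>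
        (\<forall>\<omega>\<in>space M. \<forall>s t. 0 \<le> s \<longrightarrow> s < t \<longrightarrow> t \<le> T \<longrightarrow>
           ennreal ((X t \<omega> - X s \<omega>) ^ (2 * l)) \<le> S \<omega> * ennreal ((t - s) powr (2 * real l * a)))"
    proof (intro bexI[OF _ Sm] conjI ballI allI impI)
      have "(\<integral>\<^sup>+\<omega>. S \<omega> \<partial>M) = ennreal (c ^ (2 * l)) * (\<integral>\<^sup>+\<omega>. S0 \<omega> \<partial>M)"
        unfolding S_def using S0m by (intro nn_integral_cmult)
      also have "\<dots> \<le> ennreal (c ^ (2 * l)) * ennreal (K * T powr b * (1 / (1 - \<rho>)))"
        using S0i by (intro mult_left_mono) auto
      also have "\<dots> = ennreal (C * K)" using c K \<rho> by (subst ennreal_mult[symmetric]) (auto simp: C_def mult_ac)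
      finally show "(\<integral>\<^sup>+\<omega>. S \<omega> \<partial>M) \<le> ennreal (C * K)" .
    next
      fix \<omega> s t assume \<omega>: "\<omega> \<in> space M" and st: "0 \<le> s" "s < t" "t \<le> T"
      show "ennreal ((X t \<omega> - X s \<omega>) ^ (2 * l)) \<le> S \<omega> * ennreal ((t - s) powr (2 * real l * a))"
      proof (cases "S0 \<omega> = \<infinity>")
        case True
        then have "S \<omega> * ennreal ((t - s) powr (2 * real l * a)) = \<infinity>"
          using c st by (simp add: S_def ennreal_mult_eq_top_iff ennreal_top_mult)
        then show ?thesis by simp
      next
        case False
        then obtain z where z: "0 \<le> z" "S0 \<omega> = ennreal z" by (cases "S0 \<omega>") auto
        define G where "G = root (2 * l) z"
        have G: "0 \<le> G" "G ^ (2 * l) = z" unfolding G_def using z l by auto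
        define y where "y u = X (T * u) \<omega>" for u
        have cy: "continuous_on {0..1} y" unfolding y_def
          using cont \<omega> T by (intro continuous_on_compose2[of "{0..T}" "\<lambda>t. X t \<omega>" "{0..1}" "\<lambda>u. T * u"])
            (auto intro!: continuous_intros mult_left_le)
        have inc: "\<bar>y (real (Suc i) / 2 ^ n) - y (real i / 2 ^ n)\<bar> \<le> G * (2 powr (- a)) ^ n" if i: "i < 2 ^ n" for n i
        proof -
          let ?d = "\<bar>y (real (Suc i) / 2 ^ n) - y (real i / 2 ^ n)\<bar>"
          have "ennreal (R ^ n * ?d ^ (2 * l)) = ennreal (R ^ n * (X (g n (Suc i)) \<omega> - X (g n i) \<omega>) ^ (2 * l))"
            by (simp add: y_def g_def power_even_abs)
          also have "\<dots> \<le> (\<Sum>i<2^n. ennreal (R ^ n * (X (g n (Suc i)) \<omega> - X (g n i) \<omega>) ^ (2 * l)))"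
            using i by (intro member_le_sum[of i]) auto
          also have "\<dots> \<le> S0 \<omega>" unfolding S0_def
            using sum_le_suminf[of "\<lambda>n. \<Sum>i<2^n. ennreal (R ^ n * (X (g n (Suc i)) \<omega> - X (g n i) \<omega>) ^ (2 * l))" "{n}"]
            by simp
          finally have "R ^ n * ?d ^ (2 * l) \<le> z" using z by simp
          then have "((2 powr a) ^ n * ?d) ^ (2 * l) \<le> G ^ (2 * l)"
            using G by (simp add: R_def power_mult_distrib power_mult[symmetric] mult.commute)
          then have "(2 powr a) ^ n * ?d \<le> G" using power_mono_iff[of "(2 powr a) ^ n * ?d" G "2 * l"] G l by simp
          then show ?thesis by (simp add: powr_minus power_inverse[symmetric] field_simps)
        qed
        have "\<bar>y (t / T) - y (s / T)\<bar> \<le> 2 powr a * (1 + 2 / (1 - 2 powr (- a))) * G * (t / T - s / T) powr a"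
          by (rule dyadic_modulus[OF cy a G(1) inc]) (use st T in \<open>auto simp: divide_strict_right_mono\<close>)
        also have "t / T - s / T = (1 / T) * (t - s)" by (simp add: diff_divide_distrib)
        also have "\<dots> powr a = (1 / T) powr a * (t - s) powr a" by (rule powr_mult)
        finally have "\<bar>X t \<omega> - X s \<omega>\<bar> \<le> c * G * (t - s) powr a"
          using T by (simp add: y_def c_def mult_ac)
        then have "\<bar>X t \<omega> - X s \<omega>\<bar> ^ (2 * l) \<le> (c * G * (t - s) powr a) ^ (2 * l)" by (intro power_mono) auto
        also have "\<dots> = c ^ (2 * l) * z * (t - s) powr (2 * real l * a)"
          using st G by (simp add: power_mult_distrib powr_realpow[symmetric] powr_powr mult_ac)
        finally have "(X t \<omega> - X s \<omega>) ^ (2 * l) \<le> c ^ (2 * l) * z * (t - s) powr (2 * real l * a)"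
          by (simp add: power_even_abs)
        then have "ennreal ((X t \<omega> - X s \<omega>) ^ (2 * l)) \<le> ennreal (c ^ (2 * l) * z * (t - s) powr (2 * real l * a))"
          by (rule ennreal_leI)
        also have "\<dots> = S \<omega> * ennreal ((t - s) powr (2 * real l * a))"
          using c z by (simp add: S_def ennreal_mult)
        finally show ?thesis .
      qed
    qed
  qed
qed

text \<open>Above \<mu> the nonpositive exponent p - n may be attached to \<mu> instead of h. This
  takes the role of Hoelder's inequality in passing from moments of order 2l to order p, and it
  works by monotone integration even for a function h not known to be measurable.\<close>

lemma powr_le_split:
  fixes h \<mu> p :: real
  assumes "0 \<le> h" "0 < \<mu>" "0 < p" "p \<le> real n"
  shows "h powr p \<le> \<mu> powr p + \<mu> powr (p - real n) * h ^ n"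
proof (cases "h \<le> \<mu>")
  case True
  then have "h powr p \<le> \<mu> powr p" using assms by (intro powr_mono2) auto
  moreover have "0 \<le> \<mu> powr (p - real n) * h ^ n" using assms by simp
  ultimately show ?thesis by linarith
next
  case False
  then have h: "0 < h" using assms by auto
  then have "h powr p = h powr (p - real n) * h ^ n" by (simp add: powr_realpow[symmetric] powr_add[symmetric])
  also have "\<dots> \<le> \<mu> powr (p - real n) * h ^ n"
    using False assms h by (intro mult_right_mono powr_mono2') auto
  finally show ?thesis using powr_ge_zero[of \<mu> p] by linarith
qed

lemma ennreal_powr_mono: "0 \<le> a \<Longrightarrow> x \<le> y \<Longrightarrow> ennreal_powr x a \<le> ennreal_powr y a"
  unfolding ennreal_powr_def
  by (auto simp: top_unique less_top[symmetric] intro!: ennreal_leI powr_mono2 enn2real_mono)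

lemma ennreal_powr_ennreal: "0 \<le> x \<Longrightarrow> ennreal_powr (ennreal x) a = ennreal (x powr a)"
  unfolding ennreal_powr_def by simp

text \<open>Pathwise, the semi-norm is at most a constant times the 2l-th root of \<open>U\<close>,
  the sum of the random constants of the coordinates. Measurability is established for this majorant
  and not for the semi-norm, which is a supremum over uncountably many pairs. Taking \<mu> =
  K^(1/(2l)) balances the two terms of \<open>powr_le_split\<close>, which produces the scaling in
  \<open>K\<close>.\<close>

lemma (in prob_space) holder_Lp_bound:
  fixes T q p b :: real and l :: nat
  assumes T: "0 < T" and q: "0 < q" and l: "1 \<le> l" and b: "1 + 2 * real l / q < b"
    and p: "0 < p" "p \<le> 2 * real l"
  shows "\<exists>C>0. \<forall>(X :: real \<Rightarrow> 'a \<Rightarrow> real ^ 'd::finite) K. 0 < K \<longrightarrow>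
     (\<forall>i. \<forall>t\<in>{0..T}. (\<lambda>\<omega>. X t \<omega> $ i) \<in> borel_measurable M) \<longrightarrow>
     (\<forall>i. \<forall>\<omega>\<in>space M. continuous_on {0..T} (\<lambda>t. X t \<omega> $ i)) \<longrightarrow>
     (\<forall>i s t. 0 \<le> s \<longrightarrow> s < t \<longrightarrow> t \<le> T \<longrightarrow>
        (\<integral>\<^sup>+\<omega>. ennreal ((X t \<omega> $ i - X s \<omega> $ i) ^ (2 * l)) \<partial>M) \<le> ennreal (K * (t - s) powr b)) \<longrightarrow>
     Lp_norm M p (\<lambda>\<omega>. holder_seminorm T q (\<lambda>t. X t \<omega>)) \<le> ennreal (C * K powr (1 / (2 * real l)))"
proof -
  define a where "a = 1 / q"
  have a: "0 < a" using q by (simp add: a_def)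
  have b': "1 + 2 * real l * a < b" using b by (simp add: a_def)
  from kolmogorov_modulus[OF T a l b'] obtain C0 where C0: "C0 > 0"
    and mod: "\<And>(X :: real \<Rightarrow> 'a \<Rightarrow> real) K. 0 \<le> K \<Longrightarrow> (\<forall>t\<in>{0..T}. X t \<in> borel_measurable M) \<Longrightarrow>
     (\<forall>\<omega>\<in>space M. continuous_on {0..T} (\<lambda>t. X t \<omega>)) \<Longrightarrow>
     (\<forall>s t. 0 \<le> s \<longrightarrow> s < t \<longrightarrow> t \<le> T \<longrightarrow>
        (\<integral>\<^sup>+\<omega>. ennreal ((X t \<omega> - X s \<omega>) ^ (2 * l)) \<partial>M) \<le> ennreal (K * (t - s) powr b)) \<Longrightarrow>
     (\<exists>S\<in>borel_measurable M. (\<integral>\<^sup>+\<omega>. S \<omega> \<partial>M) \<le> ennreal (C0 * K) \<and>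
        (\<forall>\<omega>\<in>space M. \<forall>s t. 0 \<le> s \<longrightarrow> s < t \<longrightarrow> t \<le> T \<longrightarrow>
           ennreal ((X t \<omega> - X s \<omega>) ^ (2 * l)) \<le> S \<omega> * ennreal ((t - s) powr (2 * real l * a))))"
    by blast
  define d where "d = real CARD('d)"
  have d: "0 < d" by (simp add: d_def)
  define c where "c = T powr a * d"
  have c: "0 < c" using T d by (simp add: c_def)
  define B where "B = 1 + c ^ (2 * l) * (d * C0)"
  have B: "0 < B" unfolding B_def using c d C0 by (intro add_pos_nonneg) auto
  show ?thesis
  proof (intro exI[of _ "B powr (1 / p)"] conjI allI impI)
    show "0 < B powr (1 / p)" using B by simp
    fix X :: "real \<Rightarrow> 'a \<Rightarrow> real ^ 'd" and K :: real
    assume K: "0 < K" and meas: "\<forall>i. \<forall>t\<in>{0..T}. (\<lambda>\<omega>. X t \<omega> $ i) \<in> borel_measurable M"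
      and cont: "\<forall>i. \<forall>\<omega>\<in>space M. continuous_on {0..T} (\<lambda>t. X t \<omega> $ i)"
      and mom: "\<forall>i s t. 0 \<le> s \<longrightarrow> s < t \<longrightarrow> t \<le> T \<longrightarrow>
        (\<integral>\<^sup>+\<omega>. ennreal ((X t \<omega> $ i - X s \<omega> $ i) ^ (2 * l)) \<partial>M) \<le> ennreal (K * (t - s) powr b)"
    have "\<exists>S\<in>borel_measurable M. (\<integral>\<^sup>+\<omega>. S \<omega> \<partial>M) \<le> ennreal (C0 * K) \<and>
        (\<forall>\<omega>\<in>space M. \<forall>s t. 0 \<le> s \<longrightarrow> s < t \<longrightarrow> t \<le> T \<longrightarrow>
           ennreal ((X t \<omega> $ i - X s \<omega> $ i) ^ (2 * l)) \<le> S \<omega> * ennreal ((t - s) powr (2 * real l * a)))" for i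
      by (rule mod[of K "\<lambda>t \<omega>. X t \<omega> $ i"]) (use K meas cont mom in auto)
    then have "\<exists>S. \<forall>i. S i\<in>borel_measurable M \<and> (\<integral>\<^sup>+\<omega>. S i \<omega> \<partial>M) \<le> ennreal (C0 * K) \<and>
        (\<forall>\<omega>\<in>space M. \<forall>s t. 0 \<le> s \<longrightarrow> s < t \<longrightarrow> t \<le> T \<longrightarrow>
           ennreal ((X t \<omega> $ i - X s \<omega> $ i) ^ (2 * l)) \<le> S i \<omega> * ennreal ((t - s) powr (2 * real l * a)))"
      unfolding Bex_def by (rule choice[OF allI])
    then obtain S where Sm: "\<And>i. S i \<in> borel_measurable M"
      and Si: "\<And>i. (\<integral>\<^sup>+\<omega>. S i \<omega> \<partial>M) \<le> ennreal (C0 * K)"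
      and Sb: "\<And>i \<omega> s t. \<omega> \<in> space M \<Longrightarrow> 0 \<le> s \<Longrightarrow> s < t \<Longrightarrow> t \<le> T \<Longrightarrow>
           ennreal ((X t \<omega> $ i - X s \<omega> $ i) ^ (2 * l)) \<le> S i \<omega> * ennreal ((t - s) powr (2 * real l * a))"
      by blast
    define U where "U \<omega> = (\<Sum>i\<in>UNIV. S i \<omega>)" for \<omega>
    have Um[measurable]: "U \<in> borel_measurable M" unfolding U_def using Sm by measurable
    have "(\<integral>\<^sup>+\<omega>. U \<omega> \<partial>M) = (\<Sum>i\<in>UNIV. \<integral>\<^sup>+\<omega>. S i \<omega> \<partial>M)"
      unfolding U_def by (rule nn_integral_sum) (use Sm in auto)
    also have "\<dots> \<le> (\<Sum>i\<in>(UNIV::'d set). ennreal (C0 * K))" by (intro sum_mono Si)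
    also have "\<dots> = ennreal (d * C0 * K)"
      using C0 K by (simp add: d_def ennreal_mult ennreal_of_nat_eq_real_of_nat mult.assoc)
    finally have Ui: "(\<integral>\<^sup>+\<omega>. U \<omega> \<partial>M) \<le> ennreal (d * C0 * K)" .
    define \<mu> where "\<mu> = K powr (1 / (2 * real l))"
    have \<mu>: "0 < \<mu>" using K by (simp add: \<mu>_def)
    have \<mu>R: "\<mu> ^ (2 * l) = K" using K l by (simp add: \<mu>_def powr_realpow[symmetric] powr_powr)
    have pt: "ennreal_powr (holder_seminorm T q (\<lambda>t. X t \<omega>)) p
        \<le> ennreal (\<mu> powr p) + ennreal (c ^ (2 * l) * \<mu> powr (p - real (2 * l))) * U \<omega>" if \<omega>: "\<omega> \<in> space M" for \<omega>
    proof (cases "U \<omega> = \<infinity>")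
      case True
      then show ?thesis using c \<mu> by (simp add: ennreal_mult_top)
    next
      case False
      then obtain z where z: "0 \<le> z" "U \<omega> = ennreal z" by (cases "U \<omega>") auto
      define G where "G = root (2 * l) z"
      have G: "0 \<le> G" "G ^ (2 * l) = z" unfolding G_def using z l by auto
      have inc: "norm (X t \<omega> - X s \<omega>) / \<bar>t - s\<bar> powr (1 / q) \<le> d * G" if st: "0 \<le> s" "s < t" "t \<le> T" for s t
      proof -
        have "\<bar>X t \<omega> $ i - X s \<omega> $ i\<bar> \<le> G * (t - s) powr a" for i
        proof -
          have "S i \<omega> \<le> U \<omega>" unfolding U_def by (intro member_le_sum) auto
          then have "S i \<omega> * ennreal ((t - s) powr (2 * real l * a)) \<le> ennreal z * ennreal ((t - s) powr (2 * real l * a))"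
            using z by (intro mult_right_mono) auto
          with Sb[OF \<omega> st, of i] have "ennreal ((X t \<omega> $ i - X s \<omega> $ i) ^ (2 * l)) \<le> ennreal (z * (t - s) powr (2 * real l * a))"
            using z by (simp add: ennreal_mult)
          then have "(X t \<omega> $ i - X s \<omega> $ i) ^ (2 * l) \<le> z * (t - s) powr (2 * real l * a)"
            using z by (subst (asm) ennreal_le_iff) auto
          also have "\<dots> = (G * (t - s) powr a) ^ (2 * l)"
            using st G by (simp add: power_mult_distrib powr_realpow[symmetric] powr_powr mult_ac)
          finally have "\<bar>X t \<omega> $ i - X s \<omega> $ i\<bar> ^ (2 * l) \<le> (G * (t - s) powr a) ^ (2 * l)"
            by (simp add: power_even_abs)
          then show ?thesis
            using power_mono_iff[of "\<bar>X t \<omega> $ i - X s \<omega> $ i\<bar>" "G * (t - s) powr a" "2 * l"] G l by simp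
        qed
        then have "(\<Sum>i\<in>UNIV. \<bar>(X t \<omega> - X s \<omega>) $ i\<bar>) \<le> (\<Sum>i\<in>(UNIV::'d set). G * (t - s) powr a)"
          by (intro sum_mono) auto
        with norm_le_l1_cart[of "X t \<omega> - X s \<omega>"] have "norm (X t \<omega> - X s \<omega>) \<le> d * (G * (t - s) powr a)"
          by (simp add: d_def)
        then show ?thesis using st by (simp add: a_def divide_le_eq mult.assoc)
      qed
      have "holder_seminorm T q (\<lambda>t. X t \<omega>) \<le> ennreal (T powr (1/q)) * ennreal (d * G)"
        unfolding holder_seminorm_def
        by (intro mult_left_mono SUP_least) (use inc in \<open>auto intro!: ennreal_leI\<close>)
      also have "\<dots> = ennreal (c * G)" using d G T by (simp add: ennreal_mult[symmetric] c_def a_def mult.assoc)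
      finally have "ennreal_powr (holder_seminorm T q (\<lambda>t. X t \<omega>)) p \<le> ennreal_powr (ennreal (c * G)) p"
        using p by (intro ennreal_powr_mono) auto
      also have "\<dots> = ennreal ((c * G) powr p)" using c G by (simp add: ennreal_powr_ennreal)
      also have "\<dots> \<le> ennreal (\<mu> powr p + \<mu> powr (p - real (2 * l)) * (c * G) ^ (2 * l))"
        using c G \<mu> p by (intro ennreal_leI powr_le_split) auto
      also have "\<dots> = ennreal (\<mu> powr p) + ennreal (c ^ (2 * l) * \<mu> powr (p - real (2 * l))) * U \<omega>"
      proof -
        have "\<mu> powr (p - real (2 * l)) * (c * G) ^ (2 * l) = c ^ (2 * l) * \<mu> powr (p - real (2 * l)) * z"
          using G(2) by (simp add: power_mult_distrib)
        then show ?thesis using z c by (simp add: ennreal_mult[symmetric] del: mult_cancel_left ennreal_mult_eq_top_iff)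
      qed
      finally show ?thesis .
    qed
    have "(\<integral>\<^sup>+\<omega>. ennreal_powr (holder_seminorm T q (\<lambda>t. X t \<omega>)) p \<partial>M)
        \<le> (\<integral>\<^sup>+\<omega>. ennreal (\<mu> powr p) + ennreal (c ^ (2 * l) * \<mu> powr (p - real (2 * l))) * U \<omega> \<partial>M)"
      by (intro nn_integral_mono pt)
    also have "\<dots> = ennreal (\<mu> powr p) + ennreal (c ^ (2 * l) * \<mu> powr (p - real (2 * l))) * (\<integral>\<^sup>+\<omega>. U \<omega> \<partial>M)"
      by (subst nn_integral_add) (auto simp: nn_integral_cmult emeasure_space_1)
    also have "\<dots> \<le> ennreal (\<mu> powr p) + ennreal (c ^ (2 * l) * \<mu> powr (p - real (2 * l))) * ennreal (d * C0 * K)"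
      by (intro add_mono mult_left_mono Ui) auto
    also have "\<dots> = ennreal (\<mu> powr p + c ^ (2 * l) * \<mu> powr (p - real (2 * l)) * (d * C0 * K))"
      using c d C0 K by (simp add: ennreal_mult)
    also have "\<mu> powr p + c ^ (2 * l) * \<mu> powr (p - real (2 * l)) * (d * C0 * K) = B * \<mu> powr p"
    proof -
      have "\<mu> powr (p - real (2 * l)) * K = \<mu> powr p"
        using \<mu> unfolding \<mu>R[symmetric] by (simp add: powr_realpow[symmetric] powr_add[symmetric])
      then show ?thesis by (simp add: B_def algebra_simps)
    qed
    finally have I: "(\<integral>\<^sup>+\<omega>. ennreal_powr (holder_seminorm T q (\<lambda>t. X t \<omega>)) p \<partial>M) \<le> ennreal (B * \<mu> powr p)" .
    have "Lp_norm M p (\<lambda>\<omega>. holder_seminorm T q (\<lambda>t. X t \<omega>)) \<le> ennreal_powr (ennreal (B * \<mu> powr p)) (1 / p)"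
      unfolding Lp_norm_def using p by (intro ennreal_powr_mono I) auto
    also have "\<dots> = ennreal (B powr (1 / p) * \<mu>)"
      using B p \<mu> by (simp add: ennreal_powr_ennreal powr_mult powr_powr)
    finally show "Lp_norm M p (\<lambda>\<omega>. holder_seminorm T q (\<lambda>t. X t \<omega>)) \<le> ennreal (B powr (1 / p) * K powr (1 / (2 * real l)))"
      by (simp add: \<mu>_def)
  qed
qed

subsection \<open>Centered Gaussian variables\<close>

text \<open>Characteristic functions include the degenerate case \<open>v = 0\<close> and pass to limits.\<close>

definition gauss :: "'a measure \<Rightarrow> ('a \<Rightarrow> real) \<Rightarrow> real \<Rightarrow> bool" where
  "gauss M Z v \<longleftrightarrow> 0 \<le> v \<and> Z \<in> borel_measurable M \<and>
     (\<forall>u. (\<integral>\<omega>. iexp (u * Z \<omega>) \<partial>M) = complex_of_real (exp (- (u\<^sup>2 * v) / 2)))"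

lemma gaussD:
  assumes "gauss M Z v"
  shows "0 \<le> v" "Z \<in> borel_measurable M" "(\<integral>\<omega>. iexp (u * Z \<omega>) \<partial>M) = complex_of_real (exp (- (u\<^sup>2 * v) / 2))"
  using assms by (auto simp: gauss_def)

lemma (in prob_space) integrable_iexp_comp [intro, simp]:
  "f \<in> borel_measurable M \<Longrightarrow> integrable M (\<lambda>\<omega>. iexp (f \<omega> :: real))"
  by (rule integrable_const_bound[where B=1]) (auto simp: norm_exp_i_times)

lemma (in prob_space) distr_eq_char:
  fixes X Y :: "'a \<Rightarrow> real"
  assumes [measurable]: "X \<in> borel_measurable M" "Y \<in> borel_measurable M"
    and eq: "\<And>u. (\<integral>\<omega>. iexp (u * X \<omega>) \<partial>M) = (\<integral>\<omega>. iexp (u * Y \<omega>) \<partial>M)"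
  shows "distr M borel X = distr M borel Y"
proof (rule Levy_uniqueness)
  show "char (distr M borel X) = char (distr M borel Y)"
    unfolding char_def by (rule ext) (simp add: integral_distr eq del: of_real_mult)
qed auto

lemma (in prob_space) gauss_standard:
  assumes g: "gauss M Z 1"
  shows "distr M borel Z = std_normal_distribution"
proof (rule Levy_uniqueness)
  have [measurable]: "Z \<in> borel_measurable M" using g by (rule gaussD)
  show "real_distribution (distr M borel Z)" by auto
  show "char (distr M borel Z) = char std_normal_distribution"
    unfolding char_std_normal_distribution using gaussD(3)[OF g]
    by (intro ext) (simp add: char_def integral_distr del: of_real_mult)
qed (rule real_dist_normal_dist)

lemma (in prob_space) gauss_scale:
  assumes g: "gauss M Z v"
  shows "gauss M (\<lambda>\<omega>. c * Z \<omega>) (c\<^sup>2 * v)"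
  unfolding gauss_def using gaussD(1,2)[OF g] gaussD(3)[OF g, of "_ * c"]
  by (auto simp: mult.assoc power_mult_distrib simp del: of_real_mult)

lemma (in prob_space) gauss_distributed_normal:
  assumes d: "distributed M lborel X (normal_density 0 \<sigma>)" and s: "0 < \<sigma>"
  shows "gauss M X (\<sigma>\<^sup>2)"
proof -
  have "distributed M lborel (\<lambda>x. (X x - 0) / \<sigma>) std_normal_density"
    using normal_standard_normal_convert[OF s, of X 0] d by simp
  then have Y: "distributed M lborel (\<lambda>x. X x / \<sigma>) std_normal_density" by simp
  have m: "(\<lambda>x. X x / \<sigma>) \<in> borel_measurable M" using distributed_measurable[OF Y] by simp
  have "distr M lborel (\<lambda>x. X x / \<sigma>) = std_normal_distribution" using distributed_distr_eq_density[OF Y] .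
  then have D: "distr M borel (\<lambda>x. X x / \<sigma>) = std_normal_distribution"
    by (metis distr_cong sets_lborel)
  have "gauss M (\<lambda>x. X x / \<sigma>) 1"
    unfolding gauss_def
  proof (intro conjI allI m)
    fix u
    have "(\<integral>\<omega>. iexp (u * (X \<omega> / \<sigma>)) \<partial>M) = char (distr M borel (\<lambda>x. X x / \<sigma>)) u"
      unfolding char_def using m by (simp add: integral_distr)
    then show "(\<integral>\<omega>. iexp (u * (X \<omega> / \<sigma>)) \<partial>M) = complex_of_real (exp (- (u\<^sup>2 * 1) / 2))"
      by (simp add: D char_std_normal_distribution)
  qed simp
  from gauss_scale[OF this, of \<sigma>] s show ?thesis by simp
qed

text \<open>Characters have modulus 1, so dominated convergence applies without any moment bound:
  almost sure convergence and convergence of the variances are enough.\<close>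

lemma (in prob_space) gauss_limit:
  assumes g: "\<And>n. gauss M (Z n) (v n)" and Z: "Z' \<in> borel_measurable M"
    and lim: "AE \<omega> in M. (\<lambda>n. Z n \<omega>) \<longlonglongrightarrow> Z' \<omega>" and v: "v \<longlonglongrightarrow> v'"
  shows "gauss M Z' v'"
  unfolding gauss_def
proof (intro conjI allI Z)
  show "0 \<le> v'" using v gaussD(1)[OF g] by (intro LIMSEQ_le_const) auto
  fix u
  have "(\<lambda>n. \<integral>\<omega>. iexp (u * Z n \<omega>) \<partial>M) \<longlonglongrightarrow> (\<integral>\<omega>. iexp (u * Z' \<omega>) \<partial>M)"
  proof (rule integral_dominated_convergence[where w="\<lambda>_. 1"])
    show "AE \<omega> in M. (\<lambda>n. iexp (u * Z n \<omega>)) \<longlonglongrightarrow> iexp (u * Z' \<omega>)"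
      using lim by eventually_elim (auto intro!: tendsto_intros)
  qed (use gaussD(2)[OF g] Z in \<open>auto simp: norm_exp_i_times simp del: of_real_mult\<close>)
  moreover have "(\<lambda>n. complex_of_real (exp (- (u\<^sup>2 * v n) / 2))) \<longlonglongrightarrow> complex_of_real (exp (- (u\<^sup>2 * v') / 2))"
    by (intro tendsto_intros v) simp
  ultimately show "(\<integral>\<omega>. iexp (u * Z' \<omega>) \<partial>M) = complex_of_real (exp (- (u\<^sup>2 * v') / 2))"
    unfolding gaussD(3)[OF g] by (rule LIMSEQ_unique)
qed

lemma (in prob_space) gauss_sum_indep:
  fixes X :: "'i \<Rightarrow> 'a \<Rightarrow> real"
  assumes I: "finite I" and ind: "indep_vars (\<lambda>_. borel) X I" and g: "\<And>i. i \<in> I \<Longrightarrow> gauss M (X i) (v i)"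
  shows "gauss M (\<lambda>\<omega>. \<Sum>i\<in>I. a i * X i \<omega>) (\<Sum>i\<in>I. (a i)\<^sup>2 * v i)"
  unfolding gauss_def
proof (intro conjI allI)
  have [measurable]: "i \<in> I \<Longrightarrow> X i \<in> borel_measurable M" for i using g by (blast dest: gaussD)
  show "0 \<le> (\<Sum>i\<in>I. (a i)\<^sup>2 * v i)" using gaussD(1)[OF g] by (intro sum_nonneg) auto
  show "(\<lambda>\<omega>. \<Sum>i\<in>I. a i * X i \<omega>) \<in> borel_measurable M" by measurable
  fix u
  have ind': "indep_vars (\<lambda>_. borel) (\<lambda>i \<omega>. iexp (u * a i * X i \<omega>)) I"
    by (rule indep_vars_compose2[OF ind]) auto
  have "(\<integral>\<omega>. iexp (u * (\<Sum>i\<in>I. a i * X i \<omega>)) \<partial>M) = (\<integral>\<omega>. (\<Prod>i\<in>I. iexp (u * a i * X i \<omega>)) \<partial>M)"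
    by (simp add: exp_sum[OF I, symmetric] sum_distrib_left mult_ac)
  also have "\<dots> = (\<Prod>i\<in>I. \<integral>\<omega>. iexp (u * a i * X i \<omega>) \<partial>M)"
    by (rule indep_vars_lebesgue_integral[OF I ind']) (simp del: of_real_mult)
  also have "\<dots> = (\<Prod>i\<in>I. complex_of_real (exp (- ((u * a i)\<^sup>2 * v i) / 2)))"
    by (intro prod.cong refl gaussD(3) g)
  also have "\<dots> = complex_of_real (exp (\<Sum>i\<in>I. - ((u * a i)\<^sup>2 * v i) / 2))"
    by (simp only: of_real_prod[symmetric] exp_sum[OF I])
  also have "(\<Sum>i\<in>I. - ((u * a i)\<^sup>2 * v i) / 2) = - (u\<^sup>2 * (\<Sum>i\<in>I. (a i)\<^sup>2 * v i)) / 2"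
    by (simp add: sum_distrib_left sum_negf sum_divide_distrib power_mult_distrib mult.assoc)
  finally show "(\<integral>\<omega>. iexp (u * (\<Sum>i\<in>I. a i * X i \<omega>)) \<partial>M) =
      complex_of_real (exp (- (u\<^sup>2 * (\<Sum>i\<in>I. (a i)\<^sup>2 * v i)) / 2))" .
qed

text \<open>In the degenerate case the characteristic function is that of the constant 0, so Z
  vanishes almost surely; otherwise Z / sqrt v is standard normal and the known moments
  apply.\<close>

lemma (in prob_space) gauss_moments:
  assumes g: "gauss M Z v"
  shows "integrable M (\<lambda>\<omega>. Z \<omega> ^ k)"
    and "(\<integral>\<omega>. Z \<omega> ^ (2 * k) \<partial>M) = fact (2 * k) / (2 ^ k * fact k) * v ^ k"
    and "(\<integral>\<omega>. Z \<omega> \<partial>M) = 0"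
proof -
  have [measurable]: "Z \<in> borel_measurable M" using g by (rule gaussD)
  have "integrable M (\<lambda>\<omega>. Z \<omega> ^ k) \<and> (\<integral>\<omega>. Z \<omega> ^ (2 * k) \<partial>M) = fact (2 * k) / (2 ^ k * fact k) * v ^ k
    \<and> (\<integral>\<omega>. Z \<omega> \<partial>M) = 0"
  proof (cases "v = 0")
    case True
    have "distr M borel Z = distr M borel (\<lambda>_. 0)"
      by (rule distr_eq_char) (use gaussD(3)[OF g] True in \<open>auto simp: prob_space simp del: of_real_mult\<close>)
    then have "(AE x in distr M borel Z. x = 0) \<longleftrightarrow> (AE x in distr M borel (\<lambda>_. 0). x = (0::real))"
      by (rule arg_cong[where f="\<lambda>N. AE x in N. x = 0"])
    then have "AE \<omega> in M. Z \<omega> = 0"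
      by (subst (asm) (1 2) AE_distr_iff) (auto intro: borel_closed)
    then have *: "AE \<omega> in M. Z \<omega> ^ k = 0 ^ k" "AE \<omega> in M. Z \<omega> ^ (2 * k) = 0 ^ (2 * k)" for k
      by (auto elim!: eventually_mono)
    have "integrable M (\<lambda>\<omega>. Z \<omega> ^ k)"
      using integrable_cong_AE[OF _ _ *(1)[of k]] by simp
    moreover have "(\<integral>\<omega>. Z \<omega> ^ (2 * k) \<partial>M) = 0 ^ (2 * k)"
      using integral_cong_AE[OF _ _ *(2)[of k]] by (simp add: prob_space)
    moreover have "(\<integral>\<omega>. Z \<omega> \<partial>M) = 0" using integral_cong_AE[OF _ _ *(1)[of 1]] by simp
    ultimately show ?thesis using True by (cases "k = 0") (simp_all add: power_0_left prob_space)
  next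
    case False
    then have v: "0 < v" using gaussD(1)[OF g] by simp
    define Y where "Y \<omega> = Z \<omega> / sqrt v" for \<omega>
    have [measurable]: "Y \<in> borel_measurable M" unfolding Y_def by measurable
    have "gauss M Y 1" unfolding Y_def using gauss_scale[OF g, of "1 / sqrt v"] v
      by (simp add: power_divide)
    then have D: "distr M borel Y = std_normal_distribution" by (rule gauss_standard)
    have ZY: "Z \<omega> = sqrt v * Y \<omega>" for \<omega> using v by (simp add: Y_def)
    have int: "integrable M (\<lambda>\<omega>. Y \<omega> ^ k)" for k
      using integrable_std_normal_distribution_moment[of k] unfolding D[symmetric]
      by (subst (asm) integrable_distr_eq) auto
    have mom: "(\<integral>\<omega>. Y \<omega> ^ k \<partial>M) = (\<integral>x. x ^ k \<partial>std_normal_distribution)" for k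
      unfolding D[symmetric] by (subst integral_distr) auto
    have "(\<integral>\<omega>. Z \<omega> \<partial>M) = 0"
      unfolding ZY using mom[of 1] integral_std_normal_distribution_moment_odd[of 1] by simp
    moreover have "(\<integral>\<omega>. Z \<omega> ^ (2 * k) \<partial>M) = fact (2 * k) / (2 ^ k * fact k) * v ^ k"
      unfolding ZY power_mult_distrib using mom[of "2 * k"] std_normal_distribution_even_moments[of k] v
      by (simp add: power_mult)
    ultimately show ?thesis using int unfolding ZY power_mult_distrib by simp
  qed
  then show "integrable M (\<lambda>\<omega>. Z \<omega> ^ k)"
    and "(\<integral>\<omega>. Z \<omega> ^ (2 * k) \<partial>M) = fact (2 * k) / (2 ^ k * fact k) * v ^ k"
    and "(\<integral>\<omega>. Z \<omega> \<partial>M) = 0" by auto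
qed

subsection \<open>Independence from characteristic functions\<close>

text \<open>A bounded weight, shifted by B + 1 so that it is at least 1 and then normalized, is the
  density of a probability measure \<open>N\<close>. The hypothesis says that \<xi> has the same
  characteristic function under \<open>N\<close> as under \<open>M\<close>, so its two laws agree by
  Levy's uniqueness theorem; undoing the shift gives the claim for w.\<close>

lemma (in prob_space) weighted_indep:
  fixes w \<xi> :: "'a \<Rightarrow> real"
  assumes [measurable]: "w \<in> borel_measurable M" "\<xi> \<in> borel_measurable M" and B: "\<And>\<omega>. \<bar>w \<omega>\<bar> \<le> B"
    and H: "\<And>u. (\<integral>\<omega>. w \<omega> *\<^sub>R iexp (u * \<xi> \<omega>) \<partial>M) = (\<integral>\<omega>. w \<omega> \<partial>M) *\<^sub>R (\<integral>\<omega>. iexp (u * \<xi> \<omega>) \<partial>M)"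
    and A: "A \<in> sets borel"
  shows "(\<integral>\<omega>. w \<omega> * indicator A (\<xi> \<omega>) \<partial>M) = (\<integral>\<omega>. w \<omega> \<partial>M) * (\<integral>\<omega>. indicator A (\<xi> \<omega>) \<partial>M)"
proof -
  have [simp]: "integrable M w" by (rule integrable_const_bound[where B=B]) (use B in auto)
  have iA[measurable]: "(indicator A :: real \<Rightarrow> real) \<in> borel_measurable borel" using A by simp
  define W where "W \<omega> = w \<omega> + B + 1" for \<omega>
  define c where "c = (\<integral>\<omega>. W \<omega> \<partial>M)"
  have W1: "1 \<le> W \<omega>" for \<omega> using B[of \<omega>] by (simp add: W_def)
  have W0: "0 \<le> W \<omega>" for \<omega> using W1[of \<omega>] by linarith
  have [measurable]: "W \<in> borel_measurable M" unfolding W_def by measurable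
  have [simp]: "integrable M W" unfolding W_def by (intro Bochner_Integration.integrable_add) auto
  have c: "c = (\<integral>\<omega>. w \<omega> \<partial>M) + B + 1" unfolding c_def W_def by (simp add: prob_space)
  have "1 \<le> c" unfolding c_def using integral_mono[of M "\<lambda>_. 1" W] W1 by (simp add: prob_space)
  define N where "N = density M (\<lambda>\<omega>. ennreal (W \<omega> / c))"
  have "emeasure N (space N) = (\<integral>\<^sup>+\<omega>. ennreal (W \<omega> / c) \<partial>M)"
    unfolding N_def by (simp add: emeasure_density)
  also have "\<dots> = ennreal (\<integral>\<omega>. W \<omega> / c \<partial>M)"
    using \<open>1 \<le> c\<close> W0 by (intro nn_integral_eq_integral) (auto intro!: AE_I2 divide_nonneg_nonneg)
  also have "(\<integral>\<omega>. W \<omega> / c \<partial>M) = 1" using \<open>1 \<le> c\<close> by (simp add: c_def)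
  finally interpret N: prob_space N by (intro prob_spaceI) simp
  have [measurable]: "\<xi> \<in> borel_measurable N" by (simp add: N_def)
  have intN: "(\<integral>\<omega>. f \<omega> \<partial>N) = (1 / c) *\<^sub>R (\<integral>\<omega>. W \<omega> *\<^sub>R f \<omega> \<partial>M)" if [measurable]: "f \<in> borel_measurable M"
    for f :: "'a \<Rightarrow> 'b :: {banach, second_countable_topology}"
  proof -
    have "(\<integral>\<omega>. f \<omega> \<partial>N) = (\<integral>\<omega>. (W \<omega> / c) *\<^sub>R f \<omega> \<partial>M)" unfolding N_def
      using \<open>1 \<le> c\<close> W0 by (intro integral_density) (auto intro!: AE_I2 divide_nonneg_nonneg)
    also have "\<dots> = (\<integral>\<omega>. (1 / c) *\<^sub>R (W \<omega> *\<^sub>R f \<omega>) \<partial>M)" by simp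
    finally show ?thesis by (simp only: integral_scaleR_right)
  qed
  have HW: "(\<integral>\<omega>. W \<omega> *\<^sub>R iexp (u * \<xi> \<omega>) \<partial>M) = c *\<^sub>R (\<integral>\<omega>. iexp (u * \<xi> \<omega>) \<partial>M)" for u
  proof -
    have i: "integrable M (\<lambda>\<omega>. w \<omega> *\<^sub>R iexp (u * \<xi> \<omega>))"
      by (rule integrable_const_bound[where B=B]) (use B in \<open>auto simp: norm_exp_i_times simp del: of_real_mult\<close>)
    have "(\<integral>\<omega>. W \<omega> *\<^sub>R iexp (u * \<xi> \<omega>) \<partial>M) = (\<integral>\<omega>. w \<omega> *\<^sub>R iexp (u * \<xi> \<omega>) + (B + 1) *\<^sub>R iexp (u * \<xi> \<omega>) \<partial>M)"
      by (simp add: W_def scaleR_add_left add.assoc del: of_real_mult)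
    also have "\<dots> = (\<integral>\<omega>. w \<omega> *\<^sub>R iexp (u * \<xi> \<omega>) \<partial>M) + (B + 1) *\<^sub>R (\<integral>\<omega>. iexp (u * \<xi> \<omega>) \<partial>M)"
      by (subst Bochner_Integration.integral_add[OF i]) (simp_all del: of_real_mult)
    finally show ?thesis unfolding H c by (simp add: scaleR_add_left add.assoc)
  qed
  have "distr N borel \<xi> = distr M borel \<xi>"
  proof (rule Levy_uniqueness)
    show "char (distr N borel \<xi>) = char (distr M borel \<xi>)"
    proof
      fix u
      have "char (distr N borel \<xi>) u = (\<integral>\<omega>. iexp (u * \<xi> \<omega>) \<partial>N)"
        unfolding char_def by (simp add: integral_distr del: of_real_mult)
      also have "\<dots> = (\<integral>\<omega>. iexp (u * \<xi> \<omega>) \<partial>M)"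
        using \<open>1 \<le> c\<close> by (subst intN) (auto simp: HW simp del: of_real_mult)
      also have "\<dots> = char (distr M borel \<xi>) u"
        unfolding char_def by (simp add: integral_distr del: of_real_mult)
      finally show "char (distr N borel \<xi>) u = char (distr M borel \<xi>) u" .
    qed
  qed auto
  then have "(\<integral>x. indicator A x \<partial>distr N borel \<xi>) = (\<integral>x. indicator A x \<partial>distr M borel \<xi> :: real)" by simp
  then have "(\<integral>\<omega>. indicator A (\<xi> \<omega>) \<partial>N) = (\<integral>\<omega>. indicator A (\<xi> \<omega>) \<partial>M :: real)"
    by (subst (asm) (1 2) integral_distr) auto
  then have 1: "(\<integral>\<omega>. W \<omega> * indicator A (\<xi> \<omega>) \<partial>M) = c * (\<integral>\<omega>. indicator A (\<xi> \<omega>) \<partial>M)"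
    using \<open>1 \<le> c\<close> by (subst (asm) intN) (auto simp: field_simps)
  have [measurable]: "(\<lambda>\<omega>. indicator A (\<xi> \<omega>) :: real) \<in> borel_measurable M"
    by (rule measurable_compose[OF assms(2) iA])
  have iAM[simp]: "integrable M (\<lambda>\<omega>. indicator A (\<xi> \<omega>) :: real)"
    by (rule integrable_const_bound[where B=1]) auto
  have iwA: "integrable M (\<lambda>\<omega>. w \<omega> * indicator A (\<xi> \<omega>))"
  proof (rule integrable_const_bound[where B=B])
    show "AE \<omega> in M. norm (w \<omega> * indicator A (\<xi> \<omega>)) \<le> B"
      using B order_trans[OF abs_ge_zero B] by (auto simp: indicator_def)
  qed measurable
  have "(\<integral>\<omega>. W \<omega> * indicator A (\<xi> \<omega>) \<partial>M) = (\<integral>\<omega>. w \<omega> * indicator A (\<xi> \<omega>) + (B + 1) * indicator A (\<xi> \<omega>) \<partial>M)"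
    by (simp add: W_def algebra_simps)
  also have "\<dots> = (\<integral>\<omega>. w \<omega> * indicator A (\<xi> \<omega>) \<partial>M) + (B + 1) * (\<integral>\<omega>. indicator A (\<xi> \<omega>) \<partial>M)"
    using iwA by (subst Bochner_Integration.integral_add) simp_all
  finally show ?thesis using 1 unfolding c by (simp add: algebra_simps)
qed

text \<open>In the expectation of the product, the factors are turned one after the other from
  characters into indicator functions.\<close>

lemma (in prob_space) indep_vars_char:
  fixes \<xi> :: "'i \<Rightarrow> 'a \<Rightarrow> real"
  assumes I: "finite I" and \<xi>: "\<And>i. i \<in> I \<Longrightarrow> \<xi> i \<in> borel_measurable M"
    and char: "\<And>u :: 'i \<Rightarrow> real. (\<integral>\<omega>. iexp (\<Sum>i\<in>I. u i * \<xi> i \<omega>) \<partial>M) = (\<Prod>i\<in>I. \<integral>\<omega>. iexp (u i * \<xi> i \<omega>) \<partial>M)"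
  shows "indep_vars (\<lambda>_. borel) \<xi> I"
proof -
  define \<phi> where "\<phi> i u = (\<integral>\<omega>. iexp (u * \<xi> i \<omega>) \<partial>M)" for i and u :: real
  have [simp]: "\<phi> i 0 = 1" for i by (simp add: \<phi>_def prob_space)
  have key: "(\<integral>\<omega>. (\<Prod>i\<in>J. indicator (A i) (\<xi> i \<omega>)) *\<^sub>R iexp (\<Sum>i\<in>I - J. u i * \<xi> i \<omega>) \<partial>M)
      = (\<Prod>i\<in>J. \<integral>\<omega>. indicator (A i) (\<xi> i \<omega>) \<partial>M) *\<^sub>R (\<Prod>i\<in>I - J. \<phi> i (u i))"
    if J: "J \<subseteq> I" and A: "\<And>i. i \<in> I \<Longrightarrow> A i \<in> sets borel" for J A and u :: "'i \<Rightarrow> real"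
    using finite_subset[OF J I] J
  proof (induction J arbitrary: u)
    case empty
    then show ?case using char[of u] by (simp add: \<phi>_def)
  next
    case (insert a J)
    then have a: "a \<in> I" and JI: "J \<subseteq> I" by auto
    note [measurable] = \<xi>
    have mi[measurable]: "i \<in> I \<Longrightarrow> (\<lambda>\<omega>. indicator (A i) (\<xi> i \<omega>) :: real) \<in> borel_measurable M" for i
      using measurable_compose[OF \<xi> borel_measurable_indicator[OF A]] by blast
    define R where "R = I - insert a J"
    have IJ: "I - J = insert a R" and aR: "a \<notin> R" and fR: "finite R" and RI: "R \<subseteq> I"
      using insert a I unfolding R_def by auto
    define Q where "Q \<omega> = (\<Prod>i\<in>J. indicator (A i) (\<xi> i \<omega>) :: real)" for \<omega>
    define S where "S \<omega> = (\<Sum>i\<in>R. u i * \<xi> i \<omega>)" for \<omega>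
    define P where "P = (\<Prod>i\<in>J. \<integral>\<omega>. indicator (A i) (\<xi> i \<omega>) \<partial>M :: real)"
    have Qm[measurable]: "Q \<in> borel_measurable M" unfolding Q_def by (intro borel_measurable_prod mi) (use JI in auto)
    have Sm[measurable]: "S \<in> borel_measurable M" unfolding S_def
      by (intro borel_measurable_sum borel_measurable_times \<xi> borel_measurable_const) (use RI in auto)
    have \<xi>a[measurable]: "\<xi> a \<in> borel_measurable M" using \<xi> a by auto
    have Q01: "0 \<le> Q \<omega>" "Q \<omega> \<le> 1" for \<omega>
      unfolding Q_def by (auto intro!: prod_nonneg prod_le_1)
    have IH: "(\<integral>\<omega>. Q \<omega> *\<^sub>R iexp (v * \<xi> a \<omega> + s * S \<omega>) \<partial>M) = \<phi> a v * (P *\<^sub>R (\<Prod>i\<in>R. \<phi> i (s * u i)))" for v s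
    proof -
      \<comment> \<open>The frequency v at a stays free for \<open>weighted_indep\<close>, while the
        parameter s rescales all remaining frequencies at once, so that both S and - S are available
        below.\<close>
      let ?u = "\<lambda>i. if i = a then v else s * u i"
      have *: "(\<Sum>i\<in>I - J. ?u i * \<xi> i \<omega>) = v * \<xi> a \<omega> + s * S \<omega>" for \<omega>
        unfolding IJ using aR fR by (simp add: S_def sum_distrib_left mult.assoc) (rule sum.cong, auto)
      have **: "(\<Prod>i\<in>I - J. \<phi> i (?u i)) = \<phi> a v * (\<Prod>i\<in>R. \<phi> i (s * u i))"
        unfolding IJ using aR fR by simp (intro disjI2 prod.cong, auto)
      show ?thesis using insert.IH[OF JI, of ?u] unfolding * ** Q_def[symmetric] P_def[symmetric] by simp
    qed
    have iQ: "integrable M (\<lambda>\<omega>. Q \<omega> *\<^sub>R iexp (f \<omega>))" if "f \<in> borel_measurable M" for f :: "'a \<Rightarrow> real"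
      by (rule integrable_const_bound[where B=1]) (use that Q01 in \<open>auto simp: norm_exp_i_times simp del: of_real_mult\<close>)
    define D where "D s = P *\<^sub>R (\<Prod>i\<in>R. \<phi> i (s * u i))" for s :: real
    have D: "(\<integral>\<omega>. Q \<omega> *\<^sub>R iexp (v * \<xi> a \<omega> + s * S \<omega>) \<partial>M) = \<phi> a v * D s" for v s
      unfolding D_def by (rule IH)
    \<comment> \<open>\<open>weighted_indep\<close> takes real weights, but the remaining factor
      \<open>iexp (S \<omega>)\<close> is complex. Its cosine and sine parts are recovered by
      combining the induction hypothesis at s = 1 and s = -1.\<close>
    have trig: "iexp (v * x + 1 * y) + iexp (v * x + (- 1) * y) = (2 * cos y) *\<^sub>R iexp (v * x)"
      "iexp (v * x + 1 * y) - iexp (v * x + (- 1) * y) = (2 * sin y) *\<^sub>R (\<i> * iexp (v * x))" for v x y :: real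
    proof -
      have e: "iexp (v * x + s * y) = iexp (v * x) * (complex_of_real (cos (s * y)) + \<i> * complex_of_real (sin (s * y)))" for s
      proof -
        have "iexp (s * y) = complex_of_real (cos (s * y)) + \<i> * complex_of_real (sin (s * y))"
          by (simp add: cis_conv_exp[symmetric] complex_eq_iff del: of_real_mult)
        then show ?thesis unfolding of_real_add distrib_left exp_add by (simp add: distrib_left)
      qed
      show "iexp (v * x + 1 * y) + iexp (v * x + (- 1) * y) = (2 * cos y) *\<^sub>R iexp (v * x)"
        "iexp (v * x + 1 * y) - iexp (v * x + (- 1) * y) = (2 * sin y) *\<^sub>R (\<i> * iexp (v * x))"
        unfolding e by (simp_all add: scaleR_conv_of_real algebra_simps)
    qed
    have gen: "(\<integral>\<omega>. w \<omega> * indicator (A a) (\<xi> a \<omega>) \<partial>M) = (\<integral>\<omega>. w \<omega> \<partial>M) * (\<integral>\<omega>. indicator (A a) (\<xi> a \<omega>) \<partial>M)"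
      if w[measurable]: "w \<in> borel_measurable M" and wB: "\<And>\<omega>. \<bar>w \<omega>\<bar> \<le> 1"
        and c: "\<And>v. (\<integral>\<omega>. w \<omega> *\<^sub>R iexp (v * \<xi> a \<omega>) \<partial>M) = \<phi> a v * c" for w :: "'a \<Rightarrow> real" and c
    proof (rule weighted_indep[where B=1, OF w \<xi>a wB _ A[OF a]])
      fix v
      \<comment> \<open>Evaluation at v = 0 identifies the constant c as the expectation of
        w.\<close>
      have "complex_of_real (\<integral>\<omega>. w \<omega> \<partial>M) = (\<integral>\<omega>. w \<omega> *\<^sub>R iexp (0 * \<xi> a \<omega>) \<partial>M)"
        by (simp add: scaleR_conv_of_real)
      then have "c = complex_of_real (\<integral>\<omega>. w \<omega> \<partial>M)" unfolding c by simp
      with c[of v] show "(\<integral>\<omega>. w \<omega> *\<^sub>R iexp (v * \<xi> a \<omega>) \<partial>M) = (\<integral>\<omega>. w \<omega> \<partial>M) *\<^sub>R (\<integral>\<omega>. iexp (v * \<xi> a \<omega>) \<partial>M)"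
        by (simp add: \<phi>_def scaleR_conv_of_real mult.commute)
    qed
    have iQv: "integrable M (\<lambda>\<omega>. Q \<omega> *\<^sub>R iexp (v * \<xi> a \<omega> + s * S \<omega>))" for v s
      by (rule iQ) measurable
    have gc: "(\<integral>\<omega>. (Q \<omega> * cos (S \<omega>)) * indicator (A a) (\<xi> a \<omega>) \<partial>M)
        = (\<integral>\<omega>. Q \<omega> * cos (S \<omega>) \<partial>M) * (\<integral>\<omega>. indicator (A a) (\<xi> a \<omega>) \<partial>M)"
    proof (rule gen)
      show "\<bar>Q \<omega> * cos (S \<omega>)\<bar> \<le> 1" for \<omega>
        using Q01[of \<omega>] abs_cos_le_one[of "S \<omega>"] by (simp add: abs_mult mult_le_one)
      fix v
      have "(\<integral>\<omega>. (Q \<omega> * cos (S \<omega>)) *\<^sub>R iexp (v * \<xi> a \<omega>) \<partial>M)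
          = (\<integral>\<omega>. (1/2) *\<^sub>R (Q \<omega> *\<^sub>R iexp (v * \<xi> a \<omega> + 1 * S \<omega>) + Q \<omega> *\<^sub>R iexp (v * \<xi> a \<omega> + (- 1) * S \<omega>)) \<partial>M)"
        unfolding scaleR_add_right[symmetric, of "Q _"] trig by simp
      also have "\<dots> = (1/2) *\<^sub>R (\<phi> a v * D 1 + \<phi> a v * D (- 1))"
        by (subst integral_scaleR_right, subst Bochner_Integration.integral_add[OF iQv iQv]) (simp only: D)
      finally show "(\<integral>\<omega>. (Q \<omega> * cos (S \<omega>)) *\<^sub>R iexp (v * \<xi> a \<omega>) \<partial>M) = \<phi> a v * ((1/2) *\<^sub>R (D 1 + D (- 1)))"
        by (simp add: algebra_simps)
    qed measurable
    have gs: "(\<integral>\<omega>. (Q \<omega> * sin (S \<omega>)) * indicator (A a) (\<xi> a \<omega>) \<partial>M)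
        = (\<integral>\<omega>. Q \<omega> * sin (S \<omega>) \<partial>M) * (\<integral>\<omega>. indicator (A a) (\<xi> a \<omega>) \<partial>M)"
    proof (rule gen)
      show "\<bar>Q \<omega> * sin (S \<omega>)\<bar> \<le> 1" for \<omega>
        using Q01[of \<omega>] abs_sin_le_one[of "S \<omega>"] by (simp add: abs_mult mult_le_one)
      fix v
      have "(\<integral>\<omega>. (Q \<omega> * sin (S \<omega>)) *\<^sub>R iexp (v * \<xi> a \<omega>) \<partial>M)
          = (\<integral>\<omega>. (- \<i> / 2) * (Q \<omega> *\<^sub>R iexp (v * \<xi> a \<omega> + 1 * S \<omega>) - Q \<omega> *\<^sub>R iexp (v * \<xi> a \<omega> + (- 1) * S \<omega>)) \<partial>M)"
        unfolding scaleR_diff_right[symmetric, of "Q _"] trig by (simp add: scaleR_conv_of_real mult_ac)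
      also have "\<dots> = (- \<i> / 2) * (\<phi> a v * D 1 - \<phi> a v * D (- 1))"
        by (subst integral_mult_right_zero, subst Bochner_Integration.integral_diff[OF iQv iQv]) (simp only: D)
      finally show "(\<integral>\<omega>. (Q \<omega> * sin (S \<omega>)) *\<^sub>R iexp (v * \<xi> a \<omega>) \<partial>M) = \<phi> a v * ((- \<i> / 2) * (D 1 - D (- 1)))"
        by (simp add: algebra_simps)
    qed measurable
    have split: "(\<integral>\<omega>. f \<omega> *\<^sub>R iexp (S \<omega>) \<partial>M) = complex_of_real (\<integral>\<omega>. f \<omega> * cos (S \<omega>) \<partial>M) + \<i> * complex_of_real (\<integral>\<omega>. f \<omega> * sin (S \<omega>) \<partial>M)"
      if [measurable]: "f \<in> borel_measurable M" and fB: "\<And>\<omega>. \<bar>f \<omega>\<bar> \<le> 1" for f :: "'a \<Rightarrow> real"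
    proof -
      have i: "integrable M (\<lambda>\<omega>. f \<omega> * cos (S \<omega>))" "integrable M (\<lambda>\<omega>. f \<omega> * sin (S \<omega>))"
        by (rule integrable_const_bound[where B=1]; use fB in \<open>auto simp: abs_mult intro!: mult_le_one\<close>)+
      have "(\<integral>\<omega>. f \<omega> *\<^sub>R iexp (S \<omega>) \<partial>M) = (\<integral>\<omega>. complex_of_real (f \<omega> * cos (S \<omega>)) + \<i> * complex_of_real (f \<omega> * sin (S \<omega>)) \<partial>M)"
        by (intro Bochner_Integration.integral_cong refl)
          (simp add: cis_conv_exp[symmetric] complex_eq_iff)
      also have "\<dots> = (\<integral>\<omega>. complex_of_real (f \<omega> * cos (S \<omega>)) \<partial>M) + (\<integral>\<omega>. \<i> * complex_of_real (f \<omega> * sin (S \<omega>)) \<partial>M)"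
        using i by (intro Bochner_Integration.integral_add integrable_mult_right integrable_of_real) auto
      finally show ?thesis using i by (simp only: integral_mult_right_zero integral_complex_of_real)
    qed
    have prodins: "(\<Prod>i\<in>insert a J. indicator (A i) (\<xi> i \<omega>) :: real) = Q \<omega> * indicator (A a) (\<xi> a \<omega>)" for \<omega>
      using insert by (simp add: Q_def)
    have "(\<integral>\<omega>. (\<Prod>i\<in>insert a J. indicator (A i) (\<xi> i \<omega>)) *\<^sub>R iexp (\<Sum>i\<in>I - insert a J. u i * \<xi> i \<omega>) \<partial>M)
       = (\<integral>\<omega>. (Q \<omega> * indicator (A a) (\<xi> a \<omega>)) *\<^sub>R iexp (S \<omega>) \<partial>M)"
      unfolding prodins R_def[symmetric] S_def[symmetric] ..
    also have "\<dots> = complex_of_real (\<integral>\<omega>. (Q \<omega> * cos (S \<omega>)) * indicator (A a) (\<xi> a \<omega>) \<partial>M)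
        + \<i> * complex_of_real (\<integral>\<omega>. (Q \<omega> * sin (S \<omega>)) * indicator (A a) (\<xi> a \<omega>) \<partial>M)"
    proof (subst split)
      show "(\<lambda>\<omega>. Q \<omega> * indicator (A a) (\<xi> a \<omega>)) \<in> borel_measurable M" using a by measurable
      show "\<bar>Q \<omega> * indicator (A a) (\<xi> a \<omega>)\<bar> \<le> 1" for \<omega> using Q01[of \<omega>] by (simp add: indicator_def)
    qed (simp add: mult_ac)
    also have "\<dots> = (\<integral>\<omega>. indicator (A a) (\<xi> a \<omega>) \<partial>M) *\<^sub>R (\<integral>\<omega>. Q \<omega> *\<^sub>R iexp (S \<omega>) \<partial>M)"
      unfolding gc gs using Q01 by (subst split) (auto simp: scaleR_conv_of_real algebra_simps)
    also have "(\<integral>\<omega>. Q \<omega> *\<^sub>R iexp (S \<omega>) \<partial>M) = P *\<^sub>R (\<Prod>i\<in>R. \<phi> i (u i))"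
      using IH[of 0 1] by simp
    also have "(\<integral>\<omega>. indicator (A a) (\<xi> a \<omega>) \<partial>M) *\<^sub>R (P *\<^sub>R (\<Prod>i\<in>R. \<phi> i (u i)))
      = (\<Prod>i\<in>insert a J. \<integral>\<omega>. indicator (A i) (\<xi> i \<omega>) \<partial>M) *\<^sub>R (\<Prod>i\<in>I - insert a J. \<phi> i (u i))"
      using insert by (simp add: P_def R_def)
    finally show ?case .
  qed
  show ?thesis
    unfolding indep_vars_def2 indep_sets_def
  proof (intro conjI ballI allI impI)
    fix J B assume J: "J \<subseteq> I" "J \<noteq> {}" "finite J" and B: "B \<in> Pi J (\<lambda>i. {\<xi> i -` A \<inter> space M |A. A \<in> sets borel})"
    then have "\<forall>i\<in>J. \<exists>A. A \<in> sets borel \<and> B i = \<xi> i -` A \<inter> space M" by (auto simp: Pi_iff)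
    then obtain A0 where A0: "\<And>i. i \<in> J \<Longrightarrow> A0 i \<in> sets borel" "\<And>i. i \<in> J \<Longrightarrow> B i = \<xi> i -` A0 i \<inter> space M"
      by metis
    define A where "A i = (if i \<in> J then A0 i else {})" for i
    have A: "A i \<in> sets borel" "i \<in> J \<Longrightarrow> B i = \<xi> i -` A i \<inter> space M" for i using A0 by (auto simp: A_def)
    have Bs: "i \<in> J \<Longrightarrow> B i \<in> sets M" for i using A \<xi> J by auto
    have "(\<Inter>j\<in>J. B j) \<in> sets M" using J Bs by (intro sets.finite_INT) auto
    then have "complex_of_real (prob (\<Inter>j\<in>J. B j)) = complex_of_real (\<integral>\<omega>. indicator (\<Inter>j\<in>J. B j) \<omega> \<partial>M)"
      by simp
    also have "(\<integral>\<omega>. indicator (\<Inter>j\<in>J. B j) \<omega> \<partial>M) = (\<integral>\<omega>. (\<Prod>i\<in>J. indicator (A i) (\<xi> i \<omega>)) \<partial>M :: real)"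
    proof (rule Bochner_Integration.integral_cong[OF refl])
      fix \<omega> assume "\<omega> \<in> space M"
      then have "i \<in> J \<Longrightarrow> \<omega> \<in> B i \<longleftrightarrow> \<xi> i \<omega> \<in> A i" for i using A by auto
      then show "indicator (\<Inter>j\<in>J. B j) \<omega> = (\<Prod>i\<in>J. indicator (A i) (\<xi> i \<omega>) :: real)"
        using J by (auto simp: indicator_def prod.If_cases prod_zero_iff)
    qed
    also have "complex_of_real \<dots> = (\<integral>\<omega>. (\<Prod>i\<in>J. indicator (A i) (\<xi> i \<omega>)) *\<^sub>R iexp (\<Sum>i\<in>I - J. 0 * \<xi> i \<omega>) \<partial>M)"
      by (simp add: scaleR_conv_of_real del: of_real_prod)
    also have "\<dots> = complex_of_real (\<Prod>i\<in>J. \<integral>\<omega>. indicator (A i) (\<xi> i \<omega>) \<partial>M)"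
      by (subst key[OF J(1)]) (use A in \<open>simp_all add: scaleR_conv_of_real del: of_real_prod\<close>)
    also have "(\<Prod>i\<in>J. \<integral>\<omega>. indicator (A i) (\<xi> i \<omega>) \<partial>M) = (\<Prod>i\<in>J. prob (B i))"
    proof (rule prod.cong[OF refl])
      fix i assume i: "i \<in> J"
      have "(\<integral>\<omega>. indicator (A i) (\<xi> i \<omega>) \<partial>M) = (\<integral>\<omega>. indicator (B i) \<omega> \<partial>M :: real)"
        using A(2)[OF i] by (intro Bochner_Integration.integral_cong) (auto simp: indicator_def)
      then show "(\<integral>\<omega>. indicator (A i) (\<xi> i \<omega>) \<partial>M) = prob (B i)" using Bs[OF i] by simp
    qed
    finally show "prob (\<Inter>j\<in>J. B j) = (\<Prod>j\<in>J. prob (B j))" by (simp only: of_real_eq_iff)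
  qed (use \<xi> in auto)
qed

subsection \<open>Even moments of sums of independent variables\<close>

text \<open>The recursion collects the coefficients of x^2 in the induction step of
  \<open>mz_pointwise\<close>: 1 + 4j + 2j + 2j C with C the previous constant. The additional
  summand C makes monotonicity immediate.\<close>

fun mz_const :: "nat \<Rightarrow> real" where
  "mz_const 0 = 1"
| "mz_const (Suc j) = 1 + 6 * real j + (2 * real j + 1) * mz_const j"

lemma mz_const_ge1: "1 \<le> mz_const j"
  by (induction j) (auto intro!: add_nonneg_nonneg order_trans[of 1 "1 + _"] mult_nonneg_nonneg)

lemma mz_const_mono: "i \<le> j \<Longrightarrow> mz_const i \<le> mz_const j"
proof (induction rule: dec_induct)
  case (step n)
  have "0 \<le> real n * mz_const n" using mz_const_ge1[of n] by (intro mult_nonneg_nonneg) auto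
  then have "mz_const n \<le> mz_const (Suc n)" by (simp add: algebra_simps)
  then show ?case using step by linarith
qed simp

lemma power_diff_le:
  fixes a b :: real
  assumes "0 \<le> b" "b \<le> a"
  shows "a ^ j - b ^ j \<le> real j * (a - b) * a ^ (j - 1)"
proof (induction j)
  case (Suc j)
  have "a ^ Suc j - b ^ Suc j = a * (a ^ j - b ^ j) + (a - b) * b ^ j" by (simp add: algebra_simps)
  also have "\<dots> \<le> a * (real j * (a - b) * a ^ (j - 1)) + (a - b) * a ^ j"
    using Suc assms by (intro add_mono mult_left_mono power_mono) auto
  also have "\<dots> = real (Suc j) * (a - b) * a ^ (Suc j - 1)"
    by (cases j) (simp_all add: algebra_simps)
  finally show ?case .
qed simp

text \<open>The first-order term in \<open>x\<close> is kept exact because its expectation vanishes for centered \<open>x\<close>.\<close>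

lemma mz_pointwise:
  fixes s x :: real
  shows "(s + x) ^ (2 * j) \<le> 2 * real j * s ^ (2 * j - 1) * x + (s\<^sup>2 + mz_const j * x\<^sup>2) ^ j"
proof (induction j)
  case (Suc j)
  define C where "C = mz_const j"
  define A where "A = s\<^sup>2 + C * x\<^sup>2"
  define C' where "C' = mz_const (Suc j)"
  have C1: "1 \<le> C" unfolding C_def by (rule mz_const_ge1)
  have CC: "C \<le> C'" unfolding C_def C'_def by (rule mz_const_mono) simp
  have x2: "x\<^sup>2 \<le> C * x\<^sup>2" using C1 by (simp add: mult_le_cancel_right1)
  have sA: "s\<^sup>2 \<le> A" unfolding A_def using x2 zero_le_power2[of x] by linarith
  have A0: "0 \<le> A" using sA zero_le_power2[of s] by linarith
  have sx: "\<bar>s * x\<bar> \<le> A"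
  proof -
    have "2 * (\<bar>s\<bar> * \<bar>x\<bar>) \<le> s\<^sup>2 + x\<^sup>2" using sum_squares_bound[of "\<bar>s\<bar>" "\<bar>x\<bar>"] by (simp add: mult.assoc)
    moreover have "0 \<le> \<bar>s\<bar> * \<bar>x\<bar>" by simp
    ultimately show ?thesis using x2 unfolding A_def abs_mult by linarith
  qed
  have s2j: "s ^ (2 * i) \<le> A ^ i" for i unfolding power_mult using sA by (intro power_mono) auto
  show ?case
  proof (cases "j = 0")
    case True
    then show ?thesis by (simp add: power2_sum)
  next
    case False
    then obtain i where i: "j = Suc i" by (cases j) auto
    have IH: "(s + x) ^ (2 * j) \<le> 2 * real j * s ^ (2 * j - 1) * x + A ^ j"
      using Suc.IH by (simp add: A_def C_def)
    have "(s + x) ^ (2 * Suc j) = (s + x)\<^sup>2 * (s + x) ^ (2 * j)" by (simp add: power_add power2_eq_square)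
    also have "\<dots> \<le> (s + x)\<^sup>2 * (2 * real j * s ^ (2 * j - 1) * x + A ^ j)"
      using IH by (intro mult_left_mono) auto
    \<comment> \<open>The cross term 2 s x A^j supplies the 2 s^(2j+1) x that the exact linear term
      lacks. What remains, 2 s x (A^j - s^(2j)), is of second order in x, because A - s^2 = C
      x^2.\<close>
    also have "\<dots> = 2 * real (Suc j) * s ^ (2 * Suc j - 1) * x + s\<^sup>2 * A ^ j + x\<^sup>2 * A ^ j
        + (4 * real j * (s ^ (2 * j) * x\<^sup>2) + 2 * real j * (s ^ (2 * i) * (s * x) * x\<^sup>2) + 2 * (s * x) * (A ^ j - s ^ (2 * j)))"
      unfolding i by (simp add: power2_eq_square algebra_simps power_mult)
    also have "4 * real j * (s ^ (2 * j) * x\<^sup>2) + 2 * real j * (s ^ (2 * i) * (s * x) * x\<^sup>2) + 2 * (s * x) * (A ^ j - s ^ (2 * j))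
        \<le> 4 * real j * (A ^ j * x\<^sup>2) + 2 * real j * (A ^ j * x\<^sup>2) + 2 * (real j * C * x\<^sup>2 * A ^ j)"
    proof -
      have "s ^ (2 * i) * (s * x) \<le> s ^ (2 * i) * \<bar>s * x\<bar>" by (intro mult_left_mono) auto
      also have "\<dots> \<le> A ^ i * A" using sx s2j A0 by (intro mult_mono) auto
      finally have "s ^ (2 * i) * (s * x) \<le> A ^ j" by (simp add: i mult.commute)
      then have h2: "2 * real j * (s ^ (2 * i) * (s * x) * x\<^sup>2) \<le> 2 * real j * (A ^ j * x\<^sup>2)"
        by (intro mult_left_mono mult_right_mono) auto
      have h1: "4 * real j * (s ^ (2 * j) * x\<^sup>2) \<le> 4 * real j * (A ^ j * x\<^sup>2)"
        by (intro mult_left_mono mult_right_mono s2j) auto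
      have nn: "0 \<le> A ^ j - s ^ (2 * j)" using s2j[of j] by simp
      have "2 * (s * x) * (A ^ j - s ^ (2 * j)) \<le> 2 * (A * (A ^ j - s ^ (2 * j)))"
        using sx nn mult_right_mono[of "s * x" A "A ^ j - s ^ (2 * j)"] by (simp add: mult.assoc)
      also have "A ^ j - s ^ (2 * j) \<le> real j * (A - s\<^sup>2) * A ^ (j - 1)"
        unfolding power_mult using sA by (intro power_diff_le) auto
      then have "2 * (A * (A ^ j - s ^ (2 * j))) \<le> 2 * (A * (real j * (A - s\<^sup>2) * A ^ (j - 1)))"
        using A0 by (intro mult_left_mono) auto
      also have "\<dots> = 2 * (real j * C * x\<^sup>2 * A ^ j)" by (simp add: A_def i mult_ac)
      finally have h3: "2 * (s * x) * (A ^ j - s ^ (2 * j)) \<le> 2 * (real j * C * x\<^sup>2 * A ^ j)" .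
      show ?thesis by (intro add_mono h1 h2 h3)
    qed
    also have "2 * real (Suc j) * s ^ (2 * Suc j - 1) * x + s\<^sup>2 * A ^ j + x\<^sup>2 * A ^ j
        + (4 * real j * (A ^ j * x\<^sup>2) + 2 * real j * (A ^ j * x\<^sup>2) + 2 * (real j * C * x\<^sup>2 * A ^ j))
      \<le> 2 * real (Suc j) * s ^ (2 * Suc j - 1) * x + (s\<^sup>2 + C' * x\<^sup>2) * A ^ j"
    proof -
      have "0 \<le> C * (x\<^sup>2 * A ^ j)" using C1 A0 by simp
      then show ?thesis by (simp add: C'_def C_def algebra_simps)
    qed
    also have "(s\<^sup>2 + C' * x\<^sup>2) * A ^ j \<le> (s\<^sup>2 + C' * x\<^sup>2) * (s\<^sup>2 + C' * x\<^sup>2) ^ j"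
    proof -
      have "C * x\<^sup>2 \<le> C' * x\<^sup>2" using CC by (intro mult_right_mono) auto
      moreover have "0 \<le> C' * x\<^sup>2" using CC C1 by simp
      ultimately show ?thesis using A0 unfolding A_def by (intro mult_left_mono power_mono) auto
    qed
    finally show ?thesis by (simp add: C'_def)
  qed
qed simp

text \<open>A Marcinkiewicz-Zygmund type bound, by adding one summand X to an independent partial
  sum S. In \<open>mz_pointwise\<close> the linear term has expectation zero, and the binomial
  expansion of the other term factorizes by independence, so that the bounds for S and X recombine
  to a binomial power. The expansion involves all lower even moments of S, hence all orders j <= l
  are carried along.\<close>

lemma (in prob_space) indep_sum_even_moment:
  fixes Y :: "'i \<Rightarrow> 'a \<Rightarrow> real"
  assumes I: "finite I" and ind: "indep_vars (\<lambda>_. borel) Y I"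
    and int: "\<And>i k. i \<in> I \<Longrightarrow> integrable M (\<lambda>\<omega>. Y i \<omega> ^ k)"
    and mean: "\<And>i. i \<in> I \<Longrightarrow> (\<integral>\<omega>. Y i \<omega> \<partial>M) = 0"
    and mom: "\<And>i j. i \<in> I \<Longrightarrow> 1 \<le> j \<Longrightarrow> j \<le> l \<Longrightarrow> (\<integral>\<omega>. Y i \<omega> ^ (2 * j) \<partial>M) \<le> b i ^ j"
    and b: "\<And>i. i \<in> I \<Longrightarrow> 0 \<le> b i"
  shows "(\<forall>k. integrable M (\<lambda>\<omega>. (\<Sum>i\<in>I. Y i \<omega>) ^ k)) \<and>
     (\<forall>j\<le>l. (\<integral>\<omega>. (\<Sum>i\<in>I. Y i \<omega>) ^ (2 * j) \<partial>M) \<le> (mz_const l * (\<Sum>i\<in>I. b i)) ^ j)"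
  using I ind int mean mom b
proof (induction I)
  case empty
  then show ?case by (auto simp: power_0_left prob_space)
next
  case (insert a I)
  define S where "S \<omega> = (\<Sum>i\<in>I. Y i \<omega>)" for \<omega>
  define X where "X = Y a"
  define B where "B = (\<Sum>i\<in>I. b i)"
  define C where "C = mz_const l"
  have C: "0 \<le> C" using mz_const_ge1[of l] by (simp add: C_def)
  have B: "0 \<le> B" unfolding B_def using insert by (intro sum_nonneg) auto
  have "indep_vars (\<lambda>_. borel) Y I" using insert.prems(1) by (rule indep_vars_subset) auto
  then have IH: "\<And>k. integrable M (\<lambda>\<omega>. S \<omega> ^ k)"
    "\<And>j. j \<le> l \<Longrightarrow> (\<integral>\<omega>. S \<omega> ^ (2 * j) \<partial>M) \<le> (C * B) ^ j"
    using insert unfolding S_def B_def C_def by auto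
  have iX: "integrable M (\<lambda>\<omega>. X \<omega> ^ k)" for k unfolding X_def using insert by auto
  have mX: "(\<integral>\<omega>. X \<omega> ^ (2 * j) \<partial>M) \<le> b a ^ j" if "j \<le> l" for j
    using insert.prems(4)[of a j] that by (cases j) (auto simp: X_def prob_space)
  have ba: "0 \<le> b a" using insert by auto
  have iv: "indep_var borel X borel S" unfolding X_def S_def
    using insert by (intro indep_vars_sum) auto
  have iv2: "indep_var borel (\<lambda>\<omega>. X \<omega> ^ k) borel (\<lambda>\<omega>. S \<omega> ^ i)" for i k
  proof -
    have "indep_var borel ((\<lambda>x. x ^ k) \<circ> X) borel ((\<lambda>x. x ^ i) \<circ> S)"
      by (rule indep_var_compose[OF iv]) auto
    then show ?thesis by (simp add: comp_def)
  qed
  have prod: "integrable M (\<lambda>\<omega>. S \<omega> ^ i * X \<omega> ^ k)"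
    "(\<integral>\<omega>. S \<omega> ^ i * X \<omega> ^ k \<partial>M) = (\<integral>\<omega>. S \<omega> ^ i \<partial>M) * (\<integral>\<omega>. X \<omega> ^ k \<partial>M)" for i k
    using indep_var_integrable[OF iv2 iX IH(1)] indep_var_lebesgue_integral[OF iv2 iX IH(1)]
    by (simp_all add: mult.commute)
  have sum: "(\<Sum>i\<in>insert a I. Y i \<omega>) = S \<omega> + X \<omega>" for \<omega>
    using insert by (simp add: S_def X_def)
  have int': "integrable M (\<lambda>\<omega>. (S \<omega> + X \<omega>) ^ k)" for k
    unfolding binomial_ring using prod(1) by (intro Bochner_Integration.integrable_sum) (simp add: mult.assoc)
  have "(\<integral>\<omega>. (S \<omega> + X \<omega>) ^ (2 * j) \<partial>M) \<le> (C * (b a + B)) ^ j" if j: "j \<le> l" for j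
  proof -
    have pt: "(S \<omega> + X \<omega>) ^ (2 * j) \<le> 2 * real j * (S \<omega> ^ (2 * j - 1) * X \<omega> ^ 1)
        + (\<Sum>k\<le>j. real (j choose k) * C ^ (j - k) * (S \<omega> ^ (2 * k) * X \<omega> ^ (2 * (j - k))))" for \<omega>
    proof -
      have "(S \<omega>)\<^sup>2 + mz_const j * (X \<omega>)\<^sup>2 \<le> (S \<omega>)\<^sup>2 + C * (X \<omega>)\<^sup>2"
        unfolding C_def using mz_const_mono[OF j] by (intro add_left_mono mult_right_mono) auto
      then have "((S \<omega>)\<^sup>2 + mz_const j * (X \<omega>)\<^sup>2) ^ j \<le> ((S \<omega>)\<^sup>2 + C * (X \<omega>)\<^sup>2) ^ j"
        using mz_const_ge1[of j] by (intro power_mono add_nonneg_nonneg mult_nonneg_nonneg) auto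
      also have "\<dots> = (\<Sum>k\<le>j. real (j choose k) * C ^ (j - k) * (S \<omega> ^ (2 * k) * X \<omega> ^ (2 * (j - k))))"
        unfolding binomial_ring by (intro sum.cong) (simp_all add: power_mult_distrib mult_ac flip: power_mult)
      finally show ?thesis using mz_pointwise[of "S \<omega>" "X \<omega>" j] by (simp add: mult.assoc)
    qed
    have "(\<integral>\<omega>. (S \<omega> + X \<omega>) ^ (2 * j) \<partial>M) \<le> (\<integral>\<omega>. 2 * real j * (S \<omega> ^ (2 * j - 1) * X \<omega> ^ 1)
        + (\<Sum>k\<le>j. real (j choose k) * C ^ (j - k) * (S \<omega> ^ (2 * k) * X \<omega> ^ (2 * (j - k)))) \<partial>M)"
      by (intro integral_mono int' pt Bochner_Integration.integrable_add Bochner_Integration.integrable_sum integrable_mult_right prod(1))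
    also have "\<dots> = 2 * real j * ((\<integral>\<omega>. S \<omega> ^ (2 * j - 1) \<partial>M) * (\<integral>\<omega>. X \<omega> ^ 1 \<partial>M))
        + (\<Sum>k\<le>j. real (j choose k) * C ^ (j - k) * ((\<integral>\<omega>. S \<omega> ^ (2 * k) \<partial>M) * (\<integral>\<omega>. X \<omega> ^ (2 * (j - k)) \<partial>M)))"
      by (subst Bochner_Integration.integral_add, (intro Bochner_Integration.integrable_sum integrable_mult_right prod(1))+,
          subst Bochner_Integration.integral_sum, intro integrable_mult_right prod(1)) (simp only: integral_mult_right_zero prod(2))
    also have "\<dots> = (\<Sum>k\<le>j. real (j choose k) * C ^ (j - k) * ((\<integral>\<omega>. S \<omega> ^ (2 * k) \<partial>M) * (\<integral>\<omega>. X \<omega> ^ (2 * (j - k)) \<partial>M)))"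
      using insert.prems(3)[of a] by (simp add: X_def)
    also have "\<dots> \<le> (\<Sum>k\<le>j. real (j choose k) * C ^ (j - k) * ((C * B) ^ k * b a ^ (j - k)))"
      using IH(2) mX j C B ba by (intro sum_mono mult_left_mono mult_mono) (auto intro!: integral_nonneg_AE)
    also have "\<dots> = (C * B + C * b a) ^ j"
      unfolding binomial_ring by (intro sum.cong) (simp_all add: power_mult_distrib mult_ac)
    finally show ?thesis by (simp add: algebra_simps)
  qed
  then show ?case using int' insert unfolding sum by (auto simp: C_def B_def)
qed

subsection \<open>The Fourier series of a triangle wave\<close>

lemma sum_cos_odd:
  "(\<Sum>k<n. cos ((2 * real k + 1) * y)) * (2 * sin y) = sin (2 * real n * y)"
proof (induction n)
  case (Suc n)
  have "sin (2 * real (Suc n) * y) - sin (2 * real n * y) = 2 * sin y * cos ((2 * real n + 1) * y)"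
    using sin_diff_sin[of "2 * real (Suc n) * y" "2 * real n * y"] by (simp add: algebra_simps add_divide_distrib)
  then show ?case using Suc by (simp add: algebra_simps)
qed simp

text \<open>The sum s has derivative sin(2ny) / (2 sin y), which is not small but oscillates. Adding
  cos(2ny) / (4n sin y), as an integration by parts would, leaves a derivative of order 1/n away
  from 0 and pi. At pi/2 the sum is a partial sum of the Leibniz series. The term with sin d comes
  from the two boundary corrections, the one with its square from the derivative.\<close>

lemma sum_sin_odd_bound:
  assumes d: "0 < d" and y: "d \<le> y" "y \<le> pi - d" and n: "0 < n"
  shows "\<bar>(\<Sum>k<n. sin ((2 * real k + 1) * y) / (2 * real k + 1)) - (\<Sum>k<n. (- 1) ^ k / (2 * real k + 1))\<bar>
     \<le> (1 / real n) * (1 / (2 * sin d) + pi / (4 * (sin d)\<^sup>2))"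
proof -
  define s where "s y = (\<Sum>k<n. sin ((2 * real k + 1) * y) / (2 * real k + 1))" for y
  define g where "g y = s y + cos (2 * real n * y) / (4 * real n * sin y)" for y
  have dpi: "d \<le> pi / 2" using y by simp
  have sd: "0 < sin d" using d dpi pi_half_less_two by (intro sin_gt_zero) (auto simp: field_simps intro: le_less_trans[of d "pi/2"])
  have sin_ge: "sin d \<le> sin x" if "x \<in> {d..pi - d}" for x
  proof (cases "x \<le> pi / 2")
    case True
    then show ?thesis using that d by (intro sin_monotone_2pi_le) auto
  next
    case False
    then have "sin d \<le> sin (pi - x)" using that d by (intro sin_monotone_2pi_le) auto
    then show ?thesis by simp
  qed
  have ds: "(s has_field_derivative sin (2 * real n * x) / (2 * sin x)) (at x within {d..pi - d})" if "x \<in> {d..pi - d}" for x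
  proof -
    have "(s has_field_derivative (\<Sum>k<n. cos ((2 * real k + 1) * x))) (at x within {d..pi - d})"
      unfolding s_def by (auto intro!: derivative_eq_intros sum.cong simp: mult.commute)
    also have "(\<Sum>k<n. cos ((2 * real k + 1) * x)) = sin (2 * real n * x) / (2 * sin x)"
      using sum_cos_odd[of x n] sin_ge[OF that] sd by (simp add: field_simps)
    finally show ?thesis .
  qed
  have dg: "(g has_field_derivative - (cos (2 * real n * x) * cos x) / (4 * real n * (sin x)\<^sup>2)) (at x within {d..pi - d})"
    if "x \<in> {d..pi - d}" for x
  proof -
    have s0: "sin x \<noteq> 0" using sin_ge[OF that] sd by auto
    show ?thesis unfolding g_def using n s0
      by (auto intro!: derivative_eq_intros ds[OF that] simp: field_simps power2_eq_square)
  qed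
  have "norm (g y - g (pi / 2)) \<le> (1 / (4 * real n * (sin d)\<^sup>2)) * norm (y - pi / 2)"
  proof (rule field_differentiable_bound[OF _ dg])
    fix x assume x: "x \<in> {d..pi - d}"
    have "\<bar>cos (2 * real n * x) * cos x\<bar> \<le> 1" by (simp add: abs_mult mult_le_one)
    moreover have "(sin d)\<^sup>2 \<le> (sin x)\<^sup>2" using sin_ge[OF x] sd by (intro power_mono) auto
    ultimately show "norm (- (cos (2 * real n * x) * cos x) / (4 * real n * (sin x)\<^sup>2)) \<le> 1 / (4 * real n * (sin d)\<^sup>2)"
      using n sd by (auto simp: abs_mult intro!: frac_le)
  qed (use y dpi d in auto)
  also have "\<dots> \<le> (1 / (4 * real n * (sin d)\<^sup>2)) * pi"
    using y d dpi by (intro mult_left_mono) (auto simp: abs_le_iff)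
  finally have 1: "\<bar>g y - g (pi / 2)\<bar> \<le> (1 / real n) * (pi / (4 * (sin d)\<^sup>2))" by simp
  have c: "\<bar>cos (2 * real n * x) / (4 * real n * sin x)\<bar> \<le> (1 / real n) * (1 / (4 * sin d))" if "x \<in> {d..pi - d}" for x
  proof -
    have "\<bar>cos (2 * real n * x)\<bar> / (4 * real n * sin x) \<le> 1 / (4 * real n * sin d)"
      using sin_ge[OF that] sd n by (intro frac_le mult_left_mono) auto
    then show ?thesis using sin_ge[OF that] sd by (simp add: abs_mult)
  qed
  have "\<bar>s y - s (pi / 2)\<bar> \<le> (1 / real n) * (pi / (4 * (sin d)\<^sup>2)) + 2 * ((1 / real n) * (1 / (4 * sin d)))"
    using 1 c[of y] c[of "pi / 2"] y d dpi unfolding g_def atLeastAtMost_iff by linarith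
  also have "\<dots> = (1 / real n) * (1 / (2 * sin d) + pi / (4 * (sin d)\<^sup>2))" by (simp add: distrib_left)
  finally have "\<bar>s y - s (pi / 2)\<bar> \<le> (1 / real n) * (1 / (2 * sin d) + pi / (4 * (sin d)\<^sup>2))" .
  moreover have "s (pi / 2) = (\<Sum>k<n. (- 1) ^ k / (2 * real k + 1))"
    unfolding s_def
  proof (intro sum.cong refl)
    fix k
    have "(2 * real k + 1) * (pi / 2) = pi / 2 + real k * pi" by (simp add: algebra_simps)
    show "sin ((2 * real k + 1) * (pi / 2)) / (2 * real k + 1) = (- 1) ^ k / (2 * real k + 1)"
      unfolding \<open>(2 * real k + 1) * (pi / 2) = pi / 2 + real k * pi\<close> sin_add by simp
  qed
  ultimately show ?thesis by (simp add: s_def)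
qed

text \<open>All summands vanish at pi/2, so the value at y is obtained from the derivative between
  pi/2 and y. The derivative is minus the sum of sines and tends to -pi/4 uniformly away from the
  end points, by \<open>sum_sin_odd_bound\<close> and the Leibniz series.\<close>

lemma cos_odd_interior:
  assumes y: "0 < y" "y < pi"
  shows "(\<lambda>n. \<Sum>k<n. cos ((2 * real k + 1) * y) / (2 * real k + 1)\<^sup>2) \<longlonglongrightarrow> pi\<^sup>2 / 8 - pi * y / 4"
proof -
  define d where "d = min y (pi - y)"
  have d: "0 < d" "d \<le> y" "y \<le> pi - d" using y by (auto simp: d_def)
  define K where "K = 1 / (2 * sin d) + pi / (4 * (sin d)\<^sup>2)"
  define L where "L n = (\<Sum>k<n. (- 1) ^ k / (2 * real k + 1) :: real)" for n
  define F where "F n x = (\<Sum>k<n. cos ((2 * real k + 1) * x) / (2 * real k + 1)\<^sup>2)" for n x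
  have L: "L \<longlonglongrightarrow> pi / 4"
  proof -
    have "summable (\<lambda>k. (- 1) ^ k * (1 / real (k * 2 + 1) * 1 ^ (k * 2 + 1)))" by (rule summable_arctan_series) simp
    then have "summable (\<lambda>k. (- 1) ^ k * 1 / real (k * 2 + 1))" by simp
    from summable_LIMSEQ[OF this] show ?thesis unfolding L_def pi_series[symmetric] by (simp add: mult.commute add.commute)
  qed
  have bnd: "\<bar>F n y - (pi\<^sup>2 / 8 - pi * y / 4)\<bar> \<le> ((1 / real n) * K + \<bar>L n - pi / 4\<bar>) * pi" if n: "0 < n" for n
  proof -
    have F0: "F n (pi / 2) = 0"
      unfolding F_def
    proof (intro sum.neutral ballI)
      fix k
      have "(2 * real k + 1) * (pi / 2) = pi / 2 + real k * pi" by (simp add: algebra_simps)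
      show "cos ((2 * real k + 1) * (pi / 2)) / (2 * real k + 1)\<^sup>2 = 0"
        unfolding \<open>(2 * real k + 1) * (pi / 2) = pi / 2 + real k * pi\<close> cos_add by simp
    qed
    have "norm ((F n y + pi / 4 * y) - (F n (pi / 2) + pi / 4 * (pi / 2))) \<le> ((1 / real n) * K + \<bar>L n - pi / 4\<bar>) * norm (y - pi / 2)"
    proof (rule field_differentiable_bound[where S = "{d..pi - d}"])
      fix x assume x: "x \<in> {d..pi - d}"
      show "((\<lambda>x. F n x + pi / 4 * x) has_field_derivative
          - (\<Sum>k<n. sin ((2 * real k + 1) * x) / (2 * real k + 1)) + pi / 4) (at x within {d..pi - d})"
        unfolding F_def by (auto intro!: derivative_eq_intros sum.cong simp: sum_negf[symmetric] power2_eq_square)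
      show "norm (- (\<Sum>k<n. sin ((2 * real k + 1) * x) / (2 * real k + 1)) + pi / 4) \<le> (1 / real n) * K + \<bar>L n - pi / 4\<bar>"
        using sum_sin_odd_bound[OF d(1) _ _ n, of x] x unfolding L_def[symmetric] K_def[symmetric] real_norm_def by auto
    qed (use d in auto)
    also have "\<dots> \<le> ((1 / real n) * K + \<bar>L n - pi / 4\<bar>) * pi"
    proof (intro mult_left_mono)
      have "0 < sin d" using d y by (intro sin_gt_zero) auto
      then show "0 \<le> (1 / real n) * K + \<bar>L n - pi / 4\<bar>" by (auto simp: K_def)
    qed (use y in \<open>auto simp: abs_le_iff\<close>)
    finally show ?thesis by (simp add: F0 power2_eq_square algebra_simps)
  qed
  have lim: "(\<lambda>n. ((1 / real n) * K + \<bar>L n - pi / 4\<bar>) * pi) \<longlonglongrightarrow> (0 * K + \<bar>pi / 4 - pi / 4\<bar>) * pi"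
    by (intro tendsto_intros L lim_1_over_n)
  have zero: "(0 * K + \<bar>pi / 4 - pi / 4\<bar>) * pi = 0" by simp
  have "\<forall>\<^sub>F n in sequentially. norm (F n y - (pi\<^sup>2 / 8 - pi * y / 4)) \<le> ((1 / real n) * K + \<bar>L n - pi / 4\<bar>) * pi"
    unfolding real_norm_def by (intro eventually_sequentiallyI[of 1] bnd) linarith
  then have "(\<lambda>n. F n y - (pi\<^sup>2 / 8 - pi * y / 4)) \<longlonglongrightarrow> 0"
    by (rule Lim_null_comparison) (rule lim[unfolded zero])
  then show ?thesis unfolding F_def by (simp add: LIM_zero_iff)
qed

text \<open>The squared denominators make the convergence uniform on the closed interval, so the
  limit is continuous and the formula extends from the interior to the end points. The case y = 0 is
  the one that \<open>mercer\<close> uses for every t.\<close>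

lemma cos_odd_series:
  assumes y: "0 \<le> y" "y \<le> pi"
  shows "(\<lambda>n. \<Sum>k<n. cos ((2 * real k + 1) * y) / (2 * real k + 1)\<^sup>2) \<longlonglongrightarrow> pi\<^sup>2 / 8 - pi * y / 4"
proof -
  define F where "F n x = (\<Sum>k<n. cos ((2 * real k + 1) * x) / (2 * real k + 1)\<^sup>2)" for n x
  define G where "G x = (\<Sum>k. cos ((2 * real k + 1) * x) / (2 * real k + 1)\<^sup>2)" for x
  have ul: "uniform_limit {0..pi} F G sequentially"
    unfolding F_def G_def
  proof (rule Weierstrass_m_test)
    show "norm (cos ((2 * real n + 1) * x) / (2 * real n + 1)\<^sup>2) \<le> 1 / real (Suc n) ^ 2" for n x
      by (auto intro!: frac_le power_mono)
    show "summable (\<lambda>n. 1 / real (Suc n) ^ 2)"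
      using inverse_power_summable[of 2] by (subst summable_Suc_iff) (simp add: inverse_eq_divide)
  qed
  have contG: "continuous_on {0..pi} G"
    by (rule uniform_limit_theorem[OF _ ul]) (auto simp: F_def intro!: continuous_intros always_eventually)
  have FG: "(\<lambda>n. F n x) \<longlonglongrightarrow> G x" if "x \<in> {0..pi}" for x
    using tendsto_uniform_limitI[OF ul that] .
  have eq: "G x = pi\<^sup>2 / 8 - pi * x / 4" if "x \<in> {0<..<pi}" for x
    using LIMSEQ_unique[OF FG[of x] cos_odd_interior[of x, folded F_def]] that by auto
  have "G y = pi\<^sup>2 / 8 - pi * y / 4"
  proof (rule continuous_constant_on_closure[of "{0<..<pi}" "\<lambda>x. G x - (pi\<^sup>2 / 8 - pi * x / 4)" 0 y, simplified])
    show "continuous_on {0..pi} (\<lambda>x. G x - (pi\<^sup>2 / 8 - pi * x / 4))" by (intro continuous_intros contG) auto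
  qed (use eq y in auto)
  then show ?thesis using FG[of y] y by (simp add: F_def)
qed

subsection \<open>The Karhunen-Loeve system\<close>

text \<open>For k >= 1 this is 1 / sqrt(\<open>kl_lambda T k\<close>), the angular frequency of
  \<open>kl_e T k\<close>.\<close>

definition kl_freq :: "real \<Rightarrow> nat \<Rightarrow> real" where
  "kl_freq T k = pi * (real k - 1 / 2) / T"

text \<open>The derivative of \<open>sqrt (kl_lambda T k) * kl_e T k\<close>. It vanishes at T, so
  integration by parts turns \<open>kl_xi T X k\<close> into the Wiener integral of
  \<open>kl_phi T k\<close>; orthonormality of this system is what makes the coefficients
  independent.\<close>

definition kl_phi :: "real \<Rightarrow> nat \<Rightarrow> real \<Rightarrow> real" where
  "kl_phi T k t = sqrt (2 / T) * cos (kl_freq T k * t)"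

lemma kl_freq_pos: "0 < T \<Longrightarrow> 1 \<le> k \<Longrightarrow> 0 < kl_freq T k"
  unfolding kl_freq_def by (intro divide_pos_pos mult_pos_pos) (auto simp: field_simps)

lemma sqrt_kl_lambda: "0 < T \<Longrightarrow> 1 \<le> k \<Longrightarrow> sqrt (kl_lambda T k) = 1 / kl_freq T k"
  unfolding kl_lambda_def kl_freq_def by (subst real_sqrt_abs) (auto simp: abs_mult field_simps)

lemma kl_e_freq: "0 < T \<Longrightarrow> 1 \<le> k \<Longrightarrow> kl_e T k t = sqrt (2 / T) * sin (kl_freq T k * t)"
  unfolding kl_e_def by (simp add: sqrt_kl_lambda mult.commute)

lemma kl_phi_T: "0 < T \<Longrightarrow> kl_phi T k T = 0"
proof -
  assume T: "0 < T"
  have "kl_freq T k * T = pi * (real k - 1 / 2)" using T by (simp add: kl_freq_def)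
  also have "\<dots> = - (pi / 2) + real k * pi" by (simp add: right_diff_distrib)
  finally have e: "kl_freq T k * T = - (pi / 2) + real k * pi" .
  show ?thesis unfolding kl_phi_def e cos_add by simp
qed

lemma kl_phi_deriv:
  "0 < T \<Longrightarrow> 1 \<le> k \<Longrightarrow> (kl_phi T k has_real_derivative - (kl_freq T k * kl_e T k t)) (at t within S)"
  unfolding kl_phi_def by (auto intro!: derivative_eq_intros simp: kl_e_freq)

lemma kl_e_deriv:
  "0 < T \<Longrightarrow> 1 \<le> k \<Longrightarrow> ((\<lambda>t. kl_e T k t / kl_freq T k) has_real_derivative kl_phi T k t) (at t within S)"
proof -
  assume T: "0 < T" "1 \<le> k"
  have "kl_e T k = (\<lambda>t. sqrt (2 / T) * sin (kl_freq T k * t))" using kl_e_freq[OF T] by blast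
  then show ?thesis using kl_freq_pos[OF T] by (auto intro!: derivative_eq_intros simp: kl_phi_def)
qed

text \<open>Mercer's expansion of the covariance min(s,t) on the diagonal. Writing the squared sine
  as (1 - cos)/2 turns the sum into a difference of two triangle-wave series, taken at 0 and at y =
  pi t / T.\<close>

lemma mercer:
  assumes T: "0 < T" and t: "0 \<le> t" "t \<le> T"
  shows "(\<lambda>n. \<Sum>k=1..n. (sqrt (kl_lambda T k) * kl_e T k t)\<^sup>2) \<longlonglongrightarrow> t"
proof -
  define y where "y = pi * t / T"
  have y: "0 \<le> y" "y \<le> pi" using t T by (auto simp: y_def field_simps)
  have trm: "(sqrt (kl_lambda T (Suc k)) * kl_e T (Suc k) t)\<^sup>2
     = (4 * T / pi\<^sup>2) * (cos ((2 * real k + 1) * 0) / (2 * real k + 1)\<^sup>2 - cos ((2 * real k + 1) * y) / (2 * real k + 1)\<^sup>2)" for k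
  proof -
    have f: "kl_freq T (Suc k) = pi * (2 * real k + 1) / (2 * T)" using T by (simp add: kl_freq_def field_simps)
    have "2 * (a / (2 * T) * t) = a / T * t" for a by simp
    then have "2 * (kl_freq T (Suc k) * t) = pi * (2 * real k + 1) / T * t" unfolding f by blast
    also have "\<dots> = (2 * real k + 1) * y" by (simp add: y_def)
    finally have "2 * (kl_freq T (Suc k) * t) = (2 * real k + 1) * y" .
    then have "(sin (kl_freq T (Suc k) * t))\<^sup>2 = (1 - cos ((2 * real k + 1) * y)) / 2"
      using cos_double_sin[of "kl_freq T (Suc k) * t"] by simp
    note S = this
    have "(sqrt (kl_lambda T (Suc k)) * kl_e T (Suc k) t)\<^sup>2
       = (1 / kl_freq T (Suc k))\<^sup>2 * ((sqrt (2 / T))\<^sup>2 * (sin (kl_freq T (Suc k) * t))\<^sup>2)"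
      using T by (simp only: sqrt_kl_lambda kl_e_freq power_mult_distrib One_nat_def Suc_le_mono le0)
    also have "1 / kl_freq T (Suc k) = 2 * T / (pi * (2 * real k + 1))" by (simp add: f)
    also have "(sqrt (2 / T))\<^sup>2 = 2 / T" using T by simp
    finally have "(sqrt (kl_lambda T (Suc k)) * kl_e T (Suc k) t)\<^sup>2
       = (2 * T / (pi * (2 * real k + 1)))\<^sup>2 * ((2 / T) * ((1 - cos ((2 * real k + 1) * y)) / 2))"
      unfolding S .
    also have "\<dots> = (4 * T / pi\<^sup>2) * ((1 - cos ((2 * real k + 1) * y)) / (2 * real k + 1)\<^sup>2)"
    proof -
      have "(2 * T / (pi * a))\<^sup>2 * ((2 / T) * (z / 2)) = (4 * T / pi\<^sup>2) * (z / a\<^sup>2)" for a z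
        using T by (simp add: power2_eq_square mult_ac)
      then show ?thesis .
    qed
    finally show ?thesis by (simp add: diff_divide_distrib)
  qed
  have "(\<lambda>n. (4 * T / pi\<^sup>2) * ((\<Sum>k<n. cos ((2 * real k + 1) * 0) / (2 * real k + 1)\<^sup>2)
      - (\<Sum>k<n. cos ((2 * real k + 1) * y) / (2 * real k + 1)\<^sup>2))) \<longlonglongrightarrow>
      (4 * T / pi\<^sup>2) * ((pi\<^sup>2 / 8 - pi * 0 / 4) - (pi\<^sup>2 / 8 - pi * y / 4))"
    by (intro tendsto_intros cos_odd_series y) auto
  also have "(4 * T / pi\<^sup>2) * ((pi\<^sup>2 / 8 - pi * 0 / 4) - (pi\<^sup>2 / 8 - pi * y / 4)) = t"
    using T by (simp add: y_def power2_eq_square)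
  also have "(\<lambda>n. (4 * T / pi\<^sup>2) * ((\<Sum>k<n. cos ((2 * real k + 1) * 0) / (2 * real k + 1)\<^sup>2)
      - (\<Sum>k<n. cos ((2 * real k + 1) * y) / (2 * real k + 1)\<^sup>2)))
     = (\<lambda>n. \<Sum>k=1..n. (sqrt (kl_lambda T k) * kl_e T k t)\<^sup>2)"
    unfolding sum_subtractf[symmetric] sum_distrib_left trm[symmetric]
    by (simp add: sum.shift_bounds_cl_Suc_ivl[of _ 0, simplified] atLeast0LessThan[symmetric] sum.atLeast1_atMost_eq)
  finally show ?thesis .
qed

lemma integral_cos_int_pi:
  assumes T: "0 < T"
  shows "((\<lambda>u. cos (pi * real_of_int m / T * u)) has_integral (if m = 0 then T else 0)) {0..T}"
proof (cases "m = 0")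
  case True
  then show ?thesis using has_integral_const_real[of "1::real" 0 T] T by simp
next
  case False
  let ?F = "\<lambda>u. sin (pi * real_of_int m / T * u) / (pi * real_of_int m / T)"
  have "((\<lambda>u. cos (pi * real_of_int m / T * u)) has_integral ?F T - ?F 0) {0..T}"
    using T False by (intro fundamental_theorem_of_calculus)
      (auto intro!: derivative_eq_intros simp: has_real_derivative_iff_has_vector_derivative[symmetric])
  moreover have "sin (pi * real_of_int m / T * T) = 0" unfolding sin_zero_iff_int2
    using T by (intro exI[of _ m]) simp
  ultimately show ?thesis using False by simp
qed

lemma kl_orthonormal:
  assumes T: "0 < T" and jk: "1 \<le> j" "1 \<le> k"
  shows "((\<lambda>u. kl_e T j u * kl_e T k u) has_integral (if j = k then 1 else 0)) {0..T}"
    and "((\<lambda>u. kl_phi T j u * kl_phi T k u) has_integral (if j = k then 1 else 0)) {0..T}"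
proof -
  define a where "a = int j - int k"
  \<comment> \<open>The two shifts by 1/2 add up to 1, so b is an integer and at least 1; the cosine
    with parameter b therefore integrates to 0, and only a = 0, that is j = k, contributes.\<close>
  define b where "b = int j + int k - 1"
  have b0: "b \<noteq> 0" using jk by (simp add: b_def)
  have f1: "kl_freq T j * u - kl_freq T k * u = pi * real_of_int a / T * u"
    and f2: "kl_freq T j * u + kl_freq T k * u = pi * real_of_int b / T * u" for u
  proof -
    have "kl_freq T i * u = pi / T * u * (real i - 1 / 2)" for i by (simp add: kl_freq_def)
    moreover have "pi * real_of_int m / T * u = pi / T * u * real_of_int m" for m by simp
    moreover have "real_of_int a = (real j - 1 / 2) - (real k - 1 / 2)" "real_of_int b = (real j - 1 / 2) + (real k - 1 / 2)"
      by (simp_all add: a_def b_def)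
    ultimately show "kl_freq T j * u - kl_freq T k * u = pi * real_of_int a / T * u"
      "kl_freq T j * u + kl_freq T k * u = pi * real_of_int b / T * u"
      by (metis right_diff_distrib, metis distrib_left)
  qed
  have e: "kl_e T j u * kl_e T k u = (1 / T) * (cos (pi * real_of_int a / T * u) - cos (pi * real_of_int b / T * u))"
    "kl_phi T j u * kl_phi T k u = (1 / T) * (cos (pi * real_of_int a / T * u) + cos (pi * real_of_int b / T * u))" for u
  proof -
    have g: "2 / T * (x * y) = 1 / T * (z + x * y - (z - x * y))" "2 / T * (x * y) = 1 / T * (x * y + z + (x * y - z))"
      for x y z by (auto simp: distrib_left)
    have s: "sqrt (2 / T) * x * (sqrt (2 / T) * y) = (2 / T) * (x * y)" for x y
    proof -
      have "sqrt (2 / T) * x * (sqrt (2 / T) * y) = (sqrt (2 / T) * sqrt (2 / T)) * (x * y)" by (simp only: mult_ac)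
      then show ?thesis using T by simp
    qed
    show "kl_e T j u * kl_e T k u = (1 / T) * (cos (pi * real_of_int a / T * u) - cos (pi * real_of_int b / T * u))"
      unfolding kl_e_freq[OF T jk(1)] kl_e_freq[OF T jk(2)] s f1[symmetric] f2[symmetric] cos_diff cos_add by (rule g)
    show "kl_phi T j u * kl_phi T k u = (1 / T) * (cos (pi * real_of_int a / T * u) + cos (pi * real_of_int b / T * u))"
      unfolding kl_phi_def s f1[symmetric] f2[symmetric] cos_diff cos_add by (rule g)
  qed
  have a: "(1 / T) * ((if a = 0 then T else 0) + c) = (if j = k then 1 else 0) + (1 / T) * c" for c
    using T by (simp add: a_def distrib_left)
  show "((\<lambda>u. kl_e T j u * kl_e T k u) has_integral (if j = k then 1 else 0)) {0..T}"
    using has_integral_mult_right[OF has_integral_diff[OF integral_cos_int_pi[OF T, of a] integral_cos_int_pi[OF T, of b]], of "1 / T"] b0 a[of 0]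
    by (simp only: e) simp
  show "((\<lambda>u. kl_phi T j u * kl_phi T k u) has_integral (if j = k then 1 else 0)) {0..T}"
    using has_integral_mult_right[OF has_integral_add[OF integral_cos_int_pi[OF T, of a] integral_cos_int_pi[OF T, of b]], of "1 / T"] b0 a[of 0]
    by (simp only: e) simp
qed

text \<open>Riemann-Stieltjes sums, with the antiderivative \<open>G\<close> of \<open>x \<phi>'\<close> in place of the integral.\<close>

lemma riemann_stieltjes_sums:
  fixes x \<phi> \<phi>' G :: "real \<Rightarrow> real" and J :: "nat \<Rightarrow> nat"
  assumes T: "0 < T" and x: "continuous_on {0..T} x"
    and d\<phi>: "\<And>u. u \<in> {0..T} \<Longrightarrow> (\<phi> has_real_derivative \<phi>' u) (at u within {0..T})"
    and \<phi>': "continuous_on {0..T} \<phi>'"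
    and dG: "\<And>u. u \<in> {0..T} \<Longrightarrow> (G has_real_derivative x u * \<phi>' u) (at u within {0..T})"
    and J: "\<And>n. J n \<le> n" and Jt: "(\<lambda>n. T * real (J n) / real n) \<longlonglongrightarrow> t" and t: "t \<in> {0..T}"
    and s: "\<And>n j. j < n \<Longrightarrow> s n j \<in> {T * real j / real n..T * real (Suc j) / real n}"
  shows "(\<lambda>n. \<Sum>j<J n. x (s n j) * (\<phi> (T * real (Suc j) / real n) - \<phi> (T * real j / real n))) \<longlonglongrightarrow> G t - G 0"
proof -
  define p where "p n j = T * real j / real n" for n j
  have p01: "p n j \<in> {0..T}" if "j \<le> n" "0 < n" for n j
  proof -
    have "real j / real n \<le> 1" using that by simp
    then have "T * (real j / real n) \<le> T * 1" using T by (intro mult_left_mono) auto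
    then show ?thesis using T by (simp add: p_def)
  qed
  have "bounded (\<phi>' ` {0..T})" by (intro compact_imp_bounded compact_continuous_image \<phi>' compact_Icc)
  then obtain B where B: "0 < B" "\<And>u. u \<in> {0..T} \<Longrightarrow> \<bar>\<phi>' u\<bar> \<le> B"
    unfolding bounded_pos by auto
  have cG: "continuous_on {0..T} G" by (rule DERIV_continuous_on[OF dG])
  have uc: "uniformly_continuous_on {0..T} x" by (rule compact_uniformly_continuous[OF x]) simp
  let ?S = "\<lambda>n. \<Sum>j<J n. x (s n j) * (\<phi> (p n (Suc j)) - \<phi> (p n j))"
  have "(\<lambda>n. ?S n - (G (p n (J n)) - G 0)) \<longlonglongrightarrow> 0"
  proof (rule LIMSEQ_I)
    fix r :: real assume r: "0 < r"
    define \<epsilon> where "\<epsilon> = r / (2 * B * T)"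
    have \<epsilon>: "0 < \<epsilon>" using r B T by (simp add: \<epsilon>_def)
    obtain \<delta> where \<delta>: "0 < \<delta>" "\<And>u v. u \<in> {0..T} \<Longrightarrow> v \<in> {0..T} \<Longrightarrow> dist v u < \<delta> \<Longrightarrow> dist (x v) (x u) < \<epsilon>"
      using uc \<epsilon> unfolding uniformly_continuous_on_def by meson
    obtain N where N: "T / \<delta> < real N" using reals_Archimedean2 by blast
    show "\<exists>no. \<forall>n\<ge>no. norm (?S n - (G (p n (J n)) - G 0) - 0) < r"
    proof (intro exI[of _ "Suc N"] allI impI)
      fix n assume n: "Suc N \<le> n"
      then have n0: "0 < n" and "T / \<delta> < real n" using N by auto
      then have Tn: "T / real n < \<delta>" using \<delta> by (simp add: field_simps)
      have cell: "\<bar>x (s n j) * (\<phi> (p n (Suc j)) - \<phi> (p n j)) - (G (p n (Suc j)) - G (p n j))\<bar> \<le> \<epsilon> * B * (T / real n)"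
        if j: "j < n" for j
      proof -
        let ?I = "{p n j..p n (Suc j)}"
        have I: "?I \<subseteq> {0..T}" using p01[of j n] p01[of "Suc j" n] j n0 by auto
        have len: "p n (Suc j) - p n j = T / real n" by (simp add: p_def diff_divide_distrib[symmetric] algebra_simps)
        have le: "p n j \<le> p n (Suc j)" using len T n0 by (smt (verit) divide_pos_pos of_nat_0_less_iff)
        have sI: "s n j \<in> ?I" using s[OF j] by (simp add: p_def)
        \<comment> \<open>The mean value inequality for \<open>x (s n j) * \<phi> - G\<close> on one
          cell: its derivative is (x(s) - x(u)) \<phi>'(u), which uniform continuity of x makes at
          most \<epsilon> B.\<close>
        have "norm ((x (s n j) * \<phi> (p n (Suc j)) - G (p n (Suc j))) - (x (s n j) * \<phi> (p n j) - G (p n j)))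
           \<le> \<epsilon> * B * norm (p n (Suc j) - p n j)"
        proof (rule field_differentiable_bound[where S="?I"])
          fix u assume u: "u \<in> ?I"
          then have uT: "u \<in> {0..T}" using I by auto
          show "((\<lambda>u. x (s n j) * \<phi> u - G u) has_real_derivative x (s n j) * \<phi>' u - x u * \<phi>' u) (at u within ?I)"
            by (intro DERIV_diff DERIV_cmult DERIV_subset[OF d\<phi>[OF uT] I] DERIV_subset[OF dG[OF uT] I])
          have "dist (s n j) u < \<delta>" using u sI len Tn by (auto simp: dist_real_def)
          then have "\<bar>x (s n j) - x u\<bar> \<le> \<epsilon>" using \<delta>(2)[OF uT, of "s n j"] sI I by (auto simp: dist_real_def)
          then have "\<bar>x (s n j) - x u\<bar> * \<bar>\<phi>' u\<bar> \<le> \<epsilon> * B" using B(2)[OF uT] \<epsilon> by (intro mult_mono) auto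
          then show "norm (x (s n j) * \<phi>' u - x u * \<phi>' u) \<le> \<epsilon> * B"
            by (simp add: abs_mult[symmetric] left_diff_distrib)
        qed (use le in auto)
        then show ?thesis using len T n0 by (simp add: algebra_simps)
      qed
      have tel: "G (p n (J n)) - G 0 = (\<Sum>j<J n. G (p n (Suc j)) - G (p n j))"
        by (subst sum_lessThan_telescope) (simp add: p_def)
      have "\<bar>?S n - (G (p n (J n)) - G 0)\<bar> \<le> (\<Sum>j<J n. \<epsilon> * B * (T / real n))"
        unfolding tel sum_subtractf[symmetric]
        by (rule order_trans[OF sum_abs sum_mono]) (use cell J[of n] in auto)
      also have "\<dots> = \<epsilon> * B * T * (real (J n) / real n)" by simp
      also have "\<dots> \<le> \<epsilon> * B * T * 1" using \<epsilon> B T J[of n] n0 by (intro mult_left_mono) auto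
      also have "\<dots> < r" using r B T by (simp add: \<epsilon>_def)
      finally show "norm (?S n - (G (p n (J n)) - G 0) - 0) < r" by simp
    qed
  qed
  moreover have "(\<lambda>n. G (p n (J n)) - G 0) \<longlonglongrightarrow> G t - G 0"
  proof (intro tendsto_intros continuous_on_tendsto_compose[OF cG _ t])
    show "(\<lambda>n. p n (J n)) \<longlonglongrightarrow> t" using Jt by (simp add: p_def)
    show "\<forall>\<^sub>F n in sequentially. p n (J n) \<in> {0..T}"
      using J p01 by (intro eventually_sequentiallyI[of 1]) auto
  qed
  ultimately have "(\<lambda>n. (?S n - (G (p n (J n)) - G 0)) + (G (p n (J n)) - G 0)) \<longlonglongrightarrow> 0 + (G t - G 0)"
    by (rule tendsto_add)
  then show ?thesis by (simp add: p_def)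
qed

lemma riemann_sums:
  fixes f G :: "real \<Rightarrow> real"
  assumes T: "0 < T" and f: "continuous_on {0..T} f"
    and dG: "\<And>u. u \<in> {0..T} \<Longrightarrow> (G has_real_derivative f u) (at u within {0..T})"
    and J: "\<And>n. J n \<le> n" and Jt: "(\<lambda>n. T * real (J n) / real n) \<longlonglongrightarrow> t" and t: "t \<in> {0..T}"
  shows "(\<lambda>n. \<Sum>j<J n. f (T * real j / real n) * (T / real n)) \<longlonglongrightarrow> G t - G 0"
proof -
  have "(\<lambda>n. \<Sum>j<J n. f (T * real j / real n) * (T * real (Suc j) / real n - T * real j / real n)) \<longlonglongrightarrow> G t - G 0"
    by (rule riemann_stieltjes_sums[where \<phi>="\<lambda>u. u" and \<phi>'="\<lambda>_. 1" and t=t, OF T f _ _ _ J Jt t])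
      (use T dG in \<open>auto intro!: divide_right_mono\<close>)
  moreover have "T * real (Suc j) / real n - T * real j / real n = T / real n" for j n
    by (simp add: diff_divide_distrib[symmetric] algebra_simps)
  ultimately show ?thesis by simp
qed

section \<open>Gaussian structure of Brownian motion and of its Karhunen-Loeve coefficients\<close>

locale brownian = prob_space M for M :: "'a measure" +
  fixes T :: real and X :: "real \<Rightarrow> 'a \<Rightarrow> real"
  assumes T: "0 < T" and bm: "scalar_brownian_motion M T X"
begin

lemma X_measurable: "t \<in> {0..T} \<Longrightarrow> X t \<in> borel_measurable M"
  and X_0: "AE \<omega> in M. X 0 \<omega> = 0"
  and X_cont: "\<omega> \<in> space M \<Longrightarrow> continuous_on {0..T} (\<lambda>t. X t \<omega>)"
  using bm unfolding scalar_brownian_motion_def by auto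

lemma X_increment_gauss:
  assumes "0 \<le> s" "s < t" "t \<le> T"
  shows "gauss M (\<lambda>\<omega>. X t \<omega> - X s \<omega>) (t - s)"
proof -
  have "distributed M lborel (\<lambda>\<omega>. X t \<omega> - X s \<omega>) (normal_density 0 (sqrt (t - s)))"
    using bm assms unfolding scalar_brownian_motion_def by blast
  from gauss_distributed_normal[OF this] assms show ?thesis by simp
qed

text \<open>The integral is \<open>\<int>\<^sub>0\<^sup>T \<Phi> dX\<close>, integrated by parts; the \<open>n\<close>-th approximation is the Ito sum
  over the uniform grid.\<close>

lemma wiener_integral_gauss:
  fixes \<Phi> \<Phi>' A A2 :: "real \<Rightarrow> real"
  assumes d\<Phi>: "\<And>u. u \<in> {0..T} \<Longrightarrow> (\<Phi> has_real_derivative \<Phi>' u) (at u within {0..T})"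
    and \<Phi>': "continuous_on {0..T} \<Phi>'" and \<Phi>T: "\<Phi> T = 0"
    and dA: "\<And>u. u \<in> {0..T} \<Longrightarrow> (A has_real_derivative \<Phi> u) (at u within {0..T})"
    and dA2: "\<And>u. u \<in> {0..T} \<Longrightarrow> (A2 has_real_derivative (\<Phi> u)\<^sup>2) (at u within {0..T})"
    and t: "t \<in> {0..T}"
  shows "gauss M (\<lambda>\<omega>. c * X t \<omega> - (LINT u:{0..T}|lborel. X u \<omega> * \<Phi>' u))
     (c\<^sup>2 * t + 2 * c * (A t - A 0) + (A2 T - A2 0))"
proof -
  define p where "p n j = T * real j / real n" for n j
  define J where "J n = nat \<lceil>real n * (t / T)\<rceil>" for n
  have tT: "0 \<le> t / T" "t / T \<le> 1" using t T by auto
  have J_le: "J n \<le> n" for n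
  proof -
    have "real n * (t / T) \<le> real n * 1" using tT by (intro mult_left_mono) auto
    then show ?thesis unfolding J_def by (simp add: ceiling_le_iff nat_le_iff)
  qed
  have J_bnd: "real n * (t / T) \<le> real (J n)" "real (J n) \<le> real n * (t / T) + 1" for n
  proof -
    have "0 \<le> real n * (t / T)" using tT by (intro mult_nonneg_nonneg) auto
    then have "real (J n) = of_int \<lceil>real n * (t / T)\<rceil>" unfolding J_def by (intro of_nat_nat) simp
    then show "real n * (t / T) \<le> real (J n)" "real (J n) \<le> real n * (t / T) + 1"
      using ceiling_correct[of "real n * (t / T)"] by linarith+
  qed
  have Jt: "(\<lambda>n. p n (J n)) \<longlonglongrightarrow> t"
  proof (rule tendsto_sandwich)
    show "\<forall>\<^sub>F n in sequentially. t \<le> p n (J n)" "\<forall>\<^sub>F n in sequentially. p n (J n) \<le> t + T * (1 / real n)"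
      using J_bnd T by (auto intro!: eventually_sequentiallyI[of 1] simp: p_def field_simps)
    have "(\<lambda>n. t + T * (1 / real n)) \<longlonglongrightarrow> t + T * 0" by (intro tendsto_intros lim_1_over_n)
    then show "(\<lambda>n. t + T * (1 / real n)) \<longlonglongrightarrow> t" by simp
  qed simp
  have p01: "p n j \<in> {0..T}" if "j \<le> n" for n j
  proof -
    have "real j / real n \<le> 1" using that by (cases "n = 0") auto
    then have "T * (real j / real n) \<le> T * 1" using T by (intro mult_left_mono) auto
    then show ?thesis using T by (simp add: p_def)
  qed
  \<comment> \<open>On the grid, c X_t is c times the sum of the increments before t. Together with
    the increments weighted by \<Phi> this discretizes the Wiener integral of c 1_[0,t] +
    \<Phi>.\<close>
  define a where "a n j = (if j < J n then c else 0) + \<Phi> (p n j)" for n j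
  define Z where "Z n \<omega> = (\<Sum>j<n. a n j * (X (p n (Suc j)) \<omega> - X (p n j) \<omega>))" for n \<omega>
  define v where "v n = (\<Sum>j<n. (a n j)\<^sup>2 * (T / real n))" for n
  have gZ: "gauss M (Z n) (v n)" for n
  proof (cases "n = 0")
    case True
    then show ?thesis by (simp add: Z_def[abs_def] v_def gauss_def prob_space)
  next
    case False
    have d: "p n (Suc j) - p n j = T / real n" for j by (simp add: p_def diff_divide_distrib[symmetric] algebra_simps)
    have sm: "strict_mono_on {..n} (p n)" using T False by (auto simp: strict_mono_on_def p_def divide_strict_right_mono)
    have "p n ` {..n} \<subseteq> {0..T}" using p01 by auto
    with sm have ind: "indep_vars (\<lambda>_. borel) (\<lambda>j \<omega>. X (p n (Suc j)) \<omega> - X (p n j) \<omega>) {..<n}"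
      using bm unfolding scalar_brownian_motion_def by blast
    show ?thesis unfolding Z_def v_def
    proof (rule gauss_sum_indep[OF _ ind])
      fix j assume "j \<in> {..<n}"
      then show "gauss M (\<lambda>\<omega>. X (p n (Suc j)) \<omega> - X (p n j) \<omega>) (T / real n)"
        using X_increment_gauss[of "p n j" "p n (Suc j)"] p01[of j n] p01[of "Suc j" n] d[of j] T False
        by (auto simp: algebra_simps)
    qed simp
  qed
  have c\<Phi>: "continuous_on {0..T} \<Phi>" by (rule DERIV_continuous_on[OF d\<Phi>])
  \<comment> \<open>Expanding the square of c 1_[0,t] + \<Phi> gives the three terms of the limit
    variance: c^2 t, the mixed term from the antiderivative \<open>A\<close> of \<Phi>, and the
    energy of \<Phi> from \<open>A2\<close>.\<close>
  have vlim: "v \<longlonglongrightarrow> c\<^sup>2 * t + 2 * c * (A t - A 0) + (A2 T - A2 0)"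
  proof -
    have id: "(\<lambda>n. T * real n / real n) \<longlonglongrightarrow> T"
      by (rule tendsto_eventually, rule eventually_sequentiallyI[of 1]) simp
    have 1: "(\<lambda>n. \<Sum>j<J n. \<Phi> (p n j) * (T / real n)) \<longlonglongrightarrow> A t - A 0"
      unfolding p_def by (rule riemann_sums[OF T c\<Phi> dA J_le Jt[unfolded p_def] t])
    have 2: "(\<lambda>n. \<Sum>j<n. (\<Phi> (p n j))\<^sup>2 * (T / real n)) \<longlonglongrightarrow> A2 T - A2 0"
      unfolding p_def by (rule riemann_sums[OF T _ dA2 _ id]) (use T c\<Phi> in \<open>auto intro!: continuous_intros\<close>)
    have "v n = c\<^sup>2 * p n (J n) + 2 * c * (\<Sum>j<J n. \<Phi> (p n j) * (T / real n)) + (\<Sum>j<n. (\<Phi> (p n j))\<^sup>2 * (T / real n))" for n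
    proof -
      have "v n = (\<Sum>j<n. (if j < J n then (c\<^sup>2 + 2 * c * \<Phi> (p n j)) * (T / real n) else 0) + (\<Phi> (p n j))\<^sup>2 * (T / real n))"
          unfolding v_def a_def by (intro sum.cong refl) (simp add: power2_sum distrib_right add_divide_distrib)
      also have "\<dots> = (\<Sum>j<J n. (c\<^sup>2 + 2 * c * \<Phi> (p n j)) * (T / real n)) + (\<Sum>j<n. (\<Phi> (p n j))\<^sup>2 * (T / real n))"
      proof -
        have "{..<n} \<inter> {j. j < J n} = {..<J n}" using J_le[of n] by auto
        then show ?thesis unfolding sum.distrib by (simp add: sum.inter_restrict[symmetric] sum.If_cases)
      qed
      also have "(\<Sum>j<J n. (c\<^sup>2 + 2 * c * \<Phi> (p n j)) * (T / real n)) = c\<^sup>2 * p n (J n) + 2 * c * (\<Sum>j<J n. \<Phi> (p n j) * (T / real n))"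
      proof -
        have "(\<Sum>j<J n. (c\<^sup>2 + 2 * c * \<Phi> (p n j)) * (T / real n)) = (\<Sum>j<J n. c\<^sup>2 * (T / real n) + 2 * c * (\<Phi> (p n j) * (T / real n)))"
          by (intro sum.cong refl) (simp only: distrib_right mult.assoc)
        also have "\<dots> = real (J n) * (c\<^sup>2 * (T / real n)) + 2 * c * (\<Sum>j<J n. \<Phi> (p n j) * (T / real n))"
          by (simp only: sum.distrib sum_distrib_left sum_constant card_lessThan)
        finally show ?thesis by (simp add: p_def)
      qed
      finally show ?thesis .
    qed
    then have v: "v = (\<lambda>n. c\<^sup>2 * p n (J n) + 2 * c * (\<Sum>j<J n. \<Phi> (p n j) * (T / real n)) + (\<Sum>j<n. (\<Phi> (p n j))\<^sup>2 * (T / real n)))"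
      by blast
    show ?thesis unfolding v by (intro tendsto_intros 1 2 Jt)
  qed
  \<comment> \<open>The form after summation by parts differences \<Phi> instead of the path, so it
    converges for every continuous path. It equals \<open>Z n\<close> when n > 0 and the path starts
    at 0, since the boundary term at T vanishes with \<Phi>.\<close>
  define Z' where "Z' n \<omega> = c * X (p n (J n)) \<omega> - (\<Sum>j<n. X (p n (Suc j)) \<omega> * (\<Phi> (p n (Suc j)) - \<Phi> (p n j)))" for n \<omega>
  define Zl where "Zl \<omega> = c * X t \<omega> - (LINT u:{0..T}|lborel. X u \<omega> * \<Phi>' u)" for \<omega>
  have lim: "(\<lambda>n. Z' n \<omega>) \<longlonglongrightarrow> Zl \<omega>" if \<omega>: "\<omega> \<in> space M" for \<omega>
  proof -
    have cf: "continuous_on {0..T} (\<lambda>u. X u \<omega> * \<Phi>' u)" by (intro continuous_intros X_cont[OF \<omega>] \<Phi>')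
    define G where "G u = integral {0..u} (\<lambda>u. X u \<omega> * \<Phi>' u)" for u
    have dG: "(G has_real_derivative X u \<omega> * \<Phi>' u) (at u within {0..T})" if "u \<in> {0..T}" for u
      unfolding G_def by (rule integral_has_real_derivative[OF cf that])
    have GT: "G T - G 0 = (LINT u:{0..T}|lborel. X u \<omega> * \<Phi>' u)"
      unfolding G_def using set_borel_integral_eq_integral(2)[OF borel_integrable_atLeastAtMost'[OF cf]] by simp
    have id: "(\<lambda>n. T * real n / real n) \<longlonglongrightarrow> T"
      by (rule tendsto_eventually, rule eventually_sequentiallyI[of 1]) simp
    have "(\<lambda>n. \<Sum>j<n. X (p n (Suc j)) \<omega> * (\<Phi> (p n (Suc j)) - \<Phi> (p n j))) \<longlonglongrightarrow> G T - G 0"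
      unfolding p_def
      by (rule riemann_stieltjes_sums[OF T X_cont[OF \<omega>] d\<Phi> \<Phi>' dG _ id]) (use T in \<open>auto intro!: divide_right_mono mult_left_mono\<close>)
    moreover have "(\<lambda>n. X (p n (J n)) \<omega>) \<longlonglongrightarrow> X t \<omega>"
      by (rule continuous_on_tendsto_compose[OF X_cont[OF \<omega>] Jt t]) (use p01 J_le in auto)
    ultimately show ?thesis unfolding Z'_def Zl_def GT by (intro tendsto_intros)
  qed
  have Z'm: "Z' n \<in> borel_measurable M" for n
    unfolding Z'_def using p01 J_le
    by (intro borel_measurable_diff borel_measurable_times borel_measurable_sum borel_measurable_const X_measurable) auto
  have Zm: "Zl \<in> borel_measurable M"
    by (rule borel_measurable_LIMSEQ_real[OF lim Z'm])
  have ZZ': "Z n \<omega> = Z' n \<omega>" if x0: "X 0 \<omega> = 0" and n: "0 < n" for n \<omega>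
  proof -
    have pn: "p n n = T" "p n 0 = 0" using n by (auto simp: p_def)
    have Inter: "{..<n} \<inter> {j. j < J n} = {..<J n}" using J_le[of n] by auto
    have "Z n \<omega> = (\<Sum>j<n. if j < J n then c * (X (p n (Suc j)) \<omega> - X (p n j) \<omega>) else 0)
        + (\<Sum>j<n. \<Phi> (p n j) * (X (p n (Suc j)) \<omega> - X (p n j) \<omega>))"
      unfolding Z_def a_def sum.distrib[symmetric] by (intro sum.cong refl) (simp add: distrib_right)
    also have "(\<Sum>j<n. if j < J n then c * (X (p n (Suc j)) \<omega> - X (p n j) \<omega>) else 0)
        = c * (\<Sum>j<J n. X (p n (Suc j)) \<omega> - X (p n j) \<omega>)"
      by (simp add: sum.If_cases Inter sum_distrib_left)
    also have "(\<Sum>j<J n. X (p n (Suc j)) \<omega> - X (p n j) \<omega>) = X (p n (J n)) \<omega>"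
      by (subst sum_lessThan_telescope) (simp add: pn x0)
    also have "(\<Sum>j<n. \<Phi> (p n j) * (X (p n (Suc j)) \<omega> - X (p n j) \<omega>))
        = (\<Sum>j<n. (\<Phi> (p n (Suc j)) * X (p n (Suc j)) \<omega> - \<Phi> (p n j) * X (p n j) \<omega>)
           - X (p n (Suc j)) \<omega> * (\<Phi> (p n (Suc j)) - \<Phi> (p n j)))"
      by (intro sum.cong refl) (simp add: algebra_simps)
    also have "\<dots> = (\<Phi> (p n n) * X (p n n) \<omega> - \<Phi> (p n 0) * X (p n 0) \<omega>)
        - (\<Sum>j<n. X (p n (Suc j)) \<omega> * (\<Phi> (p n (Suc j)) - \<Phi> (p n j)))"
      unfolding sum_subtractf[of _ _ "{..<n}"] using sum_lessThan_telescope[of "\<lambda>j. \<Phi> (p n j) * X (p n j) \<omega>" n]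
      by (simp add: sum_subtractf)
    finally show ?thesis by (simp add: pn x0 \<Phi>T Z'_def)
  qed
  have "gauss M Zl (c\<^sup>2 * t + 2 * c * (A t - A 0) + (A2 T - A2 0))"
  proof (rule gauss_limit[OF gZ Zm _ vlim])
    show "AE \<omega> in M. (\<lambda>n. Z n \<omega>) \<longlonglongrightarrow> Zl \<omega>"
      using X_0 AE_space
    proof eventually_elim
      case (elim \<omega>)
      from lim[OF elim(2)] show ?case
        by (rule Lim_transform_eventually) (use ZZ'[OF elim(1)] in \<open>auto intro!: eventually_sequentiallyI[of 1]\<close>)
    qed
  qed
  then show ?thesis by (simp add: Zl_def[abs_def])
qed

abbreviation "\<xi> \<equiv> kl_xi T X"

lemma kl_e_cont: "1 \<le> k \<Longrightarrow> continuous_on S (kl_e T k)"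
proof -
  assume "1 \<le> k"
  then have "kl_e T k = (\<lambda>t. sqrt (2 / T) * sin (kl_freq T k * t))" using kl_e_freq[OF T] by blast
  then show ?thesis by (auto intro!: continuous_intros)
qed

lemma kl_xi_freq: "1 \<le> k \<Longrightarrow> \<xi> k \<omega> = kl_freq T k * (LINT u:{0..T}|lborel. X u \<omega> * kl_e T k u)"
  unfolding kl_xi_def by (simp add: sqrt_kl_lambda[OF T])

text \<open>The combination is a Wiener integral: \<open>\<xi> k\<close> integrates
  \<open>kl_phi T k\<close>, whose antiderivative is \<open>sqrt (kl_lambda T k) * kl_e T k\<close>.
  Hence the covariance of X_t and \<open>\<xi> k\<close> is that function at t, and orthonormality
  reduces the variance of the sum to the sum of the squares. The laws and independence of the
  coefficients and the law of the remainder are all specializations.\<close>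

lemma kl_gauss:
  assumes t: "t \<in> {0..T}"
  shows "gauss M (\<lambda>\<omega>. c * X t \<omega> + (\<Sum>k=1..n. u k * \<xi> k \<omega>))
     (c\<^sup>2 * t + 2 * c * (\<Sum>k=1..n. u k * (sqrt (kl_lambda T k) * kl_e T k t)) + (\<Sum>k=1..n. (u k)\<^sup>2))"
proof -
  define \<Phi> where "\<Phi> x = (\<Sum>k=1..n. u k * kl_phi T k x)" for x
  define \<Phi>' where "\<Phi>' x = (\<Sum>k=1..n. u k * - (kl_freq T k * kl_e T k x))" for x
  define A where "A x = (\<Sum>k=1..n. u k * (kl_e T k x / kl_freq T k))" for x
  define A2 where "A2 x = integral {0..x} (\<lambda>x. (\<Phi> x)\<^sup>2)" for x
  have d\<Phi>: "(\<Phi> has_real_derivative \<Phi>' x) (at x within S)" for x S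
    unfolding \<Phi>_def \<Phi>'_def by (intro DERIV_sum DERIV_cmult kl_phi_deriv[OF T]) auto
  have c\<Phi>: "continuous_on {0..T} \<Phi>" by (rule DERIV_continuous_on[OF d\<Phi>])
  have c\<Phi>': "continuous_on {0..T} \<Phi>'" unfolding \<Phi>'_def by (intro continuous_intros kl_e_cont) auto
  have dA: "(A has_real_derivative \<Phi> x) (at x within {0..T})" for x
    unfolding \<Phi>_def A_def by (intro DERIV_sum DERIV_cmult kl_e_deriv[OF T]) auto
  have dA2: "(A2 has_real_derivative (\<Phi> x)\<^sup>2) (at x within {0..T})" if "x \<in> {0..T}" for x
    unfolding A2_def by (intro integral_has_real_derivative continuous_intros c\<Phi> that)
  have "((\<lambda>x. (\<Phi> x)\<^sup>2) has_integral (\<Sum>j=1..n. \<Sum>k=1..n. (u j * u k) * (if j = k then 1 else 0))) {0..T}"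
  proof -
    have "((\<lambda>x. \<Sum>j=1..n. \<Sum>k=1..n. (u j * u k) * (kl_phi T j x * kl_phi T k x))
        has_integral (\<Sum>j=1..n. \<Sum>k=1..n. (u j * u k) * (if j = k then 1 else 0))) {0..T}"
      by (intro has_integral_sum has_integral_mult_right kl_orthonormal(2)[OF T]) auto
    then show ?thesis unfolding \<Phi>_def power2_eq_square sum_product by (simp only: mult_ac)
  qed
  then have A2T: "A2 T = (\<Sum>k=1..n. (u k)\<^sup>2)"
    unfolding A2_def by (simp add: integral_unique power2_eq_square sum.delta if_distrib cong: if_cong)
  have A0: "A 0 = 0" "A2 0 = 0" unfolding A_def A2_def by (auto intro!: sum.neutral simp: kl_e_def)
  have At: "A t = (\<Sum>k=1..n. u k * (sqrt (kl_lambda T k) * kl_e T k t))"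
    unfolding A_def by (intro sum.cong refl) (simp add: sqrt_kl_lambda[OF T])
  have Z: "c * X t \<omega> - (LINT x:{0..T}|lborel. X x \<omega> * \<Phi>' x) = c * X t \<omega> + (\<Sum>k=1..n. u k * \<xi> k \<omega>)"
    if \<omega>: "\<omega> \<in> space M" for \<omega>
  proof -
    have i: "set_integrable lborel {0..T} (\<lambda>x. X x \<omega> * kl_e T k x)" if "k \<in> {1..n}" for k
      using that by (intro borel_integrable_atLeastAtMost' continuous_intros X_cont[OF \<omega>] kl_e_cont) auto
    have "set_integrable lborel {0..T} (\<lambda>x. X x \<omega> * \<Phi>' x)"
      by (intro borel_integrable_atLeastAtMost' continuous_intros X_cont[OF \<omega>] c\<Phi>')
    then have "(LINT x:{0..T}|lborel. X x \<omega> * \<Phi>' x) = integral {0..T} (\<lambda>x. X x \<omega> * \<Phi>' x)"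
      by (rule set_borel_integral_eq_integral)
    also have "\<dots> = integral {0..T} (\<lambda>x. \<Sum>k=1..n. - (u k * kl_freq T k) * (X x \<omega> * kl_e T k x))"
      unfolding \<Phi>'_def sum_distrib_left by (simp add: mult_ac)
    also have "\<dots> = (\<Sum>k=1..n. - (u k * kl_freq T k) * (LINT x:{0..T}|lborel. X x \<omega> * kl_e T k x))"
      by (intro integral_unique has_integral_sum has_integral_mult_right)
        (auto simp: set_borel_integral_eq_integral[OF i] intro!: integrable_integral)
    also have "\<dots> = - (\<Sum>k=1..n. u k * \<xi> k \<omega>)"
      unfolding sum_negf[symmetric] by (intro sum.cong refl) (simp add: kl_xi_freq)
    finally show ?thesis by simp
  qed
  from wiener_integral_gauss[OF d\<Phi> c\<Phi>' _ dA dA2 t, of c] have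
    "gauss M (\<lambda>\<omega>. c * X t \<omega> - (LINT x:{0..T}|lborel. X x \<omega> * \<Phi>' x)) (c\<^sup>2 * t + 2 * c * (A t - A 0) + (A2 T - A2 0))"
    by (simp add: \<Phi>_def kl_phi_T[OF T])
  then show ?thesis unfolding A0 At A2T using Z
    by (auto simp: gauss_def cong: measurable_cong Bochner_Integration.integral_cong)
qed

lemma xi_comb_gauss: "gauss M (\<lambda>\<omega>. \<Sum>k=1..n. u k * \<xi> k \<omega>) (\<Sum>k=1..n. (u k)\<^sup>2)"
  using kl_gauss[of 0 0 u n] T by simp

lemma xi_gauss: "1 \<le> k \<Longrightarrow> gauss M (\<xi> k) 1"
  using xi_comb_gauss[of "\<lambda>j. if j = k then 1 else 0" k]
  by (simp add: if_distrib[of "\<lambda>x. x * _"] if_distrib[of "\<lambda>x. x\<^sup>2"] sum.delta cong: if_cong)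

lemma xi_measurable [measurable]: "1 \<le> k \<Longrightarrow> \<xi> k \<in> borel_measurable M"
  using xi_gauss by (rule gaussD(2))

text \<open>The variance of a combination is the sum of the squared coefficients, so its character
  factorizes as \<open>indep_vars_char\<close> requires.\<close>

lemma xi_indep: "indep_vars (\<lambda>_. borel) \<xi> {1..n}"
proof (rule indep_vars_char)
  fix u :: "nat \<Rightarrow> real"
  have "(\<integral>\<omega>. iexp (\<Sum>i\<in>{1..n}. u i * \<xi> i \<omega>) \<partial>M) = complex_of_real (exp (\<Sum>k=1..n. - (u k)\<^sup>2 / 2))"
    using gaussD(3)[OF xi_comb_gauss[of u n], of 1] by (simp add: sum_negf sum_divide_distrib)
  also have "\<dots> = (\<Prod>i\<in>{1..n}. \<integral>\<omega>. iexp (u i * \<xi> i \<omega>) \<partial>M)"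
    unfolding exp_sum[OF finite_atLeastAtMost] of_real_prod
    by (intro prod.cong refl) (subst gaussD(3)[OF xi_gauss], auto)
  finally show "(\<integral>\<omega>. iexp (\<Sum>i\<in>{1..n}. u i * \<xi> i \<omega>) \<partial>M) = (\<Prod>i\<in>{1..n}. \<integral>\<omega>. iexp (u i * \<xi> i \<omega>) \<partial>M)" .
qed auto

text \<open>By \<open>mercer\<close> this variance tends to 0; being Gaussian, the remainder then
  has vanishing moments of every order. The convergence of the expansion is used in this
  form.\<close>

lemma kl_remainder_gauss:
  assumes t: "t \<in> {0..T}"
  shows "gauss M (\<lambda>\<omega>. X t \<omega> - (\<Sum>k=1..n. sqrt (kl_lambda T k) * kl_e T k t * \<xi> k \<omega>))
     (t - (\<Sum>k=1..n. (sqrt (kl_lambda T k) * kl_e T k t)\<^sup>2))"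
proof -
  let ?c = "\<lambda>k. sqrt (kl_lambda T k) * kl_e T k t"
  have "1\<^sup>2 * t + 2 * 1 * (\<Sum>k=1..n. - ?c k * ?c k) + (\<Sum>k=1..n. (- ?c k)\<^sup>2) = t - (\<Sum>k=1..n. (?c k)\<^sup>2)"
    by (simp add: sum_negf power2_eq_square)
  moreover have "1 * X t \<omega> + (\<Sum>k=1..n. - ?c k * \<xi> k \<omega>) = X t \<omega> - (\<Sum>k=1..n. ?c k * \<xi> k \<omega>)" for \<omega>
    by (simp add: sum_negf)
  ultimately show ?thesis using kl_gauss[OF t, of 1 "\<lambda>k. - ?c k" n] by (simp only:)
qed

end

section \<open>Distortion of the standard normal law\<close>

lemma std_normal_prob: "prob_space std_normal_distribution"
  by (rule prob_space_normal_density) simp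

lemma std_normal_nn_moment:
  "(\<integral>\<^sup>+x. ennreal (x ^ (2 * k)) \<partial>std_normal_distribution) = ennreal (fact (2 * k) / (2 ^ k * fact k))"
  using std_normal_distribution_even_moments[of k] by (subst nn_integral_eq_integral) auto

definition min_sq_dist :: "real set \<Rightarrow> real \<Rightarrow> real" where
  "min_sq_dist \<alpha> x = (MIN a\<in>\<alpha>. (dist x a)\<^sup>2)"

text \<open>A functional of the codebook alone. By \<open>distortion_gauss\<close> it is the
  distortion of every \<open>\<xi> k\<close>, so one sequence of errors serves all coordinates and
  all allocations that are compared.\<close>

definition normal_distortion :: "real set \<Rightarrow> ennreal" where
  "normal_distortion \<alpha> = (\<integral>\<^sup>+x. ennreal (min_sq_dist \<alpha> x) \<partial>std_normal_distribution)"

definition normal_quant_error :: "nat \<Rightarrow> ennreal" where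
  "normal_quant_error n = (INF \<alpha>\<in>codebooks UNIV n. normal_distortion \<alpha>)"

lemma codebooksD: "\<alpha> \<in> codebooks H n \<Longrightarrow> finite \<alpha>" "\<alpha> \<in> codebooks H n \<Longrightarrow> \<alpha> \<noteq> {}"
  "\<alpha> \<in> codebooks H n \<Longrightarrow> card \<alpha> \<le> n" "\<alpha> \<in> codebooks H n \<Longrightarrow> \<alpha> \<subseteq> H"
  by (auto simp: codebooks_def)

lemma min_sq_dist_le: "finite \<alpha> \<Longrightarrow> a \<in> \<alpha> \<Longrightarrow> min_sq_dist \<alpha> x \<le> (x - a)\<^sup>2"
  unfolding min_sq_dist_def by (rule order_trans[OF Min_le[of _ "(dist x a)\<^sup>2"]]) (auto simp: dist_real_def)

lemma min_sq_dist_ge: "finite \<alpha> \<Longrightarrow> \<alpha> \<noteq> {} \<Longrightarrow> (\<And>a. a \<in> \<alpha> \<Longrightarrow> c \<le> (x - a)\<^sup>2) \<Longrightarrow> c \<le> min_sq_dist \<alpha> x"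
  unfolding min_sq_dist_def by (subst Min_ge_iff) (auto simp: dist_real_def)

lemma min_sq_dist_nonneg: "finite \<alpha> \<Longrightarrow> \<alpha> \<noteq> {} \<Longrightarrow> 0 \<le> min_sq_dist \<alpha> x"
  by (rule min_sq_dist_ge) auto

lemma min_sq_dist_measurable [measurable]:
  "finite \<alpha> \<Longrightarrow> \<alpha> \<noteq> {} \<Longrightarrow> min_sq_dist \<alpha> \<in> borel_measurable borel"
proof (induction \<alpha> rule: finite_ne_induct)
  case (singleton a)
  then show ?case by (simp add: min_sq_dist_def[abs_def])
next
  case (insert a \<alpha>)
  then have "min_sq_dist (insert a \<alpha>) = (\<lambda>x. min ((dist x a)\<^sup>2) (min_sq_dist \<alpha> x))"
    by (intro ext) (simp add: min_sq_dist_def)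
  then show ?case using insert by simp
qed

lemma normal_quant_error_le: "\<alpha> \<in> codebooks UNIV n \<Longrightarrow> normal_quant_error n \<le> normal_distortion \<alpha>"
  unfolding normal_quant_error_def by (rule INF_lower)

lemma normal_quant_error_le_1: "1 \<le> n \<Longrightarrow> normal_quant_error n \<le> 1"
proof -
  assume "1 \<le> n"
  then have "normal_quant_error n \<le> normal_distortion {0}"
    by (intro normal_quant_error_le) (simp add: codebooks_def)
  also have "\<dots> = 1" using std_normal_nn_moment[of 1] by (simp add: normal_distortion_def min_sq_dist_def)
  finally show ?thesis .
qed

subsection \<open>Existence of optimal scalar quantizers\<close>

text \<open>One further subsequence per coordinate. Extended reals are compact, so a point escaping
  to infinity has a limit as well and no boundedness of the codebooks has to be shown
  beforehand.\<close>

lemma ereal_vector_subsequence: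
  fixes a :: "nat \<Rightarrow> nat \<Rightarrow> ereal"
  shows "\<exists>r b. strict_mono r \<and> (\<forall>i<n. (\<lambda>j. a (r j) i) \<longlonglongrightarrow> b i)"
proof (induction n)
  case 0
  show ?case by (intro exI[of _ id]) (auto simp: strict_mono_def)
next
  case (Suc n)
  then obtain r b where r: "strict_mono r" "\<And>i. i < n \<Longrightarrow> (\<lambda>j. a (r j) i) \<longlonglongrightarrow> b i" by blast
  obtain l s where s: "strict_mono s" "((\<lambda>j. a (r j) n) \<circ> s) \<longlonglongrightarrow> l"
    using compact_complete_linorder[of "\<lambda>j. a (r j) n"] by blast
  have "(\<lambda>j. a ((r \<circ> s) j) i) \<longlonglongrightarrow> (b(n := l)) i" if "i < Suc n" for i
  proof (cases "i = n")
    case True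
    then show ?thesis using s(2) by (simp add: comp_def)
  next
    case False
    then have "i < n" using that by simp
    from LIMSEQ_subseq_LIMSEQ[OF r(2)[OF this] s(1)] False show ?thesis by (simp add: comp_def)
  qed
  then show ?case using strict_mono_o[OF r(1) s(1)] by blast
qed

text \<open>Points of a minimizing sequence that escape to infinity do not contribute in the limit, so the
  remaining limit points are already optimal, by Fatou's lemma.\<close>

lemma optimal_codebook_exists:
  assumes n: "1 \<le> n"
  shows "\<exists>\<alpha>\<in>codebooks UNIV n. normal_distortion \<alpha> = normal_quant_error n"
proof -
  have "{0} \<in> codebooks (UNIV :: real set) n" using n by (simp add: codebooks_def)
  then have "normal_distortion ` codebooks UNIV n \<noteq> {}" by blast
  from Inf_as_limit[OF this] obtain u where u: "\<And>j. u j \<in> normal_distortion ` codebooks UNIV n"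
    "u \<longlonglongrightarrow> normal_quant_error n" unfolding normal_quant_error_def by auto
  then have "\<forall>j. \<exists>\<alpha>. \<alpha> \<in> codebooks UNIV n \<and> u j = normal_distortion \<alpha>" by blast
  then obtain \<alpha> where \<alpha>: "\<And>j. \<alpha> j \<in> codebooks UNIV n" "\<And>j. u j = normal_distortion (\<alpha> j)" by metis
  \<comment> \<open>Enumeration with repetitions, so that codebooks with fewer than n points are
    also indexed by all of \<open>{..<n}\<close>.\<close>
  have "\<exists>f. f ` {..<n} = \<alpha> j" for j
  proof -
    note cb = codebooksD[OF \<alpha>(1)[of j]]
    obtain h where h: "bij_betw h {0..<card (\<alpha> j)} (\<alpha> j)" using ex_bij_betw_nat_finite[OF cb(1)] by blast
    have c0: "0 < card (\<alpha> j)" using cb by (simp add: card_gt_0_iff)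
    have "(\<lambda>i. h (if i < card (\<alpha> j) then i else 0)) ` {..<n} = h ` {0..<card (\<alpha> j)}"
      using c0 cb(3) by (force simp: image_iff)
    then show ?thesis using h by (auto simp: bij_betw_def)
  qed
  then obtain f where f: "\<And>j. f j ` {..<n} = \<alpha> j" by metis
  obtain r b where r: "strict_mono r" and b: "\<And>i. i < n \<Longrightarrow> (\<lambda>j. ereal (f (r j) i)) \<longlonglongrightarrow> b i"
    using ereal_vector_subsequence[of n "\<lambda>j i. ereal (f j i)"] by blast
  define J where "J = {i. i < n \<and> \<bar>b i\<bar> \<noteq> \<infinity>}"
  define \<beta> where "\<beta> = (\<lambda>i. real_of_ereal (b i)) ` J"
  \<comment> \<open>Points with a finite limit are eventually farther than c because their limit
    lies in \<beta>; the others are eventually farther than any bound. The first disjunct covers the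
    case that every point escapes, where \<beta> is empty and \<open>min_sq_dist \<beta> x\<close>
    has no meaning.\<close>
  have key: "\<forall>\<^sub>F j in sequentially. c < min_sq_dist (\<alpha> (r j)) x" if c: "J = {} \<or> c < min_sq_dist \<beta> x" for c x
  proof -
    have "\<forall>\<^sub>F j in sequentially. c < (x - f (r j) i)\<^sup>2" if i: "i \<in> {..<n}" for i
    proof (cases "i \<in> J")
      case True
      then have "(\<lambda>j. f (r j) i) \<longlonglongrightarrow> real_of_ereal (b i)"
        using lim_real_of_ereal[of "\<lambda>j. ereal (f (r j) i)" "real_of_ereal (b i)"] b[of i] i
        by (simp add: J_def ereal_real')
      then have lim: "(\<lambda>j. (x - f (r j) i)\<^sup>2) \<longlonglongrightarrow> (x - real_of_ereal (b i))\<^sup>2" by (intro tendsto_intros)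
      have "min_sq_dist \<beta> x \<le> (x - real_of_ereal (b i))\<^sup>2"
        using True by (intro min_sq_dist_le) (auto simp: \<beta>_def J_def)
      moreover have "c < min_sq_dist \<beta> x" using c True by auto
      ultimately show ?thesis by (intro order_tendstoD(1)[OF lim]) linarith
    next
      case False
      have big: "c < (x - y)\<^sup>2" if "\<bar>x\<bar> + \<bar>c\<bar> + 1 < \<bar>y\<bar>" for y
      proof -
        have "\<bar>c\<bar> + 1 \<le> \<bar>x - y\<bar>" using that by linarith
        then have "(\<bar>c\<bar> + 1)\<^sup>2 \<le> \<bar>x - y\<bar>\<^sup>2" by (intro power_mono) auto
        moreover have "(\<bar>c\<bar> + 1)\<^sup>2 = c\<^sup>2 + 2 * \<bar>c\<bar> + 1" by (simp add: power2_sum)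
        ultimately show ?thesis using zero_le_power2[of c] abs_ge_self[of c] unfolding power2_abs by linarith
      qed
      from False i consider "b i = \<infinity>" | "b i = - \<infinity>" by (auto simp: J_def)
      then show ?thesis
      proof cases
        case 1
        then have "\<forall>\<^sub>F j in sequentially. ereal (\<bar>x\<bar> + \<bar>c\<bar> + 1) < ereal (f (r j) i)"
          using b[of i] i by (simp add: tendsto_PInfty)
        then show ?thesis by eventually_elim (rule big, simp)
      next
        case 2
        then have "\<forall>\<^sub>F j in sequentially. ereal (f (r j) i) < ereal (- (\<bar>x\<bar> + \<bar>c\<bar> + 1))"
          using b[of i] i by (simp only: tendsto_MInfty lessThan_iff)
        then show ?thesis by eventually_elim (rule big, simp)
      qed
    qed
    then have "\<forall>\<^sub>F j in sequentially. \<forall>i\<in>{..<n}. c < (x - f (r j) i)\<^sup>2"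
      by (intro eventually_ball_finite) auto
    then show ?thesis
    proof eventually_elim
      case (elim j)
      show ?case
        unfolding min_sq_dist_def f[symmetric] using elim n
        by (subst Min_gr_iff) (auto simp: dist_real_def lessThan_empty_iff)
    qed
  qed
  have meas: "(\<lambda>x. ennreal (min_sq_dist (\<alpha> (r j)) x)) \<in> borel_measurable std_normal_distribution" for j
    using codebooksD[OF \<alpha>(1)[of "r j"]] by measurable
  have lim: "(\<lambda>j. normal_distortion (\<alpha> (r j))) \<longlonglongrightarrow> normal_quant_error n"
    using LIMSEQ_subseq_LIMSEQ[OF u(2) r] by (simp add: comp_def \<alpha>(2))
  have fatou: "(\<integral>\<^sup>+x. liminf (\<lambda>j. ennreal (min_sq_dist (\<alpha> (r j)) x)) \<partial>std_normal_distribution) \<le> normal_quant_error n"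
    using nn_integral_liminf[of "\<lambda>j x. ennreal (min_sq_dist (\<alpha> (r j)) x)", OF meas] lim_imp_Liminf[OF _ lim]
    by (simp add: normal_distortion_def)
  \<comment> \<open>If every point escaped, the distances would tend to infinity everywhere, and
    Fatou's lemma would make the optimal error infinite, although the codebook {0} already achieves
    1.\<close>
  have "J \<noteq> {}"
  proof
    assume J: "J = {}"
    have "liminf (\<lambda>j. ennreal (min_sq_dist (\<alpha> (r j)) x)) = \<infinity>" for x
    proof -
      have "\<infinity> \<le> liminf (\<lambda>j. ennreal (min_sq_dist (\<alpha> (r j)) x))"
        unfolding le_Liminf_iff
      proof (intro allI impI)
        fix y :: ennreal assume "y < \<infinity>"
        then obtain c where c: "0 \<le> c" "y = ennreal c" by (cases y) auto
        show "\<forall>\<^sub>F j in sequentially. y < ennreal (min_sq_dist (\<alpha> (r j)) x)"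
          using key[of c x] J c by (auto elim!: eventually_mono simp: ennreal_less_iff)
      qed
      then show ?thesis by (simp add: top_unique)
    qed
    then have "(\<infinity> :: ennreal) \<le> normal_quant_error n"
      using fatou prob_space.emeasure_space_1[OF std_normal_prob] by (simp add: ennreal_top_mult)
    also have "\<dots> \<le> 1" by (rule normal_quant_error_le_1[OF n])
    finally show False by (simp add: top_unique)
  qed
  have fJ: "finite J" by (simp add: J_def)
  have "card \<beta> \<le> card {..<n}"
    unfolding \<beta>_def by (rule order_trans[OF card_image_le[OF fJ] card_mono]) (auto simp: J_def)
  then have \<beta>: "\<beta> \<in> codebooks UNIV n" using fJ \<open>J \<noteq> {}\<close> by (simp add: codebooks_def \<beta>_def)
  have "normal_distortion \<beta> \<le> (\<integral>\<^sup>+x. liminf (\<lambda>j. ennreal (min_sq_dist (\<alpha> (r j)) x)) \<partial>std_normal_distribution)"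
    unfolding normal_distortion_def
  proof (intro nn_integral_mono)
    fix x
    show "ennreal (min_sq_dist \<beta> x) \<le> liminf (\<lambda>j. ennreal (min_sq_dist (\<alpha> (r j)) x))"
      unfolding le_Liminf_iff
    proof (intro allI impI)
      fix y assume y: "y < ennreal (min_sq_dist \<beta> x)"
      then obtain c where c: "0 \<le> c" "y = ennreal c" by (cases y) auto
      then have "c < min_sq_dist \<beta> x" using y by (simp add: ennreal_less_iff)
      from key[of c x] this c show "\<forall>\<^sub>F j in sequentially. y < ennreal (min_sq_dist (\<alpha> (r j)) x)"
        by (auto elim!: eventually_mono simp: ennreal_less_iff)
    qed
  qed
  with fatou have "normal_distortion \<beta> \<le> normal_quant_error n" by (rule order_trans[rotated])
  with normal_quant_error_le[OF \<beta>] \<beta> show ?thesis by (intro bexI[of _ \<beta>] antisym)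
qed

subsection \<open>Rate of the scalar quantization error\<close>

text \<open>The grid consists of the midpoints of n equal cells of [-R, R]. For x inside, the
  midpoint of its cell is at distance at most R / n. For x outside, the extreme grid point on the
  same side is at distance at most |x|, and x^2 is at most x^(2j+2) / R^(2j) because |x| >=
  R.\<close>

lemma grid_near:
  fixes x R :: real
  assumes n: "1 \<le> n" and R: "0 < R"
  shows "\<exists>i<n. (x - R * (2 * real i + 1 - real n) / real n)\<^sup>2 \<le> (R / real n)\<^sup>2 + x ^ (2 * Suc j) / R ^ (2 * j)"
proof -
  define g where "g i = R * (2 * real i + 1 - real n) / real n" for i
  have "0 \<le> x ^ (2 * Suc j)" by (rule zero_le_even_power) simp
  then have nn: "0 \<le> x ^ (2 * Suc j) / R ^ (2 * j)" using R by (intro divide_nonneg_nonneg) auto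
  show ?thesis
  proof (cases "\<bar>x\<bar> < R")
    case True
    define z where "z = (x + R) / (2 * R)"
    define y where "y = z * real n"
    have z: "0 \<le> z" "z < 1" using True R by (auto simp: z_def field_simps)
    have y: "0 \<le> y" "y < real n"
      using z n mult_strict_right_mono[of z 1 "real n"] by (auto simp: y_def)
    define i where "i = nat \<lfloor>y\<rfloor>"
    have i: "real i \<le> y" "y < real i + 1" using y by (auto simp: i_def of_nat_nat)
    have "i < n" using i y by linarith
    have "x - g i = (R / real n) * (2 * (y - real i) - 1)"
    proof -
      have "x = 2 * R * z - R" using R by (simp add: z_def)
      moreover have "2 * R * z - R - R * (2 * real i + 1 - real n) / real n = (R / real n) * (2 * (z * real n - real i) - 1)"
        using n by (simp add: field_simps)
      ultimately show ?thesis by (simp only: g_def y_def)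
    qed
    then have "\<bar>x - g i\<bar> = (R / real n) * \<bar>2 * (y - real i) - 1\<bar>"
      using R by (simp only: abs_mult) simp
    also have "\<dots> \<le> (R / real n) * 1"
      using R i by (intro mult_left_mono) (auto simp: abs_le_iff)
    finally have "(x - g i)\<^sup>2 \<le> (R / real n)\<^sup>2"
      using power_mono[of "\<bar>x - g i\<bar>" "R / real n" 2] by simp
    then show ?thesis using \<open>i < n\<close> nn by (intro exI[of _ i]) (auto simp: g_def)
  next
    case False
    have x2: "x\<^sup>2 \<le> x ^ (2 * Suc j) / R ^ (2 * j)"
    proof -
      have "R ^ (2 * j) \<le> \<bar>x\<bar> ^ (2 * j)" using False R by (intro power_mono) auto
      then have "x\<^sup>2 * R ^ (2 * j) \<le> x\<^sup>2 * x ^ (2 * j)" by (intro mult_left_mono) (auto simp: power_even_abs)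
      also have "\<dots> = x ^ (2 * Suc j)" by (simp add: power2_eq_square power_add[symmetric])
      finally show ?thesis using R by (simp add: field_simps)
    qed
    define i where "i = (if 0 \<le> x then n - 1 else 0)"
    have g1: "\<bar>g (n - 1)\<bar> \<le> R \<and> 0 \<le> g (n - 1)" "\<bar>g 0\<bar> \<le> R \<and> g 0 \<le> 0"
    proof -
      have "g (n - 1) = R * ((real n - 1) / real n)" "g 0 = - (R * ((real n - 1) / real n))"
        using n by (simp_all add: g_def of_nat_diff field_simps)
      moreover have "0 \<le> (real n - 1) / real n" "(real n - 1) / real n \<le> 1" using n by auto
      then have "0 \<le> R * ((real n - 1) / real n)" "R * ((real n - 1) / real n) \<le> R"
        using R by (intro mult_nonneg_nonneg, simp_all only: less_imp_le) (rule mult_left_le, simp_all)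
      ultimately show "\<bar>g (n - 1)\<bar> \<le> R \<and> 0 \<le> g (n - 1)" "\<bar>g 0\<bar> \<le> R \<and> g 0 \<le> 0" by auto
    qed
    have "\<bar>x - g i\<bar> \<le> \<bar>x\<bar>" using g1 False unfolding i_def by (auto split: if_splits)
    then have "(x - g i)\<^sup>2 \<le> x\<^sup>2" by (simp add: abs_le_square_iff)
    then have "(x - g i)\<^sup>2 \<le> (R / real n)\<^sup>2 + x ^ (2 * Suc j) / R ^ (2 * j)"
      using x2 zero_le_power2[of "R / real n"] by linarith
    moreover have "i < n" using n by (simp add: i_def)
    ultimately show ?thesis by (auto simp: g_def)
  qed
qed

text \<open>The grid half-width R = n^(\<epsilon>/2) grows so slowly that (R/n)^2 =
  n^(-2+\<epsilon>), while the tail beyond R is controlled by a moment of sufficiently high order,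
  the same for all n.\<close>

lemma normal_quant_error_rate:
  assumes \<epsilon>: "0 < \<epsilon>"
  shows "\<exists>C>0. \<forall>n\<ge>1. normal_quant_error n \<le> ennreal (C * real n powr (- 2 + \<epsilon>))"
proof -
  \<comment> \<open>The tail term is of order R^(-2j) = n^(- \<epsilon> j), which this choice of j
    makes at most n^(-2).\<close>
  obtain j :: nat where j: "2 / \<epsilon> < real j" using reals_Archimedean2 by blast
  define m where "m = fact (2 * Suc j) / (2 ^ Suc j * fact (Suc j) :: real)"
  have m: "0 < m" by (simp add: m_def)
  show ?thesis
  proof (intro exI[of _ "1 + m"] conjI allI impI)
    fix n :: nat assume n: "1 \<le> n"
    define R where "R = real n powr (\<epsilon> / 2)"
    have R: "0 < R" using n by (simp add: R_def)
    define \<alpha> where "\<alpha> = (\<lambda>i. R * (2 * real i + 1 - real n) / real n) ` {..<n}"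
    have f\<alpha>: "finite \<alpha>" by (simp add: \<alpha>_def)
    have \<alpha>: "\<alpha> \<in> codebooks UNIV n"
      unfolding codebooks_def using n card_image_le[of "{..<n}"] by (auto simp: \<alpha>_def lessThan_empty_iff)
    have pt: "min_sq_dist \<alpha> x \<le> (R / real n)\<^sup>2 + (1 / R ^ (2 * j)) * x ^ (2 * Suc j)" for x
    proof -
      obtain i where i: "i < n" "(x - R * (2 * real i + 1 - real n) / real n)\<^sup>2 \<le> (R / real n)\<^sup>2 + x ^ (2 * Suc j) / R ^ (2 * j)"
        using grid_near[OF n R] by blast
      then show ?thesis using min_sq_dist_le[OF f\<alpha>, of "R * (2 * real i + 1 - real n) / real n" x]
        by (force simp: \<alpha>_def)
    qed
    have "normal_quant_error n \<le> normal_distortion \<alpha>" by (rule normal_quant_error_le[OF \<alpha>])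
    also have "\<dots> \<le> (\<integral>\<^sup>+x. ennreal ((R / real n)\<^sup>2) + ennreal (1 / R ^ (2 * j)) * ennreal (x ^ (2 * Suc j)) \<partial>std_normal_distribution)"
      unfolding normal_distortion_def
    proof (intro nn_integral_mono)
      fix x
      have "ennreal (min_sq_dist \<alpha> x) \<le> ennreal ((R / real n)\<^sup>2 + (1 / R ^ (2 * j)) * x ^ (2 * Suc j))"
        by (rule ennreal_leI[OF pt])
      also have "\<dots> = ennreal ((R / real n)\<^sup>2) + ennreal (1 / R ^ (2 * j)) * ennreal (x ^ (2 * Suc j))"
        using R zero_le_even_power[of "2 * Suc j" x]
        by (subst ennreal_plus) (auto simp: ennreal_mult[symmetric] simp del: power_Suc mult_Suc_right)
      finally show "ennreal (min_sq_dist \<alpha> x) \<le> ennreal ((R / real n)\<^sup>2) + ennreal (1 / R ^ (2 * j)) * ennreal (x ^ (2 * Suc j))" .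
    qed
    also have "\<dots> = ennreal ((R / real n)\<^sup>2) + ennreal (1 / R ^ (2 * j)) * ennreal m"
      using std_normal_nn_moment[of "Suc j"] prob_space.emeasure_space_1[OF std_normal_prob]
      by (subst nn_integral_add) (simp_all add: nn_integral_cmult m_def del: mult_Suc_right power_Suc fact_Suc)
    also have "\<dots> = ennreal ((R / real n)\<^sup>2 + (1 / R ^ (2 * j)) * m)"
      using R m by (subst ennreal_mult[symmetric]) auto
    also have "\<dots> \<le> ennreal ((1 + m) * real n powr (- 2 + \<epsilon>))"
    proof (rule ennreal_leI)
      have "(R / real n)\<^sup>2 = real n powr (- 2 + \<epsilon>)"
      proof -
        have "R\<^sup>2 = real n powr \<epsilon>" using n by (simp add: R_def power2_eq_square powr_add[symmetric])
        moreover have "real n powr (- 2 + \<epsilon>) = real n powr (- 2) * real n powr \<epsilon>" by (rule powr_add)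
        moreover have "real n powr (- 2) = 1 / (real n)\<^sup>2" using n by (simp add: powr_minus powr_numeral divide_inverse)
        ultimately show ?thesis by (simp add: power_divide)
      qed
      moreover have "1 / R ^ (2 * j) \<le> real n powr (- 2 + \<epsilon>)"
      proof -
        have "1 / R ^ (2 * j) = real n powr (- (\<epsilon> * real j))"
        proof -
          have "R ^ (2 * j) = R powr real (2 * j)" using R by (rule powr_realpow[symmetric])
          also have "\<dots> = real n powr (\<epsilon> * real j)" unfolding R_def powr_powr by simp
          finally show ?thesis by (simp add: powr_minus_divide)
        qed
        also have "\<dots> \<le> real n powr (- 2 + \<epsilon>)" using n j \<epsilon> by (intro powr_mono) (auto simp: field_simps)
        finally show ?thesis .
      qed
      ultimately show "(R / real n)\<^sup>2 + (1 / R ^ (2 * j)) * m \<le> (1 + m) * real n powr (- 2 + \<epsilon>)"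
        using m mult_right_mono[of "1 / R ^ (2 * j)" "real n powr (- 2 + \<epsilon>)" m] by (simp add: distrib_right mult.commute)
    qed
    finally show "normal_quant_error n \<le> ennreal ((1 + m) * real n powr (- 2 + \<epsilon>))" .
  qed (use m in auto)
qed

section \<open>Optimal quantizers of a standard Gaussian variable\<close>

definition quant_err :: "nat \<Rightarrow> real" where
  "quant_err n = enn2real (normal_quant_error n)"

lemma ennreal_quant_err: "1 \<le> n \<Longrightarrow> ennreal (quant_err n) = normal_quant_error n"
  unfolding quant_err_def using normal_quant_error_le_1[of n] by (intro ennreal_enn2real) (auto simp: less_top[symmetric] top_unique)

lemma quant_err_nonneg: "0 \<le> quant_err n" by (simp add: quant_err_def)

lemma quant_err_le_1: "1 \<le> n \<Longrightarrow> quant_err n \<le> 1"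
  using normal_quant_error_le_1[of n] ennreal_quant_err[of n] by (metis ennreal_1 ennreal_le_iff zero_le_one)

lemma quant_err_rate:
  assumes "0 < \<epsilon>"
  shows "\<exists>C>0. \<forall>n\<ge>1. quant_err n \<le> C * real n powr (- 2 + \<epsilon>)"
proof -
  obtain C where C: "C > 0" "\<And>n. 1 \<le> n \<Longrightarrow> normal_quant_error n \<le> ennreal (C * real n powr (- 2 + \<epsilon>))"
    using normal_quant_error_rate[OF assms] by blast
  have "quant_err n \<le> C * real n powr (- 2 + \<epsilon>)" if "1 \<le> n" for n
    using C(2)[OF that] C(1) ennreal_quant_err[OF that] by (metis ennreal_le_iff less_imp_le mult_nonneg_nonneg powr_ge_zero)
  then show ?thesis using C(1) by blast
qed

text \<open>Ties may be broken arbitrarily, but they occur only at midpoints of two code points.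
  Hence the preimage of a point is the open set where it is strictly nearest together with a subset
  of a finite set.\<close>

lemma nearest_projection_measurable:
  fixes \<pi> :: "real \<Rightarrow> real"
  assumes \<pi>: "nearest_neighbour_projection UNIV dist \<alpha> \<pi>" and \<alpha>: "finite \<alpha>"
  shows "\<pi> \<in> borel_measurable borel"
proof (rule borel_measurable_simple_function)
  have in\<alpha>: "\<pi> x \<in> \<alpha>" and near: "a \<in> \<alpha> \<Longrightarrow> \<bar>x - \<pi> x\<bar> \<le> \<bar>x - a\<bar>" for x a
    using \<pi> by (auto simp: nearest_neighbour_projection_def dist_real_def)
  define F where "F = (\<lambda>(b, c). (b + c) / 2) ` (\<alpha> \<times> \<alpha>)"
  have fF: "finite F" using \<alpha> by (simp add: F_def)
  show "simple_function borel \<pi>"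
    unfolding simple_function_def
  proof (intro conjI ballI)
    show "finite (\<pi> ` space borel)" by (rule finite_subset[OF _ \<alpha>]) (use in\<alpha> in auto)
    fix a
    define U where "U = (\<Inter>b\<in>\<alpha> - {a}. {x. \<bar>x - a\<bar> < \<bar>x - b\<bar>})"
    have oU: "open U" unfolding U_def using \<alpha> by (intro open_INT ballI open_Collect_less continuous_intros) auto
    have eq: "\<pi> -` {a} \<inter> space borel = (if a \<in> \<alpha> then U \<union> (\<pi> -` {a} \<inter> F) else {})"
    proof (cases "a \<in> \<alpha>")
      case True
      have "x \<in> U \<or> x \<in> F" if x: "\<pi> x = a" for x
      proof (rule disjCI)
        assume "x \<notin> F"
        have "\<bar>x - a\<bar> < \<bar>x - b\<bar>" if b: "b \<in> \<alpha> - {a}" for b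
        proof (rule ccontr)
          assume "\<not> ?thesis"
          then have "\<bar>x - a\<bar> = \<bar>x - b\<bar>" using near[of b x] b x by auto
          then have "x = (a + b) / 2" using b by (auto simp: abs_if split: if_splits)
          then have "x \<in> F" unfolding F_def using True b by (intro image_eqI[of _ _ "(a, b)"]) auto
          with \<open>x \<notin> F\<close> show False ..
        qed
        then show "x \<in> U" by (simp add: U_def)
      qed
      moreover have "\<pi> x = a" if "x \<in> U" for x
      proof (rule ccontr)
        assume "\<pi> x \<noteq> a"
        then have "\<bar>x - a\<bar> < \<bar>x - \<pi> x\<bar>" using that in\<alpha>[of x] by (auto simp: U_def)
        with near[OF True, of x] show False by simp
      qed
      ultimately show ?thesis using True by auto
    qed (use in\<alpha> in auto)
    have "\<pi> -` {a} \<inter> F \<in> sets borel" by (rule borel_closed[OF finite_imp_closed]) (use fF in auto)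
    then show "\<pi> -` {a} \<inter> space borel \<in> sets borel" unfolding eq using borel_open[OF oU] by (auto intro: sets.Un)
  qed
qed

lemma (in prob_space) gauss_nn_integral:
  assumes g: "gauss M \<xi> 1" and f: "f \<in> borel_measurable borel"
  shows "(\<integral>\<^sup>+\<omega>. f (\<xi> \<omega>) \<partial>M) = (\<integral>\<^sup>+x. f x \<partial>std_normal_distribution)"
  unfolding gauss_standard[OF g, symmetric] using gaussD(2)[OF g] f by (subst nn_integral_distr) auto

lemma (in prob_space) distortion_gauss:
  assumes g: "gauss M \<xi> 1" and \<alpha>: "finite \<alpha>" "\<alpha> \<noteq> {}"
  shows "distortion M dist \<xi> \<alpha> = normal_distortion \<alpha>"
  using gauss_nn_integral[OF g, of "\<lambda>x. ennreal (min_sq_dist \<alpha> x)"] \<alpha>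
  by (simp add: distortion_def normal_distortion_def min_sq_dist_def[symmetric])

text \<open>Optimality of a product quantization is a comparison with actual quantizations;
  existence is what turns arbitrary competing sizes into such competitors.\<close>

lemma (in prob_space) optimal_quantization_gauss_exists:
  assumes g: "gauss M \<xi> 1" and n: "1 \<le> n"
  shows "\<exists>\<xi>h. optimal_quantization M UNIV dist \<xi> n \<xi>h"
proof -
  obtain \<alpha> where \<alpha>: "\<alpha> \<in> codebooks UNIV n" "normal_distortion \<alpha> = normal_quant_error n"
    using optimal_codebook_exists[OF n] by blast
  note cb = codebooksD[OF \<alpha>(1)]
  define \<pi> where "\<pi> x = (SOME a. a \<in> \<alpha> \<and> (\<forall>b\<in>\<alpha>. dist x a \<le> dist x b))" for x :: real
  have "\<exists>a. a \<in> \<alpha> \<and> (\<forall>b\<in>\<alpha>. dist x a \<le> dist x b)" for x :: real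
    using arg_min_if_finite[OF cb(1,2), of "dist x"] by (intro exI[of _ "arg_min_on (dist x) \<alpha>"]) (auto simp: not_less)
  then have "\<pi> x \<in> \<alpha> \<and> (\<forall>b\<in>\<alpha>. dist x (\<pi> x) \<le> dist x b)" for x
    unfolding \<pi>_def by (rule someI_ex)
  then have nn: "nearest_neighbour_projection UNIV dist \<alpha> \<pi>" by (auto simp: nearest_neighbour_projection_def)
  have [measurable]: "\<pi> \<in> borel_measurable borel" by (rule nearest_projection_measurable[OF nn cb(1)])
  have [measurable]: "\<xi> \<in> borel_measurable M" using g by (rule gaussD)
  have "optimal_quantization M UNIV dist \<xi> n (\<lambda>\<omega>. \<pi> (\<xi> \<omega>))"
    unfolding optimal_quantization_def
  proof (intro bexI[OF _ \<alpha>(1)] conjI ballI exI[of _ \<pi>] nn refl)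
    fix \<beta> assume "\<beta> \<in> codebooks (UNIV :: real set) n"
    then show "distortion M dist \<xi> \<alpha> \<le> distortion M dist \<xi> \<beta>"
      using cb codebooksD[of \<beta>] \<alpha>(2) normal_quant_error_le[of \<beta> n] by (simp add: distortion_gauss[OF g])
  qed measurable
  then show ?thesis by blast
qed

text \<open>That the error is a function of \<xi> alone transfers independence from the coefficients
  to the errors. The growth bound is uniform in n: some code point lies in [-4, 4], and the nearest
  one is no farther from x. The error is centered, since translating the codebook by the mean m of
  the error would lower the distortion by m^2.\<close>

lemma (in prob_space) optimal_quantization_gauss:
  assumes g: "gauss M \<xi> 1" and n: "1 \<le> n" and opt: "optimal_quantization M UNIV dist \<xi> n \<xi>h"
  shows "\<exists>g. g \<in> borel_measurable borel \<and> (\<forall>\<omega>\<in>space M. \<xi> \<omega> - \<xi>h \<omega> = g (\<xi> \<omega>)) \<and> (\<forall>x. \<bar>g x\<bar> \<le> \<bar>x\<bar> + 4) \<and>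
    (\<integral>\<omega>. g (\<xi> \<omega>) \<partial>M) = 0 \<and> (\<integral>\<omega>. (g (\<xi> \<omega>))\<^sup>2 \<partial>M) = quant_err n"
proof -
  obtain \<alpha> \<pi> where \<alpha>: "\<alpha> \<in> codebooks UNIV n"
    and min: "\<And>\<beta>. \<beta> \<in> codebooks UNIV n \<Longrightarrow> distortion M dist \<xi> \<alpha> \<le> distortion M dist \<xi> \<beta>"
    and \<pi>: "nearest_neighbour_projection UNIV dist \<alpha> \<pi>" "\<And>\<omega>. \<omega> \<in> space M \<Longrightarrow> \<xi>h \<omega> = \<pi> (\<xi> \<omega>)"
    using opt unfolding optimal_quantization_def by blast
  note cb = codebooksD[OF \<alpha>]
  have nd: "normal_distortion \<alpha> = normal_quant_error n"
    unfolding normal_quant_error_def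
  proof (rule antisym)
    show "normal_distortion \<alpha> \<le> (INF \<alpha>\<in>codebooks UNIV n. normal_distortion \<alpha>)"
    proof (rule INF_greatest)
      fix \<beta> assume \<beta>: "\<beta> \<in> codebooks (UNIV :: real set) n"
      then show "normal_distortion \<alpha> \<le> normal_distortion \<beta>"
        using min[OF \<beta>] cb codebooksD[OF \<beta>] by (simp add: distortion_gauss[OF g])
    qed
  qed (rule INF_lower[OF \<alpha>])
  have in\<alpha>: "\<pi> x \<in> \<alpha>" and near: "a \<in> \<alpha> \<Longrightarrow> \<bar>x - \<pi> x\<bar> \<le> \<bar>x - a\<bar>" for x a
    using \<pi> by (auto simp: nearest_neighbour_projection_def dist_real_def)
  have msd: "min_sq_dist \<alpha> x = (x - \<pi> x)\<^sup>2" for x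
    using min_sq_dist_le[OF cb(1) in\<alpha>] near cb
    by (intro antisym min_sq_dist_ge) (auto simp: abs_le_square_iff[symmetric])
  define h where "h x = x - \<pi> x" for x
  have [measurable]: "\<pi> \<in> borel_measurable borel" by (rule nearest_projection_measurable[OF \<pi>(1) cb(1)])
  have hm[measurable]: "h \<in> borel_measurable borel" unfolding h_def by measurable
  have \<xi>m[measurable]: "\<xi> \<in> borel_measurable M" using g by (rule gaussD)
  have "\<exists>a\<in>\<alpha>. \<bar>a\<bar> \<le> 4"
  proof (rule ccontr)
    assume "\<not> ?thesis"
    then have far: "\<And>a. a \<in> \<alpha> \<Longrightarrow> 4 < \<bar>a\<bar>" by auto
    \<comment> \<open>With all code points outside [-4, 4] the squared distance is at least (4 -
      |x|)^2 >= 16 - 8|x| >= 12 - 4x^2. The last bound has expectation 8, against an optimal error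
      of at most 1.\<close>
    have "12 - 4 * x\<^sup>2 \<le> min_sq_dist \<alpha> x" for x
    proof (cases "\<bar>x\<bar> \<le> 4")
      case True
      have "16 - 8 * \<bar>x\<bar> \<le> (4 - \<bar>x\<bar>)\<^sup>2" by (simp add: power2_diff)
      moreover have "(4 - \<bar>x\<bar>)\<^sup>2 \<le> min_sq_dist \<alpha> x"
      proof (rule min_sq_dist_ge[OF cb(1,2)])
        fix a assume "a \<in> \<alpha>"
        then have "\<bar>4 - \<bar>x\<bar>\<bar> \<le> \<bar>x - a\<bar>" using far[of a] True by linarith
        then show "(4 - \<bar>x\<bar>)\<^sup>2 \<le> (x - a)\<^sup>2" by (simp add: abs_le_square_iff)
      qed
      moreover have "2 * \<bar>x\<bar> \<le> 1 + x\<^sup>2" using sum_squares_bound[of 1 "\<bar>x\<bar>"] by simp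
      ultimately show ?thesis by linarith
    next
      case False
      then have "4\<^sup>2 \<le> \<bar>x\<bar>\<^sup>2" by (intro power_mono) auto
      then show ?thesis using min_sq_dist_nonneg[OF cb(1,2), of x] by simp
    qed
    then have ge: "12 \<le> min_sq_dist \<alpha> x + 4 * x ^ (2 * 1)" for x by (simp add: algebra_simps power2_eq_square)
    have "ennreal 12 \<le> ennreal (min_sq_dist \<alpha> x) + ennreal 4 * ennreal (x ^ (2 * 1))" for x
    proof -
      have "ennreal 12 \<le> ennreal (min_sq_dist \<alpha> x + 4 * x ^ (2 * 1))" by (rule ennreal_leI[OF ge])
      also have "\<dots> = ennreal (min_sq_dist \<alpha> x) + ennreal (4 * x ^ (2 * 1))"
        using min_sq_dist_nonneg[OF cb(1,2), of x] by (intro ennreal_plus) auto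
      also have "ennreal (4 * x ^ (2 * 1)) = ennreal 4 * ennreal (x ^ (2 * 1))" by (rule ennreal_mult) auto
      finally show ?thesis .
    qed
    then have "(\<integral>\<^sup>+x. ennreal 12 \<partial>std_normal_distribution) \<le> (\<integral>\<^sup>+x. ennreal (min_sq_dist \<alpha> x) + ennreal 4 * ennreal (x ^ (2 * 1)) \<partial>std_normal_distribution)"
      by (intro nn_integral_mono) auto
    also have "\<dots> = normal_distortion \<alpha> + ennreal 4 * ennreal 1"
      using std_normal_nn_moment[of 1] cb by (subst nn_integral_add) (auto simp: nn_integral_cmult normal_distortion_def)
    also have "\<dots> \<le> 1 + ennreal 4 * ennreal 1"
      unfolding nd by (intro add_mono normal_quant_error_le_1 n) auto
    also have "\<dots> = ennreal 5" by simp
    finally show False using prob_space.emeasure_space_1[OF std_normal_prob] by simp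
  qed
  then obtain a0 where a0: "a0 \<in> \<alpha>" "\<bar>a0\<bar> \<le> 4" by blast
  have hb: "\<bar>h x\<bar> \<le> \<bar>x\<bar> + 4" for x using near[OF a0(1), of x] a0(2) unfolding h_def by linarith
  have iY2: "integrable M (\<lambda>\<omega>. (h (\<xi> \<omega>))\<^sup>2)"
  proof (rule Bochner_Integration.integrable_bound)
    show "integrable M (\<lambda>\<omega>. 2 * (\<xi> \<omega>)\<^sup>2 + 32)" using gauss_moments(1)[OF g, of 2] by auto
    have "(h x)\<^sup>2 \<le> 2 * x\<^sup>2 + 32" for x
    proof -
      have "(h x)\<^sup>2 \<le> (\<bar>x\<bar> + 4)\<^sup>2" using power_mono[OF hb abs_ge_zero, of x 2] by simp
      moreover have "8 * \<bar>x\<bar> \<le> x\<^sup>2 + 16" using sum_squares_bound[of 4 "\<bar>x\<bar>"] by simp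
      ultimately show ?thesis by (simp add: power2_sum)
    qed
    then show "AE \<omega> in M. norm ((h (\<xi> \<omega>))\<^sup>2) \<le> norm (2 * (\<xi> \<omega>)\<^sup>2 + 32)" by auto
  qed measurable
  have iY: "integrable M (\<lambda>\<omega>. h (\<xi> \<omega>))"
  proof (rule Bochner_Integration.integrable_bound)
    show "integrable M (\<lambda>\<omega>. 1 + (h (\<xi> \<omega>))\<^sup>2)" using iY2 by auto
    have "\<bar>y\<bar> \<le> 1 + y\<^sup>2" for y :: real using sum_squares_bound[of 1 "\<bar>y\<bar>"] by simp
    then show "AE \<omega> in M. norm (h (\<xi> \<omega>)) \<le> norm (1 + (h (\<xi> \<omega>))\<^sup>2)" by auto
  qed measurable
  have E: "ennreal (\<integral>\<omega>. (h (\<xi> \<omega>))\<^sup>2 \<partial>M) = normal_quant_error n"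
  proof -
    have "ennreal (\<integral>\<omega>. (h (\<xi> \<omega>))\<^sup>2 \<partial>M) = (\<integral>\<^sup>+\<omega>. ennreal ((h (\<xi> \<omega>))\<^sup>2) \<partial>M)"
      using iY2 by (subst nn_integral_eq_integral) auto
    also have "\<dots> = normal_distortion \<alpha>"
      unfolding normal_distortion_def msd h_def[symmetric]
      by (rule gauss_nn_integral[OF g, of "\<lambda>x. ennreal ((h x)\<^sup>2)"]) measurable
    finally show ?thesis by (simp add: nd)
  qed
  define D where "D = (\<integral>\<omega>. (h (\<xi> \<omega>))\<^sup>2 \<partial>M)"
  define m where "m = (\<integral>\<omega>. h (\<xi> \<omega>) \<partial>M)"
  have "D \<le> D - m\<^sup>2"
  proof -
    \<comment> \<open>The translated codebook is admissible and is evaluated with the old assignment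
      \<pi> shifted by m, which need not be nearest and so only overestimates its
      distortion.\<close>
    define \<beta> where "\<beta> = (\<lambda>a. a + m) ` \<alpha>"
    have \<beta>: "\<beta> \<in> codebooks UNIV n"
      using \<alpha> card_image_le[OF cb(1), of "\<lambda>a. a + m"] by (auto simp: codebooks_def \<beta>_def)
    have eq: "(h x - m)\<^sup>2 = (h x)\<^sup>2 - 2 * m * h x + m\<^sup>2" for x by (simp add: power2_diff algebra_simps)
    have i: "integrable M (\<lambda>\<omega>. (h (\<xi> \<omega>) - m)\<^sup>2)" unfolding eq using iY iY2 by auto
    have "ennreal D \<le> normal_distortion \<beta>" using E normal_quant_error_le[OF \<beta>] by (simp add: D_def)
    also have "\<dots> \<le> (\<integral>\<^sup>+x. ennreal ((h x - m)\<^sup>2) \<partial>std_normal_distribution)"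
      unfolding normal_distortion_def
    proof (intro nn_integral_mono ennreal_leI)
      fix x
      have "min_sq_dist \<beta> x \<le> (x - (\<pi> x + m))\<^sup>2" using cb(1) in\<alpha> by (intro min_sq_dist_le) (auto simp: \<beta>_def)
      then show "min_sq_dist \<beta> x \<le> (h x - m)\<^sup>2" by (simp add: h_def algebra_simps)
    qed
    also have "\<dots> = (\<integral>\<^sup>+\<omega>. ennreal ((h (\<xi> \<omega>) - m)\<^sup>2) \<partial>M)"
      by (rule gauss_nn_integral[OF g, symmetric]) measurable
    also have "\<dots> = ennreal (\<integral>\<omega>. (h (\<xi> \<omega>) - m)\<^sup>2 \<partial>M)" using i by (subst nn_integral_eq_integral) auto
    finally have "D \<le> (\<integral>\<omega>. (h (\<xi> \<omega>) - m)\<^sup>2 \<partial>M)" by (subst (asm) ennreal_le_iff) auto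
    also have "\<dots> = D - 2 * m * m + m\<^sup>2" unfolding eq using iY iY2 by (simp add: D_def m_def prob_space)
    finally show ?thesis by (simp add: power2_eq_square)
  qed
  then have m: "m = 0" using zero_le_power2[of m] by simp
  have "ennreal D = ennreal (quant_err n)" using E ennreal_quant_err[OF n] by (simp add: D_def)
  then have "D = quant_err n" using quant_err_nonneg[of n] by (subst (asm) ennreal_inj) (auto simp: D_def)
  then show ?thesis using hb m \<pi>(2) by (intro exI[of _ h]) (auto simp: m_def D_def h_def hm[unfolded h_def])
qed

text \<open>A coordinate left out of a product quantization contributes its whole variance 1. The
  exact value at level one makes this the same as quantizing it at level one, so allocations of
  different lengths become comparable.\<close>

lemma quant_err_1: "quant_err 1 = 1"
proof -
  interpret prob_space std_normal_distribution by (rule std_normal_prob)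
  \<comment> \<open>The identity on the normal law itself serves as the Gaussian variable, so the
    lemmas on \<open>gauss\<close> supply its moments.\<close>
  have g: "gauss std_normal_distribution (\<lambda>x. x) 1"
    unfolding gauss_def using char_std_normal_distribution unfolding char_def fun_eq_iff by auto
  obtain \<alpha> where \<alpha>: "\<alpha> \<in> codebooks UNIV 1" "normal_distortion \<alpha> = normal_quant_error 1"
    using optimal_codebook_exists[of 1] by blast
  have "0 < card \<alpha>" using codebooksD[OF \<alpha>(1)] by (simp add: card_gt_0_iff)
  then have "card \<alpha> = 1" using codebooksD(3)[OF \<alpha>(1)] by linarith
  then obtain a where a: "\<alpha> = {a}" by (rule card_1_singletonE)
  have m: "expectation (\<lambda>x. x) = 0" "expectation (\<lambda>x. x\<^sup>2) = 1" "integrable std_normal_distribution (\<lambda>x. x)" "integrable std_normal_distribution (\<lambda>x. x\<^sup>2)"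
    using gauss_moments(1)[OF g, of 1] gauss_moments(2)[OF g, of 1] gauss_moments(3)[OF g] gauss_moments(1)[OF g, of 2]
    by simp_all
  have eq: "(x - a)\<^sup>2 = x\<^sup>2 - 2 * a * x + a\<^sup>2" for x by (simp add: power2_diff algebra_simps)
  have i: "integrable std_normal_distribution (\<lambda>x. (x - a)\<^sup>2)" unfolding eq using m by auto
  have "normal_quant_error 1 = ennreal (expectation (\<lambda>x. (x - a)\<^sup>2))"
    unfolding \<alpha>(2)[symmetric] a normal_distortion_def using i
    by (subst nn_integral_eq_integral[symmetric]) (auto simp: min_sq_dist_def dist_real_def)
  also have "expectation (\<lambda>x. (x - a)\<^sup>2) = 1 + a\<^sup>2" unfolding eq using m prob_space by simp
  finally have "normal_quant_error 1 = ennreal (1 + a\<^sup>2)" .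
  then have "quant_err 1 = 1 + a\<^sup>2" unfolding quant_err_def by (simp only: enn2real_ennreal add_nonneg_nonneg zero_le_one zero_le_power2)
  then show ?thesis using quant_err_le_1[of 1] zero_le_power2[of a] by linarith
qed

subsection \<open>Higher moments of quantization errors\<close>

text \<open>Below \<tau> all but two powers of |y| are replaced by \<tau>; above \<tau> one has V >=
  |y| > \<tau>, so a factor (V / \<tau>)^(2i) >= 1 can be inserted. It interpolates between a small
  second moment and a bounded high one.\<close>

lemma even_power_split:
  fixes y V \<tau> :: real
  assumes "\<bar>y\<bar> \<le> V" "0 < \<tau>" "1 \<le> j"
  shows "y ^ (2 * j) \<le> \<tau> ^ (2 * j - 2) * y\<^sup>2 + (1 / \<tau>) ^ (2 * i) * V ^ (2 * j + 2 * i)"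
proof (cases "\<bar>y\<bar> \<le> \<tau>")
  case True
  obtain k where k: "j = Suc k" using assms(3) by (cases j) auto
  have "y ^ (2 * j) = \<bar>y\<bar> ^ (2 * k) * y\<^sup>2" by (simp add: k power_even_abs power2_eq_square)
  also have "\<dots> \<le> \<tau> ^ (2 * k) * y\<^sup>2" using True by (intro mult_right_mono power_mono) auto
  moreover have "0 \<le> (1 / \<tau>) ^ (2 * i) * V ^ (2 * j + 2 * i)" using assms by (intro mult_nonneg_nonneg zero_le_power) auto
  ultimately show ?thesis by (simp add: k)
next
  case False
  have "y ^ (2 * j) = \<bar>y\<bar> ^ (2 * j)" by (simp add: power_even_abs)
  also have "\<dots> \<le> 1 * V ^ (2 * j)" using assms power_mono[of "\<bar>y\<bar>" V "2 * j"] by simp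
  also have "\<dots> \<le> ((1 / \<tau>) * V) ^ (2 * i) * V ^ (2 * j)"
    using assms False by (intro mult_right_mono one_le_power zero_le_power) (auto simp: field_simps)
  also have "\<dots> = (1 / \<tau>) ^ (2 * i) * V ^ (2 * j + 2 * i)"
    unfolding power_mult_distrib power_add by (simp only: mult_ac)
  finally show ?thesis using assms by (smt (verit) mult_nonneg_nonneg zero_le_power zero_le_power2)
qed

lemma (in prob_space) linear_growth_integrable:
  assumes g: "gauss M \<xi> 1" and h: "h \<in> borel_measurable borel" "\<And>x. \<bar>h x\<bar> \<le> \<bar>x\<bar> + 4"
  shows "integrable M (\<lambda>\<omega>. h (\<xi> \<omega>) ^ k)" "integrable M (\<lambda>\<omega>. (\<bar>\<xi> \<omega>\<bar> + 4) ^ k)"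
proof -
  have \<xi>m[measurable]: "\<xi> \<in> borel_measurable M" using g by (rule gaussD)
  note h(1)[measurable]
  have "integrable M (\<lambda>\<omega>. \<bar>\<xi> \<omega>\<bar> ^ i)" for i
    using integrable_norm[OF gauss_moments(1)[OF g, of i]] by (simp add: power_abs)
  then show i: "integrable M (\<lambda>\<omega>. (\<bar>\<xi> \<omega>\<bar> + 4) ^ k)"
    unfolding binomial_ring by (intro Bochner_Integration.integrable_sum integrable_mult_left integrable_mult_right)
  show "integrable M (\<lambda>\<omega>. h (\<xi> \<omega>) ^ k)"
    by (rule Bochner_Integration.integrable_bound[OF i]) (use h(2) in \<open>auto simp: power_abs intro!: power_mono AE_I2\<close>)
qed

text \<open>For \<delta> < 1, \<open>even_power_split\<close> with \<tau> = \<delta>^(-\<eta>) gives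
  a term of order \<delta>^(1 - \<eta>(2j - 2)) from the second moment and one of order \<delta>^(2
  i \<eta>) from a high moment of |\<xi>| + 4. Both exponents can be made at least u j precisely
  because u l < 1 leaves room for a positive \<eta>. For \<delta> >= 1 the moments of |\<xi>| + 4
  suffice.\<close>

lemma (in prob_space) linear_growth_moment:
  fixes l :: nat and u :: real
  assumes l: "1 \<le> l" and u: "0 < u" "u * real l < 1"
  shows "\<exists>C>0. \<forall>\<xi> h \<delta> j. gauss M \<xi> 1 \<longrightarrow> h \<in> borel_measurable borel \<longrightarrow> (\<forall>x. \<bar>h x\<bar> \<le> \<bar>x\<bar> + 4) \<longrightarrow> 0 < \<delta> \<longrightarrow>
     (\<integral>\<omega>. (h (\<xi> \<omega>))\<^sup>2 \<partial>M) \<le> \<delta> \<longrightarrow> 1 \<le> j \<longrightarrow> j \<le> l \<longrightarrow>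
     (\<integral>\<omega>. h (\<xi> \<omega>) ^ (2 * j) \<partial>M) \<le> C * \<delta> powr (u * real j)"
proof -
  \<comment> \<open>Here 2 l \<eta> = 1 - u l is exactly the room available to the first exponent; i
    is then taken so large that 2 i \<eta> >= 1.\<close>
  define \<eta> where "\<eta> = (1 - u * real l) / (2 * real l)"
  have \<eta>: "0 < \<eta>" using u l by (simp add: \<eta>_def)
  obtain i :: nat where i: "1 / (2 * \<eta>) < real i" using reals_Archimedean2 by blast
  define c where "c k = (\<integral>x. (\<bar>x\<bar> + 4) ^ k \<partial>std_normal_distribution)" for k
  have c0: "0 \<le> c k" for k unfolding c_def by (intro integral_nonneg_AE) auto
  define C where "C = 1 + (\<Sum>k\<le>2 * l + 2 * i. c k)"
  have cC: "c k \<le> C - 1" if "k \<le> 2 * l + 2 * i" for k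
    unfolding C_def using member_le_sum[of k "{..2 * l + 2 * i}" c] c0 that by simp
  have C: "1 \<le> C" unfolding C_def using c0 by (simp add: sum_nonneg)
  show ?thesis
  proof (intro exI[of _ C] conjI allI impI)
    fix \<xi> h \<delta> j
    assume g: "gauss M \<xi> 1" and h: "h \<in> borel_measurable borel" "\<forall>x. \<bar>h x\<bar> \<le> \<bar>x\<bar> + 4" and \<delta>: "0 < \<delta>"
      and D: "(\<integral>\<omega>. (h (\<xi> \<omega>))\<^sup>2 \<partial>M) \<le> \<delta>" and j: "1 \<le> j" "j \<le> l"
    note int = linear_growth_integrable[OF g h(1) h(2)[rule_format]]
    have \<xi>m[measurable]: "\<xi> \<in> borel_measurable M" using g by (rule gaussD)
    have ck: "(\<integral>\<omega>. (\<bar>\<xi> \<omega>\<bar> + 4) ^ k \<partial>M) = c k" for k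
      unfolding c_def gauss_standard[OF g, symmetric] by (subst integral_distr) auto
    show "(\<integral>\<omega>. h (\<xi> \<omega>) ^ (2 * j) \<partial>M) \<le> C * \<delta> powr (u * real j)"
    proof (cases "1 \<le> \<delta>")
      case True
      have "(\<integral>\<omega>. h (\<xi> \<omega>) ^ (2 * j) \<partial>M) \<le> (\<integral>\<omega>. (\<bar>\<xi> \<omega>\<bar> + 4) ^ (2 * j) \<partial>M)"
      proof (rule integral_mono[OF int(1) int(2)])
        fix \<omega>
        show "h (\<xi> \<omega>) ^ (2 * j) \<le> (\<bar>\<xi> \<omega>\<bar> + 4) ^ (2 * j)"
          using power_mono[OF h(2)[rule_format, of "\<xi> \<omega>"] abs_ge_zero, of "2 * j"] by (simp add: power_even_abs)
      qed
      also have "\<dots> \<le> C * 1" unfolding ck using cC[of "2 * j"] j by simp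
      also have "\<dots> \<le> C * \<delta> powr (u * real j)" using C True u by (intro mult_left_mono ge_one_powr_ge_zero) auto
      finally show ?thesis .
    next
      case False
      define \<tau> where "\<tau> = \<delta> powr (- \<eta>)"
      have \<tau>: "0 < \<tau>" using \<delta> by (simp add: \<tau>_def)
      have "(\<integral>\<omega>. h (\<xi> \<omega>) ^ (2 * j) \<partial>M)
         \<le> (\<integral>\<omega>. \<tau> ^ (2 * j - 2) * (h (\<xi> \<omega>))\<^sup>2 + (1 / \<tau>) ^ (2 * i) * (\<bar>\<xi> \<omega>\<bar> + 4) ^ (2 * j + 2 * i) \<partial>M)"
        using int h(2) \<tau> j by (intro integral_mono even_power_split) auto
      also have "\<dots> = \<tau> ^ (2 * j - 2) * (\<integral>\<omega>. (h (\<xi> \<omega>))\<^sup>2 \<partial>M) + (1 / \<tau>) ^ (2 * i) * c (2 * j + 2 * i)"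
        using int by (subst Bochner_Integration.integral_add) (auto simp: ck)
      also have "\<dots> \<le> \<delta> powr (u * real j) * 1 + \<delta> powr (u * real j) * (C - 1)"
      proof (rule add_mono)
        have e: "(1 / \<tau>) ^ (2 * i) = \<delta> powr (2 * real i * \<eta>)"
        proof -
          have "(1 / \<tau>) = \<delta> powr \<eta>" by (simp add: \<tau>_def powr_minus divide_inverse)
          then show ?thesis using \<delta> by (simp add: powr_realpow[symmetric] powr_powr mult_ac)
        qed
        have uj: "u * real j \<le> u * real l" using u j by simp
        have "1 \<le> 2 * real i * \<eta>" using i \<eta> by (simp add: field_simps)
        then have "u * real j \<le> 2 * real i * \<eta>" using uj u(2) by linarith
        then have "(1 / \<tau>) ^ (2 * i) \<le> \<delta> powr (u * real j)" unfolding e by (rule powr_mono') (use \<delta> False in auto)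
        then show "(1 / \<tau>) ^ (2 * i) * c (2 * j + 2 * i) \<le> \<delta> powr (u * real j) * (C - 1)"
          using cC[of "2 * j + 2 * i"] j c0 by (intro mult_mono) auto
        have "\<tau> ^ (2 * j - 2) * (\<integral>\<omega>. (h (\<xi> \<omega>))\<^sup>2 \<partial>M) \<le> \<tau> ^ (2 * j - 2) * \<delta>" using D \<tau> by (intro mult_left_mono) auto
        also have "\<tau> ^ (2 * j - 2) * \<delta> = \<delta> powr (- (\<eta> * (2 * real j - 2))) * \<delta>"
          using \<delta> j by (simp add: \<tau>_def powr_realpow[symmetric] powr_powr of_nat_diff)
        also have "\<dots> = \<delta> powr (1 - \<eta> * (2 * real j - 2))"
          using \<delta> powr_add[of \<delta> "- (\<eta> * (2 * real j - 2))" 1] by (simp only: powr_one less_imp_le) (simp add: add.commute)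
        also have "\<dots> \<le> \<delta> powr (u * real j)"
        proof (rule powr_mono')
          have "\<eta> * (2 * real j - 2) \<le> \<eta> * (2 * real l)" using \<eta> j by (intro mult_left_mono) auto
          also have "\<dots> = 1 - u * real l" using l by (simp add: \<eta>_def)
          finally show "u * real j \<le> 1 - \<eta> * (2 * real j - 2)" using uj by linarith
        qed (use \<delta> False in auto)
        finally show "\<tau> ^ (2 * j - 2) * (\<integral>\<omega>. (h (\<xi> \<omega>))\<^sup>2 \<partial>M) \<le> \<delta> powr (u * real j) * 1" by simp
      qed
      finally show ?thesis by (simp add: algebra_simps)
    qed
  qed (use C in auto)
qed

subsection \<open>Optimal allocation of levels\<close>

lemma powr_minus_2: "0 < y \<Longrightarrow> y powr (- 2) = 1 / y\<^sup>2" for y :: real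
  by (simp add: powr_minus powr_numeral divide_inverse)

text \<open>While j <= y the product is y^K / K!, a single term of the exponential series; factors
  with j > y equal 1. The induction carries the closed form for K <= y along with the bound.\<close>

lemma prod_max_le_exp:
  fixes y :: real
  assumes y: "0 \<le> y"
  shows "(\<Prod>j=1..K. max 1 (y / real j)) \<le> exp y"
proof -
  have e: "y ^ n / fact n \<le> exp y" for n
  proof -
    have "(\<Sum>i\<in>{n}. y ^ i /\<^sub>R fact i) \<le> (\<Sum>i. y ^ i /\<^sub>R fact i)"
      using y summable_exp_generic[of y] by (intro sum_le_suminf) auto
    then show ?thesis by (simp add: exp_def divide_inverse mult.commute)
  qed
  have "(real K \<le> y \<longrightarrow> (\<Prod>j=1..K. max 1 (y / real j)) = y ^ K / fact K) \<and> (\<Prod>j=1..K. max 1 (y / real j)) \<le> exp y"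
  proof (induction K)
    case 0
    then show ?case using y by simp
  next
    case (Suc K)
    have rec: "(\<Prod>j=1..Suc K. max 1 (y / real j)) = (\<Prod>j=1..K. max 1 (y / real j)) * max 1 (y / real (Suc K))" by simp
    show ?case
    proof (cases "real (Suc K) \<le> y")
      case True
      then have m: "max 1 (y / real (Suc K)) = y / real (Suc K)" by (simp add: max_def)
      have "(\<Prod>j=1..K. max 1 (y / real j)) = y ^ K / fact K" using Suc True by simp
      then have "(\<Prod>j=1..Suc K. max 1 (y / real j)) = y ^ K / fact K * (y / real (Suc K))" by (simp only: rec m)
      also have "\<dots> = y ^ Suc K / fact (Suc K)" by (simp add: mult_ac)
      finally have pe: "(\<Prod>j=1..Suc K. max 1 (y / real j)) = y ^ Suc K / fact (Suc K)" .
      show ?thesis unfolding pe using e[of "Suc K"] by blast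
    next
      case False
      then have m: "max 1 (y / real (Suc K)) = 1" by (simp add: max_def)
      show ?thesis unfolding rec m using Suc False by simp
    qed
  qed
  then show ?thesis ..
qed

lemma kl_lambda_ratio:
  assumes T: "0 < T" and jk: "1 \<le> j" "1 \<le> k"
  shows "kl_lambda T j / kl_lambda T k \<le> 4 * (real k)\<^sup>2 / (real j)\<^sup>2"
proof -
  have "kl_lambda T j / kl_lambda T k = ((real k - 1 / 2) / (real j - 1 / 2))\<^sup>2"
    using T jk by (simp add: kl_lambda_def power_divide power_mult_distrib)
  also have "\<dots> \<le> (real k / (real j / 2))\<^sup>2"
    using jk by (intro power_mono frac_le divide_nonneg_nonneg) auto
  also have "\<dots> = 4 * (real k)\<^sup>2 / (real j)\<^sup>2" by (simp add: power_divide)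
  finally show ?thesis .
qed

lemma kl_lambda_pos: "0 < T \<Longrightarrow> 1 \<le> k \<Longrightarrow> 0 < kl_lambda T k"
  unfolding kl_lambda_def by (intro zero_less_power divide_pos_pos mult_pos_pos) (auto simp: field_simps)

text \<open>If \<open>e (n k)\<close> were large, one could afford to multiply \<open>n k\<close> by \<open>B \<approx> ln m\<close>: unless the budget
  \<open>m\<close> already leaves room for that, the factor \<open>B\<close> can be taken from indices \<open>j\<close> with \<open>j n\<^sub>j\<close> at least
  of order \<open>ln m\<close>, each of which contributes only \<open>O((ln m)\<^sup>-\<^sup>2)\<close>.\<close>

lemma optimal_allocation_bound:
  fixes e :: "nat \<Rightarrow> real" and \<epsilon> T :: real
  assumes T: "0 < T" and e0: "\<And>n. 0 \<le> e n"
    and rate: "\<And>\<epsilon>. 0 < \<epsilon> \<Longrightarrow> \<exists>C>0. \<forall>n\<ge>1. e n \<le> C * real n powr (- 2 + \<epsilon>)" and \<epsilon>: "0 < \<epsilon>"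
  shows "\<exists>C>0. \<exists>m0. \<forall>m\<ge>m0. \<forall>n L. (\<forall>k. 1 \<le> n k) \<longrightarrow> (\<forall>k>L. n k = 1) \<longrightarrow> (\<Prod>k=1..L. n k) \<le> m \<longrightarrow>
     (\<forall>K n'. L \<le> K \<longrightarrow> (\<forall>k. 1 \<le> n' k) \<longrightarrow> (\<Prod>k=1..K. n' k) \<le> m \<longrightarrow>
        (\<Sum>k=1..K. kl_lambda T k * e (n k)) \<le> (\<Sum>k=1..K. kl_lambda T k * e (n' k))) \<longrightarrow>
     (\<forall>k\<ge>1. e (n k) \<le> C * (real k)\<^sup>2 * ln (real m) powr (- 2 + \<epsilon>))"
proof -
  \<comment> \<open>The exponent -2 is worsened by at most 3 \<eta>: by 2 \<eta> through the rate of
    e at levels up to the order of (ln m)^2, and by \<eta> through summing over about log ln m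
    indices. The cap 1 keeps \<open>- 2 + \<eta>\<close> negative and 4^\<eta> at most 4.\<close>
  define \<eta> where "\<eta> = min 1 (\<epsilon> / 3)"
  have \<eta>: "0 < \<eta>" "\<eta> \<le> 1" "3 * \<eta> \<le> \<epsilon>" using \<epsilon> by (auto simp: \<eta>_def)
  obtain C0 where C0: "0 < C0" and e_le: "\<And>n. 1 \<le> n \<Longrightarrow> e n \<le> C0 * real n powr (- 2 + \<eta>)"
    using rate[OF \<eta>(1)] by blast
  \<comment> \<open>With x = ln m, a <= log 2 x + 1 and B <= 2x, this condition amounts to B^(2a+1)
    <= e^(x/2), which rules out the case of few large levels. The next one absorbs the number a of
    halved levels into x^\<eta>.\<close>
  have "\<forall>\<^sub>F x::real in at_top. exp ((2 * (log 2 x + 1) + 1) * ln (2 * x)) \<le> exp (x / 2)" by real_asymp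
  moreover have "\<forall>\<^sub>F x::real in at_top. log 2 x + 1 \<le> x powr \<eta>" using \<eta>(1) by real_asymp
  ultimately have "\<forall>\<^sub>F x::real in at_top. 1 \<le> x \<and> exp ((2 * (log 2 x + 1) + 1) * ln (2 * x)) \<le> exp (x / 2) \<and> log 2 x + 1 \<le> x powr \<eta>"
    using eventually_ge_at_top[of 1] by eventually_elim auto
  then have "\<forall>\<^sub>F m in sequentially. 1 \<le> ln (real m) \<and> exp ((2 * (log 2 (ln (real m)) + 1) + 1) * ln (2 * ln (real m))) \<le> exp (ln (real m) / 2)
      \<and> log 2 (ln (real m)) + 1 \<le> ln (real m) powr \<eta>"
    by (rule eventually_compose_filterlim) real_asymp
  then obtain m0 where m0: "\<And>m. m0 \<le> m \<Longrightarrow> 1 \<le> ln (real m) \<and> exp ((2 * (log 2 (ln (real m)) + 1) + 1) * ln (2 * ln (real m))) \<le> exp (ln (real m) / 2)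
      \<and> log 2 (ln (real m)) + 1 \<le> ln (real m) powr \<eta>"
    unfolding eventually_sequentially by blast
  define C where "C = 577 * C0"
  show ?thesis
  proof (intro exI[of _ C] conjI exI[of _ "max 1 m0"] allI impI)
    show "0 < C" using C0 by (simp add: C_def)
    fix m n L k
    assume m: "max 1 m0 \<le> m" and n1: "\<forall>k. 1 \<le> n k" and nL: "\<forall>k>L. n k = 1" and nm: "(\<Prod>k=1..L. n k) \<le> m"
      and opt: "\<forall>K n'. L \<le> K \<longrightarrow> (\<forall>k. 1 \<le> n' k) \<longrightarrow> (\<Prod>k=1..K. n' k) \<le> m \<longrightarrow>
        (\<Sum>k=1..K. kl_lambda T k * e (n k)) \<le> (\<Sum>k=1..K. kl_lambda T k * e (n' k))" and k: "1 \<le> (k::nat)"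
    define x where "x = ln (real m)"
    have x: "1 \<le> x" "exp ((2 * (log 2 x + 1) + 1) * ln (2 * x)) \<le> exp (x / 2)" "log 2 x + 1 \<le> x powr \<eta>"
      using m0[of m] m by (auto simp: x_def)
    have mx: "real m = exp x" using m by (simp add: x_def)
    have k2: "1 \<le> (real k)\<^sup>2" using k by simp
    define P where "P = x powr (- 2 + \<epsilon>)"
    have xP: "x powr s \<le> P" if "s \<le> - 2 + 3 * \<eta>" for s
      unfolding P_def using x that \<eta> by (intro powr_mono) auto
    have P: "0 < P" using x by (simp add: P_def)
    \<comment> \<open>B is a power of two between x and 2x, so the factor B can also be collected by
      halving a levels.\<close>
    define a where "a = nat \<lceil>log 2 x\<rceil>"
    define B where "B = (2::nat) ^ a"
    have lx: "0 \<le> log 2 x" using x by simp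
    have a: "log 2 x \<le> real a" "real a \<le> log 2 x + 1" using lx unfolding a_def by (auto simp: of_nat_nat)
    have B2: "real B = 2 powr real a" by (simp add: B_def powr_realpow)
    have "2 powr log 2 x = x" using x by simp
    then have Bx: "x \<le> real B" "real B \<le> 2 * x"
      using powr_mono[OF a(1), of 2] powr_mono[OF a(2), of 2] by (auto simp: B2 powr_add)
    have B1: "1 \<le> B" by (simp add: B_def)
    have eB: "e q \<le> C0 * P" if "B \<le> q" for q
    proof -
      have q: "x \<le> real q" "1 \<le> q" using that Bx B1 by linarith+
      have "e q \<le> C0 * real q powr (- 2 + \<eta>)" by (rule e_le[OF q(2)])
      also have "\<dots> \<le> C0 * x powr (- 2 + \<eta>)" using C0 q x \<eta> by (intro mult_left_mono powr_mono2') auto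
      also have "\<dots> \<le> C0 * P" using C0 \<eta> by (intro mult_left_mono xP) auto
      finally show ?thesis .
    qed
    define K where "K = max L k"
    have kK: "k \<in> {1..K}" using k by (simp add: K_def)
    have prodK: "(\<Prod>j=1..K. n j) \<le> m"
    proof -
      have "(\<Prod>j=1..K. n j) = (\<Prod>j=1..L. n j)"
        using nL by (intro prod.mono_neutral_right) (auto simp: K_def)
      then show ?thesis using nm by simp
    qed
    \<comment> \<open>Only k and J change. Optimality compares the weighted errors; the nonnegative
      old cost of J is dropped, and division by the eigenvalue at k leaves the ratios bounded by
      \<open>kl_lambda_ratio\<close>.\<close>
    have exch: "e (n k) \<le> e (n' k) + (\<Sum>j\<in>J. 4 * (real k)\<^sup>2 / (real j)\<^sup>2 * e (n' j))"
      if J: "J \<subseteq> {1..K} - {k}" and n': "\<And>j. 1 \<le> n' j" "\<And>j. j \<notin> insert k J \<Longrightarrow> n' j = n j" and m': "(\<Prod>j=1..K. n' j) \<le> m" for J n'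
    proof -
      have fJ: "finite J" using J by (rule finite_subset) auto
      let ?S = "\<lambda>n A. \<Sum>j\<in>A. kl_lambda T j * e (n j)"
      have lam: "0 \<le> kl_lambda T j" for j by (simp add: kl_lambda_def)
      have le: "?S n {1..K} \<le> ?S n' {1..K}" using opt n' m' by (auto simp: K_def)
      have split: "?S f {1..K} = kl_lambda T k * e (f k) + ?S f J + ?S f ({1..K} - insert k J)" for f
      proof -
        have "?S f {1..K} = ?S f (insert k J) + ?S f ({1..K} - insert k J)"
          using J kK by (intro sum.subset_diff[THEN trans[OF _ add.commute]]) auto
        also have "?S f (insert k J) = kl_lambda T k * e (f k) + ?S f J" using J fJ by (subst sum.insert) auto
        finally show ?thesis .
      qed
      have "?S n ({1..K} - insert k J) = ?S n' ({1..K} - insert k J)" using n' by (intro sum.cong) auto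
      moreover have "0 \<le> ?S n J" using lam e0 by (intro sum_nonneg mult_nonneg_nonneg) auto
      ultimately have "kl_lambda T k * e (n k) \<le> kl_lambda T k * e (n' k) + ?S n' J" using le unfolding split by linarith
      then have "e (n k) \<le> e (n' k) + (\<Sum>j\<in>J. kl_lambda T j / kl_lambda T k * e (n' j))"
        using kl_lambda_pos[OF T k] by (simp add: field_simps sum_divide_distrib[symmetric])
      also have "\<dots> \<le> e (n' k) + (\<Sum>j\<in>J. 4 * (real k)\<^sup>2 / (real j)\<^sup>2 * e (n' j))"
        using J by (intro add_left_mono sum_mono mult_right_mono kl_lambda_ratio[OF T] e0) (use J k in auto)
      finally show ?thesis .
    qed
    have C0P: "C0 * P \<le> (real k)\<^sup>2 * (C0 * P)" using mult_right_mono[OF k2, of "C0 * P"] C0 P by simp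
    have "e (n k) \<le> 577 * ((real k)\<^sup>2 * (C0 * P))"
    \<comment> \<open>If k n_k is at least x/2, the rate of e alone gives the bound with the factor
      k^2; an exchange is made only for smaller n_k.\<close>
    proof (cases "x / 2 \<le> real k * real (n k)")
      case True
      have "e (n k) \<le> C0 * real (n k) powr (- 2 + \<eta>)" using e_le n1 by blast
      also have "\<dots> \<le> C0 * (x / (2 * real k)) powr (- 2 + \<eta>)"
        using C0 True x k \<eta> by (intro mult_left_mono powr_mono2') (auto simp: field_simps)
      also have "(x / (2 * real k)) powr (- 2 + \<eta>) = (2 * real k) powr (2 - \<eta>) * x powr (- 2 + \<eta>)"
        using x k by (simp add: powr_divide powr_minus_divide[of _ "2 - \<eta>", simplified])
      also have "C0 * ((2 * real k) powr (2 - \<eta>) * x powr (- 2 + \<eta>)) \<le> C0 * ((2 * real k) powr 2 * P)"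
        using C0 k \<eta> P by (intro mult_left_mono mult_mono xP powr_mono) auto
      also have "(2 * real k) powr 2 = 4 * (real k)\<^sup>2" using k by (simp add: powr_numeral power_mult_distrib)
      finally have "e (n k) \<le> 4 * ((real k)\<^sup>2 * (C0 * P))" by (simp add: mult_ac)
      moreover have "0 \<le> (real k)\<^sup>2 * (C0 * P)" using C0 P by simp
      ultimately show ?thesis by linarith
    next
      case small: False
      define E where "E = {j \<in> {1..K}. 2 \<le> n j \<and> x / 2 \<le> real j * real (n j)}"
      have fE: "finite E" and kE: "k \<notin> E" and EK: "E \<subseteq> {1..K} - {k}" using small by (auto simp: E_def)
      have nk: "B * n k = (B * n k)" "B \<le> B * n k" using n1 by (auto simp: Suc_le_eq)
      have prod_upd: "(\<Prod>j=1..K. n' j) \<le> m"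
        if J: "J \<subseteq> {1..K} - {k}" and k': "n' k = B * n k" and o: "\<And>j. j \<notin> insert k J \<Longrightarrow> n' j = n j"
          and BJ: "B * (\<Prod>j\<in>J. n' j) \<le> (\<Prod>j\<in>J. n j)" for J n'
      proof -
        have fJ: "finite J" using J by (rule finite_subset) auto
        have sp: "(\<Prod>j=1..K. f j) = f k * (\<Prod>j\<in>J. f j) * (\<Prod>j\<in>{1..K} - insert k J. f j)" for f :: "nat \<Rightarrow> nat"
        proof -
          have "(\<Prod>j=1..K. f j) = (\<Prod>j\<in>insert k J. f j) * (\<Prod>j\<in>{1..K} - insert k J. f j)"
            using J kK by (intro prod.subset_diff[THEN trans[OF _ mult.commute]]) auto
          also have "(\<Prod>j\<in>insert k J. f j) = f k * (\<Prod>j\<in>J. f j)" using J fJ by (subst prod.insert) auto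
          finally show ?thesis .
        qed
        have r: "(\<Prod>j\<in>{1..K} - insert k J. n' j) = (\<Prod>j\<in>{1..K} - insert k J. n j)" using o by (intro prod.cong) auto
        have "(\<Prod>j=1..K. n' j) = n k * (B * (\<Prod>j\<in>J. n' j)) * (\<Prod>j\<in>{1..K} - insert k J. n j)"
          unfolding sp k' r by (simp add: mult_ac)
        also have "\<dots> \<le> n k * (\<Prod>j\<in>J. n j) * (\<Prod>j\<in>{1..K} - insert k J. n j)"
          using BJ by (intro mult_right_mono mult_left_mono) auto
        also have "\<dots> \<le> m" using prodK unfolding sp .
        finally show ?thesis .
      qed
      show ?thesis
      proof (cases "B * (\<Prod>j=1..K. n j) \<le> m")
        case True
        let ?n' = "n(k := B * n k)"
        have "(\<Prod>j=1..K. ?n' j) = B * (\<Prod>j=1..K. n j)"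
          using kK by (simp add: prod.remove[of _ k] mult_ac)
        then have "e (n k) \<le> e (?n' k) + (\<Sum>j\<in>{}. 4 * (real k)\<^sup>2 / (real j)\<^sup>2 * e (?n' j))"
          using True n1 B1 by (intro exch) (auto simp: Suc_le_eq)
        also have "\<dots> \<le> C0 * P" using eB[OF nk(2)] by simp
        moreover have "0 \<le> (real k)\<^sup>2 * (C0 * P)" using C0 P by simp
        ultimately show ?thesis using C0P by linarith
      next
        case full: False
        \<comment> \<open>Either one index can give up the whole factor B and still keep a level of
          at least B, or a indices can give up a factor 2 each, or there are so few large levels
          that the product is at most m / B, which contradicts \<open>full\<close>.\<close>
        consider (big) j where "j \<in> E" "B\<^sup>2 \<le> n j" | (many) "\<forall>j\<in>E. n j < B\<^sup>2" "a \<le> card E" | (few) "\<forall>j\<in>E. n j < B\<^sup>2" "card E < a"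
          using not_le by blast
        then show ?thesis
        proof cases
          case big
          let ?n' = "n(k := B * n k, j := n j div B)"
          have jk: "j \<noteq> k" using big kE by auto
          have divB: "B \<le> n j div B" using big B1 by (simp add: less_eq_div_iff_mult_less_eq power2_eq_square)
          have j1: "1 \<le> (real j)\<^sup>2" using big by (auto simp: E_def)
          have "e (n k) \<le> e (?n' k) + (\<Sum>i\<in>{j}. 4 * (real k)\<^sup>2 / (real i)\<^sup>2 * e (?n' i))"
            using big EK jk n1 B1 divB
            by (intro exch prod_upd[where J="{j}"]) (auto simp: Suc_le_eq intro: less_le_trans[of 0 B])
          also have "\<dots> \<le> C0 * P + 4 * (real k)\<^sup>2 * (C0 * P)"
          proof -
            have "4 * (real k)\<^sup>2 / (real j)\<^sup>2 * e (n j div B) \<le> 4 * (real k)\<^sup>2 * (C0 * P)"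
            proof (rule mult_mono[OF _ eB[OF divB] _ e0])
              have "4 * (real k)\<^sup>2 / (real j)\<^sup>2 \<le> 4 * (real k)\<^sup>2 / 1" using j1 big by (intro divide_left_mono) (auto simp: E_def)
              then show "4 * (real k)\<^sup>2 / (real j)\<^sup>2 \<le> 4 * (real k)\<^sup>2" by simp
            qed simp
            then show ?thesis using eB[OF nk(2)] jk by simp
          qed
          also have "\<dots> \<le> 577 * ((real k)\<^sup>2 * (C0 * P))"
          proof -
            have "0 \<le> (real k)\<^sup>2 * (C0 * P)" using C0 P by simp
            then show ?thesis using C0P unfolding mult.assoc by linarith
          qed
          finally show ?thesis .
        next
          case many
          obtain J where J: "J \<subseteq> E" "card J = a" "finite J" using obtain_subset_with_card_n[OF many(2)] fE finite_subset by metis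
          let ?n' = "\<lambda>j. if j = k then B * n k else if j \<in> J then n j div 2 else n j"
          have n2: "2 \<le> n j" "x / 2 \<le> real j * real (n j)" "1 \<le> j" if "j \<in> J" for j using J that by (auto simp: E_def)
          have kJ: "k \<notin> J" using J kE by auto
          have BJ: "B * (\<Prod>j\<in>J. ?n' j) \<le> (\<Prod>j\<in>J. n j)"
          proof -
            have "B * (\<Prod>j\<in>J. ?n' j) = (\<Prod>j\<in>J. 2 * (n j div 2))"
              unfolding prod.distrib prod_constant J(2) B_def using kJ by (intro arg_cong2[where f="(*)"] refl prod.cong) auto
            also have "\<dots> \<le> (\<Prod>j\<in>J. n j)" by (intro prod_mono) auto
            finally show ?thesis .
          qed
          have "e (n k) \<le> e (?n' k) + (\<Sum>j\<in>J. 4 * (real k)\<^sup>2 / (real j)\<^sup>2 * e (?n' j))"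
          proof (intro exch prod_upd[where J=J] BJ)
            show "1 \<le> ?n' j" for j using n1 B1 n2[of j] by (auto simp: Suc_le_eq)
          qed (use J EK in auto)
          also have "(\<Sum>j\<in>J. 4 * (real k)\<^sup>2 / (real j)\<^sup>2 * e (?n' j)) \<le> (\<Sum>j\<in>J. 576 * ((real k)\<^sup>2 * C0 * x powr (- 2 + 2 * \<eta>)))"
          proof (intro sum_mono)
            fix j assume j: "j \<in> J"
            define r where "r = real (n j)"
            have r: "2 \<le> r" "x / 2 \<le> real j * r" "r \<le> (2 * x)\<^sup>2"
            proof -
              show "2 \<le> r" "x / 2 \<le> real j * r" using n2[OF j] by (auto simp: r_def)
              have "n j < B\<^sup>2" using many(1) J j by auto
              then have "r \<le> (real B)\<^sup>2" unfolding r_def by (metis less_imp_le of_nat_le_iff of_nat_power)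
              also have "\<dots> \<le> (2 * x)\<^sup>2" using Bx by (intro power_mono) auto
              finally show "r \<le> (2 * x)\<^sup>2" .
            qed
            have j0: "0 < real j" using n2[OF j] by simp
            \<comment> \<open>Integer halving of a level of at least 2 divides it by at most 3, the
              worst case being level 3.\<close>
            have d: "r / 3 \<le> real (n j div 2)" "1 \<le> n j div 2"               proof -
                have "n j \<le> 3 * (n j div 2)" "1 \<le> n j div 2" using n2(1)[OF j] by presburger+
                then show "r / 3 \<le> real (n j div 2)" "1 \<le> n j div 2" unfolding r_def by linarith+
              qed
            have "e (n j div 2) \<le> C0 * real (n j div 2) powr (- 2 + \<eta>)" by (rule e_le[OF d(2)])
            also have "\<dots> \<le> C0 * (r / 3) powr (- 2 + \<eta>)" using C0 d r \<eta> by (intro mult_left_mono powr_mono2') auto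
            also have "\<dots> \<le> C0 * (9 / r\<^sup>2 * (4 * x powr (2 * \<eta>)))"
            proof (intro mult_left_mono)
              have "(r / 3) powr (- 2 + \<eta>) = (r / 3) powr (- 2) * (r / 3) powr \<eta>" by (rule powr_add)
              also have "(r / 3) powr (- 2) = 9 / r\<^sup>2" using r by (simp add: powr_minus_2 power_divide)
              also have "(r / 3) powr \<eta> \<le> (4 * x\<^sup>2) powr \<eta>" using r \<eta> x by (intro powr_mono2) (auto simp: power_mult_distrib)
              also have "(4 * x\<^sup>2) powr \<eta> = 4 powr \<eta> * x powr (2 * \<eta>)"
                using x by (simp add: powr_mult powr_powr flip: powr_numeral)
              also have "4 powr \<eta> \<le> (4::real) powr 1" using \<eta> by (intro powr_mono) auto
              finally show "(r / 3) powr (- 2 + \<eta>) \<le> 9 / r\<^sup>2 * (4 * x powr (2 * \<eta>))"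
                using r by (simp add: mult_left_mono mult_right_mono divide_right_mono)
            qed (use C0 in auto)
            finally have ej: "e (n j div 2) \<le> C0 * (9 / r\<^sup>2 * (4 * x powr (2 * \<eta>)))" .
            have jr: "1 / ((real j)\<^sup>2 * r\<^sup>2) \<le> 4 * x powr (- 2)"
            proof -
              have "(x / 2)\<^sup>2 \<le> (real j * r)\<^sup>2" using r x by (intro power_mono) auto
              then have "1 / (real j * r)\<^sup>2 \<le> 1 / (x / 2)\<^sup>2" using x j0 r
                by (intro divide_left_mono mult_pos_pos zero_less_power) auto
              also have "1 / (x / 2)\<^sup>2 = 4 * x powr (- 2)" using x by (simp add: powr_minus_2 power_divide)
              finally show ?thesis by (simp add: power_mult_distrib)
            qed
            have "4 * (real k)\<^sup>2 / (real j)\<^sup>2 * e (?n' j) \<le> 4 * (real k)\<^sup>2 / (real j)\<^sup>2 * (C0 * (9 / r\<^sup>2 * (4 * x powr (2 * \<eta>))))"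
              using ej j kJ by (intro mult_left_mono) auto
            \<comment> \<open>The factors are 4 from the ratio of eigenvalues, 9 from (r/3)^(-2) and
              4 from 4^\<eta>; another 4 from (x/2)^(-2) makes 576. The remaining 1 in 577 is the
              new error at k.\<close>
            also have "\<dots> = 144 * ((real k)\<^sup>2 * C0 * x powr (2 * \<eta>)) * (1 / ((real j)\<^sup>2 * r\<^sup>2))" by (simp add: mult_ac)
            also have "\<dots> \<le> 144 * ((real k)\<^sup>2 * C0 * x powr (2 * \<eta>)) * (4 * x powr (- 2))"
              using jr C0 by (intro mult_left_mono) auto
            also have "\<dots> = 576 * ((real k)\<^sup>2 * C0 * (x powr (- 2) * x powr (2 * \<eta>)))" by simp
            also have "x powr (- 2) * x powr (2 * \<eta>) = x powr (- 2 + 2 * \<eta>)" by (rule powr_add[symmetric])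
            finally show "4 * (real k)\<^sup>2 / (real j)\<^sup>2 * e (?n' j) \<le> 576 * ((real k)\<^sup>2 * C0 * x powr (- 2 + 2 * \<eta>))" .
          qed
          also have "\<dots> = 576 * ((real k)\<^sup>2 * C0 * (real a * x powr (- 2 + 2 * \<eta>)))" using J by simp
          also have "\<dots> \<le> 576 * ((real k)\<^sup>2 * C0 * P)"
          proof (intro mult_left_mono)
            have "real a * x powr (- 2 + 2 * \<eta>) \<le> x powr \<eta> * x powr (- 2 + 2 * \<eta>)" using a x by (intro mult_right_mono) auto
            also have "\<dots> = x powr (- 2 + 3 * \<eta>)" by (simp add: powr_add[symmetric])
            also have "\<dots> \<le> P" by (rule xP) simp
            finally show "real a * x powr (- 2 + 2 * \<eta>) \<le> P" .
          qed (use C0 in auto)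
          finally have "e (n k) \<le> C0 * P + 576 * ((real k)\<^sup>2 * C0 * P)" using eB[OF nk(2)] by simp
          then show ?thesis using C0P by (simp add: mult.assoc)
        next
          case few
          \<comment> \<open>\<open>E\<close> has fewer than a elements, each with level below B^2.
            Outside \<open>E\<close> a level is 1 or satisfies j n_j < x/2, so the product of these
            levels is at most e^(x/2) by \<open>prod_max_le_exp\<close>.\<close>
          have "real (\<Prod>j=1..K. n j) = real (\<Prod>j\<in>E. n j) * real (\<Prod>j\<in>{1..K} - E. n j)"
            using EK unfolding of_nat_mult[symmetric] by (intro arg_cong[where f=real] prod.subset_diff[THEN trans[OF _ mult.commute]]) auto
          also have "\<dots> \<le> (real B)\<^sup>2 ^ a * exp (x / 2)"
          proof (intro mult_mono)
            have "(\<Prod>j\<in>E. n j) \<le> (\<Prod>j\<in>E. B\<^sup>2)" using few by (intro prod_mono) (auto intro: less_imp_le)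
            also have "\<dots> \<le> (B\<^sup>2) ^ a" using few B1 by (simp add: power_increasing)
            finally have "real (\<Prod>j\<in>E. n j) \<le> real ((B\<^sup>2) ^ a)" by (rule of_nat_mono)
            then show "real (\<Prod>j\<in>E. n j) \<le> (real B)\<^sup>2 ^ a" by simp
            have "real (\<Prod>j\<in>{1..K} - E. n j) \<le> (\<Prod>j\<in>{1..K} - E. max 1 ((x / 2) / real j))"
              unfolding of_nat_prod
            proof (intro prod_mono conjI)
              fix j assume j: "j \<in> {1..K} - E"
              then have "n j < 2 \<or> real j * real (n j) < x / 2" by (auto simp: E_def)
              then show "real (n j) \<le> max 1 ((x / 2) / real j)" using j by (auto simp: field_simps le_max_iff_disj)
            qed auto
            also have "\<dots> \<le> (\<Prod>j=1..K. max 1 ((x / 2) / real j))"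
              by (intro prod_mono2) auto
            also have "\<dots> \<le> exp (x / 2)" using x by (intro prod_max_le_exp) auto
            finally show "real (\<Prod>j\<in>{1..K} - E. n j) \<le> exp (x / 2)" .
          qed (auto intro!: prod_nonneg)
          finally have "real (B * (\<Prod>j=1..K. n j)) \<le> real B * ((real B)\<^sup>2 ^ a * exp (x / 2))"
            unfolding of_nat_mult by (intro mult_left_mono) auto
          also have "\<dots> = real B powr (2 * real a + 1) * exp (x / 2)"
          proof -
            have "2 * real a + 1 = real (2 * a + 1)" by simp
            then have "real B powr (2 * real a + 1) = real B ^ (2 * a + 1)" using B1 by (simp only: powr_realpow of_nat_0_less_iff)
            also have "\<dots> = real B * (real B)\<^sup>2 ^ a" by (simp flip: power_mult)
            finally show ?thesis by (simp only: mult.assoc)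
          qed
          also have "real B powr (2 * real a + 1) = exp ((2 * real a + 1) * ln (real B))" using B1 by (simp add: powr_def)
          also have "\<dots> \<le> exp ((2 * (log 2 x + 1) + 1) * ln (2 * x))"
            using a Bx B1 x lx unfolding exp_le_cancel_iff by (intro mult_mono ln_mono) auto
          also have "\<dots> \<le> exp (x / 2)" by (rule x(2))
          finally have "real (B * (\<Prod>j=1..K. n j)) \<le> exp (x / 2) * exp (x / 2)" by (simp add: mult_right_mono)
          also have "\<dots> = real m" by (simp add: mx exp_add[symmetric])
          finally have "B * (\<Prod>j=1..K. n j) \<le> m" by (simp only: of_nat_le_iff)
          with full show ?thesis by simp
        qed
      qed
    qed
    then show "e (n k) \<le> C * (real k)\<^sup>2 * ln (real m) powr (- 2 + \<epsilon>)"
      by (simp add: C_def P_def x_def mult_ac)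
  qed
qed

subsection \<open>Errors of optimal product quantizations\<close>

context brownian begin

lemma X_gauss: "t \<in> {0..T} \<Longrightarrow> gauss M (X t) t"
  using kl_gauss[of t 1 "\<lambda>_. 0" 0] by simp

definition energy :: "'a \<Rightarrow> real" where
  "energy \<omega> = integral {0..T} (\<lambda>t. (X t \<omega>)\<^sup>2)"

text \<open>The pathwise integral is the limit of Riemann sums over uniform grids. This yields
  measurability in \<omega>, and Fatou's lemma yields a finite expectation, as each sum has
  expectation at most T^2.\<close>

lemma energy_measurable [measurable]: "energy \<in> borel_measurable M"
  and energy_finite: "(\<integral>\<^sup>+\<omega>. ennreal (energy \<omega>) \<partial>M) < \<infinity>"
proof -
  define S where "S n \<omega> = (\<Sum>j<n. (X (T * real j / real n) \<omega>)\<^sup>2 * (T / real n))" for n \<omega>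
  have p01: "T * real j / real n \<in> {0..T}" if "j < n" for j n
  proof -
    have "T * (real j / real n) \<le> T * 1" using T that by (intro mult_left_mono) auto
    then show ?thesis using T by simp
  qed
  have lim: "(\<lambda>n. S n \<omega>) \<longlonglongrightarrow> energy \<omega>" if \<omega>: "\<omega> \<in> space M" for \<omega>
  proof -
    have c: "continuous_on {0..T} (\<lambda>t. (X t \<omega>)\<^sup>2)" by (intro continuous_intros X_cont \<omega>)
    define G where "G u = integral {0..u} (\<lambda>t. (X t \<omega>)\<^sup>2)" for u
    have dG: "(G has_real_derivative (X u \<omega>)\<^sup>2) (at u within {0..T})" if "u \<in> {0..T}" for u
      unfolding G_def by (rule integral_has_real_derivative[OF c that])
    have "(\<lambda>n. T * real n / real n) \<longlonglongrightarrow> T"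
      by (rule tendsto_eventually, rule eventually_sequentiallyI[of 1]) simp
    from riemann_sums[OF T c dG order_refl this] T show ?thesis by (simp add: S_def energy_def G_def)
  qed
  have Sm: "S n \<in> borel_measurable M" for n
    unfolding S_def using p01 by (intro borel_measurable_sum borel_measurable_times borel_measurable_power X_measurable) auto
  show "energy \<in> borel_measurable M" by (rule borel_measurable_LIMSEQ_real[OF lim Sm])
  have "(\<integral>\<^sup>+\<omega>. ennreal (energy \<omega>) \<partial>M) = (\<integral>\<^sup>+\<omega>. liminf (\<lambda>n. ennreal (S n \<omega>)) \<partial>M)"
  proof (intro nn_integral_cong)
    fix \<omega> assume "\<omega> \<in> space M"
    from tendsto_ennrealI[OF lim[OF this]] show "ennreal (energy \<omega>) = liminf (\<lambda>n. ennreal (S n \<omega>))"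
      by (intro lim_imp_Liminf[symmetric]) auto
  qed
  also have "\<dots> \<le> liminf (\<lambda>n. \<integral>\<^sup>+\<omega>. ennreal (S n \<omega>) \<partial>M)" using Sm by (intro nn_integral_liminf) auto
  also have "\<dots> \<le> liminf (\<lambda>n. ennreal (T\<^sup>2))"
  proof (intro Liminf_mono always_eventually allI)
    fix n
    have i: "integrable M (\<lambda>\<omega>. (X (T * real j / real n) \<omega>)\<^sup>2)" if "j < n" for j
      using gauss_moments(1)[OF X_gauss[OF p01[OF that]]] .
    have e: "(\<integral>\<omega>. (X (T * real j / real n) \<omega>)\<^sup>2 \<partial>M) \<le> T" if "j < n" for j
      using gauss_moments(2)[OF X_gauss[OF p01[OF that]], of 1] p01[OF that] by simp
    have "(\<integral>\<^sup>+\<omega>. ennreal (S n \<omega>) \<partial>M) = ennreal (\<integral>\<omega>. S n \<omega> \<partial>M)"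
      unfolding S_def using i T by (intro nn_integral_eq_integral) (auto intro!: AE_I2 sum_nonneg)
    also have "(\<integral>\<omega>. S n \<omega> \<partial>M) = (\<Sum>j<n. (\<integral>\<omega>. (X (T * real j / real n) \<omega>)\<^sup>2 \<partial>M) * (T / real n))"
      unfolding S_def using i by (subst Bochner_Integration.integral_sum) auto
    also have "\<dots> \<le> (\<Sum>j<n. T * (T / real n))" using e T by (intro sum_mono mult_right_mono) auto
    also have "\<dots> \<le> T\<^sup>2" by (cases "n = 0") (simp_all add: power2_eq_square)
    finally show "(\<integral>\<^sup>+\<omega>. ennreal (S n \<omega>) \<partial>M) \<le> ennreal (T\<^sup>2)" by (simp add: ennreal_leI)
  qed
  also have "\<dots> < \<infinity>" by (simp add: Liminf_const)
  finally show "(\<integral>\<^sup>+\<omega>. ennreal (energy \<omega>) \<partial>M) < \<infinity>" .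
qed

text \<open>Pythagoras for the orthonormal system \<open>kl_e\<close>: the path has the coefficients
  \<open>sqrt (kl_lambda T k) * \<xi> k\<close>, so the chosen coefficients \<open>c\<close> enter
  only through the last sum, and the bracket is common to all expansions with K terms.\<close>

lemma L2_expansion:
  assumes \<omega>: "\<omega> \<in> space M"
  shows "integral {0..T} (\<lambda>t. (X t \<omega> - (\<Sum>k=1..K. sqrt (kl_lambda T k) * c k * kl_e T k t))\<^sup>2)
    = (energy \<omega> - (\<Sum>k=1..K. kl_lambda T k * (\<xi> k \<omega>)\<^sup>2)) + (\<Sum>k=1..K. kl_lambda T k * (\<xi> k \<omega> - c k)\<^sup>2)"
proof -
  define a where "a k = sqrt (kl_lambda T k) * c k" for k
  have cX: "continuous_on {0..T} (\<lambda>t. X t \<omega>)" by (rule X_cont[OF \<omega>])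
  have h1: "((\<lambda>t. (X t \<omega>)\<^sup>2) has_integral energy \<omega>) {0..T}"
    unfolding energy_def by (intro integrable_integral integrable_continuous_interval continuous_intros cX)
  have h2: "((\<lambda>t. X t \<omega> * kl_e T k t) has_integral (\<xi> k \<omega> / kl_freq T k)) {0..T}" if "k \<in> {1..K}" for k
  proof -
    have c: "continuous_on {0..T} (\<lambda>t. X t \<omega> * kl_e T k t)" using that by (intro continuous_intros cX kl_e_cont) auto
    have "(LINT u:{0..T}|lborel. X u \<omega> * kl_e T k u) = \<xi> k \<omega> / kl_freq T k"
      using that kl_freq_pos[OF T, of k] by (simp add: kl_xi_freq)
    then show ?thesis
      using set_borel_integral_eq_integral[OF borel_integrable_atLeastAtMost'[OF c]]
        integrable_integral[OF set_borel_integral_eq_integral(1)[OF borel_integrable_atLeastAtMost'[OF c]]] by simp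
  qed
  have "((\<lambda>t. (X t \<omega>)\<^sup>2 + ((\<Sum>k=1..K. (- 2 * a k) * (X t \<omega> * kl_e T k t)) + (\<Sum>j=1..K. \<Sum>k=1..K. (a j * a k) * (kl_e T j t * kl_e T k t))))
      has_integral (energy \<omega> + ((\<Sum>k=1..K. (- 2 * a k) * (\<xi> k \<omega> / kl_freq T k)) + (\<Sum>j=1..K. \<Sum>k=1..K. (a j * a k) * (if j = k then 1 else 0))))) {0..T}"
    by (intro has_integral_add h1 has_integral_sum has_integral_mult_right h2 kl_orthonormal(1)[OF T]) auto
  also have "(\<lambda>t. (X t \<omega>)\<^sup>2 + ((\<Sum>k=1..K. (- 2 * a k) * (X t \<omega> * kl_e T k t)) + (\<Sum>j=1..K. \<Sum>k=1..K. (a j * a k) * (kl_e T j t * kl_e T k t))))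
      = (\<lambda>t. (X t \<omega> - (\<Sum>k=1..K. a k * kl_e T k t))\<^sup>2)"
  proof
    fix t
    have 1: "(\<Sum>k=1..K. (- 2 * a k) * (X t \<omega> * kl_e T k t)) = - 2 * X t \<omega> * (\<Sum>k=1..K. a k * kl_e T k t)"
      by (simp add: sum_distrib_left mult_ac)
    have 2: "(\<Sum>j=1..K. \<Sum>k=1..K. (a j * a k) * (kl_e T j t * kl_e T k t)) = (\<Sum>k=1..K. a k * kl_e T k t) * (\<Sum>k=1..K. a k * kl_e T k t)"
      unfolding sum_product by (simp add: mult_ac)
    show "(X t \<omega>)\<^sup>2 + ((\<Sum>k=1..K. (- 2 * a k) * (X t \<omega> * kl_e T k t)) + (\<Sum>j=1..K. \<Sum>k=1..K. (a j * a k) * (kl_e T j t * kl_e T k t)))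
      = (X t \<omega> - (\<Sum>k=1..K. a k * kl_e T k t))\<^sup>2"
      unfolding 1 2 by (simp add: power2_eq_square algebra_simps)
  qed
  finally have H: "integral {0..T} (\<lambda>t. (X t \<omega> - (\<Sum>k=1..K. a k * kl_e T k t))\<^sup>2)
      = energy \<omega> + ((\<Sum>k=1..K. (- 2 * a k) * (\<xi> k \<omega> / kl_freq T k)) + (\<Sum>j=1..K. (a j)\<^sup>2))"
    by (simp add: integral_unique power2_eq_square if_distrib sum.delta cong: if_cong)
  have "(\<Sum>k=1..K. (- 2 * a k) * (\<xi> k \<omega> / kl_freq T k)) + (\<Sum>j=1..K. (a j)\<^sup>2)
     = (\<Sum>k=1..K. kl_lambda T k * (\<xi> k \<omega> - c k)\<^sup>2 - kl_lambda T k * (\<xi> k \<omega>)\<^sup>2)"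
    unfolding sum.distrib[symmetric]
  proof (intro sum.cong refl)
    fix k assume k: "k \<in> {1..K}"
    have l: "kl_lambda T k = 1 / kl_freq T k * (1 / kl_freq T k)"
      using sqrt_kl_lambda[OF T, of k] k kl_lambda_pos[OF T, of k] by (metis atLeastAtMost_iff less_imp_le real_sqrt_mult_self abs_of_nonneg)
    have ak: "a k = c k / kl_freq T k" using k by (simp add: a_def sqrt_kl_lambda[OF T])
    show "- 2 * a k * (\<xi> k \<omega> / kl_freq T k) + (a k)\<^sup>2 = kl_lambda T k * (\<xi> k \<omega> - c k)\<^sup>2 - kl_lambda T k * (\<xi> k \<omega>)\<^sup>2"
      unfolding ak l by (simp add: power2_eq_square diff_divide_distrib algebra_simps)
  qed
  then show ?thesis using H unfolding sum_subtractf by (simp add: a_def)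
qed

text \<open>The first summand depends on K but not on the quantizers, so for a common K the
  comparison of quadratic errors reduces to that of the weighted scalar errors.\<close>

lemma quadratic_error_formula:
  assumes Y: "\<And>\<omega> t. \<omega> \<in> space M \<Longrightarrow> t \<in> {0..T} \<Longrightarrow> Y t \<omega> = (\<Sum>k=1..K. sqrt (kl_lambda T k) * c k \<omega> * kl_e T k t)"
    and g: "\<And>k. k \<in> {1..K} \<Longrightarrow> g k \<in> borel_measurable borel" "\<And>k x. k \<in> {1..K} \<Longrightarrow> \<bar>g k x\<bar> \<le> \<bar>x\<bar> + 4"
      "\<And>k \<omega>. k \<in> {1..K} \<Longrightarrow> \<omega> \<in> space M \<Longrightarrow> \<xi> k \<omega> - c k \<omega> = g k (\<xi> k \<omega>)"
      "\<And>k. k \<in> {1..K} \<Longrightarrow> (\<integral>\<omega>. (g k (\<xi> k \<omega>))\<^sup>2 \<partial>M) = e k"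
  shows "quadratic_error M T X Y = (\<integral>\<^sup>+\<omega>. ennreal (energy \<omega> - (\<Sum>k=1..K. kl_lambda T k * (\<xi> k \<omega>)\<^sup>2)) \<partial>M)
     + ennreal (\<Sum>k=1..K. kl_lambda T k * e k)"
proof -
  define A where "A \<omega> = energy \<omega> - (\<Sum>k=1..K. kl_lambda T k * (\<xi> k \<omega>)\<^sup>2)" for \<omega>
  have lam: "0 \<le> kl_lambda T k" for k by (simp add: kl_lambda_def)
  have [measurable]: "k \<in> {1..K} \<Longrightarrow> (\<lambda>\<omega>. g k (\<xi> k \<omega>)) \<in> borel_measurable M" for k
    using g(1)[of k] xi_measurable[of k] by (auto intro: measurable_compose)
  have Am: "A \<in> borel_measurable M"
    unfolding A_def by (intro borel_measurable_diff energy_measurable borel_measurable_sum borel_measurable_times borel_measurable_const borel_measurable_power xi_measurable) auto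
  \<comment> \<open>The residual is the squared distance to the expansion with the exact
    coefficients, hence nonnegative; \<open>ennreal\<close> therefore splits the sum without
    truncation.\<close>
  have A0: "0 \<le> A \<omega>" if "\<omega> \<in> space M" for \<omega>
  proof -
    have "0 \<le> integral {0..T} (\<lambda>t. (X t \<omega> - (\<Sum>k=1..K. sqrt (kl_lambda T k) * \<xi> k \<omega> * kl_e T k t))\<^sup>2)"
      by (intro Henstock_Kurzweil_Integration.integral_nonneg integrable_continuous_interval continuous_intros X_cont[OF that] kl_e_cont) auto
    then show ?thesis unfolding L2_expansion[OF that] by (simp add: A_def)
  qed
  have i: "integrable M (\<lambda>\<omega>. (g k (\<xi> k \<omega>))\<^sup>2)" if "k \<in> {1..K}" for k
    using linear_growth_integrable(1)[OF xi_gauss g(1,2)[OF that]] that by auto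
  have inner: "(\<integral>\<^sup>+t\<in>{0..T}. ennreal ((norm (X t \<omega> - Y t \<omega>))\<^sup>2) \<partial>lborel)
     = ennreal (A \<omega>) + ennreal (\<Sum>k=1..K. kl_lambda T k * (g k (\<xi> k \<omega>))\<^sup>2)" if \<omega>: "\<omega> \<in> space M" for \<omega>
  proof -
    let ?f = "\<lambda>t. (X t \<omega> - (\<Sum>k=1..K. sqrt (kl_lambda T k) * c k \<omega> * kl_e T k t))\<^sup>2"
    have cf: "continuous_on {0..T} ?f" by (intro continuous_intros X_cont[OF \<omega>] kl_e_cont) auto
    have fi: "set_integrable lborel {0..T} ?f" by (rule borel_integrable_atLeastAtMost'[OF cf])
    have "(\<integral>\<^sup>+t\<in>{0..T}. ennreal ((norm (X t \<omega> - Y t \<omega>))\<^sup>2) \<partial>lborel) = (\<integral>\<^sup>+t. ennreal (indicator {0..T} t *\<^sub>R ?f t) \<partial>lborel)"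
      using Y[OF \<omega>] by (intro nn_integral_cong) (auto simp: indicator_def)
    also have "\<dots> = ennreal (LINT t:{0..T}|lborel. ?f t)"
      using fi unfolding set_lebesgue_integral_def set_integrable_def by (intro nn_integral_eq_integral) (auto simp: indicator_def)
    also have "(LINT t:{0..T}|lborel. ?f t) = integral {0..T} ?f" by (rule set_borel_integral_eq_integral(2)[OF fi])
    also have "\<dots> = A \<omega> + (\<Sum>k=1..K. kl_lambda T k * (g k (\<xi> k \<omega>))\<^sup>2)"
      unfolding L2_expansion[OF \<omega>] A_def using g(3)[OF _ \<omega>] by simp
    finally show ?thesis using A0[OF \<omega>] lam by (simp add: sum_nonneg)
  qed
  have "quadratic_error M T X Y = (\<integral>\<^sup>+\<omega>. ennreal (A \<omega>) + ennreal (\<Sum>k=1..K. kl_lambda T k * (g k (\<xi> k \<omega>))\<^sup>2) \<partial>M)"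
    unfolding quadratic_error_def by (intro nn_integral_cong inner)
  also have "\<dots> = (\<integral>\<^sup>+\<omega>. ennreal (A \<omega>) \<partial>M) + (\<integral>\<^sup>+\<omega>. ennreal (\<Sum>k=1..K. kl_lambda T k * (g k (\<xi> k \<omega>))\<^sup>2) \<partial>M)"
    using Am by (intro nn_integral_add) auto
  also have "(\<integral>\<^sup>+\<omega>. ennreal (\<Sum>k=1..K. kl_lambda T k * (g k (\<xi> k \<omega>))\<^sup>2) \<partial>M) = ennreal (\<integral>\<omega>. (\<Sum>k=1..K. kl_lambda T k * (g k (\<xi> k \<omega>))\<^sup>2) \<partial>M)"
    using i lam by (intro nn_integral_eq_integral Bochner_Integration.integrable_sum integrable_mult_right AE_I2 sum_nonneg mult_nonneg_nonneg) auto
  also have "(\<integral>\<omega>. (\<Sum>k=1..K. kl_lambda T k * (g k (\<xi> k \<omega>))\<^sup>2) \<partial>M) = (\<Sum>k=1..K. kl_lambda T k * e k)"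
    using i g(4) by (subst Bochner_Integration.integral_sum) auto
  finally show ?thesis by (simp add: A_def)
qed

text \<open>Finiteness permits cancelling this common summand when two errors are compared in
  \<open>ennreal\<close>.\<close>

lemma residual_energy_finite: "(\<integral>\<^sup>+\<omega>. ennreal (energy \<omega> - (\<Sum>k=1..K. kl_lambda T k * (\<xi> k \<omega>)\<^sup>2)) \<partial>M) < \<infinity>"
  by (rule le_less_trans[OF nn_integral_mono energy_finite]) (auto intro!: ennreal_leI sum_nonneg simp: kl_lambda_def)

text \<open>Product quantizations have index sets of different sizes; coordinates beyond the last one are
  treated as quantized at level one, that is, by zero.\<close>

lemma optimal_product_structure:
  assumes opt: "optimal_product_quantization M T X m Xh"
  obtains n L g where "\<forall>k. 1 \<le> n k" "\<forall>k>L. n k = 1" "(\<Prod>k=1..L. n k) \<le> m"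
    "\<forall>K n'. L \<le> K \<longrightarrow> (\<forall>k. 1 \<le> n' k) \<longrightarrow> (\<Prod>k=1..K. n' k) \<le> m \<longrightarrow>
        (\<Sum>k=1..K. kl_lambda T k * quant_err (n k)) \<le> (\<Sum>k=1..K. kl_lambda T k * quant_err (n' k))"
    "\<And>k. 1 \<le> k \<Longrightarrow> g k \<in> borel_measurable borel" "\<And>k x. 1 \<le> k \<Longrightarrow> \<bar>g k x\<bar> \<le> \<bar>x\<bar> + 4"
    "\<And>k. 1 \<le> k \<Longrightarrow> (\<integral>\<omega>. g k (\<xi> k \<omega>) \<partial>M) = 0" "\<And>k. 1 \<le> k \<Longrightarrow> (\<integral>\<omega>. (g k (\<xi> k \<omega>))\<^sup>2 \<partial>M) = quant_err (n k)"
    "\<And>K \<omega> t. L \<le> K \<Longrightarrow> \<omega> \<in> space M \<Longrightarrow> t \<in> {0..T} \<Longrightarrow>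
        Xh t \<omega> = (\<Sum>k=1..K. sqrt (kl_lambda T k) * (\<xi> k \<omega> - g k (\<xi> k \<omega>)) * kl_e T k t)"
proof -
  obtain L n0 \<xi>h where L: "1 \<le> L" "\<forall>k\<in>{1..L}. 1 \<le> n0 k" "(\<Prod>k=1..L. n0 k) \<le> m"
    "\<forall>k\<in>{1..L}. optimal_quantization M UNIV dist (\<xi> k) (n0 k) (\<xi>h k)"
    "\<forall>\<omega>\<in>space M. \<forall>t\<in>{0..T}. Xh t \<omega> = (\<Sum>k=1..L. sqrt (kl_lambda T k) * \<xi>h k \<omega> * kl_e T k t)"
    using opt unfolding optimal_product_quantization_def product_quantization_def by blast
  define n where "n k = (if k \<in> {1..L} then n0 k else 1)" for k
  have n1: "1 \<le> n k" for k using L(2) by (auto simp: n_def)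
  have nL: "n k = 1" if "L < k" for k using that by (simp add: n_def)
  have "(\<Prod>k=1..L. n k) = (\<Prod>k=1..L. n0 k)" by (intro prod.cong) (auto simp: n_def)
  then have pn: "(\<Prod>k=1..L. n k) \<le> m" using L(3) by simp
  have quantizer: "\<exists>g. g \<in> borel_measurable borel \<and> (\<forall>\<omega>\<in>space M. \<xi> k \<omega> - \<zeta> \<omega> = g (\<xi> k \<omega>)) \<and> (\<forall>x. \<bar>g x\<bar> \<le> \<bar>x\<bar> + 4) \<and>
    (\<integral>\<omega>. g (\<xi> k \<omega>) \<partial>M) = 0 \<and> (\<integral>\<omega>. (g (\<xi> k \<omega>))\<^sup>2 \<partial>M) = quant_err j"
    if "1 \<le> k" "1 \<le> j" "optimal_quantization M UNIV dist (\<xi> k) j \<zeta>" for k j \<zeta>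
    using optimal_quantization_gauss[OF xi_gauss[OF that(1)] that(2,3)] .
  have "\<exists>g. g \<in> borel_measurable borel \<and> (\<forall>x. \<bar>g x\<bar> \<le> \<bar>x\<bar> + 4) \<and> (\<integral>\<omega>. g (\<xi> k \<omega>) \<partial>M) = 0 \<and>
      (\<integral>\<omega>. (g (\<xi> k \<omega>))\<^sup>2 \<partial>M) = quant_err (n k) \<and> (\<forall>\<omega>\<in>space M. \<xi> k \<omega> - (if k \<le> L then \<xi>h k \<omega> else 0) = g (\<xi> k \<omega>))"
    if k: "1 \<le> k" for k
  proof (cases "k \<le> L")
    case True
    then have o: "optimal_quantization M UNIV dist (\<xi> k) (n k) (\<xi>h k)" using L k by (simp add: n_def)
    show ?thesis using quantizer[OF k n1 o] True by auto
  next
    case False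
    then have "quant_err (n k) = 1" using nL quant_err_1 by simp
    then show ?thesis
      using False gauss_moments(2)[OF xi_gauss[OF k], of 1] gauss_moments(3)[OF xi_gauss[OF k]] by (intro exI[of _ "\<lambda>x. x"]) auto
  qed
  then have "\<exists>g. \<forall>k. 1 \<le> k \<longrightarrow> g k \<in> borel_measurable borel \<and> (\<forall>x. \<bar>g k x\<bar> \<le> \<bar>x\<bar> + 4) \<and> (\<integral>\<omega>. g k (\<xi> k \<omega>) \<partial>M) = 0 \<and>
      (\<integral>\<omega>. (g k (\<xi> k \<omega>))\<^sup>2 \<partial>M) = quant_err (n k) \<and> (\<forall>\<omega>\<in>space M. \<xi> k \<omega> - (if k \<le> L then \<xi>h k \<omega> else 0) = g k (\<xi> k \<omega>))"
    by (intro choice allI) blast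
  then obtain g where g: "\<And>k. 1 \<le> k \<Longrightarrow> g k \<in> borel_measurable borel" "\<And>k x. 1 \<le> k \<Longrightarrow> \<bar>g k x\<bar> \<le> \<bar>x\<bar> + 4"
      "\<And>k. 1 \<le> k \<Longrightarrow> (\<integral>\<omega>. g k (\<xi> k \<omega>) \<partial>M) = 0" "\<And>k. 1 \<le> k \<Longrightarrow> (\<integral>\<omega>. (g k (\<xi> k \<omega>))\<^sup>2 \<partial>M) = quant_err (n k)"
      "\<And>k \<omega>. 1 \<le> k \<Longrightarrow> \<omega> \<in> space M \<Longrightarrow> \<xi> k \<omega> - (if k \<le> L then \<xi>h k \<omega> else 0) = g k (\<xi> k \<omega>)"
    by blast
  have Xh: "Xh t \<omega> = (\<Sum>k=1..K. sqrt (kl_lambda T k) * (if k \<le> L then \<xi>h k \<omega> else 0) * kl_e T k t)"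
    if "L \<le> K" "\<omega> \<in> space M" "t \<in> {0..T}" for K \<omega> t
  proof -
    have "(\<Sum>k=1..K. sqrt (kl_lambda T k) * (if k \<le> L then \<xi>h k \<omega> else 0) * kl_e T k t)
        = (\<Sum>k=1..L. sqrt (kl_lambda T k) * (if k \<le> L then \<xi>h k \<omega> else 0) * kl_e T k t)"
      using that(1) by (intro sum.mono_neutral_right) auto
    then show ?thesis using L(5) that by simp
  qed
  have cmp: "(\<Sum>k=1..K. kl_lambda T k * quant_err (n k)) \<le> (\<Sum>k=1..K. kl_lambda T k * quant_err (n' k))"
    if K: "L \<le> K" and n': "\<forall>k. 1 \<le> n' k" and m: "(\<Prod>k=1..K. n' k) \<le> m" for K n'
  proof -
    \<comment> \<open>The competing sizes are realized by optimal scalar quantizers, which produces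
      a product quantization of level m to which optimality of \<open>Xh\<close> applies.\<close>
    have "\<forall>k. \<exists>\<zeta>. 1 \<le> k \<longrightarrow> optimal_quantization M UNIV dist (\<xi> k) (n' k) \<zeta>"
      using optimal_quantization_gauss_exists[OF xi_gauss] n' by blast
    then obtain \<zeta> where \<zeta>: "\<And>k. 1 \<le> k \<Longrightarrow> optimal_quantization M UNIV dist (\<xi> k) (n' k) (\<zeta> k)" by metis
    define Y where "Y t \<omega> = (\<Sum>k=1..K. sqrt (kl_lambda T k) * \<zeta> k \<omega> * kl_e T k t)" for t \<omega>
    have "product_quantization M T X m Y"
      unfolding product_quantization_def using L(1) K n' m \<zeta> by (intro exI[of _ K] exI[of _ n'] exI[of _ \<zeta>]) (auto simp: Y_def)
    then have le: "quadratic_error M T X Xh \<le> quadratic_error M T X Y"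
      using opt unfolding optimal_product_quantization_def by blast
    have "\<forall>k. \<exists>g. 1 \<le> k \<longrightarrow> g \<in> borel_measurable borel \<and> (\<forall>\<omega>\<in>space M. \<xi> k \<omega> - \<zeta> k \<omega> = g (\<xi> k \<omega>)) \<and> (\<forall>x. \<bar>g x\<bar> \<le> \<bar>x\<bar> + 4) \<and>
      (\<integral>\<omega>. g (\<xi> k \<omega>) \<partial>M) = 0 \<and> (\<integral>\<omega>. (g (\<xi> k \<omega>))\<^sup>2 \<partial>M) = quant_err (n' k)"
      using quantizer \<zeta> n' by blast
    then obtain g' where g': "\<And>k. 1 \<le> k \<Longrightarrow> g' k \<in> borel_measurable borel" "\<And>k \<omega>. 1 \<le> k \<Longrightarrow> \<omega> \<in> space M \<Longrightarrow> \<xi> k \<omega> - \<zeta> k \<omega> = g' k (\<xi> k \<omega>)"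
      "\<And>k x. 1 \<le> k \<Longrightarrow> \<bar>g' k x\<bar> \<le> \<bar>x\<bar> + 4" "\<And>k. 1 \<le> k \<Longrightarrow> (\<integral>\<omega>. (g' k (\<xi> k \<omega>))\<^sup>2 \<partial>M) = quant_err (n' k)"
      by (subst (asm) choice_iff) blast
    have 1: "quadratic_error M T X Xh = (\<integral>\<^sup>+\<omega>. ennreal (energy \<omega> - (\<Sum>k=1..K. kl_lambda T k * (\<xi> k \<omega>)\<^sup>2)) \<partial>M)
      + ennreal (\<Sum>k=1..K. kl_lambda T k * quant_err (n k))"
      by (rule quadratic_error_formula[where g=g, OF Xh[OF K]]) (use g in auto)
    have 2: "quadratic_error M T X Y = (\<integral>\<^sup>+\<omega>. ennreal (energy \<omega> - (\<Sum>k=1..K. kl_lambda T k * (\<xi> k \<omega>)\<^sup>2)) \<partial>M)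
      + ennreal (\<Sum>k=1..K. kl_lambda T k * quant_err (n' k))"
      by (rule quadratic_error_formula[where g=g' and c=\<zeta>]) (use g' in \<open>auto simp: Y_def\<close>)
    have "ennreal (\<Sum>k=1..K. kl_lambda T k * quant_err (n k)) \<le> ennreal (\<Sum>k=1..K. kl_lambda T k * quant_err (n' k))"
      using le residual_energy_finite[of K] unfolding 1 2 by (simp add: ennreal_add_left_cancel_le less_top[symmetric])
    then show ?thesis by (subst (asm) ennreal_le_iff) (auto intro!: sum_nonneg simp: kl_lambda_def quant_err_nonneg)
  qed
  have rep: "Xh t \<omega> = (\<Sum>k=1..K. sqrt (kl_lambda T k) * (\<xi> k \<omega> - g k (\<xi> k \<omega>)) * kl_e T k t)"
    if "L \<le> K" "\<omega> \<in> space M" "t \<in> {0..T}" for K \<omega> t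
    unfolding Xh[OF that]
  proof (intro sum.cong refl)
    fix k assume "k \<in> {1..K}"
    then have "(if k \<le> L then \<xi>h k \<omega> else 0) = \<xi> k \<omega> - g k (\<xi> k \<omega>)" using g(5)[of k \<omega>] that(2) by auto
    then show "sqrt (kl_lambda T k) * (if k \<le> L then \<xi>h k \<omega> else 0) * kl_e T k t = sqrt (kl_lambda T k) * (\<xi> k \<omega> - g k (\<xi> k \<omega>)) * kl_e T k t"
      by (simp only:)
  qed
  show thesis by (rule that[of n L g, OF _ _ pn _ g(1-4) rep]) (use n1 nL cmp in auto)
qed

end

section \<open>Moments of the increments of the error\<close>

lemma even_power_sum3:
  fixes p q r :: real
  shows "(p + q + r) ^ (2 * l) \<le> 9 ^ l * (p ^ (2 * l) + q ^ (2 * l) + r ^ (2 * l))"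
proof -
  define m where "m = max \<bar>p\<bar> (max \<bar>q\<bar> \<bar>r\<bar>)"
  have ab: "\<bar>p + q + r\<bar> \<le> 3 * m" unfolding m_def by linarith
  have "(p + q + r) ^ (2 * l) = \<bar>p + q + r\<bar> ^ (2 * l)" by (simp add: power_even_abs)
  also have "\<dots> \<le> (3 * m) ^ (2 * l)" by (intro power_mono ab) simp
  also have "\<dots> = 9 ^ l * m ^ (2 * l)" by (simp add: power_mult_distrib power_mult)
  also have "m ^ (2 * l) \<le> p ^ (2 * l) + q ^ (2 * l) + r ^ (2 * l)"
  proof -
    have nn: "0 \<le> p ^ (2 * l)" "0 \<le> q ^ (2 * l)" "0 \<le> r ^ (2 * l)" by (simp_all add: power_mult)
    have "m = \<bar>p\<bar> \<or> m = \<bar>q\<bar> \<or> m = \<bar>r\<bar>" unfolding m_def by linarith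
    then show ?thesis using nn by (elim disjE) (simp_all add: power_even_abs)
  qed
  finally show ?thesis by simp
qed

text \<open>Interpolation between the Lipschitz bound, for |x - y| <= 1, and the boundedness of the
  sine beyond that.\<close>

lemma abs_sin_diff_le_powr:
  fixes x y :: real
  assumes "0 < \<beta>" "\<beta> \<le> 1"
  shows "\<bar>sin x - sin y\<bar> \<le> 2 * \<bar>x - y\<bar> powr \<beta>"
proof (cases "\<bar>x - y\<bar> \<le> 1")
  case True
  have "\<bar>sin x - sin y\<bar> = 2 * \<bar>sin ((x - y) / 2)\<bar> * \<bar>cos ((x + y) / 2)\<bar>" by (simp add: sin_diff_sin abs_mult)
  also have "\<dots> \<le> 2 * \<bar>(x - y) / 2\<bar> * 1" by (intro mult_mono abs_sin_x_le_abs_x) auto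
  also have "\<dots> = \<bar>x - y\<bar>" by simp
  also have "\<dots> \<le> \<bar>x - y\<bar> powr \<beta>"
    using powr_mono'[of \<beta> 1 "\<bar>x - y\<bar>"] assms True by (cases "x = y") auto
  finally show ?thesis using powr_ge_zero[of "\<bar>x - y\<bar>" \<beta>] by linarith
next
  case False
  then have "1 \<le> \<bar>x - y\<bar> powr \<beta>" using assms by (intro ge_one_powr_ge_zero) auto
  then show ?thesis using sin_le_one[of x] sin_ge_minus_one[of x] sin_le_one[of y] sin_ge_minus_one[of y] by linarith
qed

context brownian begin

text \<open>A trade between regularity in time and decay in k: each time exponent 2 \<beta> costs as
  much decay in k. Multiplied by the k^(2u) that the allocation bound brings in, the series over k
  converges when \<beta> + u < 1/2.\<close>

lemma kl_increment_coeff: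
  assumes k: "1 \<le> k" and \<beta>: "0 < \<beta>" "\<beta> < 1" and st: "s < t"
  shows "(sqrt (kl_lambda T k) * (kl_e T k t - kl_e T k s))\<^sup>2 \<le> 8 / T * T powr (2 - 2 * \<beta>) * real k powr (2 * \<beta> - 2) * (t - s) powr (2 * \<beta>)"
proof -
  define \<kappa> where "\<kappa> = kl_freq T k"
  have \<kappa>0: "0 < \<kappa>" unfolding \<kappa>_def by (rule kl_freq_pos[OF T k])
  have \<kappa>: "real k / T \<le> \<kappa>"
  proof -
    have "real k \<le> 2 * (real k - 1 / 2)" using k by simp
    also have "\<dots> \<le> pi * (real k - 1 / 2)" using k pi_ge_two by (intro mult_right_mono) auto
    finally show ?thesis unfolding \<kappa>_def kl_freq_def using T by (intro divide_right_mono) auto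
  qed
  define z where "z = \<kappa> * (t - s)"
  have z: "0 < z" using \<kappa>0 st by (simp add: z_def)
  have "\<bar>sin (\<kappa> * t) - sin (\<kappa> * s)\<bar> \<le> 2 * \<bar>\<kappa> * t - \<kappa> * s\<bar> powr \<beta>"
    using \<beta> by (intro abs_sin_diff_le_powr) auto
  also have "\<bar>\<kappa> * t - \<kappa> * s\<bar> = z" using z by (simp add: z_def right_diff_distrib)
  finally have "\<bar>sin (\<kappa> * t) - sin (\<kappa> * s)\<bar>\<^sup>2 \<le> (2 * z powr \<beta>)\<^sup>2" by (intro power_mono) auto
  also have "(2 * z powr \<beta>)\<^sup>2 = 4 * (\<kappa> powr (2 * \<beta>) * (t - s) powr (2 * \<beta>))"
  proof -
    have "(2 * z powr \<beta>)\<^sup>2 = 4 * z powr (2 * \<beta>)" by (simp add: power2_eq_square flip: powr_add)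
    also have "z powr (2 * \<beta>) = \<kappa> powr (2 * \<beta>) * (t - s) powr (2 * \<beta>)" unfolding z_def by (rule powr_mult)
    finally show ?thesis .
  qed
  finally have sin: "(sin (\<kappa> * t) - sin (\<kappa> * s))\<^sup>2 \<le> 4 * (\<kappa> powr (2 * \<beta>) * (t - s) powr (2 * \<beta>))" by simp
  have "(sqrt (kl_lambda T k) * (kl_e T k t - kl_e T k s))\<^sup>2 = (1 / \<kappa>)\<^sup>2 * ((sqrt (2 / T))\<^sup>2 * (sin (\<kappa> * t) - sin (\<kappa> * s))\<^sup>2)"
    unfolding sqrt_kl_lambda[OF T k] kl_e_freq[OF T k] \<kappa>_def[symmetric] power_mult_distrib[symmetric] by (simp only: right_diff_distrib)
  also have "\<dots> = \<kappa> powr (- 2) * (2 / T * (sin (\<kappa> * t) - sin (\<kappa> * s))\<^sup>2)"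
    using T \<kappa>0 by (simp add: power_divide powr_minus_2)
  also have "\<dots> \<le> \<kappa> powr (- 2) * (2 / T * (4 * (\<kappa> powr (2 * \<beta>) * (t - s) powr (2 * \<beta>))))"
    using T by (intro mult_left_mono sin) auto
  also have "\<dots> = 8 / T * (\<kappa> powr (- 2) * \<kappa> powr (2 * \<beta>)) * (t - s) powr (2 * \<beta>)" by simp
  also have "\<kappa> powr (- 2) * \<kappa> powr (2 * \<beta>) = \<kappa> powr (- 2 + 2 * \<beta>)" by (rule powr_add[symmetric])
  also have "8 / T * \<kappa> powr (- 2 + 2 * \<beta>) * (t - s) powr (2 * \<beta>) \<le> 8 / T * (T powr (2 - 2 * \<beta>) * real k powr (2 * \<beta> - 2)) * (t - s) powr (2 * \<beta>)"
  proof (intro mult_right_mono mult_left_mono)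
    have "\<kappa> powr (- 2 + 2 * \<beta>) \<le> (real k / T) powr (- 2 + 2 * \<beta>)" using \<kappa> k T \<beta> by (intro powr_mono2') auto
    also have "\<dots> = real k powr (- 2 + 2 * \<beta>) / T powr (- 2 + 2 * \<beta>)" by (rule powr_divide)
    also have "\<dots> = real k powr (- 2 + 2 * \<beta>) * T powr (- (- 2 + 2 * \<beta>))" by (simp only: powr_minus divide_inverse)
    finally show "\<kappa> powr (- 2 + 2 * \<beta>) \<le> T powr (2 - 2 * \<beta>) * real k powr (2 * \<beta> - 2)"
      by (simp add: mult.commute add.commute)
  qed (use T in auto)
  finally show ?thesis by (simp only: mult.assoc)
qed

text \<open>For N >= L the increment of the error is an independent centered sum over k <= N plus
  the increment of the Gaussian remainder after N terms. The sum is bounded uniformly in N by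
  \<open>indep_sum_even_moment\<close>, and the remainder disappears as N grows.\<close>

lemma increment_moment:
  assumes l: "1 \<le> l" and u: "0 < u" "u * real l < 1" and \<beta>: "0 < \<beta>" "\<beta> + u < 1 / 2" and \<epsilon>: "0 < \<epsilon>"
  shows "\<exists>C>0. \<exists>m0. \<forall>m\<ge>m0. \<forall>Xh. optimal_product_quantization M T X m Xh \<longrightarrow>
     (\<forall>s t. 0 \<le> s \<longrightarrow> s < t \<longrightarrow> t \<le> T \<longrightarrow>
        (\<integral>\<^sup>+\<omega>. ennreal (((X t \<omega> - Xh t \<omega>) - (X s \<omega> - Xh s \<omega>)) ^ (2 * l)) \<partial>M)
          \<le> ennreal (C * (ln (real m) powr (- 2 + \<epsilon>)) powr (u * real l) * (t - s) powr (2 * real l * \<beta>)))"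
proof -
  obtain C1 where C1: "0 < C1" and mom: "\<And>\<zeta> h \<delta> j. gauss M \<zeta> 1 \<Longrightarrow> h \<in> borel_measurable borel \<Longrightarrow> (\<forall>x. \<bar>h x\<bar> \<le> \<bar>x\<bar> + 4) \<Longrightarrow> 0 < \<delta> \<Longrightarrow>
     (\<integral>\<omega>. (h (\<zeta> \<omega>))\<^sup>2 \<partial>M) \<le> \<delta> \<Longrightarrow> 1 \<le> j \<Longrightarrow> j \<le> l \<Longrightarrow> (\<integral>\<omega>. h (\<zeta> \<omega>) ^ (2 * j) \<partial>M) \<le> C1 * \<delta> powr (u * real j)"
    using linear_growth_moment[OF l u] by blast
  obtain C2 m0 where C2: "0 < C2" and alloc: "\<And>m n L k. m0 \<le> m \<Longrightarrow> (\<forall>k. 1 \<le> n k) \<Longrightarrow> (\<forall>k>L. n k = 1) \<Longrightarrow> (\<Prod>k=1..L. n k) \<le> m \<Longrightarrow>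
     (\<forall>K n'. L \<le> K \<longrightarrow> (\<forall>k. 1 \<le> n' k) \<longrightarrow> (\<Prod>k=1..K. n' k) \<le> m \<longrightarrow>
        (\<Sum>k=1..K. kl_lambda T k * quant_err (n k)) \<le> (\<Sum>k=1..K. kl_lambda T k * quant_err (n' k))) \<Longrightarrow>
     1 \<le> k \<Longrightarrow> quant_err (n k) \<le> C2 * (real k)\<^sup>2 * ln (real m) powr (- 2 + \<epsilon>)"
    using optimal_allocation_bound[where e=quant_err, OF T quant_err_nonneg quant_err_rate \<epsilon>] by blast
  define D1 where "D1 = max 1 C1"
  \<comment> \<open>The exponent is below -1 exactly because \<beta> + u < 1/2.\<close>
  define Z where "Z = (\<Sum>k. real k powr (2 * \<beta> - 2 + 2 * u))"
  have sZ: "summable (\<lambda>k. real k powr (2 * \<beta> - 2 + 2 * u))" using \<beta> by (subst summable_real_powr_iff) auto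
  have Z0: "0 \<le> Z" unfolding Z_def using sZ by (intro suminf_nonneg) auto
  define Q where "Q = D1 * (8 / T * T powr (2 - 2 * \<beta>)) * C2 powr u"
  have Q0: "0 \<le> Q" unfolding Q_def D1_def using T by (intro mult_nonneg_nonneg) auto
  define C where "C = 9 ^ l * (mz_const l * (Q * Z)) ^ l + 1"
  have mz0: "0 \<le> mz_const l" using mz_const_ge1[of l] by linarith
  have C: "0 < C" unfolding C_def using mz0 Q0 Z0 by (intro add_nonneg_pos mult_nonneg_nonneg zero_le_power) auto
  show ?thesis
  proof (intro exI[of _ C] conjI C exI[of _ "max m0 3"] allI impI)
    fix m Xh s t
    assume m: "max m0 3 \<le> m" and opt: "optimal_product_quantization M T X m Xh" and st: "0 \<le> s" "s < t" "t \<le> T"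
    define P where "P = ln (real m) powr (- 2 + \<epsilon>)"
    have "0 < ln (real m)" using m by (intro ln_gt_zero) auto
    then have P: "0 < P" by (simp add: P_def)
    obtain n L g where n1: "\<forall>k. 1 \<le> n k" and nL: "\<forall>k>L. n k = 1" and pn: "(\<Prod>k=1..L. n k) \<le> m" and
      on: "\<forall>K n'. L \<le> K \<longrightarrow> (\<forall>k. 1 \<le> n' k) \<longrightarrow> (\<Prod>k=1..K. n' k) \<le> m \<longrightarrow>
        (\<Sum>k=1..K. kl_lambda T k * quant_err (n k)) \<le> (\<Sum>k=1..K. kl_lambda T k * quant_err (n' k))" and
      g': "\<And>k. 1 \<le> k \<Longrightarrow> g k \<in> borel_measurable borel" "\<And>k x. 1 \<le> k \<Longrightarrow> \<bar>g k x\<bar> \<le> \<bar>x\<bar> + 4"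
        "\<And>k. 1 \<le> k \<Longrightarrow> (\<integral>\<omega>. g k (\<xi> k \<omega>) \<partial>M) = 0" "\<And>k. 1 \<le> k \<Longrightarrow> (\<integral>\<omega>. (g k (\<xi> k \<omega>))\<^sup>2 \<partial>M) = quant_err (n k)" and
      Xh: "\<And>K \<omega> t. L \<le> K \<Longrightarrow> \<omega> \<in> space M \<Longrightarrow> t \<in> {0..T} \<Longrightarrow>
        Xh t \<omega> = (\<Sum>k=1..K. sqrt (kl_lambda T k) * (\<xi> k \<omega> - g k (\<xi> k \<omega>)) * kl_e T k t)"
      by (rule optimal_product_structure[OF opt], rule that, assumption+)
    have g: "g k \<in> borel_measurable borel \<and> (\<forall>x. \<bar>g k x\<bar> \<le> \<bar>x\<bar> + 4) \<and> (\<integral>\<omega>. g k (\<xi> k \<omega>) \<partial>M) = 0 \<and>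
        (\<integral>\<omega>. (g k (\<xi> k \<omega>))\<^sup>2 \<partial>M) = quant_err (n k)" if "1 \<le> k" for k
      using g'[OF that] by blast
    define a where "a k = sqrt (kl_lambda T k) * (kl_e T k t - kl_e T k s)" for k
    \<comment> \<open>The bound on the mean square error grows like k^2; it is harmless because it
      enters with the power u only.\<close>
    define \<delta> where "\<delta> k = C2 * (real k)\<^sup>2 * P" for k
    have \<delta>: "0 < \<delta> k" if "1 \<le> k" for k using that C2 P by (simp add: \<delta>_def)
    define b where "b k = D1 * (a k)\<^sup>2 * \<delta> k powr u" for k
    have b0: "0 \<le> b k" for k by (simp add: b_def D1_def)
    define Y where "Y k \<omega> = a k * g k (\<xi> k \<omega>)" for k \<omega>
    have int: "integrable M (\<lambda>\<omega>. g k (\<xi> k \<omega>) ^ i)" if "1 \<le> k" for k i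
      using linear_growth_integrable(1)[OF xi_gauss[OF that]] g[OF that] by blast
    have Ymom: "(\<integral>\<omega>. Y k \<omega> ^ (2 * j) \<partial>M) \<le> b k ^ j" if k: "1 \<le> k" and j: "1 \<le> j" "j \<le> l" for k j
    proof -
      have "quant_err (n k) \<le> \<delta> k" using alloc[OF _ n1 nL pn on k] m by (simp add: \<delta>_def P_def)
      then have "(\<integral>\<omega>. g k (\<xi> k \<omega>) ^ (2 * j) \<partial>M) \<le> C1 * \<delta> k powr (u * real j)"
        using g[OF k] \<delta>[OF k] j by (intro mom xi_gauss[OF k]) auto
      also have "\<dots> \<le> D1 ^ j * (\<delta> k powr u) ^ j"
      proof (intro mult_mono)
        have "C1 \<le> D1 ^ 1" by (simp add: D1_def)
        also have "\<dots> \<le> D1 ^ j" using j by (intro power_increasing) (auto simp: D1_def)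
        finally show "C1 \<le> D1 ^ j" .
        show "\<delta> k powr (u * real j) \<le> (\<delta> k powr u) ^ j" using \<delta>[OF k] by (simp add: powr_realpow[symmetric] powr_powr)
      qed (auto simp: D1_def)
      finally have "(a k ^ (2 * j)) * (\<integral>\<omega>. g k (\<xi> k \<omega>) ^ (2 * j) \<partial>M) \<le> (a k ^ (2 * j)) * (D1 ^ j * (\<delta> k powr u) ^ j)"
        by (intro mult_left_mono) (simp_all add: power_mult)
      also have "\<dots> = b k ^ j" unfolding b_def power_mult_distrib by (simp add: mult_ac flip: power_mult)
      finally show ?thesis unfolding Y_def power_mult_distrib by simp
    qed
    have bQ: "b k \<le> Q * P powr u * (t - s) powr (2 * \<beta>) * real k powr (2 * \<beta> - 2 + 2 * u)" if k: "1 \<le> k" for k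
    proof -
      have "\<delta> k powr u = C2 powr u * real k powr (2 * u) * P powr u"
        using C2 P k by (simp add: \<delta>_def powr_mult) (simp add: powr_powr flip: powr_numeral)
      moreover have "(a k)\<^sup>2 \<le> 8 / T * T powr (2 - 2 * \<beta>) * real k powr (2 * \<beta> - 2) * (t - s) powr (2 * \<beta>)"
        unfolding a_def using \<beta> u by (intro kl_increment_coeff[OF k]) (use st in auto)
      ultimately have "b k \<le> D1 * (8 / T * T powr (2 - 2 * \<beta>) * real k powr (2 * \<beta> - 2) * (t - s) powr (2 * \<beta>)) * (C2 powr u * real k powr (2 * u) * P powr u)"
        unfolding b_def by (simp only:) (intro mult_right_mono mult_left_mono, auto simp: D1_def)
      also have "\<dots> = Q * P powr u * (t - s) powr (2 * \<beta>) * (real k powr (2 * \<beta> - 2) * real k powr (2 * u))"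
        unfolding Q_def by (simp only: mult_ac)
      also have "real k powr (2 * \<beta> - 2) * real k powr (2 * u) = real k powr (2 * \<beta> - 2 + 2 * u)" by (rule powr_add[symmetric])
      finally show ?thesis .
    qed
    have sum_b: "(\<Sum>k=1..N. b k) \<le> Q * P powr u * (t - s) powr (2 * \<beta>) * Z" for N
    proof -
      have "(\<Sum>k=1..N. b k) \<le> (\<Sum>k=1..N. Q * P powr u * (t - s) powr (2 * \<beta>) * real k powr (2 * \<beta> - 2 + 2 * u))"
        using bQ by (intro sum_mono) auto
      also have "\<dots> = Q * P powr u * (t - s) powr (2 * \<beta>) * (\<Sum>k=1..N. real k powr (2 * \<beta> - 2 + 2 * u))"
        by (simp only: sum_distrib_left)
      also have "\<dots> \<le> Q * P powr u * (t - s) powr (2 * \<beta>) * Z"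
        unfolding Z_def using Q0 by (intro mult_left_mono sum_le_suminf sZ mult_nonneg_nonneg) auto
      finally show ?thesis .
    qed
    define S where "S N \<omega> = (\<Sum>k=1..N. Y k \<omega>)" for N \<omega>
    define Rm where "Rm N r \<omega> = X r \<omega> - (\<Sum>k=1..N. sqrt (kl_lambda T k) * kl_e T k r * \<xi> k \<omega>)" for N r \<omega>
    define V where "V N r = r - (\<Sum>k=1..N. (sqrt (kl_lambda T k) * kl_e T k r)\<^sup>2)" for N r
    define c where "c = (fact (2 * l) / (2 ^ l * fact l) :: real)"
    define B where "B = mz_const l * (Q * P powr u * (t - s) powr (2 * \<beta>) * Z)"
    have RG: "gauss M (Rm N r) (V N r)" if "r \<in> {0..T}" for N r
      unfolding Rm_def V_def by (rule kl_remainder_gauss[OF that])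
    have Sm: "integrable M (\<lambda>\<omega>. S N \<omega> ^ (2 * l))" "(\<integral>\<omega>. S N \<omega> ^ (2 * l) \<partial>M) \<le> B ^ l" for N
    proof -
      have ind: "indep_vars (\<lambda>_. borel) Y {1..N}"
        unfolding Y_def
      proof (rule indep_vars_compose2[OF xi_indep, of _ "\<lambda>k x. a k * g k x"])
        fix k assume "k \<in> {1..N}"
        then have "g k \<in> borel_measurable borel" using g by auto
        then show "(\<lambda>x. a k * g k x) \<in> borel_measurable borel" by simp
      qed
      have "(\<forall>k. integrable M (\<lambda>\<omega>. (\<Sum>i\<in>{1..N}. Y i \<omega>) ^ k)) \<and>
         (\<forall>j\<le>l. (\<integral>\<omega>. (\<Sum>i\<in>{1..N}. Y i \<omega>) ^ (2 * j) \<partial>M) \<le> (mz_const l * (\<Sum>i\<in>{1..N}. b i)) ^ j)"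
      proof (rule indep_sum_even_moment[OF _ ind])
        show "integrable M (\<lambda>\<omega>. Y i \<omega> ^ k)" if "i \<in> {1..N}" for i k
          unfolding Y_def power_mult_distrib using int[of i k] that by auto
        show "(\<integral>\<omega>. Y i \<omega> \<partial>M) = 0" if "i \<in> {1..N}" for i using g[of i] that by (simp add: Y_def)
      qed (use Ymom b0 in auto)
      then have i: "integrable M (\<lambda>\<omega>. S N \<omega> ^ (2 * l))" and le: "(\<integral>\<omega>. S N \<omega> ^ (2 * l) \<partial>M) \<le> (mz_const l * (\<Sum>i\<in>{1..N}. b i)) ^ l"
        unfolding S_def by auto
      show "integrable M (\<lambda>\<omega>. S N \<omega> ^ (2 * l))" by (rule i)
      have "(mz_const l * (\<Sum>i\<in>{1..N}. b i)) ^ l \<le> B ^ l"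
        unfolding B_def using mz0 b0 by (intro power_mono mult_left_mono sum_b mult_nonneg_nonneg sum_nonneg) auto
      then show "(\<integral>\<omega>. S N \<omega> ^ (2 * l) \<partial>M) \<le> B ^ l" using le by linarith
    qed
    define D where "D \<omega> = (X t \<omega> - Xh t \<omega>) - (X s \<omega> - Xh s \<omega>)" for \<omega>
    have tT: "t \<in> {0..T}" "s \<in> {0..T}" using st by auto
    \<comment> \<open>In the k-th term X contributes \<open>\<xi> k\<close> and the quantization
      \<open>\<xi> k - g k (\<xi> k)\<close>, so only \<open>g k (\<xi> k)\<close> is left; this
      includes the padded indices between L and N.\<close>
    have Deq: "D \<omega> = Rm N t \<omega> + - Rm N s \<omega> + S N \<omega>" if "L \<le> N" "\<omega> \<in> space M" for N \<omega>
      unfolding D_def Rm_def S_def Y_def a_def Xh[OF that tT(1)] Xh[OF that tT(2)]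
      by (simp add: sum_subtractf[symmetric] sum.distrib[symmetric] algebra_simps)
    have bound: "(\<integral>\<^sup>+\<omega>. ennreal (D \<omega> ^ (2 * l)) \<partial>M) \<le> ennreal (9 ^ l * (c * V N t ^ l + c * V N s ^ l + B ^ l))" if N: "L \<le> N" for N
    proof -
      have iR: "integrable M (\<lambda>\<omega>. Rm N r \<omega> ^ (2 * l))" "(\<integral>\<omega>. Rm N r \<omega> ^ (2 * l) \<partial>M) = c * V N r ^ l" if "r \<in> {0..T}" for r
        using gauss_moments(1,2)[OF RG[OF that]] by (auto simp: c_def)
      have "(\<integral>\<^sup>+\<omega>. ennreal (D \<omega> ^ (2 * l)) \<partial>M) \<le> (\<integral>\<^sup>+\<omega>. ennreal (9 ^ l * (Rm N t \<omega> ^ (2 * l) + Rm N s \<omega> ^ (2 * l) + S N \<omega> ^ (2 * l))) \<partial>M)"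
        using even_power_sum3[of "Rm N t _" "- Rm N s _" "S N _" l] Deq[OF N] by (intro nn_integral_mono ennreal_leI) auto
      also have "\<dots> = ennreal (\<integral>\<omega>. 9 ^ l * (Rm N t \<omega> ^ (2 * l) + Rm N s \<omega> ^ (2 * l) + S N \<omega> ^ (2 * l)) \<partial>M)"
        using iR(1)[OF tT(1)] iR(1)[OF tT(2)] Sm(1)[of N]
        by (intro nn_integral_eq_integral) (auto simp: power_mult intro!: AE_I2 mult_nonneg_nonneg add_nonneg_nonneg)
      also have "(\<integral>\<omega>. 9 ^ l * (Rm N t \<omega> ^ (2 * l) + Rm N s \<omega> ^ (2 * l) + S N \<omega> ^ (2 * l)) \<partial>M)
          = 9 ^ l * (c * V N t ^ l + c * V N s ^ l + (\<integral>\<omega>. S N \<omega> ^ (2 * l) \<partial>M))"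
        using iR[OF tT(1)] iR[OF tT(2)] Sm(1)[of N] by simp
      also have "ennreal \<dots> \<le> ennreal (9 ^ l * (c * V N t ^ l + c * V N s ^ l + B ^ l))"
        using Sm(2)[of N] by (intro ennreal_leI mult_left_mono add_left_mono) auto
      finally show ?thesis .
    qed
    have V0: "(\<lambda>N. V N r) \<longlonglongrightarrow> 0" if "r \<in> {0..T}" for r
      using tendsto_diff[OF tendsto_const mercer[OF T], of r r] that unfolding V_def by simp
    have lim: "(\<lambda>N. ennreal (9 ^ l * (c * V N t ^ l + c * V N s ^ l + B ^ l))) \<longlonglongrightarrow> ennreal (9 ^ l * (c * 0 ^ l + c * 0 ^ l + B ^ l))"
      by (intro tendsto_intros V0 tT)
    \<comment> \<open>The left side does not involve N, so letting N tend to infinity removes both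
      remainders, whose variances \<open>V N\<close> tend to 0.\<close>
    have "(\<integral>\<^sup>+\<omega>. ennreal (D \<omega> ^ (2 * l)) \<partial>M) \<le> ennreal (9 ^ l * (c * 0 ^ l + c * 0 ^ l + B ^ l))"
      by (rule LIMSEQ_le_const[OF lim]) (use bound in blast)
    also have "\<dots> = ennreal (9 ^ l * B ^ l)" using l by (simp add: power_0_left)
    also have "\<dots> \<le> ennreal (C * P powr (u * real l) * (t - s) powr (2 * real l * \<beta>))"
    proof (rule ennreal_leI)
      have "9 ^ l * B ^ l = 9 ^ l * (mz_const l * (Q * Z)) ^ l * ((P powr u) ^ l * ((t - s) powr (2 * \<beta>)) ^ l)"
        unfolding B_def power_mult_distrib by (simp only: mult_ac)
      also have "(P powr u) ^ l * ((t - s) powr (2 * \<beta>)) ^ l = P powr (u * real l) * (t - s) powr (2 * real l * \<beta>)"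
        using P st by (simp add: powr_realpow[symmetric] powr_powr mult_ac)
      also have "9 ^ l * (mz_const l * (Q * Z)) ^ l * (P powr (u * real l) * (t - s) powr (2 * real l * \<beta>))
          \<le> C * (P powr (u * real l) * (t - s) powr (2 * real l * \<beta>))"
        by (intro mult_right_mono) (auto simp: C_def)
      finally show "9 ^ l * B ^ l \<le> C * P powr (u * real l) * (t - s) powr (2 * real l * \<beta>)" by (simp only: mult.assoc)
    qed
    finally show "(\<integral>\<^sup>+\<omega>. ennreal (((X t \<omega> - Xh t \<omega>) - (X s \<omega> - Xh s \<omega>)) ^ (2 * l)) \<partial>M)
          \<le> ennreal (C * (ln (real m) powr (- 2 + \<epsilon>)) powr (u * real l) * (t - s) powr (2 * real l * \<beta>))"
      by (simp add: D_def P_def)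
  qed
qed

end

subsection \<open>Regularity of quantizations\<close>

text \<open>The carrier H has no sigma-algebra. The definition of an optimal quantization makes the
  finitely many level sets of \<open>Zh\<close> measurable instead, so composing with any real
  function gives a simple function.\<close>

lemma optimal_quantization_comp_measurable:
  fixes f :: "'h \<Rightarrow> real"
  assumes opt: "optimal_quantization M H \<delta> Z m Zh" and Z: "\<And>\<omega>. \<omega> \<in> space M \<Longrightarrow> Z \<omega> \<in> H"
  shows "(\<lambda>\<omega>. f (Zh \<omega>)) \<in> borel_measurable M"
proof (rule borel_measurable_simple_function)
  obtain \<alpha> \<pi> where \<alpha>: "\<alpha> \<in> codebooks H m" and \<pi>: "nearest_neighbour_projection H \<delta> \<alpha> \<pi>" "\<forall>\<omega>\<in>space M. Zh \<omega> = \<pi> (Z \<omega>)"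
    and ms: "\<forall>a\<in>\<alpha>. {\<omega>\<in>space M. Zh \<omega> = a} \<in> sets M"
    using opt unfolding optimal_quantization_def by blast
  have f\<alpha>: "finite \<alpha>" by (rule codebooksD[OF \<alpha>])
  have in\<alpha>: "\<omega> \<in> space M \<Longrightarrow> Zh \<omega> \<in> \<alpha>" for \<omega> using \<pi> Z by (auto simp: nearest_neighbour_projection_def)
  show "simple_function M (\<lambda>\<omega>. f (Zh \<omega>))"
    unfolding simple_function_def
  proof (intro conjI ballI)
    show "finite ((\<lambda>\<omega>. f (Zh \<omega>)) ` space M)" by (rule finite_subset[of _ "f ` \<alpha>"]) (use in\<alpha> f\<alpha> in auto)
    fix y
    have "(\<lambda>\<omega>. f (Zh \<omega>)) -` {y} \<inter> space M = (\<Union>a\<in>{a \<in> \<alpha>. f a = y}. {\<omega>\<in>space M. Zh \<omega> = a})" using in\<alpha> by auto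
    also have "\<dots> \<in> sets M" using f\<alpha> ms by (intro sets.finite_UN) auto
    finally show "(\<lambda>\<omega>. f (Zh \<omega>)) -` {y} \<inter> space M \<in> sets M" .
  qed
qed

context brownian begin

lemma kl_expansion_regular:
  assumes Xh: "\<And>\<omega> t. \<omega> \<in> space M \<Longrightarrow> t \<in> {0..T} \<Longrightarrow> Xh t \<omega> = (\<Sum>k=1..L. c k \<omega> * kl_e T k t)"
    and c: "\<And>k. k \<in> {1..L} \<Longrightarrow> c k \<in> borel_measurable M"
  shows "t \<in> {0..T} \<Longrightarrow> Xh t \<in> borel_measurable M" "\<omega> \<in> space M \<Longrightarrow> continuous_on {0..T} (\<lambda>t. Xh t \<omega>)"
proof -
  assume t: "t \<in> {0..T}"
  have "Xh t \<in> borel_measurable M \<longleftrightarrow> (\<lambda>\<omega>. \<Sum>k=1..L. c k \<omega> * kl_e T k t) \<in> borel_measurable M"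
    using Xh t by (intro measurable_cong) auto
  then show "Xh t \<in> borel_measurable M" using c by (simp add: borel_measurable_sum)
next
  assume \<omega>: "\<omega> \<in> space M"
  have "continuous_on {0..T} (\<lambda>t. Xh t \<omega>) \<longleftrightarrow> continuous_on {0..T} (\<lambda>t. \<Sum>k=1..L. c k \<omega> * kl_e T k t)"
    using Xh[OF \<omega>] by (intro continuous_on_cong) auto
  then show "continuous_on {0..T} (\<lambda>t. Xh t \<omega>)" by (auto intro!: continuous_intros kl_e_cont)
qed

lemma quantization_regular:
  assumes "product_quantization M T X m Xh \<or> optimal_functional_quantization M T X m Xh"
  shows "(\<forall>t\<in>{0..T}. Xh t \<in> borel_measurable M) \<and> (\<forall>\<omega>\<in>space M. continuous_on {0..T} (\<lambda>t. Xh t \<omega>))"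
  using assms
proof
  assume "product_quantization M T X m Xh"
  then obtain L n \<xi>h where L: "\<forall>k\<in>{1..L}. optimal_quantization M UNIV dist (\<xi> k) (n k) (\<xi>h k)"
    "\<forall>\<omega>\<in>space M. \<forall>t\<in>{0..T}. Xh t \<omega> = (\<Sum>k=1..L. sqrt (kl_lambda T k) * \<xi>h k \<omega> * kl_e T k t)"
    unfolding product_quantization_def by blast
  have "(\<lambda>\<omega>. sqrt (kl_lambda T k) * \<xi>h k \<omega>) \<in> borel_measurable M" if "k \<in> {1..L}" for k
    using optimal_quantization_comp_measurable[OF L(1)[rule_format, OF that], of "\<lambda>x. sqrt (kl_lambda T k) * x"] by simp
  then show ?thesis using kl_expansion_regular[where Xh=Xh and L=L and c="\<lambda>k \<omega>. sqrt (kl_lambda T k) * \<xi>h k \<omega>"] L(2) by blast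
next
  assume "optimal_functional_quantization M T X m Xh"
  then obtain l \<zeta>h where l: "optimal_quantization M (euclidean_carrier l) (euclidean_distance l)
          (\<lambda>\<omega>. \<lambda>k\<in>{1..l}. sqrt (kl_lambda T k) * \<xi> k \<omega>) m \<zeta>h"
    "\<forall>\<omega>\<in>space M. \<forall>t\<in>{0..T}. Xh t \<omega> = (\<Sum>k=1..l. \<zeta>h \<omega> k * kl_e T k t)"
    unfolding optimal_functional_quantization_def by blast
  have "(\<lambda>\<omega>. \<zeta>h \<omega> k) \<in> borel_measurable M" for k
    by (rule optimal_quantization_comp_measurable[OF l(1), of "\<lambda>z. z k"]) (simp add: euclidean_carrier_def)
  then show ?thesis using kl_expansion_regular[where Xh=Xh and L=l and c="\<lambda>k \<omega>. \<zeta>h \<omega> k"] l(2) by blast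
qed

end

subsection \<open>Convergence for stationary quantizers\<close>

lemma ennreal_tendsto_0I:
  fixes f :: "nat \<Rightarrow> ennreal"
  assumes "\<And>r::real. 0 < r \<Longrightarrow> \<forall>\<^sub>F n in sequentially. f n \<le> ennreal r"
  shows "f \<longlonglongrightarrow> 0"
proof (rule order_tendstoI)
  fix a :: ennreal assume "0 < a"
  then obtain b where b: "0 < b" "b < a" using dense by blast
  then obtain r where r: "0 \<le> r" "b = ennreal r" by (cases b) auto
  with b have "0 < r" by (cases "r = 0") auto
  from assms[OF this] show "\<forall>\<^sub>F n in sequentially. f n < a"
    by eventually_elim (use r b in auto)
qed simp

text \<open>No measurability is required of \<open>f\<close>.\<close>

lemma nn_integral_le_add:
  fixes u g f :: "'a \<Rightarrow> ennreal"
  assumes [measurable]: "u \<in> borel_measurable M" "g \<in> borel_measurable M"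
    and le: "\<And>\<omega>. \<omega> \<in> space M \<Longrightarrow> u \<omega> \<le> f \<omega> + g \<omega>"
  shows "(\<integral>\<^sup>+\<omega>. u \<omega> \<partial>M) \<le> (\<integral>\<^sup>+\<omega>. f \<omega> \<partial>M) + (\<integral>\<^sup>+\<omega>. g \<omega> \<partial>M)"
proof -
  define w where "w \<omega> = (if g \<omega> = \<top> then 0 else u \<omega> - g \<omega>)" for \<omega>
  have [measurable]: "w \<in> borel_measurable M" unfolding w_def by measurable
  have "u \<omega> \<le> w \<omega> + g \<omega>" for \<omega>
  proof (cases "g \<omega> \<le> u \<omega>")
    case True
    then show ?thesis by (auto simp: w_def diff_add_cancel_ennreal)
  next
    case False
    then show ?thesis using add_increasing[of "w \<omega>" "u \<omega>" "g \<omega>"] by auto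
  qed
  then have "(\<integral>\<^sup>+\<omega>. u \<omega> \<partial>M) \<le> (\<integral>\<^sup>+\<omega>. w \<omega> + g \<omega> \<partial>M)" by (intro nn_integral_mono) auto
  also have "\<dots> = (\<integral>\<^sup>+\<omega>. w \<omega> \<partial>M) + (\<integral>\<^sup>+\<omega>. g \<omega> \<partial>M)" by (rule nn_integral_add) measurable
  also have "(\<integral>\<^sup>+\<omega>. w \<omega> \<partial>M) \<le> (\<integral>\<^sup>+\<omega>. f \<omega> \<partial>M)"
    using le by (intro nn_integral_mono) (auto simp: w_def ennreal_minus_le_iff add.commute)
  finally show ?thesis by simp
qed

lemma even_power_diff_le:
  fixes p q :: real
  shows "(p - q) ^ (2 * l) \<le> 4 ^ l * (p ^ (2 * l) + q ^ (2 * l))"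
proof -
  define m where "m = max \<bar>p\<bar> \<bar>q\<bar>"
  have "(p - q) ^ (2 * l) = \<bar>p - q\<bar> ^ (2 * l)" by (simp add: power_even_abs)
  also have "\<dots> \<le> (2 * m) ^ (2 * l)" by (intro power_mono) (auto simp: m_def)
  also have "\<dots> = 4 ^ l * m ^ (2 * l)" by (simp add: power_mult_distrib power_mult)
  also have "m ^ (2 * l) \<le> p ^ (2 * l) + q ^ (2 * l)"
  proof -
    have nn: "0 \<le> p ^ (2 * l)" "0 \<le> q ^ (2 * l)" by (simp_all add: power_mult)
    have "m = \<bar>p\<bar> \<or> m = \<bar>q\<bar>" unfolding m_def by linarith
    then show ?thesis using nn by (elim disjE) (simp_all add: power_even_abs)
  qed
  finally show ?thesis by simp
qed

context brownian begin

lemma X_diff_gauss: "0 \<le> s \<Longrightarrow> s \<le> t \<Longrightarrow> t \<le> T \<Longrightarrow> gauss M (\<lambda>\<omega>. X t \<omega> - X s \<omega>) (t - s)"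
  using X_increment_gauss[of s t] by (cases "s = t") (auto simp: gauss_def prob_space)

text \<open>4^l comes from \<open>even_power_diff_le\<close>, 2 from the increments of X and of Xh,
  whose moments have the same bound, and the quotient is the moment of order 2l of a standard normal
  variable.\<close>

definition incr_const :: "nat \<Rightarrow> real" where
  "incr_const l = 4 ^ l * 2 * (fact (2 * l) / (2 ^ l * fact l))"

text \<open>By stationarity and Jensen's inequality, increments of \<open>Xh\<close> have at most the moments of those of \<open>X\<close>.\<close>

lemma stationary_increment_moment:
  assumes sub: "subalgebra M F"
    and Xm: "\<And>t. t \<in> {0..T} \<Longrightarrow> Xh t \<in> borel_measurable M"
    and st: "\<And>t. t \<in> {0..T} \<Longrightarrow> AE \<omega> in M. Xh t \<omega> = real_cond_exp M F (X t) \<omega>"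
    and t: "0 \<le> s" "s \<le> t" "t \<le> T"
  shows "integrable M (\<lambda>\<omega>. ((X t \<omega> - Xh t \<omega>) - (X s \<omega> - Xh s \<omega>)) ^ (2 * l))"
    and "(\<integral>\<omega>. ((X t \<omega> - Xh t \<omega>) - (X s \<omega> - Xh s \<omega>)) ^ (2 * l) \<partial>M) \<le> incr_const l * (t - s) ^ l"
proof -
  interpret finite_measure_subalgebra M F by unfold_locales (rule sub)
  have tT: "t \<in> {0..T}" "s \<in> {0..T}" using t by auto
  note [measurable] = X_measurable[OF tT(1)] X_measurable[OF tT(2)] Xm[OF tT(1)] Xm[OF tT(2)]
  define V where "V \<omega> = X t \<omega> - X s \<omega>" for \<omega>
  define Vh where "Vh \<omega> = Xh t \<omega> - Xh s \<omega>" for \<omega>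
  have gV: "gauss M V (t - s)" unfolding V_def by (rule X_diff_gauss[OF t])
  note mV = gauss_moments[OF gV]
  have iX: "integrable M (X r)" if "r \<in> {0..T}" for r using gauss_moments(1)[OF X_gauss[OF that], of 1] by simp
  have iV: "integrable M V" using mV(1)[of 1] by simp
  have "AE \<omega> in M. real_cond_exp M F V \<omega> = real_cond_exp M F (X t) \<omega> - real_cond_exp M F (X s) \<omega>"
    unfolding V_def using iX[OF tT(1)] iX[OF tT(2)] by (rule real_cond_exp_diff)
  with st[OF tT(1)] st[OF tT(2)] have Vh: "AE \<omega> in M. Vh \<omega> = real_cond_exp M F V \<omega>"
    unfolding Vh_def by eventually_elim simp
  have conv: "convex_on UNIV (\<lambda>x::real. x ^ (2 * l))"
  proof (rule convex_on_realI[where f'="\<lambda>x. real (2 * l) * x ^ (2 * l - 1)"])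
    show "real (2 * l) * x ^ (2 * l - 1) \<le> real (2 * l) * y ^ (2 * l - 1)" if "x \<le> y" for x y :: real
      using that by (cases "l = 0") (auto intro!: mult_left_mono power_mono_odd)
  qed (auto intro!: derivative_eq_intros)
  have J: "AE \<omega> in M. real_cond_exp M F V \<omega> ^ (2 * l) \<le> real_cond_exp M F (\<lambda>\<omega>. V \<omega> ^ (2 * l)) \<omega>"
    by (rule real_cond_exp_jensens_inequality(2)[OF iV, where I=UNIV]) (use mV(1) conv in auto)
  have ic: "integrable M (real_cond_exp M F (\<lambda>\<omega>. V \<omega> ^ (2 * l)))" "(\<integral>\<omega>. real_cond_exp M F (\<lambda>\<omega>. V \<omega> ^ (2 * l)) \<omega> \<partial>M) = (\<integral>\<omega>. V \<omega> ^ (2 * l) \<partial>M)"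
    using real_cond_exp_int[OF mV(1)] by auto
  have Vhm[measurable]: "Vh \<in> borel_measurable M" unfolding Vh_def by measurable
  have le: "AE \<omega> in M. Vh \<omega> ^ (2 * l) \<le> real_cond_exp M F (\<lambda>\<omega>. V \<omega> ^ (2 * l)) \<omega>"
    using Vh J by eventually_elim simp
  have iVh: "integrable M (\<lambda>\<omega>. Vh \<omega> ^ (2 * l))"
    by (rule Bochner_Integration.integrable_bound[OF ic(1)])
      (use le in \<open>auto elim!: eventually_mono simp: power_mult intro: order_trans[OF _ abs_ge_self]\<close>)
  have eVh: "(\<integral>\<omega>. Vh \<omega> ^ (2 * l) \<partial>M) \<le> (\<integral>\<omega>. V \<omega> ^ (2 * l) \<partial>M)"
    using integral_mono_AE[OF iVh ic(1) le] ic(2) by simp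
  have eq: "(X t \<omega> - Xh t \<omega>) - (X s \<omega> - Xh s \<omega>) = V \<omega> - Vh \<omega>" for \<omega> by (simp add: V_def Vh_def)
  have pt: "(V \<omega> - Vh \<omega>) ^ (2 * l) \<le> 4 ^ l * (V \<omega> ^ (2 * l) + Vh \<omega> ^ (2 * l))" for \<omega> by (rule even_power_diff_le)
  have iB: "integrable M (\<lambda>\<omega>. 4 ^ l * (V \<omega> ^ (2 * l) + Vh \<omega> ^ (2 * l)))" using mV(1)[of "2 * l"] iVh by auto
  have Vm[measurable]: "V \<in> borel_measurable M" unfolding V_def by measurable
  have i: "integrable M (\<lambda>\<omega>. (V \<omega> - Vh \<omega>) ^ (2 * l))"
    by (rule Bochner_Integration.integrable_bound[OF iB]) (use pt in \<open>auto simp: power_mult intro!: AE_I2 intro: order_trans[OF _ abs_ge_self]\<close>)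
  then show "integrable M (\<lambda>\<omega>. ((X t \<omega> - Xh t \<omega>) - (X s \<omega> - Xh s \<omega>)) ^ (2 * l))" unfolding eq .
  have "(\<integral>\<omega>. (V \<omega> - Vh \<omega>) ^ (2 * l) \<partial>M) \<le> (\<integral>\<omega>. 4 ^ l * (V \<omega> ^ (2 * l) + Vh \<omega> ^ (2 * l)) \<partial>M)"
    by (intro integral_mono i iB pt)
  also have "\<dots> = 4 ^ l * ((\<integral>\<omega>. V \<omega> ^ (2 * l) \<partial>M) + (\<integral>\<omega>. Vh \<omega> ^ (2 * l) \<partial>M))"
    using mV(1)[of "2 * l"] iVh by simp
  also have "\<dots> \<le> 4 ^ l * ((\<integral>\<omega>. V \<omega> ^ (2 * l) \<partial>M) + (\<integral>\<omega>. V \<omega> ^ (2 * l) \<partial>M))"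
    using eVh by (intro mult_left_mono) auto
  also have "\<dots> = incr_const l * (t - s) ^ l" unfolding mV(2) incr_const_def by (simp add: mult_ac)
  finally show "(\<integral>\<omega>. ((X t \<omega> - Xh t \<omega>) - (X s \<omega> - Xh s \<omega>)) ^ (2 * l) \<partial>M) \<le> incr_const l * (t - s) ^ l" unfolding eq .
qed

end

text \<open>The mean square error at a fixed time is controlled by the one averaged over time, because the
  path of \<open>D\<close> does not vary much over a short interval \<open>I\<close> around that time.\<close>

lemma (in prob_space) pointwise_mean_square:
  assumes T: "0 < T" and A: "0 < A" and r: "0 < r"
  shows "\<exists>\<epsilon>>0. \<forall>D. (\<forall>t\<in>{0..T}. D t \<in> borel_measurable M) \<longrightarrow> (\<forall>\<omega>\<in>space M. continuous_on {0..T} (\<lambda>t. D t \<omega>)) \<longrightarrow>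
     (\<forall>s t. 0 \<le> s \<longrightarrow> s < t \<longrightarrow> t \<le> T \<longrightarrow> (\<integral>\<^sup>+\<omega>. ennreal ((D t \<omega> - D s \<omega>) ^ (2 * 3)) \<partial>M) \<le> ennreal (A * (t - s) powr 3)) \<longrightarrow>
     (\<integral>\<^sup>+\<omega>. (\<integral>\<^sup>+t\<in>{0..T}. ennreal ((D t \<omega>)\<^sup>2) \<partial>lborel) \<partial>M) \<le> ennreal \<epsilon> \<longrightarrow>
     (\<forall>t\<in>{0..T}. (\<integral>\<^sup>+\<omega>. ennreal ((D t \<omega>)\<^sup>2) \<partial>M) \<le> ennreal r)"
proof -
  \<comment> \<open>Sixth moments with exponent b = 3, as \<open>stationary_increment_moment\<close>
    gives for l = 3, leave room for the Hoelder exponent 1/4, since 1 + 6/4 < 3.\<close>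
  have ll: "(1::nat) \<le> 3" "1 + 2 * real 3 * (1 / 4) < (3::real)" "(0::real) < 1 / 4" by simp_all
  from kolmogorov_modulus[OF T ll(3,1,2)] obtain C where C: "0 < C" and mod: "\<And>X K. 0 \<le> K \<Longrightarrow> (\<forall>t\<in>{0..T}. X t \<in> borel_measurable M) \<Longrightarrow>
     (\<forall>\<omega>\<in>space M. continuous_on {0..T} (\<lambda>t. X t \<omega>)) \<Longrightarrow>
     (\<forall>s t. 0 \<le> s \<longrightarrow> s < t \<longrightarrow> t \<le> T \<longrightarrow> (\<integral>\<^sup>+\<omega>. ennreal ((X t \<omega> - X s \<omega>) ^ (2 * 3)) \<partial>M) \<le> ennreal (K * (t - s) powr 3)) \<Longrightarrow>
     (\<exists>S\<in>borel_measurable M. (\<integral>\<^sup>+\<omega>. S \<omega> \<partial>M) \<le> ennreal (C * K) \<and>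
        (\<forall>\<omega>\<in>space M. \<forall>s t. 0 \<le> s \<longrightarrow> s < t \<longrightarrow> t \<le> T \<longrightarrow>
           ennreal ((X t \<omega> - X s \<omega>) ^ (2 * 3)) \<le> S \<omega> * ennreal ((t - s) powr (2 * real 3 * (1 / 4)))))"
    by blast
  define B where "B = 2 * (1 + C * A)"
  have B: "0 < B" using C A by (simp add: B_def add_pos_pos)
  \<comment> \<open>The interval length \<eta> makes the oscillation contribute at most r/2;
    afterwards \<epsilon> = \<eta> r / 4 makes the time average over such an interval contribute at
    most r/2.\<close>
  define \<eta> where "\<eta> = min T ((r / (2 * B))\<^sup>2)"
  have \<eta>: "0 < \<eta>" "\<eta> \<le> T" using T r B by (auto simp: \<eta>_def)
  have "sqrt \<eta> \<le> sqrt ((r / (2 * B))\<^sup>2)" unfolding \<eta>_def by (intro real_sqrt_le_mono) simp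
  also have "\<dots> = r / (2 * B)" using r B by simp
  finally have sq: "B * sqrt \<eta> \<le> r / 2" using B by (simp add: field_simps)
  define \<epsilon> where "\<epsilon> = \<eta> * r / 4"
  have \<epsilon>: "0 < \<epsilon>" using \<eta> r by (simp add: \<epsilon>_def)
  show ?thesis
  proof (intro exI[of _ \<epsilon>] conjI \<epsilon> allI impI ballI)
    fix D t
    assume Dm: "\<forall>t\<in>{0..T}. D t \<in> borel_measurable M" and Dc: "\<forall>\<omega>\<in>space M. continuous_on {0..T} (\<lambda>t. D t \<omega>)"
      and mom: "\<forall>s t. 0 \<le> s \<longrightarrow> s < t \<longrightarrow> t \<le> T \<longrightarrow> (\<integral>\<^sup>+\<omega>. ennreal ((D t \<omega> - D s \<omega>) ^ (2 * 3)) \<partial>M) \<le> ennreal (A * (t - s) powr 3)"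
      and small: "(\<integral>\<^sup>+\<omega>. (\<integral>\<^sup>+t\<in>{0..T}. ennreal ((D t \<omega>)\<^sup>2) \<partial>lborel) \<partial>M) \<le> ennreal \<epsilon>" and t: "t \<in> {0..T}"
    have "\<exists>S\<in>borel_measurable M. (\<integral>\<^sup>+\<omega>. S \<omega> \<partial>M) \<le> ennreal (C * A) \<and>
        (\<forall>\<omega>\<in>space M. \<forall>s t. 0 \<le> s \<longrightarrow> s < t \<longrightarrow> t \<le> T \<longrightarrow>
           ennreal ((D t \<omega> - D s \<omega>) ^ (2 * 3)) \<le> S \<omega> * ennreal ((t - s) powr (2 * real 3 * (1 / 4))))"
      by (rule mod[OF less_imp_le[OF A] Dm Dc mom])
    then obtain S where Sm[measurable]: "S \<in> borel_measurable M" and Si: "(\<integral>\<^sup>+\<omega>. S \<omega> \<partial>M) \<le> ennreal (C * A)"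
      and Sb: "\<And>\<omega> s t. \<omega> \<in> space M \<Longrightarrow> 0 \<le> s \<Longrightarrow> s < t \<Longrightarrow> t \<le> T \<Longrightarrow>
           ennreal ((D t \<omega> - D s \<omega>) ^ (2 * 3)) \<le> S \<omega> * ennreal ((t - s) powr (2 * real 3 * (1 / 4)))" by blast
    \<comment> \<open>The interval of length \<eta> ends at t, or starts at 0 if that would leave
      [0, T].\<close>
    define a where "a = max 0 (t - \<eta>)"
    define I where "I = {a..a + \<eta>}"
    have I: "I \<subseteq> {0..T}" "t \<in> I" using t \<eta> by (auto simp: I_def a_def)
    have near: "\<bar>t - s\<bar> \<le> \<eta>" if "s \<in> I" for s using that t \<eta> by (auto simp: I_def a_def max_def abs_le_iff split: if_splits)
    have diff: "ennreal ((D t \<omega> - D s \<omega>)\<^sup>2) \<le> (1 + S \<omega>) * ennreal (sqrt \<eta>)" if \<omega>: "\<omega> \<in> space M" and s: "s \<in> I" for \<omega> s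
    proof (cases "S \<omega> = \<infinity>")
      case True
      then show ?thesis using \<eta> by (simp add: ennreal_top_mult)
    next
      case False
      then obtain z where z: "0 \<le> z" "S \<omega> = ennreal z" by (cases "S \<omega>") auto
      have sT: "s \<in> {0..T}" using I s by auto
      have "(D t \<omega> - D s \<omega>) ^ 6 \<le> z * \<bar>t - s\<bar> powr (3 / 2)"
      proof -
        consider "s < t" | "t < s" | "s = t" by linarith
        then show ?thesis
        proof cases
          case 1
          from Sb[OF \<omega>, of s t] 1 t sT z show ?thesis by (simp add: ennreal_mult[symmetric])
        next
          case 2
          from Sb[OF \<omega>, of t s] 2 t sT z show ?thesis by (simp add: ennreal_mult[symmetric] power_even_abs_numeral abs_minus_commute power2_commute[of "D s \<omega>"])
            (metis (no_types) even_numeral power_minus_even minus_diff_eq)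
        qed simp
      qed
      \<comment> \<open>Enlarging z to (1 + z)^3 makes the bound a perfect cube. After taking the
        cube root it is linear in z, so the first moment of \<open>S\<close> is enough.\<close>
      also have "\<dots> \<le> (1 + z) ^ 3 * (sqrt \<eta>) ^ 3"
      proof (intro mult_mono)
        have "z \<le> 1 + z" "1 + z \<le> (1 + z) ^ 3" using z by (auto intro: self_le_power)
        then show "z \<le> (1 + z) ^ 3" by linarith
        have "\<bar>t - s\<bar> powr (3 / 2) \<le> \<eta> powr (3 / 2)" using near[OF s] by (intro powr_mono2) auto
        also have "\<dots> = (sqrt \<eta>) ^ 3" using \<eta> by (simp add: powr_half_sqrt[symmetric] powr_realpow[symmetric] powr_powr)
        finally show "\<bar>t - s\<bar> powr (3 / 2) \<le> (sqrt \<eta>) ^ 3" .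
      qed (use z in auto)
      finally have "((D t \<omega> - D s \<omega>)\<^sup>2) ^ 3 \<le> ((1 + z) * sqrt \<eta>) ^ 3" by (simp add: power_mult_distrib flip: power_mult)
      then have "(D t \<omega> - D s \<omega>)\<^sup>2 \<le> (1 + z) * sqrt \<eta>" using z \<eta> by (subst (asm) power_mono_iff) auto
      then have "ennreal ((D t \<omega> - D s \<omega>)\<^sup>2) \<le> ennreal ((1 + z) * sqrt \<eta>)" by (rule ennreal_leI)
      also have "\<dots> = (1 + S \<omega>) * ennreal (sqrt \<eta>)" using z \<eta> by (simp add: ennreal_mult ennreal_1[symmetric] del: ennreal_1)
      finally show ?thesis .
    qed
    define f where "f \<omega> = (\<integral>\<^sup>+t\<in>{0..T}. ennreal ((D t \<omega>)\<^sup>2) \<partial>lborel)" for \<omega>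
    define g where "g \<omega> = ennreal \<eta> * ((1 + S \<omega>) * ennreal (sqrt \<eta>))" for \<omega>
    have le: "ennreal (\<eta> / 2) * ennreal ((D t \<omega>)\<^sup>2) \<le> f \<omega> + g \<omega>" if \<omega>: "\<omega> \<in> space M" for \<omega>
    proof -
      define c where "c = (1 + S \<omega>) * ennreal (sqrt \<eta>)"
      have sp: "ennreal ((D t \<omega>)\<^sup>2 / 2) \<le> ennreal ((D s \<omega>)\<^sup>2) + c" if s: "s \<in> I" for s
      proof -
        have "(D t \<omega>)\<^sup>2 / 2 \<le> (D s \<omega>)\<^sup>2 + (D t \<omega> - D s \<omega>)\<^sup>2"
          using zero_le_power2[of "D t \<omega> - 2 * D s \<omega>"] by (simp add: power2_eq_square algebra_simps)
        then have "ennreal ((D t \<omega>)\<^sup>2 / 2) \<le> ennreal ((D s \<omega>)\<^sup>2 + (D t \<omega> - D s \<omega>)\<^sup>2)" by (rule ennreal_leI)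
        also have "\<dots> = ennreal ((D s \<omega>)\<^sup>2) + ennreal ((D t \<omega> - D s \<omega>)\<^sup>2)" by (rule ennreal_plus) auto
        also have "\<dots> \<le> ennreal ((D s \<omega>)\<^sup>2) + c" unfolding c_def by (intro add_left_mono diff[OF \<omega> s])
        finally show ?thesis .
      qed
      have em: "emeasure lborel I = ennreal \<eta>" using \<eta> by (simp add: I_def)
      have cD: "continuous_on {0..T} (\<lambda>s. (D s \<omega>)\<^sup>2)" using Dc \<omega> by (intro continuous_intros) auto
      have mD: "(\<lambda>s. ennreal ((D s \<omega>)\<^sup>2) * indicator {0..T} s) \<in> borel_measurable lborel"
      proof -
        have "(\<lambda>s. ennreal (indicator {0..T} s *\<^sub>R (D s \<omega>)\<^sup>2)) \<in> borel_measurable lborel"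
          using borel_measurable_continuous_on_indicator[OF _ cD] by auto
        also have "(\<lambda>s. ennreal (indicator {0..T} s *\<^sub>R (D s \<omega>)\<^sup>2)) = (\<lambda>s. ennreal ((D s \<omega>)\<^sup>2) * indicator {0..T} s)"
          by (auto simp: indicator_def)
        finally show ?thesis .
      qed
      have "ennreal (\<eta> / 2) * ennreal ((D t \<omega>)\<^sup>2) = ennreal ((D t \<omega>)\<^sup>2 / 2) * emeasure lborel I"
        unfolding em using \<eta> by (simp add: ennreal_mult[symmetric] mult.commute)
      also have "\<dots> = (\<integral>\<^sup>+s. ennreal ((D t \<omega>)\<^sup>2 / 2) * indicator I s \<partial>lborel)"
        by (rule nn_integral_cmult_indicator[symmetric]) (simp add: I_def)
      also have "\<dots> \<le> (\<integral>\<^sup>+s. ennreal ((D s \<omega>)\<^sup>2) * indicator {0..T} s + c * indicator I s \<partial>lborel)"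
        using sp I(1) by (intro nn_integral_mono) (auto simp: indicator_def)
      also have "\<dots> = f \<omega> + (\<integral>\<^sup>+s. c * indicator I s \<partial>lborel)"
        unfolding f_def using mD by (intro nn_integral_add) (auto simp: I_def)
      also have "(\<integral>\<^sup>+s. c * indicator I s \<partial>lborel) = c * ennreal \<eta>"
        unfolding em[symmetric] by (rule nn_integral_cmult_indicator) (simp add: I_def)
      finally show ?thesis by (simp add: g_def c_def mult.commute)
    qed
    have Dtm[measurable]: "D t \<in> borel_measurable M" using Dm t by blast
    have gm: "g \<in> borel_measurable M" unfolding g_def by measurable
    have "ennreal (\<eta> / 2) * (\<integral>\<^sup>+\<omega>. ennreal ((D t \<omega>)\<^sup>2) \<partial>M) = (\<integral>\<^sup>+\<omega>. ennreal (\<eta> / 2) * ennreal ((D t \<omega>)\<^sup>2) \<partial>M)"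
      by (rule nn_integral_cmult[symmetric]) measurable
    also have "\<dots> \<le> (\<integral>\<^sup>+\<omega>. f \<omega> \<partial>M) + (\<integral>\<^sup>+\<omega>. g \<omega> \<partial>M)"
      by (rule nn_integral_le_add[OF _ gm le]) measurable
    also have "(\<integral>\<^sup>+\<omega>. g \<omega> \<partial>M) = ennreal \<eta> * ((1 + (\<integral>\<^sup>+\<omega>. S \<omega> \<partial>M)) * ennreal (sqrt \<eta>))"
      unfolding g_def by (simp add: nn_integral_cmult nn_integral_multc nn_integral_add emeasure_space_1)
    also have "\<dots> \<le> ennreal \<eta> * ((1 + ennreal (C * A)) * ennreal (sqrt \<eta>))"
      by (intro mult_left_mono mult_right_mono add_left_mono Si) auto
    also have "\<dots> = ennreal (\<eta> * ((1 + C * A) * sqrt \<eta>))"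
      using C A \<eta> by (simp add: ennreal_mult ennreal_1[symmetric] del: ennreal_1)
    finally have "ennreal (\<eta> / 2) * (\<integral>\<^sup>+\<omega>. ennreal ((D t \<omega>)\<^sup>2) \<partial>M) \<le> (\<integral>\<^sup>+\<omega>. f \<omega> \<partial>M) + ennreal (\<eta> * ((1 + C * A) * sqrt \<eta>))"
      by (simp add: add_left_mono)
    also have "\<dots> \<le> ennreal \<epsilon> + ennreal (\<eta> * ((1 + C * A) * sqrt \<eta>))" using small unfolding f_def by (rule add_right_mono)
    also have "\<dots> = ennreal (\<epsilon> + \<eta> * ((1 + C * A) * sqrt \<eta>))" using \<epsilon> C A \<eta> by (subst ennreal_plus) auto
    also have "\<dots> \<le> ennreal (\<eta> / 2 * r)"
    proof (rule ennreal_leI)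
      have "\<eta> * ((1 + C * A) * sqrt \<eta>) = \<eta> / 2 * (B * sqrt \<eta>)" by (simp add: B_def)
      also have "\<dots> \<le> \<eta> / 2 * (r / 2)" using sq \<eta> by (intro mult_left_mono) auto
      finally show "\<epsilon> + \<eta> * ((1 + C * A) * sqrt \<eta>) \<le> \<eta> / 2 * r" by (simp add: \<epsilon>_def)
    qed
    also have "\<dots> = ennreal (\<eta> / 2) * ennreal r" using \<eta> r by (intro ennreal_mult) auto
    finally show "(\<integral>\<^sup>+\<omega>. ennreal ((D t \<omega>)\<^sup>2) \<partial>M) \<le> ennreal r"
      using \<eta> by (subst (asm) ennreal_mult_le_mult_iff) auto
  qed
qed

lemma generated_algebra_subalgebra:
  fixes Y :: "real \<Rightarrow> 'a \<Rightarrow> real ^ 'd::finite"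
  assumes Y: "\<And>t i. t \<in> {0..T} \<Longrightarrow> (\<lambda>\<omega>. Y t \<omega> $ i) \<in> borel_measurable M"
  shows "subalgebra M (generated_algebra M T Y)"
proof -
  have "Y t \<in> borel_measurable M" if "t \<in> {0..T}" for t
    using Y[OF that] by (subst borel_measurable_euclidean_space) (auto simp: Basis_vec_def inner_axis)
  then have "path_on T Y \<in> measurable M (PiM {0..T} (\<lambda>_. borel))"
    unfolding path_on_def[abs_def] by (intro measurable_restrict)
  then show ?thesis
    unfolding subalgebra_def generated_algebra_def by (auto dest: sets_image_in_sets[OF refl])
qed

context brownian begin

lemma incr_const_pos: "0 < incr_const l"
  by (simp add: incr_const_def)

text \<open>\<open>even_power_split\<close> is used with a threshold proportional to sqrt(h), the
  natural size of an increment over a time h. The moment of order 2l + 2 then contributes h^l B /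
  \<mu>^2, and the mean square contributes h^(l-1) times a quantity that is as small as desired but
  carries no further power of h. This is why one power of h is lost.\<close>

lemma stationary_small_increment_moment:
  assumes l: "1 \<le> l" and K: "0 < K"
  shows "\<exists>\<epsilon>>0. \<forall>F Xh. subalgebra M F \<longrightarrow> (\<forall>t\<in>{0..T}. Xh t \<in> borel_measurable M) \<longrightarrow>
     (\<forall>\<omega>\<in>space M. continuous_on {0..T} (\<lambda>t. Xh t \<omega>)) \<longrightarrow>
     (\<forall>t\<in>{0..T}. AE \<omega> in M. Xh t \<omega> = real_cond_exp M F (X t) \<omega>) \<longrightarrow>
     (\<integral>\<^sup>+\<omega>. (\<integral>\<^sup>+t\<in>{0..T}. ennreal ((X t \<omega> - Xh t \<omega>)\<^sup>2) \<partial>lborel) \<partial>M) \<le> ennreal \<epsilon> \<longrightarrow>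
     (\<forall>s t. 0 \<le> s \<longrightarrow> s < t \<longrightarrow> t \<le> T \<longrightarrow>
        (\<integral>\<^sup>+\<omega>. ennreal (((X t \<omega> - Xh t \<omega>) - (X s \<omega> - Xh s \<omega>)) ^ (2 * l)) \<partial>M) \<le> ennreal (K * (t - s) ^ (l - 1)))"
proof -
  define B where "B = incr_const (l + 1)"
  have B: "0 < B" by (simp add: B_def incr_const_pos)
  \<comment> \<open>A large \<mu> reduces the contribution of the high moment to K/2; with \<mu>
    fixed, r is chosen so that the mean square contributes the other K/2.\<close>
  define \<mu> where "\<mu> = sqrt (2 * B * T / K)"
  have \<mu>: "0 < \<mu>" using B T K by (simp add: \<mu>_def)
  have \<mu>2: "B * T / \<mu>\<^sup>2 = K / 2" using B T K by (simp add: \<mu>_def field_simps)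
  define r where "r = K / (8 * \<mu> ^ (2 * l - 2))"
  have r: "0 < r" using K \<mu> by (simp add: r_def)
  have \<mu>r: "\<mu> ^ (2 * l - 2) * (4 * r) = K / 2" using \<mu> by (simp add: r_def)
  obtain \<epsilon> where \<epsilon>: "0 < \<epsilon>" and ms: "\<And>D. (\<forall>t\<in>{0..T}. D t \<in> borel_measurable M) \<Longrightarrow> (\<forall>\<omega>\<in>space M. continuous_on {0..T} (\<lambda>t. D t \<omega>)) \<Longrightarrow>
     (\<forall>s t. 0 \<le> s \<longrightarrow> s < t \<longrightarrow> t \<le> T \<longrightarrow> (\<integral>\<^sup>+\<omega>. ennreal ((D t \<omega> - D s \<omega>) ^ (2 * 3)) \<partial>M) \<le> ennreal (incr_const 3 * (t - s) powr 3)) \<Longrightarrow>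
     (\<integral>\<^sup>+\<omega>. (\<integral>\<^sup>+t\<in>{0..T}. ennreal ((D t \<omega>)\<^sup>2) \<partial>lborel) \<partial>M) \<le> ennreal \<epsilon> \<Longrightarrow>
     (\<forall>t\<in>{0..T}. (\<integral>\<^sup>+\<omega>. ennreal ((D t \<omega>)\<^sup>2) \<partial>M) \<le> ennreal r)"
    using pointwise_mean_square[OF T incr_const_pos[of 3] r] by blast
  show ?thesis
  proof (rule exI[of _ \<epsilon>], intro conjI allI impI)
    show "0 < \<epsilon>" by fact
    fix F Xh s t
    assume sub: "subalgebra M F" and Xm: "\<forall>t\<in>{0..T}. Xh t \<in> borel_measurable M"
      and Xc: "\<forall>\<omega>\<in>space M. continuous_on {0..T} (\<lambda>t. Xh t \<omega>)"
      and st: "\<forall>t\<in>{0..T}. AE \<omega> in M. Xh t \<omega> = real_cond_exp M F (X t) \<omega>"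
      and qe: "(\<integral>\<^sup>+\<omega>. (\<integral>\<^sup>+t\<in>{0..T}. ennreal ((X t \<omega> - Xh t \<omega>)\<^sup>2) \<partial>lborel) \<partial>M) \<le> ennreal \<epsilon>"
      and ts: "0 \<le> s" "s < t" "t \<le> T"
    note mom = stationary_increment_moment[OF sub Xm[rule_format] st[rule_format]]
    have tT: "t \<in> {0..T}" "s \<in> {0..T}" using ts by auto
    define D where "D t \<omega> = X t \<omega> - Xh t \<omega>" for t \<omega>
    define Y where "Y \<omega> = D t \<omega> - D s \<omega>" for \<omega>
    define h where "h = t - s"
    have h: "0 < h" "h \<le> T" using ts by (auto simp: h_def)
    have Dm: "D t \<in> borel_measurable M" if "t \<in> {0..T}" for t
      unfolding D_def[abs_def] using X_measurable[OF that] Xm that by (intro borel_measurable_diff) auto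
    have "\<forall>t\<in>{0..T}. (\<integral>\<^sup>+\<omega>. ennreal ((D t \<omega>)\<^sup>2) \<partial>M) \<le> ennreal r"
    proof (rule ms)
      show "\<forall>\<omega>\<in>space M. continuous_on {0..T} (\<lambda>t. D t \<omega>)"
        unfolding D_def using X_cont Xc by (auto intro!: continuous_on_diff)
      show "\<forall>s t. 0 \<le> s \<longrightarrow> s < t \<longrightarrow> t \<le> T \<longrightarrow> (\<integral>\<^sup>+\<omega>. ennreal ((D t \<omega> - D s \<omega>) ^ (2 * 3)) \<partial>M) \<le> ennreal (incr_const 3 * (t - s) powr 3)"
      proof (intro allI impI)
        fix s t assume a: "0 \<le> s" "s < t" "t \<le> T"
        have "(\<integral>\<^sup>+\<omega>. ennreal ((D t \<omega> - D s \<omega>) ^ (2 * 3)) \<partial>M) = ennreal (\<integral>\<omega>. (D t \<omega> - D s \<omega>) ^ (2 * 3) \<partial>M)"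
          unfolding D_def using a by (intro nn_integral_eq_integral mom(1)) (auto intro: zero_le_even_power)
        also have "\<dots> \<le> ennreal (incr_const 3 * (t - s) ^ 3)"
          unfolding D_def using a by (intro ennreal_leI mom(2)) auto
        also have "(t - s) ^ 3 = (t - s) powr 3" using a by simp
        finally show "(\<integral>\<^sup>+\<omega>. ennreal ((D t \<omega> - D s \<omega>) ^ (2 * 3)) \<partial>M) \<le> ennreal (incr_const 3 * (t - s) powr 3)" .
      qed
      show "(\<integral>\<^sup>+\<omega>. (\<integral>\<^sup>+t\<in>{0..T}. ennreal ((D t \<omega>)\<^sup>2) \<partial>lborel) \<partial>M) \<le> ennreal \<epsilon>"
        unfolding D_def by (rule qe)
    qed (use Dm in auto)
    then have D2: "(\<integral>\<^sup>+\<omega>. ennreal ((D t \<omega>)\<^sup>2) \<partial>M) \<le> ennreal r" "(\<integral>\<^sup>+\<omega>. ennreal ((D s \<omega>)\<^sup>2) \<partial>M) \<le> ennreal r"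
      using tT by auto
    note [measurable] = Dm[OF tT(1)] Dm[OF tT(2)]
    have int: "integrable M (\<lambda>\<omega>. Y \<omega> ^ (2 * k))" for k
      unfolding Y_def D_def using ts by (intro mom(1)) auto
    have nni: "(\<integral>\<^sup>+\<omega>. ennreal (Y \<omega> ^ (2 * k)) \<partial>M) = ennreal (\<integral>\<omega>. Y \<omega> ^ (2 * k) \<partial>M)" for k
      by (intro nn_integral_eq_integral int) (auto intro: zero_le_even_power)
    have "ennreal (\<integral>\<omega>. (Y \<omega>)\<^sup>2 \<partial>M) = (\<integral>\<^sup>+\<omega>. ennreal ((Y \<omega>)\<^sup>2) \<partial>M)" using nni[of 1] by simp
    also have "\<dots> \<le> (\<integral>\<^sup>+\<omega>. (2 * ennreal ((D t \<omega>)\<^sup>2) + 2 * ennreal ((D s \<omega>)\<^sup>2)) \<partial>M)"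
    proof (intro nn_integral_mono)
      fix \<omega>
      have "(Y \<omega>)\<^sup>2 \<le> 2 * (D t \<omega>)\<^sup>2 + 2 * (D s \<omega>)\<^sup>2"
        using zero_le_power2[of "D t \<omega> + D s \<omega>"] by (simp add: Y_def power2_sum power2_diff)
      then show "ennreal ((Y \<omega>)\<^sup>2) \<le> 2 * ennreal ((D t \<omega>)\<^sup>2) + 2 * ennreal ((D s \<omega>)\<^sup>2)"
        using ennreal_leI[of "(Y \<omega>)\<^sup>2" "2 * (D t \<omega>)\<^sup>2 + 2 * (D s \<omega>)\<^sup>2"] by (simp add: ennreal_mult)
    qed
    also have "\<dots> = 2 * (\<integral>\<^sup>+\<omega>. ennreal ((D t \<omega>)\<^sup>2) \<partial>M) + 2 * (\<integral>\<^sup>+\<omega>. ennreal ((D s \<omega>)\<^sup>2) \<partial>M)"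
      by (simp add: nn_integral_add nn_integral_cmult)
    also have "\<dots> \<le> 2 * ennreal r + 2 * ennreal r" by (intro add_mono mult_left_mono D2) auto
    also have "\<dots> = ennreal (4 * r)"
      using r by (simp add: ennreal_mult' mult_2[symmetric] mult.assoc[symmetric])
    finally have I2: "(\<integral>\<omega>. (Y \<omega>)\<^sup>2 \<partial>M) \<le> 4 * r" using r by simp
    have I4: "(\<integral>\<omega>. Y \<omega> ^ (2 * (l + 1)) \<partial>M) \<le> B * h ^ (l + 1)"
      unfolding Y_def D_def B_def h_def using ts by (intro mom(2)) auto
    define \<tau> where "\<tau> = sqrt h * \<mu>"
    have \<tau>: "0 < \<tau>" using h \<mu> by (simp add: \<tau>_def)
    obtain k where k: "l = Suc k" using l by (cases l) auto
    have \<tau>1: "\<tau> ^ (2 * l - 2) = h ^ k * \<mu> ^ (2 * l - 2)"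
      using h by (simp add: \<tau>_def k power_mult_distrib power_mult)
    have \<tau>2: "(1 / \<tau>) ^ 2 * (B * h ^ (l + 1)) = h ^ k * (B * h / \<mu>\<^sup>2)"
      using h \<mu> by (simp add: \<tau>_def k power_mult_distrib power_divide field_simps power2_eq_square)
    have int2: "integrable M (\<lambda>\<omega>. (Y \<omega>)\<^sup>2)" using int[of 1] by simp
    have "(\<integral>\<omega>. Y \<omega> ^ (2 * l) \<partial>M) \<le> (\<integral>\<omega>. \<tau> ^ (2 * l - 2) * (Y \<omega>)\<^sup>2 + (1 / \<tau>) ^ 2 * Y \<omega> ^ (2 * (l + 1)) \<partial>M)"
    proof (intro integral_mono int Bochner_Integration.integrable_add integrable_mult_right int2)
      fix \<omega>
      have "\<bar>Y \<omega>\<bar> ^ (2 * (l + 1)) = Y \<omega> ^ (2 * (l + 1))" by (rule power_even_abs) simp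
      then show "Y \<omega> ^ (2 * l) \<le> \<tau> ^ (2 * l - 2) * (Y \<omega>)\<^sup>2 + (1 / \<tau>) ^ 2 * Y \<omega> ^ (2 * (l + 1))"
        using even_power_split[OF order_refl \<tau> l, of "Y \<omega>" 1] by simp
    qed
    also have "\<dots> = \<tau> ^ (2 * l - 2) * (\<integral>\<omega>. (Y \<omega>)\<^sup>2 \<partial>M) + (1 / \<tau>) ^ 2 * (\<integral>\<omega>. Y \<omega> ^ (2 * (l + 1)) \<partial>M)"
      using int2 int[of "l + 1"] by (subst Bochner_Integration.integral_add) auto
    also have "\<dots> \<le> \<tau> ^ (2 * l - 2) * (4 * r) + (1 / \<tau>) ^ 2 * (B * h ^ (l + 1))"
      using \<tau> by (intro add_mono mult_left_mono I2 I4) auto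
    also have "\<dots> = h ^ k * (\<mu> ^ (2 * l - 2) * (4 * r) + B * h / \<mu>\<^sup>2)"
      unfolding \<tau>1 \<tau>2 by (simp add: algebra_simps)
    also have "\<dots> \<le> h ^ k * (K / 2 + B * T / \<mu>\<^sup>2)"
      unfolding \<mu>r using h B by (intro mult_left_mono add_mono divide_right_mono) auto
    also have "\<dots> = K * h ^ (l - 1)" unfolding \<mu>2 by (simp add: k)
    finally have "(\<integral>\<omega>. Y \<omega> ^ (2 * l) \<partial>M) \<le> K * h ^ (l - 1)" .
    then show "(\<integral>\<^sup>+\<omega>. ennreal (((X t \<omega> - Xh t \<omega>) - (X s \<omega> - Xh s \<omega>)) ^ (2 * l)) \<partial>M) \<le> ennreal (K * (t - s) ^ (l - 1))"
      using nni[of l] by (simp add: Y_def D_def h_def ennreal_leI)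
  qed
qed

end

lemma brownian_coordinate:
  assumes "prob_space M" "0 < T" "brownian_motion M T W"
  shows "brownian M T (coordinate W i)"
  using assms by (simp add: brownian_def brownian_axioms_def brownian_motion_def)

lemma quantization_coordinate_regular:
  assumes "brownian M T (coordinate W i)"
    and "componentwise (product_quantization M T) W N Wh \<or> componentwise (optimal_functional_quantization M T) W N Wh"
  shows "(\<forall>t\<in>{0..T}. coordinate Wh i t \<in> borel_measurable M) \<and> (\<forall>\<omega>\<in>space M. continuous_on {0..T} (\<lambda>t. coordinate Wh i t \<omega>))"
  using assms(2) by (intro brownian.quantization_regular[OF assms(1)]) (auto simp: componentwise_def)

theorem stationary_holder_error_tendsto_0:
  fixes M :: "'a measure" and W :: "real \<Rightarrow> 'a \<Rightarrow> real ^ 'd::finite"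
  assumes M: "prob_space M" and T: "0 < T" and W: "brownian_motion M T W"
    and Wh: "\<And>N. 1 \<le> N \<Longrightarrow> stationary M T W (Wh N) \<and>
           (componentwise (product_quantization M T) W N (Wh N) \<or>
            componentwise (optimal_functional_quantization M T) W N (Wh N))"
    and conv: "(\<lambda>N. quadratic_error M T W (Wh N)) \<longlonglongrightarrow> 0"
    and q: "2 < q" and p: "0 < p"
  shows "(\<lambda>N. holder_error M T q p W (Wh N)) \<longlonglongrightarrow> 0"
proof -
  interpret prob_space M by fact
  note br = brownian_coordinate[OF M T W]
  have q2: "0 < 1 - 2 / q" using q by simp
  \<comment> \<open>l (1 - 2/q) > 2 is the same as 1 + 2l/q < l - 1, the condition of
    \<open>holder_Lp_bound\<close> for the exponent l - 1 left by the interpolation. Adding p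
    ensures p <= 2l.\<close>
  obtain l0 :: nat where l0: "2 / (1 - 2 / q) + p < real l0" using reals_Archimedean2 by blast
  define l where "l = l0 + 2"
  have l: "1 \<le> l" "2 / (1 - 2 / q) < real l" "p \<le> 2 * real l"
    using l0 q2 p by (auto simp: l_def) (smt (verit) divide_nonneg_pos)+
  have "2 < real l * (1 - 2 / q)" using l(2) q2 by (simp add: pos_divide_less_eq)
  then have b: "1 + 2 * real l / q < real (l - 1)" using l(1) by (simp add: algebra_simps of_nat_diff)
  obtain C where C: "0 < C" and bound: "\<And>(X :: real \<Rightarrow> 'a \<Rightarrow> real ^ 'd) K. 0 < K \<Longrightarrow>
     (\<forall>i. \<forall>t\<in>{0..T}. (\<lambda>\<omega>. X t \<omega> $ i) \<in> borel_measurable M) \<Longrightarrow>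
     (\<forall>i. \<forall>\<omega>\<in>space M. continuous_on {0..T} (\<lambda>t. X t \<omega> $ i)) \<Longrightarrow>
     (\<forall>i s t. 0 \<le> s \<longrightarrow> s < t \<longrightarrow> t \<le> T \<longrightarrow>
        (\<integral>\<^sup>+\<omega>. ennreal ((X t \<omega> $ i - X s \<omega> $ i) ^ (2 * l)) \<partial>M) \<le> ennreal (K * (t - s) powr real (l - 1))) \<Longrightarrow>
     Lp_norm M p (\<lambda>\<omega>. holder_seminorm T q (\<lambda>t. X t \<omega>)) \<le> ennreal (C * K powr (1 / (2 * real l)))"
    using holder_Lp_bound[OF T _ l(1) b p l(3), where 'd='d] q by auto
  show ?thesis
  proof (rule ennreal_tendsto_0I)
    fix r :: real assume r: "0 < r"
    \<comment> \<open>Chosen so that the final bound C K^(1/(2l)) is exactly r.\<close>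
    define K where "K = (r / C) powr (2 * real l)"
    have K: "0 < K" using r C by (simp add: K_def)
    have CK: "C * K powr (1 / (2 * real l)) = r" using r C l(1) by (simp add: K_def powr_powr)
    have "\<forall>i. \<exists>\<epsilon>. 0 < \<epsilon> \<and> (\<forall>F Xh. subalgebra M F \<longrightarrow> (\<forall>t\<in>{0..T}. Xh t \<in> borel_measurable M) \<longrightarrow>
     (\<forall>\<omega>\<in>space M. continuous_on {0..T} (\<lambda>t. Xh t \<omega>)) \<longrightarrow>
     (\<forall>t\<in>{0..T}. AE \<omega> in M. Xh t \<omega> = real_cond_exp M F (coordinate W i t) \<omega>) \<longrightarrow>
     (\<integral>\<^sup>+\<omega>. (\<integral>\<^sup>+t\<in>{0..T}. ennreal ((coordinate W i t \<omega> - Xh t \<omega>)\<^sup>2) \<partial>lborel) \<partial>M) \<le> ennreal \<epsilon> \<longrightarrow>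
     (\<forall>s t. 0 \<le> s \<longrightarrow> s < t \<longrightarrow> t \<le> T \<longrightarrow>
        (\<integral>\<^sup>+\<omega>. ennreal (((coordinate W i t \<omega> - Xh t \<omega>) - (coordinate W i s \<omega> - Xh s \<omega>)) ^ (2 * l)) \<partial>M) \<le> ennreal (K * (t - s) ^ (l - 1))))"
      (is "\<forall>i. \<exists>\<epsilon>. 0 < \<epsilon> \<and> ?P i \<epsilon>")
      using brownian.stationary_small_increment_moment[OF br l(1) K] by blast
    then obtain e where "\<forall>i. 0 < e i \<and> ?P i (e i)" by (rule choice[THEN exE]) blast
    then have e: "0 < e i" "?P i (e i)" for i by blast+
    define \<epsilon> where "\<epsilon> = Min (range e)"
    have \<epsilon>: "0 < \<epsilon>" "\<epsilon> \<le> e i" for i using e(1) by (auto simp: \<epsilon>_def)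
    have "\<forall>\<^sub>F N in sequentially. quadratic_error M T W (Wh N) < ennreal \<epsilon>"
      using order_tendstoD(2)[OF conv] \<epsilon>(1) by simp
    then show "\<forall>\<^sub>F N in sequentially. holder_error M T q p W (Wh N) \<le> ennreal r"
      using eventually_ge_at_top[of 1]
    proof eventually_elim
      case (elim N)
      note st = Wh[OF elim(2), THEN conjunct1] and cw = Wh[OF elim(2), THEN conjunct2]
      note reg = quantization_coordinate_regular[OF br cw]
      have sub: "subalgebra M (generated_algebra M T (Wh N))"
        using reg by (intro generated_algebra_subalgebra) (auto simp: coordinate_def)
      have stat: "\<forall>t\<in>{0..T}. AE \<omega> in M. coordinate (Wh N) i t \<omega> = real_cond_exp M (generated_algebra M T (Wh N)) (coordinate W i t) \<omega>" for i
        using st by (simp add: stationary_def coordinate_def)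
      have "(\<integral>\<^sup>+\<omega>. (\<integral>\<^sup>+t\<in>{0..T}. ennreal ((coordinate W i t \<omega> - coordinate (Wh N) i t \<omega>)\<^sup>2) \<partial>lborel) \<partial>M)
            \<le> quadratic_error M T W (Wh N)" for i
        unfolding quadratic_error_def
      proof (intro nn_integral_mono mult_right_mono ennreal_leI)
        fix \<omega> t
        have "(coordinate W i t \<omega> - coordinate (Wh N) i t \<omega>)\<^sup>2 = \<bar>(W t \<omega> - Wh N t \<omega>) $ i\<bar>\<^sup>2" by (simp add: coordinate_def)
        also have "\<dots> \<le> (norm (W t \<omega> - Wh N t \<omega>))\<^sup>2" by (intro power_mono component_le_norm_cart) auto
        finally show "(coordinate W i t \<omega> - coordinate (Wh N) i t \<omega>)\<^sup>2 \<le> (norm (W t \<omega> - Wh N t \<omega>))\<^sup>2" .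
      qed simp
      then have small: "(\<integral>\<^sup>+\<omega>. (\<integral>\<^sup>+t\<in>{0..T}. ennreal ((coordinate W i t \<omega> - coordinate (Wh N) i t \<omega>)\<^sup>2) \<partial>lborel) \<partial>M)
            \<le> ennreal (e i)" for i
        by (rule order_trans) (use elim(1) \<epsilon>(2)[of i] in \<open>auto intro: order_trans[OF less_imp_le] ennreal_leI\<close>)
      have mom: "(\<integral>\<^sup>+\<omega>. ennreal (((coordinate W i t \<omega> - coordinate (Wh N) i t \<omega>) - (coordinate W i s \<omega> - coordinate (Wh N) i s \<omega>)) ^ (2 * l)) \<partial>M)
           \<le> ennreal (K * (t - s) ^ (l - 1))" if "0 \<le> s" "s < t" "t \<le> T" for i s t
        using e(2)[of i, rule_format, OF sub _ _ _ small[of i] that] reg[of i] stat[of i] by blast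
      have "Lp_norm M p (\<lambda>\<omega>. holder_seminorm T q (\<lambda>t. W t \<omega> - Wh N t \<omega>)) \<le> ennreal (C * K powr (1 / (2 * real l)))"
      proof (rule bound[OF K, of "\<lambda>t \<omega>. W t \<omega> - Wh N t \<omega>"])
        show "\<forall>i. \<forall>t\<in>{0..T}. (\<lambda>\<omega>. (W t \<omega> - Wh N t \<omega>) $ i) \<in> borel_measurable M"
          using brownian.X_measurable[OF br] reg by (auto simp: coordinate_def intro!: borel_measurable_diff)
        show "\<forall>i. \<forall>\<omega>\<in>space M. continuous_on {0..T} (\<lambda>t. (W t \<omega> - Wh N t \<omega>) $ i)"
          using brownian.X_cont[OF br] reg by (auto simp: coordinate_def intro!: continuous_on_diff)
        show "\<forall>i s t. 0 \<le> s \<longrightarrow> s < t \<longrightarrow> t \<le> T \<longrightarrow>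
        (\<integral>\<^sup>+\<omega>. ennreal (((W t \<omega> - Wh N t \<omega>) $ i - (W s \<omega> - Wh N s \<omega>) $ i) ^ (2 * l)) \<partial>M) \<le> ennreal (K * (t - s) powr real (l - 1))"
          using mom by (auto simp: coordinate_def powr_realpow)
      qed
      then show ?case unfolding holder_error_def CK .
    qed
  qed
qed

subsection \<open>Rate for optimal product quantizations\<close>

lemma rate_exponents:
  fixes q p \<alpha> :: real
  assumes q: "2 < q" and p: "0 < p" and \<alpha>: "0 < \<alpha>"
  obtains l :: nat and u \<beta> \<epsilon> where "1 \<le> l" "0 < u" "u * real l < 1" "0 < \<beta>" "\<beta> + u < 1 / 2" "0 < \<epsilon>" "\<epsilon> < 2" "p \<le> 2 * real l"
    "1 + 2 * real l / q < 2 * real l * \<beta>" "(- 2 + \<epsilon>) * u / 2 < - (3 / 2) * min (1 / 5 * (1 - 2 / q)) (1 / p) + \<alpha>"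
proof -
  define w where "w = 1 - 2 / q"
  have w: "0 < w" "w < 1" using q by (auto simp: w_def)
  define r where "r = max p (5 / w)"
  have r: "p \<le> r" "5 / w \<le> r" by (auto simp: r_def)
  have "5 < 5 / w" using w by (simp add: field_simps)
  then have r5: "5 < r" using r by linarith
  have minr: "min (1 / 5 * w) (1 / p) = 1 / r"
  proof (cases "p \<le> 5 / w")
    case True
    then have "1 / 5 * w \<le> 1 / p" using p w by (simp add: field_simps)
    then show ?thesis using True by (simp add: r_def)
  next
    case False
    then have "1 / p \<le> 1 / 5 * w" using p w by (simp add: field_simps)
    then show ?thesis using False by (simp add: r_def)
  qed
  \<comment> \<open>An integer with r <= 2l < 4r/3. Rounding r/2 up gives 2l < r + 2, which suffices
    for r >= 6; for 5 < r < 6 the value 2l = 6 works because 4r/3 > 20/3.\<close>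
  define l where "l = (if r < 6 then 3 else nat \<lceil>r / 2\<rceil>)"
  have l: "r \<le> 2 * real l" "2 * real l < 4 / 3 * r"
    using r5 by (auto simp: l_def) linarith+
  have l1: "1 \<le> l" using l(1) r5 by simp
  define \<rho> where "\<rho> = 3 / (2 * r)"
  have \<rho>: "0 < \<rho>" "\<rho> < 3 / 10" using r5 by (auto simp: \<rho>_def field_simps)
  \<comment> \<open>u falls short of \<rho> by \<gamma> and the exponent -2 becomes -2 + 2\<gamma>;
    together this costs at most 2\<gamma> < \<alpha>. The bound \<rho>/2 keeps u positive.\<close>
  define \<gamma> where "\<gamma> = min (\<alpha> / 3) (\<rho> / 2)"
  have \<gamma>: "0 < \<gamma>" "\<gamma> \<le> \<alpha> / 3" "\<gamma> \<le> \<rho> / 2" using \<alpha> \<rho> by (auto simp: \<gamma>_def)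
  define u where "u = \<rho> - \<gamma>"
  have u: "0 < u" "u < \<rho>" using \<gamma> \<rho> by (auto simp: u_def)
  have "u * real l < \<rho> * (2 / 3 * r)" using u l l1 by (intro mult_strict_mono) auto
  also have "\<dots> = 1" using r5 by (simp add: \<rho>_def)
  finally have ul: "u * real l < 1" .
  have "1 / (2 * real l) \<le> 1 / r" using l r5 by (intro divide_left_mono) auto
  moreover have "5 / r \<le> w" using r(2) w r5 by (simp add: field_simps)
  then have "1 / q \<le> 1 / 2 - 5 / 2 * (1 / r)" using q by (simp add: w_def)
  moreover have "\<rho> = 3 / 2 * (1 / r)" by (simp add: \<rho>_def)
  ultimately have sum: "1 / q + 1 / (2 * real l) + u < 1 / 2" using \<gamma>(1) unfolding u_def by linarith
  define a where "a = 1 / q + 1 / (2 * real l)"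
  \<comment> \<open>The midpoint between the lower bound a, which Kolmogorov's criterion imposes,
    and the upper bound 1/2 - u from the summability over k.\<close>
  define \<beta> where "\<beta> = (a + (1 / 2 - u)) / 2"
  have "a < \<beta>" "\<beta> + u < 1 / 2" using sum unfolding a_def[symmetric] by (auto simp: \<beta>_def field_simps)
  then have \<beta>: "1 / q + 1 / (2 * real l) < \<beta>" "\<beta> + u < 1 / 2" by (auto simp: a_def)
  have "0 < 1 / q + 1 / (2 * real l)" using q l1 by (intro add_pos_pos) auto
  then have \<beta>0: "0 < \<beta>" using \<beta>(1) by linarith
  have "2 * real l * (1 / q + 1 / (2 * real l)) < 2 * real l * \<beta>" using \<beta>(1) l1 by (intro mult_strict_left_mono) auto
  moreover have "2 * real l * (1 / q + 1 / (2 * real l)) = 1 + 2 * real l / q" using l1 q by (simp add: field_simps)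
  ultimately have "1 + 2 * real l / q < 2 * real l * \<beta>" by simp
  moreover have "(- 2 + 2 * \<gamma>) * u / 2 < - (3 / 2) * min (1 / 5 * (1 - 2 / q)) (1 / p) + \<alpha>"
  proof -
    have "\<gamma> * u \<le> \<gamma> * 1" using u \<rho> \<gamma> by (intro mult_left_mono) auto
    moreover have "(- 2 + 2 * \<gamma>) * u / 2 = \<gamma> * u - u" by (simp add: field_simps)
    ultimately have "(- 2 + 2 * \<gamma>) * u / 2 < - \<rho> + \<alpha>" using \<gamma> \<alpha> u_def by linarith
    also have "\<rho> = 3 / 2 * min (1 / 5 * (1 - 2 / q)) (1 / p)" using minr by (simp add: \<rho>_def w_def)
    finally show ?thesis by simp
  qed
  ultimately show ?thesis
    using that[of l u \<beta> "2 * \<gamma>"] l1 u ul \<beta>0 \<beta> \<gamma> \<rho> l(1) r(1) by auto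
qed

text \<open>With z = N^(1/(2d)) >= 2 the root is z^2, and z^2 - 1 >= z absorbs the rounding. Hence
  the logarithm of the level is at least ln N / (2d), and the dimension changes only the constant in
  the rate.\<close>

lemma level_ge:
  assumes d: "1 \<le> d" and N: "4 ^ d \<le> N"
  shows "real N powr (1 / (2 * real d)) \<le> real (nat \<lfloor>root d (real N)\<rfloor>)"
proof -
  define z where "z = real N powr (1 / (2 * real d))"
  have "real (4 ^ d) \<le> real N" using N by (rule of_nat_mono)
  then have N4: "4 ^ d \<le> real N" by simp
  have N0: "0 < real N" by (rule less_le_trans[OF _ N4]) simp
  have "2 = (4 ^ d :: real) powr (1 / (2 * real d))"
    using d by (simp add: powr_realpow[symmetric] powr_powr powr_half_sqrt)
  also have "\<dots> \<le> z" unfolding z_def using N4 by (intro powr_mono2) auto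
  finally have z: "2 \<le> z" .
  have "z\<^sup>2 = root d (real N)"
    using d N0 by (simp add: z_def powr_realpow[symmetric] powr_powr root_powr_inverse)
  moreover have "2 * z \<le> z\<^sup>2" using z by (simp add: power2_eq_square)
  ultimately have "z \<le> root d (real N) - 1" using z by linarith
  also have "\<dots> \<le> real (nat \<lfloor>root d (real N)\<rfloor>)" by linarith
  finally show ?thesis unfolding z_def .
qed

theorem optimal_product_holder_error_rate:
  fixes M :: "'a measure" and W :: "real \<Rightarrow> 'a \<Rightarrow> real ^ 'd::finite"
  assumes M: "prob_space M" and T: "0 < T" and W: "brownian_motion M T W"
    and q: "2 < q" and Wh: "\<And>N. 1 \<le> N \<Longrightarrow> componentwise (optimal_product_quantization M T) W N (Wh N)"
    and p: "0 < p" and \<alpha>: "0 < \<alpha>"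
  shows "(\<forall>\<^sub>F N in sequentially. holder_error M T q p W (Wh N) < \<infinity>) \<and>
           (\<lambda>N. enn2real (holder_error M T q p W (Wh N))) \<in>
             o(\<lambda>N. ln (real N) powr (- (3 / 2) * min (1 / 5 * (1 - 2 / q)) (1 / p) + \<alpha>))"
proof -
  interpret prob_space M by fact
  note br = brownian_coordinate[OF M T W]
  obtain l :: nat and u \<beta> \<epsilon> where l: "1 \<le> l" and u: "0 < u" "u * real l < 1" and \<beta>: "0 < \<beta>" "\<beta> + u < 1 / 2"
    and \<epsilon>: "0 < \<epsilon>" "\<epsilon> < 2" and pl: "p \<le> 2 * real l" and b: "1 + 2 * real l / q < 2 * real l * \<beta>"
    and rate: "(- 2 + \<epsilon>) * u / 2 < - (3 / 2) * min (1 / 5 * (1 - 2 / q)) (1 / p) + \<alpha>"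
    by (rule rate_exponents[OF q p \<alpha>])
  obtain C where C: "0 < C" and bound: "\<And>(X :: real \<Rightarrow> 'a \<Rightarrow> real ^ 'd) K. 0 < K \<Longrightarrow>
     (\<forall>i. \<forall>t\<in>{0..T}. (\<lambda>\<omega>. X t \<omega> $ i) \<in> borel_measurable M) \<Longrightarrow>
     (\<forall>i. \<forall>\<omega>\<in>space M. continuous_on {0..T} (\<lambda>t. X t \<omega> $ i)) \<Longrightarrow>
     (\<forall>i s t. 0 \<le> s \<longrightarrow> s < t \<longrightarrow> t \<le> T \<longrightarrow>
        (\<integral>\<^sup>+\<omega>. ennreal ((X t \<omega> $ i - X s \<omega> $ i) ^ (2 * l)) \<partial>M) \<le> ennreal (K * (t - s) powr (2 * real l * \<beta>))) \<Longrightarrow>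
     Lp_norm M p (\<lambda>\<omega>. holder_seminorm T q (\<lambda>t. X t \<omega>)) \<le> ennreal (C * K powr (1 / (2 * real l)))"
    using holder_Lp_bound[OF T _ l b p pl, where 'd='d] q by auto
  define \<kappa> where "\<kappa> m = (ln (real m) powr (- 2 + \<epsilon>)) powr (u * real l)" for m
  define P where "P i c m0 \<longleftrightarrow> 0 < c \<and> (\<forall>m\<ge>m0. \<forall>Xh. optimal_product_quantization M T (coordinate W i) m Xh \<longrightarrow>
     (\<forall>s t. 0 \<le> s \<longrightarrow> s < t \<longrightarrow> t \<le> T \<longrightarrow>
        (\<integral>\<^sup>+\<omega>. ennreal (((coordinate W i t \<omega> - Xh t \<omega>) - (coordinate W i s \<omega> - Xh s \<omega>)) ^ (2 * l)) \<partial>M)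
          \<le> ennreal (c * \<kappa> m * (t - s) powr (2 * real l * \<beta>))))" for i c and m0 :: nat
  have "\<forall>i. \<exists>c m0. P i c m0"
    unfolding P_def \<kappa>_def using brownian.increment_moment[OF br l u \<beta> \<epsilon>(1)] by blast
  then obtain c where "\<forall>i. \<exists>m0. P i (c i) m0" by (rule choice[THEN exE]) blast
  then obtain m0 where "\<forall>i. P i (c i) (m0 i)" by (rule choice[THEN exE]) blast
  then have P: "P i (c i) (m0 i)" for i ..
  have c0: "0 < c i" for i using P by (simp add: P_def)
  define C1 where "C1 = Max (range c)"
  have C1: "c i \<le> C1" for i by (simp add: C1_def)
  have C10: "0 < C1" by (rule less_le_trans[OF c0 C1])
  \<comment> \<open>The finitely many coordinates have their own constants and thresholds; the
    maxima serve all of them.\<close>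
  define m1 where "m1 = Max (range m0)"
  have m1: "m0 i \<le> m1" for i by (simp add: m1_def)
  define d where "d = CARD('d)"
  have d: "1 \<le> d" by (simp add: d_def Suc_le_eq)
  define lev where "lev N = nat \<lfloor>root d (real N)\<rfloor>" for N
  define \<gamma> where "\<gamma> = (- 2 + \<epsilon>) * u / 2"
  have \<gamma>: "\<gamma> < 0" using \<epsilon>(2) u(1) by (simp add: \<gamma>_def mult_neg_pos)
  define C2 where "C2 = C * C1 powr (1 / (2 * real l)) * (1 / (2 * real d)) powr \<gamma>"
  have C2: "0 < C2" using C C10 d by (simp add: C2_def)
  have "filterlim (\<lambda>N. real N powr (1 / (2 * real d))) at_top sequentially"
    using d by real_asymp
  then have ev1: "\<forall>\<^sub>F N in sequentially. real (m1 + 2) \<le> real N powr (1 / (2 * real d))"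
    by (simp add: filterlim_at_top)
  have ev: "\<forall>\<^sub>F N in sequentially. holder_error M T q p W (Wh N) \<le> ennreal (C2 * ln (real N) powr \<gamma>)"
    using ev1 eventually_ge_at_top[of "4 ^ d"]
  proof eventually_elim
    case (elim N)
    have N1: "1 \<le> N" using elim(2) by (rule order_trans[rotated]) simp
    have le: "real N powr (1 / (2 * real d)) \<le> real (lev N)"
      unfolding lev_def by (rule level_ge[OF d elim(2)])
    have "real (m1 + 2) \<le> real (lev N)" using elim(1) le by linarith
    then have lev: "m1 \<le> lev N" "2 \<le> lev N" by linarith+
    have Np: "0 < real N powr (1 / (2 * real d))" using N1 by simp
    have "ln (real N powr (1 / (2 * real d))) \<le> ln (real (lev N))"
      using le Np lev by (subst ln_le_cancel_iff) auto
    then have lnle: "1 / (2 * real d) * ln (real N) \<le> ln (real (lev N))"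
      using N1 by (simp add: ln_powr)
    have "real 2 \<le> real N powr (1 / (2 * real d))" using elim(1) by linarith
    then have "1 < real N" using N1 by (cases "N = 1") auto
    then have lnN: "0 < ln (real N)" by simp
    have lnl: "0 < ln (real (lev N))" using lev by simp
    define K where "K = C1 * \<kappa> (lev N)"
    have \<kappa>: "0 < \<kappa> (lev N)" using lnl by (simp add: \<kappa>_def)
    have K: "0 < K" using C10 \<kappa> by (simp add: K_def)
    have opt: "optimal_product_quantization M T (coordinate W i) (lev N) (coordinate (Wh N) i)" for i
      using Wh[OF N1] by (simp add: componentwise_def lev_def d_def)
    then have "componentwise (product_quantization M T) W N (Wh N)"
      by (simp add: componentwise_def lev_def d_def optimal_product_quantization_def)
    note reg = quantization_coordinate_regular[OF br disjI1[OF this]]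
    have mom: "(\<integral>\<^sup>+\<omega>. ennreal (((coordinate W i t \<omega> - coordinate (Wh N) i t \<omega>) - (coordinate W i s \<omega> - coordinate (Wh N) i s \<omega>)) ^ (2 * l)) \<partial>M)
         \<le> ennreal (K * (t - s) powr (2 * real l * \<beta>))" if "0 \<le> s" "s < t" "t \<le> T" for i s t
    proof -
      have "m0 i \<le> lev N" using m1[of i] lev(1) by (rule order_trans)
      then have "(\<integral>\<^sup>+\<omega>. ennreal (((coordinate W i t \<omega> - coordinate (Wh N) i t \<omega>) - (coordinate W i s \<omega> - coordinate (Wh N) i s \<omega>)) ^ (2 * l)) \<partial>M)
         \<le> ennreal (c i * \<kappa> (lev N) * (t - s) powr (2 * real l * \<beta>))"
        using P[of i] opt[of i] that unfolding P_def by blast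
      also have "\<dots> \<le> ennreal (K * (t - s) powr (2 * real l * \<beta>))"
        unfolding K_def using \<kappa> C1[of i] by (intro ennreal_leI mult_right_mono) auto
      finally show ?thesis .
    qed
    have "holder_error M T q p W (Wh N) \<le> ennreal (C * K powr (1 / (2 * real l)))"
      unfolding holder_error_def
    proof (rule bound[OF K, of "\<lambda>t \<omega>. W t \<omega> - Wh N t \<omega>"])
      show "\<forall>i. \<forall>t\<in>{0..T}. (\<lambda>\<omega>. (W t \<omega> - Wh N t \<omega>) $ i) \<in> borel_measurable M"
        using brownian.X_measurable[OF br] reg by (auto simp: coordinate_def intro!: borel_measurable_diff)
      show "\<forall>i. \<forall>\<omega>\<in>space M. continuous_on {0..T} (\<lambda>t. (W t \<omega> - Wh N t \<omega>) $ i)"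
        using brownian.X_cont[OF br] reg by (auto simp: coordinate_def intro!: continuous_on_diff)
      show "\<forall>i s t. 0 \<le> s \<longrightarrow> s < t \<longrightarrow> t \<le> T \<longrightarrow>
        (\<integral>\<^sup>+\<omega>. ennreal (((W t \<omega> - Wh N t \<omega>) $ i - (W s \<omega> - Wh N s \<omega>) $ i) ^ (2 * l)) \<partial>M) \<le> ennreal (K * (t - s) powr (2 * real l * \<beta>))"
        using mom by (auto simp: coordinate_def)
    qed
    also have "\<dots> \<le> ennreal (C2 * ln (real N) powr \<gamma>)"
    proof (rule ennreal_leI)
      have "(- 2 + \<epsilon>) * (u * real l) * (1 / (2 * real l)) = \<gamma>" using l by (simp add: \<gamma>_def)
      then have "K powr (1 / (2 * real l)) = C1 powr (1 / (2 * real l)) * ln (real (lev N)) powr \<gamma>"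
        using C10 by (simp add: K_def \<kappa>_def powr_mult powr_powr)
      also have "ln (real (lev N)) powr \<gamma> \<le> (1 / (2 * real d) * ln (real N)) powr \<gamma>"
        using \<gamma> lnle lnN d by (intro powr_mono2') auto
      also have "(1 / (2 * real d) * ln (real N)) powr \<gamma> = (1 / (2 * real d)) powr \<gamma> * ln (real N) powr \<gamma>"
        by (rule powr_mult)
      finally show "C * K powr (1 / (2 * real l)) \<le> C2 * ln (real N) powr \<gamma>"
        using C by (simp add: C2_def mult_left_mono mult.assoc)
    qed
    finally show ?case .
  qed
  have fin: "\<forall>\<^sub>F N in sequentially. holder_error M T q p W (Wh N) < \<infinity>"
    using ev by eventually_elim (auto intro: le_less_trans)
  have "\<forall>\<^sub>F N in sequentially. norm (enn2real (holder_error M T q p W (Wh N))) \<le> C2 * norm (ln (real N) powr \<gamma>)"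
    using ev by eventually_elim (use C2 in \<open>auto intro: enn2real_leI\<close>)
  then have "(\<lambda>N. enn2real (holder_error M T q p W (Wh N))) \<in> O(\<lambda>N. ln (real N) powr \<gamma>)" by (rule bigoI)
  \<comment> \<open>The exponent \<gamma> is strictly smaller than the claimed one, which improves
    the bound from O to o.\<close>
  moreover have "filterlim (\<lambda>N. ln (real N)) at_top sequentially" by real_asymp
  then have "(\<lambda>N. ln (real N) powr \<gamma>) \<in> o(\<lambda>N. ln (real N) powr (- (3 / 2) * min (1 / 5 * (1 - 2 / q)) (1 / p) + \<alpha>))"
    using rate by (subst powr_smallo_iff) (auto simp: \<gamma>_def)
  ultimately show ?thesis using fin by (auto intro: landau_o.big_small_trans)
qed

theorem mainTheorem3:
  fixes M :: "'a measure" and T :: real and W :: "real \<Rightarrow> 'a \<Rightarrow> real ^ 'd::finite"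
  assumes "prob_space M"
    and "0 < T"
    and "brownian_motion M T W"
  shows
    "(\<forall>Wh :: nat \<Rightarrow> real \<Rightarrow> 'a \<Rightarrow> real ^ 'd.
        (\<forall>N\<ge>1. stationary M T W (Wh N) \<and>
           (componentwise (product_quantization M T) W N (Wh N) \<or>
            componentwise (optimal_functional_quantization M T) W N (Wh N))) \<and>
        (\<lambda>N. quadratic_error M T W (Wh N)) \<longlonglongrightarrow> 0 \<longrightarrow>
        (\<forall>q p :: real. 2 < q \<and> 0 < p \<longrightarrow> (\<lambda>N. holder_error M T q p W (Wh N)) \<longlonglongrightarrow> 0))
     \<and>
     (\<forall>(q :: real) (Wh :: nat \<Rightarrow> real \<Rightarrow> 'a \<Rightarrow> real ^ 'd).
        2 < q \<and> (\<forall>N\<ge>1. componentwise (optimal_product_quantization M T) W N (Wh N)) \<longrightarrow>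
        (\<forall>p \<alpha> :: real. 0 < p \<and> 0 < \<alpha> \<longrightarrow>
           (\<forall>\<^sub>F N in sequentially. holder_error M T q p W (Wh N) < \<infinity>) \<and>
           (\<lambda>N. enn2real (holder_error M T q p W (Wh N))) \<in>
             o(\<lambda>N. ln (real N) powr (- (3 / 2) * min (1 / 5 * (1 - 2 / q)) (1 / p) + \<alpha>))))"
proof (rule conjI)
  show "\<forall>Wh :: nat \<Rightarrow> real \<Rightarrow> 'a \<Rightarrow> real ^ 'd.
        (\<forall>N\<ge>1. stationary M T W (Wh N) \<and>
           (componentwise (product_quantization M T) W N (Wh N) \<or>
            componentwise (optimal_functional_quantization M T) W N (Wh N))) \<and>
        (\<lambda>N. quadratic_error M T W (Wh N)) \<longlonglongrightarrow> 0 \<longrightarrow>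
        (\<forall>q p :: real. 2 < q \<and> 0 < p \<longrightarrow> (\<lambda>N. holder_error M T q p W (Wh N)) \<longlonglongrightarrow> 0)"
    using stationary_holder_error_tendsto_0[OF assms] by blast
  show "\<forall>(q :: real) (Wh :: nat \<Rightarrow> real \<Rightarrow> 'a \<Rightarrow> real ^ 'd).
        2 < q \<and> (\<forall>N\<ge>1. componentwise (optimal_product_quantization M T) W N (Wh N)) \<longrightarrow>
        (\<forall>p \<alpha> :: real. 0 < p \<and> 0 < \<alpha> \<longrightarrow>
           (\<forall>\<^sub>F N in sequentially. holder_error M T q p W (Wh N) < \<infinity>) \<and>
           (\<lambda>N. enn2real (holder_error M T q p W (Wh N))) \<in>
             o(\<lambda>N. ln (real N) powr (- (3 / 2) * min (1 / 5 * (1 - 2 / q)) (1 / p) + \<alpha>)))"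
    using optimal_product_holder_error_rate[OF assms] by blast
qed

end
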